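(* Let $\mathbb D$ be a discrete valuation ring with maximal ideal $\mathfrak m=(t)$, residue field $\Bbbk$ and field of fractions $\mathbb K$. Every matrix $W\in\mathrm{Mat}_{N\times N}(\mathbb K)$ satisfies $$W\simeq\mathrm{diag}\bigl(B(\nu_1,m_1,\pi_1),\dots,B(\nu_s,m_s,\pi_s),S(\mu_1),\dots,S(\mu_p)\bigr)$$ for certain data $(\nu_1,m_1,\pi_1),\dots,(\nu_s,m_s,\pi_s),\mu_1,\dots,\mu_p$. The blocks $B(\nu,m,\pi)$ and $S(\mu)$ are indecomposable (they do not split further), and the following uniqueness statements hold: (1) The equivalence class of $B(\nu,m,\pi)$ does not depend on the choice of the lift $F$ of the Frobenius block $F(\pi^m)$; in fact it depends only on the conjugacy class of $\bar F$ over $\Bbbk$. In particular, if $\Bbbk$ is algebraically closed and $\lambda\in\Bbbk^*$, the Frobenius block $F((\xi-\lambda)^m)$ can be replaced by the Jordan block $J_m(\lambda)$. (2) $B(\nu,m,\pi)\not\simeq S(\mu)$ for all data $(\nu,m,\pi)$ and $\mu$. (3) $S(\mu)\simeq S(\mu')$ if and only if $\mu=\mu'$. (4) For $\nu=(\nu_1,\nu_2,\dots,\nu_n)$ and $\nu^{(1)}=(\nu_n,\nu_1,\dots,\nu_{n-1})$ one has $B(\nu^{(1)},m,\pi)\simeq B(\nu,m,\pi)$. (5) $B(\nu,m,\pi)\simeq B(\tilde\nu,\tilde m,\tilde\pi)$ if and only if $(\pi,m)=(\tilde\pi,\tilde m)$ and $\tilde\nu=\nu^{(l)}$ for some $l\in\mathbb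 Z$, where $\nu^{(l)}$ is the $l$-fold iterate of the rotation $\nu\mapsto\nu^{(1)}$. (6) The decomposition $W\simeq\mathrm{diag}\bigl(B(\nu_1,m_1,\pi_1),\dots,B(\nu_s,m_s,\pi_s),S(\mu_1),\dots,S(\mu_p)\bigr)$ of $W$ is unique up to automorphisms of direct summands and permutation of blocks (Krull--Schmidt property).
   Context: For a matrix $X$ over $\mathbb D$, $\bar X$ is its residue modulo $\mathfrak m$. Two matrices $W,\tilde W\in\mathrm{Mat}_{N\times N}(\mathbb K)$ are equivalent, $W\simeq\tilde W$, if there exist $S,T\in\mathrm{GL}_N(\mathbb D)$ with $\bar S=\bar T$ and $\tilde W=SWT^{-1}$. A matrix is indecomposable if it is not equivalent to a block diagonal matrix with two square diagonal blocks of smaller positive size. For $n\ge0$ and $\mu=(\mu_1,\dots,\mu_n)\in\mathbb Z^n$, $S(\mu)$ is the $(n+1)\times(n+1)$ matrix whose entry in position $(i,i+1)$ is $t^{\mu_i}$ for $1\le i\le n$ and whose other entries are $0$. For $n\ge1$, a non-periodic sequence $\nu=(\nu_1,\dots,\nu_n)\in\mathbb Z^n$ (i.e. different from all its rotations by $l$ positions, $0<l<n$), $m\in\mathbb N$ and a monic irreducible polynomial $\pi\in\Bbbk[\xi]$, $\pi\ne\xi$, of degree $d$, let $F\in\mathrm{Mat}_{md\times md}(\mathbb D)$ be such that $\bar F=F(\pi^m)$ is the Frobenius (companion) block of the polynomial $\pi^m$. Then $B(\nu,m,\pi)$ is the $dmn\times dmn$ matrix consisting of $n\times n$ blocks of size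 $dm\times dm$: the block in position $(i,i+1)$ is $t^{\nu_i}\mathbb 1_{dm}$ for $1\le i\le n-1$, the block in position $(n,1)$ is $t^{\nu_n}F$, and all other blocks are $0$ (for $n=1$, $B(\nu,m,\pi)=t^{\nu_1}F$). *)

theory Defs
  imports
    "HOL-Computational_Algebra.Computational_Algebra"
    "HOL-Combinatorics.Permutations"
    "Jordan_Normal_Form.Jordan_Normal_Form"
begin

section \<open>Discrete valuation rings and their residue fields\<close>

text \<open>A discrete valuation on a field; its value at \<open>0\<close> (formally infinity) is left unconstrained.\<close>

definition discrete_valuation :: "('k::field \<Rightarrow> int) \<Rightarrow> bool" where
  "discrete_valuation v \<longleftrightarrow>
     v ` (UNIV - {0}) = UNIV \<and>
     (\<forall>x y. x \<noteq> 0 \<longrightarrow> y \<noteq> 0 \<longrightarrow> v (x * y) = v x + v y) \<and>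
     (\<forall>x y. x \<noteq> 0 \<longrightarrow> y \<noteq> 0 \<longrightarrow> x + y \<noteq> 0 \<longrightarrow> min (v x) (v y) \<le> v (x + y))"

text \<open>An integral domain is a discrete valuation ring if it is the valuation ring of a discrete
  valuation on its field of fractions.\<close>

definition discrete_valuation_ring :: "'d::idom itself \<Rightarrow> bool" where
  "discrete_valuation_ring _ \<longleftrightarrow>
     (\<exists>v :: 'd fract \<Rightarrow> int. discrete_valuation v \<and>
        range (to_fract :: 'd \<Rightarrow> 'd fract) = {x. x = 0 \<or> 0 \<le> v x})"

text \<open>\<open>res\<close> exhibits the field \<open>'r\<close> as the quotient of \<open>'d\<close> by the ideal \<open>(t)\<close>. As this quotient is
  a field, \<open>(t)\<close> is maximal; if \<open>'d\<close> is a discrete valuation ring, it is the maximal ideal.\<close>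

definition residue_map :: "'d::idom \<Rightarrow> ('d \<Rightarrow> 'r::field) \<Rightarrow> bool" where
  "residue_map t res \<longleftrightarrow> comm_ring_hom res \<and> surj res \<and> {a. res a = 0} = {a. t dvd a}"

section \<open>Equivalence of matrices\<close>

definition GL :: "nat \<Rightarrow> 'a::semiring_1 mat set" where
  "GL N = {A \<in> carrier_mat N N. invertible_mat A}"

text \<open>Here \<open>T'\<close> is the inverse of \<open>T\<close>. Equivalent matrices are square of the same size.\<close>

definition mat_equiv :: "('d::idom \<Rightarrow> 'r::field) \<Rightarrow> 'd fract mat \<Rightarrow> 'd fract mat \<Rightarrow> bool" where
  "mat_equiv res W W' \<longleftrightarrow>
     (\<exists>N. W \<in> carrier_mat N N \<and> W' \<in> carrier_mat N N \<and>
       (\<exists>S \<in> GL N. \<exists>T \<in> GL N. \<exists>T' \<in> carrier_mat N N.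
          inverts_mat T T' \<and> inverts_mat T' T \<and>
          map_mat res S = map_mat res T \<and>
          W' = map_mat to_fract S * W * map_mat to_fract T'))"

text \<open>The sizes \<open>k\<close>, \<open>l\<close> below are smaller than that of \<open>W\<close>, because equivalent matrices have the
  same size \<open>k + l\<close>.\<close>

definition indecomposable_mat :: "('d::idom \<Rightarrow> 'r::field) \<Rightarrow> 'd fract mat \<Rightarrow> bool" where
  "indecomposable_mat res W \<longleftrightarrow>
     \<not> (\<exists>k l W1 W2. 0 < k \<and> 0 < l \<and> W1 \<in> carrier_mat k k \<and> W2 \<in> carrier_mat l l \<and>
          mat_equiv res W (diag_block_mat [W1, W2]))"

section \<open>The blocks\<close>

text \<open>Sequences are lists, indexed from \<open>0\<close>, as are matrix rows and columns.\<close>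

definition S_block :: "'d::idom \<Rightarrow> int list \<Rightarrow> 'd fract mat" where
  "S_block t \<mu> = mat (length \<mu> + 1) (length \<mu> + 1)
     (\<lambda>(i, j). if j = i + 1 then to_fract t powi (\<mu> ! i) else 0)"

text \<open>Frobenius block of a monic polynomial \<open>p\<close>: multiplication by \<open>\<xi>\<close> on \<open>\<k>[\<xi>]/(p)\<close> in the basis
  \<open>1, \<xi>, \<xi>\<^sup>2, \<dots>\<close>, acting on columns.\<close>

definition frobenius_block :: "'r::field poly \<Rightarrow> 'r mat" where
  "frobenius_block p = mat (degree p) (degree p)
     (\<lambda>(i, j). if j + 1 = degree p then - coeff p i else if i = j + 1 then 1 else 0)"

definition frobenius_lift :: "('d::idom \<Rightarrow> 'r::field) \<Rightarrow> nat \<Rightarrow> 'r poly \<Rightarrow> 'd mat \<Rightarrow> bool" where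
  "frobenius_lift res m \<pi> F \<longleftrightarrow>
     F \<in> carrier_mat (m * degree \<pi>) (m * degree \<pi>) \<and>
     map_mat res F = frobenius_block (\<pi> ^ m)"

text \<open>The matrix \<open>B(\<nu>, m, \<pi>)\<close> with an arbitrary square matrix \<open>F\<close> in the role of the lift: with
  \<open>k\<close> the size of \<open>F\<close>, the entry \<open>(i, j)\<close> lies in the block \<open>(i div k, j div k)\<close>, at position
  \<open>(i mod k, j mod k)\<close> inside that block.\<close>

definition B_block :: "'d::idom \<Rightarrow> int list \<Rightarrow> 'd mat \<Rightarrow> 'd fract mat" where
  "B_block t \<nu> F = (let n = length \<nu>; k = dim_row F in
     mat (n * k) (n * k) (\<lambda>(i, j).
       if j div k = i div k + 1 then to_fract t powi (\<nu> ! (i div k)) * 1\<^sub>m k $$ (i mod k, j mod k)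
       else if i div k = n - 1 \<and> j div k = 0
         then to_fract t powi (\<nu> ! (n - 1)) * to_fract (F $$ (i mod k, j mod k))
       else 0))"

definition nonperiodic :: "'a list \<Rightarrow> bool" where
  "nonperiodic \<nu> \<longleftrightarrow> (\<forall>l. 0 < l \<longrightarrow> l < length \<nu> \<longrightarrow> rotate l \<nu> \<noteq> \<nu>)"

definition B_data :: "int list \<times> nat \<times> 'r::field poly \<Rightarrow> bool" where
  "B_data = (\<lambda>(\<nu>, m, \<pi>). \<nu> \<noteq> [] \<and> nonperiodic \<nu> \<and> 1 \<le> m \<and>
     lead_coeff \<pi> = 1 \<and> irreducible \<pi> \<and> \<pi> \<noteq> [:0, 1:])"

definition lift_choice :: "('d::idom \<Rightarrow> 'r::field) \<Rightarrow> (nat \<Rightarrow> 'r poly \<Rightarrow> 'd mat) \<Rightarrow> bool" where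
  "lift_choice res L \<longleftrightarrow> (\<forall>\<nu> m \<pi>. B_data (\<nu>, m, \<pi>) \<longrightarrow> frobenius_lift res m \<pi> (L m \<pi>))"

text \<open>\<open>B(\<nu>, m, \<pi>)\<close>, given a choice \<open>L\<close> of the lifts entering its definition.\<close>

definition B_of :: "'d::idom \<Rightarrow> (nat \<Rightarrow> 'r::field poly \<Rightarrow> 'd mat) \<Rightarrow>
    int list \<times> nat \<times> 'r poly \<Rightarrow> 'd fract mat" where
  "B_of t L = (\<lambda>(\<nu>, m, \<pi>). B_block t \<nu> (L m \<pi>))"

text \<open>The list of diagonal blocks \<open>B(\<nu>\<^sub>1, m\<^sub>1, \<pi>\<^sub>1), \<dots>, S(\<mu>\<^sub>1), \<dots>\<close>.\<close>

definition canonical_blocks :: "'d::idom \<Rightarrow> (nat \<Rightarrow> 'r::field poly \<Rightarrow> 'd mat) \<Rightarrow>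
    (int list \<times> nat \<times> 'r poly) list \<Rightarrow> int list list \<Rightarrow> 'd fract mat list" where
  "canonical_blocks t L bs \<mu>s = map (B_of t L) bs @ map (S_block t) \<mu>s"

section \<open>Rotation of sequences\<close>

text \<open>\<open>(\<nu>\<^sub>1, \<dots>, \<nu>\<^sub>n) \<mapsto> (\<nu>\<^sub>n, \<nu>\<^sub>1, \<dots>, \<nu>\<^sub>n\<^sub>-\<^sub>1)\<close>, the inverse of \<open>rotate1\<close>.\<close>

definition rotate_right :: "'a list \<Rightarrow> 'a list" where
  "rotate_right \<nu> = (if \<nu> = [] then [] else last \<nu> # butlast \<nu>)"

lemma rotate1_rotate_right: "rotate1 (rotate_right \<nu>) = \<nu>"
  by (simp add: rotate_right_def)

lemma rotate_right_rotate1: "rotate_right (rotate1 \<nu>) = \<nu>"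
  by (cases \<nu>) (simp_all add: rotate_right_def)

text \<open>The \<open>l\<close>-fold iterate of \<open>rotate_right\<close> for an integer \<open>l\<close>.\<close>

definition rotation :: "int \<Rightarrow> 'a list \<Rightarrow> 'a list" where
  "rotation l \<nu> = (if 0 \<le> l then (rotate_right ^^ nat l) \<nu> else (rotate1 ^^ nat (- l)) \<nu>)"

end

theory Submission
  imports Defs "HOL-Library.Extended" "HOL-Library.Fun_Lexorder" "HOL-Library.Function_Algebras"
begin

text \<open>Matrices \<open>W\<close> form a \<open>\<k>\<close>-linear category: a morphism \<open>W \<rightarrow> W'\<close> is the common residue of a
  pair \<open>(S, T)\<close> with \<open>S W = W' T\<close>, and isomorphism is equivalence of matrices. Morphisms between
  the blocks are computed cell by cell: they can only lower the word read along the cycle in the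
  lexicographic order, so up to a nilpotent part an endomorphism of a block is a matrix commuting
  with the Frobenius block. Hence all blocks have local endomorphism rings, which gives
  indecomposability, the comparison of blocks and the Krull--Schmidt property.

  For existence, \<open>W\<close> is replaced by the linear relations
  \<open>R\<^sub>i = {(x, y) | W X = t\<^sup>i Y}\<close> on \<open>\<k>\<^sup>N\<close>, where \<open>x\<close>, \<open>y\<close> are the residues of the
  integral vectors \<open>X\<close>, \<open>Y\<close>. Pulling flags back along these relations produces a permutation of the
  finitely many jumps of a stable filtration; each of its cycles carries a nonperiodic word and
  an invertible monodromy, whose primary rational canonical form yields the blocks \<open>B(\<nu>, m, \<pi>)\<close>.
  The kernel of \<open>W\<close> is treated by adjoining one artificial relation, at which the cycles are finally cut
  into the strings \<open>S(\<mu>)\<close>.\<close>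


section \<open>Discrete valuation rings\<close>

text \<open>The obstacle to existence is that reduction modulo \<open>t\<close> turns
  \<open>W\<close> into relations, not maps: the second member is determined only up to the image at
  the previous exponent. This same ambiguity keeps everything comparable: images at exponent i lie
  between the whole images at i - 1 and i, so one chain of subspaces is stable under all relations
  at once. Around a cycle the composite relation induces an invertible map on a quotient only.
  Lifting it to a subspace means correcting a section, and the correction terminates because
  everything below a jump is reached from 0 along a finite prefix of its word.

  The artificial index M is taken so large that whatever lies in the domain of R_M is the residue of
  a true kernel vector of \<open>W\<close>. An edge with letter M can then be read with weight 0,
  which ends one string and starts the next. Cycles are rotated so that a letter M stands last; the
  monodromy sits on that edge and disappears with it.

  For uniqueness the cut edge is kept as a zero block with label \<open>Pinf\<close>. Strings and
  bands are then cyclic matrices of one type, and a single computation of morphisms serves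
  both.\<close>

locale dvr =
  fixes t :: "'d::idom" and res :: "'d \<Rightarrow> 'r::field"
  assumes dvr: "discrete_valuation_ring TYPE('d)"
    and residue: "residue_map t res"
begin

sublocale res: comm_ring_hom res
  using residue by (simp add: residue_map_def)

lemma res_surj: "\<exists>a. res a = c"
  using residue unfolding residue_map_def surj_def by metis

lemma res_eq_0_iff: "res a = 0 \<longleftrightarrow> t dvd a"
  using residue unfolding residue_map_def by blast

lemma res_t [simp]: "res t = 0"
  by (simp add: res_eq_0_iff)

lemma uniformizer_facts:
  shows t_nonzero: "t \<noteq> 0" and res_nonzero_imp_unit: "res a \<noteq> 0 \<Longrightarrow> a dvd 1"
    and fract_cases: "x \<noteq> 0 \<Longrightarrow> \<exists>i u. u dvd 1 \<and> x = to_fract t powi i * to_fract u"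
proof -
  obtain v :: "'d fract \<Rightarrow> int" where v: "discrete_valuation v"
    and ran: "range (to_fract :: 'd \<Rightarrow> 'd fract) = {x. x = 0 \<or> 0 \<le> v x}"
    using dvr unfolding discrete_valuation_ring_def by blast
  have sur: "\<exists>x. x \<noteq> 0 \<and> v x = i" for i
  proof -
    have "i \<in> v ` (UNIV - {0})" using v unfolding discrete_valuation_def by auto
    thus ?thesis by auto
  qed
  have mult: "x \<noteq> 0 \<Longrightarrow> y \<noteq> 0 \<Longrightarrow> v (x * y) = v x + v y" for x y
    using v unfolding discrete_valuation_def by blast
  have sub: "x \<noteq> 0 \<Longrightarrow> y \<noteq> 0 \<Longrightarrow> x + y \<noteq> 0 \<Longrightarrow> min (v x) (v y) \<le> v (x + y)" for x y
    using v unfolding discrete_valuation_def by blast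
  have v1: "v 1 = 0" using mult[of 1 1] by simp
  have vinv: "x \<noteq> 0 \<Longrightarrow> v (inverse x) = - v x" for x
    using mult[of x "inverse x"] v1 by simp
  have D: "\<exists>a. x = to_fract a" if "0 \<le> v x" for x
  proof -
    have "x \<in> range to_fract" unfolding ran using that by simp
    thus ?thesis by auto
  qed
  have vD: "0 \<le> v (to_fract a)" if "a \<noteq> 0" for a :: 'd
  proof -
    have "to_fract a \<in> {x. x = 0 \<or> 0 \<le> v x}" unfolding ran[symmetric] by simp
    thus ?thesis using that by simp
  qed
  have unit: "a dvd 1" if "a \<noteq> 0" "v (to_fract a) = 0" for a :: 'd
  proof -
    have "v (inverse (to_fract a)) = 0" using that vinv[of "to_fract a"] by simp
    then obtain b where b: "inverse (to_fract a) = to_fract b" using D by force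
    have "to_fract (a * b) = 1" using that by (simp flip: b)
    hence "to_fract (a * b) = to_fract 1" by simp
    hence "a * b = 1" unfolding to_fract_eq_iff .
    thus ?thesis by (metis dvd_triv_left)
  qed
  have unit_iff: "v (to_fract a) = 0" if "a dvd 1" for a :: 'd
  proof -
    from that obtain b where b: "1 = a * b" ..
    hence nz: "a \<noteq> 0" "b \<noteq> 0" by auto
    have "to_fract a * to_fract b = 1" by (simp flip: to_fract_mult b)
    hence "v (to_fract a) + v (to_fract b) = 0" using mult[of "to_fract a" "to_fract b"] nz v1 by simp
    thus ?thesis using vD[OF nz(1)] vD[OF nz(2)] by simp
  qed
  have tnu: "\<not> t dvd 1" using res_eq_0_iff[of 1] by simp
  \<comment> \<open>The hypothesis on \<open>res\<close> only makes the quotient by \<open>t\<close>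
    a field. If \<open>t\<close> does not divide \<open>a\<close>, an inverse \<open>b\<close> of
    \<open>a\<close> modulo \<open>t\<close> makes \<open>1 - a * b\<close> divisible by
    \<open>t\<close>; as \<open>a * b\<close> has positive valuation, \<open>1 - a * b\<close> is
    also a unit, which is absurd.\<close>
  have dvdpos: "t dvd a" if "a \<noteq> 0" "v (to_fract a) > 0" for a :: 'd
  proof (rule ccontr)
    assume "\<not> t dvd a"
    hence "res a \<noteq> 0" by (simp add: res_eq_0_iff)
    obtain b where b: "res b = inverse (res a)" using res_surj by blast
    have "res (1 - a * b) = 0" using b \<open>res a \<noteq> 0\<close> by (simp add: hom_distribs)
    hence td: "t dvd 1 - a * b" by (simp add: res_eq_0_iff)
    have "b \<noteq> 0" using b \<open>res a \<noteq> 0\<close> by auto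
    have pos: "v (to_fract (a * b)) > 0" using mult[of "to_fract a" "to_fract b"] that vD[OF \<open>b \<noteq> 0\<close>] \<open>b \<noteq> 0\<close> by simp
    have nz: "1 - a * b \<noteq> 0"
    proof
      assume "1 - a * b = 0" hence "a * b = 1" by simp
      thus False using pos v1 by simp
    qed
    have "v (to_fract (1 - a * b)) = 0"
    proof (rule ccontr)
      assume "v (to_fract (1 - a * b)) \<noteq> 0"
      hence p: "v (to_fract (1 - a * b)) > 0" using vD[OF nz] by simp
      have e: "to_fract (1 - a * b) + to_fract (a * b) = 1"
        unfolding to_fract_add[symmetric] by simp
      have "min (v (to_fract (1 - a * b))) (v (to_fract (a * b))) \<le> v (to_fract (1 - a * b) + to_fract (a * b))"
        by (rule sub) (use nz that \<open>b \<noteq> 0\<close> in \<open>simp_all add: e del: to_fract_diff to_fract_mult\<close>)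
      thus False using p pos v1 unfolding e by simp
    qed
    hence "1 - a * b dvd 1" using unit nz by blast
    thus False using td tnu dvd_trans by blast
  qed
  show t0: "t \<noteq> 0"
  proof
    assume "t = 0"
    obtain x where x: "x \<noteq> 0" "v x = 1" using sur by blast
    then obtain a where a: "x = to_fract a" using D[of x] by auto
    hence "t dvd a" using dvdpos[of a] x by auto
    thus False using \<open>t = 0\<close> a x by simp
  qed
  \<comment> \<open>Some element of valuation 1 is a multiple of \<open>t\<close>, and
    \<open>t\<close> is a non-unit, so its valuation is squeezed between 0 (excluded) and 1.\<close>
  have vt: "v (to_fract t) = 1"
  proof -
    have "v (to_fract t) > 0" using vD[OF t0] unit[OF t0] tnu by fastforce
    obtain x where x: "x \<noteq> 0" "v x = 1" using sur by blast
    then obtain a where a: "x = to_fract a" using D[of x] by auto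
    hence "t dvd a" using dvdpos[of a] x by auto
    then obtain c where c: "a = t * c" by (auto elim: dvdE)
    hence "c \<noteq> 0" using a x by auto
    have "v x = v (to_fract t) + v (to_fract c)" using mult[of "to_fract t" "to_fract c"] a c t0 \<open>c \<noteq> 0\<close> by simp
    thus ?thesis using x \<open>v (to_fract t) > 0\<close> vD[OF \<open>c \<noteq> 0\<close>] by simp
  qed
  show "a dvd 1" if "res a \<noteq> 0" for a
  proof -
    have "a \<noteq> 0" using that by auto
    moreover have "\<not> v (to_fract a) > 0" using dvdpos[OF \<open>a \<noteq> 0\<close>] that by (auto simp: res_eq_0_iff)
    ultimately show ?thesis using vD[of a] unit[of a] by force
  qed
  have vpn: "v (to_fract t ^ n) = int n" for n
    using t0 by (induction n) (simp_all add: v1 mult vt)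
  have vp: "v (to_fract t powi i) = i" for i
    using t0 vinv[of "to_fract t ^ nat (- i)"] by (cases "0 \<le> i") (simp_all add: power_int_def vpn power_inverse)
  show "\<exists>i u. u dvd 1 \<and> x = to_fract t powi i * to_fract u" if "x \<noteq> 0" for x
  proof -
    let ?y = "x * to_fract t powi (- v x)"
    have y0: "?y \<noteq> 0" using that t0 by simp
    have "v ?y = 0" using mult[OF that, of "to_fract t powi (- v x)"] vp[of "- v x"] t0 by simp
    then obtain u where u: "?y = to_fract u" using D by force
    hence "u dvd 1" using unit[of u] y0 \<open>v ?y = 0\<close> by auto
    moreover have "x = to_fract t powi (v x) * to_fract u"
      using t0 unfolding u[symmetric] by (simp add: power_int_minus)
    ultimately show ?thesis by blast
  qed
qed

lemma to_fract_pow: "to_fract (a ^ n) = to_fract (a :: 'd) ^ n"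
  by (induction n) simp_all

lemma integral_after_scaling: "\<exists>n a. to_fract t ^ n * x = to_fract a"
proof (cases "x = 0")
  case False
  then obtain i u where u: "x = to_fract t powi i * to_fract u" using fract_cases by blast
  have "to_fract t ^ nat \<bar>i\<bar> * to_fract t powi i = to_fract t powi (\<bar>i\<bar> + i)"
    using t_nonzero power_int_add[of "to_fract t" "\<bar>i\<bar>" i] by (simp add: power_int_def)
  also have "\<dots> = to_fract (t ^ nat (\<bar>i\<bar> + i))"
    by (simp add: power_int_def to_fract_pow)
  finally have "to_fract t ^ nat \<bar>i\<bar> * x = to_fract (t ^ nat (\<bar>i\<bar> + i) * u)"
    unfolding u by (simp flip: mult.assoc)
  thus ?thesis by blast
qed (auto intro: exI[of _ 0])

end

section \<open>Morphisms\<close>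

lemma four_block_mat_eqD:
  assumes "four_block_mat A B C D = four_block_mat A' B' C' D'"
    and "A \<in> carrier_mat r1 c1" "B \<in> carrier_mat r1 c2" "C \<in> carrier_mat r2 c1" "D \<in> carrier_mat r2 c2"
    and "A' \<in> carrier_mat r1 c1" "B' \<in> carrier_mat r1 c2" "C' \<in> carrier_mat r2 c1" "D' \<in> carrier_mat r2 c2"
  shows "A = A'" "B = B'" "C = C'" "D = D'"
proof -
  note [simp] = assms(2-)[THEN carrier_matD(1)] assms(2-)[THEN carrier_matD(2)]
  have *: "four_block_mat A B C D $$ (i, j) = four_block_mat A' B' C' D' $$ (i, j)" for i j
    using assms(1) by simp
  show "A = A'" proof (rule eq_matI)
    fix i j assume "i < dim_row A'" "j < dim_col A'" thus "A $$ (i,j) = A' $$ (i,j)" using *[of i j] by simp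
  qed simp_all
  show "B = B'" proof (rule eq_matI)
    fix i j assume "i < dim_row B'" "j < dim_col B'" thus "B $$ (i,j) = B' $$ (i,j)" using *[of i "c1 + j"] by simp
  qed simp_all
  show "C = C'" proof (rule eq_matI)
    fix i j assume "i < dim_row C'" "j < dim_col C'" thus "C $$ (i,j) = C' $$ (i,j)" using *[of "r1 + i" j] by simp
  qed simp_all
  show "D = D'" proof (rule eq_matI)
    fix i j assume "i < dim_row D'" "j < dim_col D'" thus "D $$ (i,j) = D' $$ (i,j)" using *[of "r1 + i" "c1 + j"] by simp
  qed simp_all
qed

lemma four_block_mat_exhaust:
  assumes "S \<in> carrier_mat (r1 + r2) (c1 + c2)"
  obtains A B C D where "S = four_block_mat A B C D"
    "A \<in> carrier_mat r1 c1" "B \<in> carrier_mat r1 c2" "C \<in> carrier_mat r2 c1" "D \<in> carrier_mat r2 c2"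
proof -
  obtain A B C D where s: "split_block S r1 c1 = (A, B, C, D)" by (metis prod_cases4)
  show ?thesis using split_block[OF s, of r2 c2] assms that by auto
qed

lemma invertible_mat_iff_left_inverse:
  assumes "(A :: 'a::field mat) \<in> carrier_mat n n"
  shows "invertible_mat A \<longleftrightarrow> (\<exists>B \<in> carrier_mat n n. B * A = 1\<^sub>m n)"
proof
  assume "invertible_mat A"
  then obtain B where B: "A * B = 1\<^sub>m (dim_row A)" "B * A = 1\<^sub>m (dim_row B)"
    unfolding invertible_mat_def inverts_mat_def by auto
  have "dim_col B = n" using arg_cong[OF B(1), of dim_col] assms by simp
  moreover have "dim_row B = n" using arg_cong[OF B(2), of dim_col] assms by simp
  ultimately have "B \<in> carrier_mat n n" by auto
  thus "\<exists>B \<in> carrier_mat n n. B * A = 1\<^sub>m n" using B by auto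
next
  assume "\<exists>B \<in> carrier_mat n n. B * A = 1\<^sub>m n"
  then obtain B where "B \<in> carrier_mat n n" "B * A = 1\<^sub>m n" by blast
  thus "invertible_mat A"
    using mat_mult_left_right_inverse[of B n A] assms unfolding invertible_mat_def inverts_mat_def by auto
qed

lemma invertible_matE:
  assumes "invertible_mat A" "A \<in> carrier_mat n n"
  obtains B where "B \<in> carrier_mat n n" "A * B = 1\<^sub>m n" "B * A = 1\<^sub>m n"
proof -
  obtain B where B: "A * B = 1\<^sub>m (dim_row A)" "B * A = 1\<^sub>m (dim_row B)"
    using assms unfolding invertible_mat_def inverts_mat_def by auto
  have "dim_col B = n" using arg_cong[OF B(1), of dim_col] assms by simp
  moreover have "dim_row B = n" using arg_cong[OF B(2), of dim_col] assms by simp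
  ultimately show ?thesis using that B assms by auto
qed

lemma invertible_matI:
  assumes "A \<in> carrier_mat n n" "B \<in> carrier_mat n n" "A * B = 1\<^sub>m n" "B * A = 1\<^sub>m n"
  shows "invertible_mat A"
  using assms unfolding invertible_mat_def inverts_mat_def by auto

lemma mult_mat_cancel:
  "A * B = (1\<^sub>m n :: 'a::semiring_1 mat) \<Longrightarrow> A \<in> carrier_mat n m \<Longrightarrow> B \<in> carrier_mat m n \<Longrightarrow> X \<in> carrier_mat n k \<Longrightarrow> A * (B * X) = X"
  by (subst assoc_mult_mat[symmetric, of A n m B n X k]) (simp_all add: left_mult_one_mat[of X n k])

lemma smult_smult_mat: "a \<cdot>\<^sub>m (b \<cdot>\<^sub>m A) = (a * b :: 'a :: semiring_1) \<cdot>\<^sub>m A"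
  by (rule eq_matI) (auto simp: mult.assoc)

lemma one_smult_mat: "(1 :: 'a :: semiring_1) \<cdot>\<^sub>m A = A"
  by (rule eq_matI) auto

lemma invertible_mat_mult:
  assumes A: "A \<in> carrier_mat n n" "invertible_mat A" and B: "B \<in> carrier_mat n n" "invertible_mat B"
  shows "invertible_mat (A * B)"
proof -
  obtain A' where A': "A' \<in> carrier_mat n n" "A * A' = 1\<^sub>m n" "A' * A = 1\<^sub>m n" using A invertible_matE by blast
  obtain B' where B': "B' \<in> carrier_mat n n" "B * B' = 1\<^sub>m n" "B' * B = 1\<^sub>m n" using B invertible_matE by blast
  have "A * B * (B' * A') = 1\<^sub>m n" "B' * A' * (A * B) = 1\<^sub>m n" using A(1) B(1) A' B'
    by (simp_all add: assoc_mult_mat[of _ n n _ n _ n] mult_mat_cancel[OF B'(2), of n] mult_mat_cancel[OF A'(3), of n])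
  thus ?thesis using A B A' B' by (intro invertible_matI[of _ n "B' * A'"]) auto
qed

lemma invertible_mat_iff_inj:
  assumes "(A :: 'a::field mat) \<in> carrier_mat n n"
  shows "invertible_mat A \<longleftrightarrow> (\<forall>v \<in> carrier_vec n. A *\<^sub>v v = 0\<^sub>v n \<longrightarrow> v = 0\<^sub>v n)"
proof -
  have "invertible_mat A \<longleftrightarrow> det A \<noteq> 0"
  proof
    assume "invertible_mat A"
    then obtain B where B: "B \<in> carrier_mat n n" "A * B = 1\<^sub>m n" using assms invertible_matE by blast
    have "det A * det B = 1" using det_mult[OF assms B(1)] B by simp
    thus "det A \<noteq> 0" by auto
  next
    assume d: "det A \<noteq> 0"
    have "(inverse (det A) \<cdot>\<^sub>m adj_mat A) * A = 1\<^sub>m n"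
      using adj_mat[OF assms] assms d by (simp add: mult_smult_assoc_mat[of _ n n _ n] smult_smult_mat one_smult_mat)
    thus "invertible_mat A" unfolding invertible_mat_iff_left_inverse[OF assms]
      using adj_mat(1)[OF assms] by (intro bexI[of _ "inverse (det A) \<cdot>\<^sub>m adj_mat A"]) auto
  qed
  thus ?thesis using det_0_iff_vec_prod_zero_field[OF assms] by auto
qed

text \<open>Written through the dimensions of both blocks, so that it is literally the form to which
  \<open>diag_block_mat\<close> unfolds on a nonempty list.\<close>

abbreviation diag2 :: "'a::zero mat \<Rightarrow> 'a mat \<Rightarrow> 'a mat" where
  "diag2 A B \<equiv> four_block_mat A (0\<^sub>m (dim_row A) (dim_col B)) (0\<^sub>m (dim_row B) (dim_col A)) B"

section \<open>The category whose morphisms are residues of intertwining pairs\<close>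

context dvr
begin

abbreviation "lft \<equiv> map_mat (to_fract :: 'd \<Rightarrow> 'd fract)"
abbreviation "mres \<equiv> map_mat res"

sublocale to_fract: comm_ring_hom "to_fract :: 'd \<Rightarrow> 'd fract"
  by unfold_locales auto

text \<open>Only the common residue is kept, not the pair: residues live over a field, where kernels
  and dimensions are available, and invertibility of the residue already lifts to \<open>S\<close>
  and \<open>T\<close> by \<open>unit_inverse_lift\<close>.\<close>

definition hom :: "'d fract mat \<Rightarrow> 'd fract mat \<Rightarrow> 'r mat set" where
  "hom W W' = {g. \<exists>S T. S \<in> carrier_mat (dim_row W') (dim_row W) \<and> T \<in> carrier_mat (dim_row W') (dim_row W) \<and>
     g = mres S \<and> mres T = mres S \<and> lft S * W = W' * lft T}"

lemma homI:
  assumes "W \<in> carrier_mat a a" "W' \<in> carrier_mat b b" "S \<in> carrier_mat b a" "T \<in> carrier_mat b a"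
    "g = mres S" "mres T = mres S" "lft S * W = W' * lft T"
  shows "g \<in> hom W W'"
  unfolding hom_def using assms by auto

lemma homE:
  assumes "g \<in> hom W W'" "W \<in> carrier_mat a a" "W' \<in> carrier_mat b b"
  obtains S T where "S \<in> carrier_mat b a" "T \<in> carrier_mat b a"
    "g = mres S" "mres T = mres S" "lft S * W = W' * lft T"
  using assms unfolding hom_def by auto

lemma hom_carrier:
  assumes "g \<in> hom W W'" "W \<in> carrier_mat a a" "W' \<in> carrier_mat b b"
  shows "g \<in> carrier_mat b a"
proof -
  obtain S where "S \<in> carrier_mat b a" "g = mres S" using homE[OF assms] .
  thus ?thesis by simp
qed

lemma hom_one: "W \<in> carrier_mat a a \<Longrightarrow> 1\<^sub>m a \<in> hom W W"
  by (rule homI[of W a W a "1\<^sub>m a" "1\<^sub>m a"]) (auto simp: res.mat_hom_one to_fract.mat_hom_one)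

lemma hom_comp:
  assumes g: "g \<in> hom W W'" and h: "h \<in> hom W' W''"
    and W: "W \<in> carrier_mat a a" "W' \<in> carrier_mat b b" "W'' \<in> carrier_mat c c"
  shows "h * g \<in> hom W W''"
proof -
  obtain S T where S: "S \<in> carrier_mat b a" "T \<in> carrier_mat b a"
    "g = mres S" "mres T = mres S" "lft S * W = W' * lft T" using homE[OF g W(1,2)] .
  obtain S' T' where S': "S' \<in> carrier_mat c b" "T' \<in> carrier_mat c b"
    "h = mres S'" "mres T' = mres S'" "lft S' * W' = W'' * lft T'" using homE[OF h W(2,3)] .
  have "lft (S' * S) * W = lft S' * (lft S * W)"
    using S S' W by (simp add: to_fract.mat_hom_mult[of _ c b _ a] assoc_mult_mat[of _ c b _ a _ a])
  also have "\<dots> = lft S' * W' * lft T"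
    unfolding S(5) using S(1,2) S'(1,2) W by (simp add: assoc_mult_mat[of _ c b _ b _ a])
  also have "\<dots> = W'' * lft (T' * T)" unfolding S'(5)
    using S(1,2) S'(1,2) W by (simp add: to_fract.mat_hom_mult[of _ c b _ a] assoc_mult_mat[of _ c c _ b _ a])
  finally show ?thesis using S S' W
    by (intro homI[of W a W'' c "S' * S" "T' * T"]) (auto simp: res.mat_hom_mult[of _ c b _ a])
qed

lemma mres_minus: "S \<in> carrier_mat b a \<Longrightarrow> S' \<in> carrier_mat b a \<Longrightarrow> mres (S - S') = mres S - mres S'"
  by (rule eq_matI) (auto simp: hom_distribs)

lemma hom_minus:
  assumes g: "g \<in> hom W W'" and h: "h \<in> hom W W'"
    and W: "W \<in> carrier_mat a a" "W' \<in> carrier_mat b b"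
  shows "g - h \<in> hom W W'"
proof -
  obtain S T where S: "S \<in> carrier_mat b a" "T \<in> carrier_mat b a"
    "g = mres S" "mres T = mres S" "lft S * W = W' * lft T" using homE[OF g W] .
  obtain S' T' where S': "S' \<in> carrier_mat b a" "T' \<in> carrier_mat b a"
    "h = mres S'" "mres T' = mres S'" "lft S' * W = W' * lft T'" using homE[OF h W] .
  have l: "lft (A - B) = lft A - lft B" if "A \<in> carrier_mat b a" "B \<in> carrier_mat b a" for A B
    using that by (intro eq_matI) auto
  have "lft (S - S') * W = W' * lft (T - T')"
    using S S' W by (simp add: l minus_mult_distrib_mat[of _ b a _ _ a] mult_minus_distrib_mat[of _ b b _ a])
  thus ?thesis using S S' W
    by (intro homI[of W a W' b "S - S'" "T - T'"]) (auto simp: mres_minus)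
qed

lemma hom_zero: "W \<in> carrier_mat a a \<Longrightarrow> W' \<in> carrier_mat b b \<Longrightarrow> 0\<^sub>m b a \<in> hom W W'"
proof -
  assume W: "W \<in> carrier_mat a a" "W' \<in> carrier_mat b b"
  have z: "map_mat f (0\<^sub>m b a) = 0\<^sub>m b a" if "f 0 = 0" for f :: "'x::zero \<Rightarrow> 'y::zero"
    using that by (intro eq_matI) auto
  show ?thesis
    by (rule homI[OF W, of "0\<^sub>m b a" "0\<^sub>m b a"]) (use W in \<open>simp_all add: z\<close>)
qed

lemma hom_add:
  assumes g: "g \<in> hom W W'" and h: "h \<in> hom W W'"
    and W: "W \<in> carrier_mat a a" "W' \<in> carrier_mat b b"
  shows "g + h \<in> hom W W'"
proof -
  have "g - (0\<^sub>m b a - h) \<in> hom W W'"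
    by (rule hom_minus[OF g hom_minus[OF hom_zero[OF W] h W] W])
  moreover have "g - (0\<^sub>m b a - h) = g + h"
    using hom_carrier[OF g W] hom_carrier[OF h W] by (intro eq_matI) auto
  ultimately show ?thesis by simp
qed

text \<open>The determinant of \<open>S\<close> has nonzero residue, hence is a unit of the
  valuation ring, and the adjugate divided by it inverts \<open>S\<close>.\<close>

lemma unit_inverse_lift:
  assumes S: "S \<in> carrier_mat n n" and inv: "invertible_mat (mres S)"
  shows "invertible_mat S"
proof -
  obtain B where B: "B \<in> carrier_mat n n" "mres S * B = 1\<^sub>m n" using inv S invertible_matE[of "mres S" n] by auto
  have "det (mres S) * det B = 1" using det_mult[of "mres S" n B] B S by simp
  hence "res (det S) \<noteq> 0" by auto
  hence "det S dvd 1" by (rule res_nonzero_imp_unit)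
  then obtain u where "1 = det S * u" ..
  hence u: "det S * u = 1" by simp
  have "S * (u \<cdot>\<^sub>m adj_mat S) = 1\<^sub>m n" "u \<cdot>\<^sub>m adj_mat S * S = 1\<^sub>m n"
    using adj_mat[OF S] S u by (simp_all add: mult_smult_distrib[of _ n n _ n] mult_smult_assoc_mat[of _ n n _ n] smult_smult_mat one_smult_mat mult.commute)
  thus ?thesis using adj_mat(1)[OF S] S by (intro invertible_matI[of S n "u \<cdot>\<^sub>m adj_mat S"]) auto
qed

text \<open>Both \<open>S'\<close> and \<open>T'\<close> reduce to the inverse of \<open>g\<close>;
  therefore their residues agree and they form a morphism in the opposite direction.\<close>

lemma invertible_hom:
  assumes g: "g \<in> hom W W'" "invertible_mat g" and W: "W \<in> carrier_mat n n" "W' \<in> carrier_mat n n"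
  obtains S T S' T' where
    "S \<in> carrier_mat n n" "T \<in> carrier_mat n n" "S' \<in> carrier_mat n n" "T' \<in> carrier_mat n n"
    "g = mres S" "mres T = mres S" "mres S' = mres T'" "lft S * W = W' * lft T"
    "S * S' = 1\<^sub>m n" "S' * S = 1\<^sub>m n" "T * T' = 1\<^sub>m n" "T' * T = 1\<^sub>m n"
    "W' = lft S * W * lft T'" "lft S' * W' = W * lft T'"
    "mres S' * g = 1\<^sub>m n" "g * mres S' = 1\<^sub>m n"
proof -
  obtain S T where S: "S \<in> carrier_mat n n" "T \<in> carrier_mat n n"
    "g = mres S" "mres T = mres S" "lft S * W = W' * lft T" using homE[OF g(1) W] .
  obtain S' where S': "S' \<in> carrier_mat n n" "S * S' = 1\<^sub>m n" "S' * S = 1\<^sub>m n"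
    using unit_inverse_lift[OF S(1)] g S invertible_matE by metis
  obtain T' where T': "T' \<in> carrier_mat n n" "T * T' = 1\<^sub>m n" "T' * T = 1\<^sub>m n"
    using unit_inverse_lift[OF S(2)] g S invertible_matE by metis
  have gS: "mres S' * g = 1\<^sub>m n" "g * mres S' = 1\<^sub>m n"
    using S' S by (simp_all flip: res.mat_hom_mult[of _ n n _ n] add: res.mat_hom_one)
  have gT: "mres T' * g = 1\<^sub>m n" "g * mres T' = 1\<^sub>m n"
    using T' S(1,2) unfolding S(3) S(4)[symmetric]
    by (simp_all flip: res.mat_hom_mult[of _ n n _ n] add: res.mat_hom_one)
  have "mres S' = mres S' * (g * mres T')" using gT S' by simp
  also have "\<dots> = mres S' * g * mres T'" using S S' T' by (simp add: assoc_mult_mat[of _ n n _ n _ n])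
  finally have eq: "mres S' = mres T'" using gS T' by simp
  have l: "lft T * lft T' = 1\<^sub>m n" "lft S' * lft S = 1\<^sub>m n"
    using T' S' S by (simp_all flip: to_fract.mat_hom_mult[of _ n n _ n] add: to_fract.mat_hom_one)
  have W': "W' = lft S * W * lft T'" unfolding S(5)
    using l W S T' by (simp add: assoc_mult_mat[of _ n n _ n _ n])
  have "W' = lft S * (W * lft T')" unfolding W' using W S(1) T'(1) by (intro assoc_mult_mat) auto
  hence "lft S' * W' = lft S' * (lft S * (W * lft T'))" by (rule arg_cong)
  also have "\<dots> = W * lft T'" using S(1) S'(1) W T'(1) by (intro mult_mat_cancel[OF l(2)]) auto
  finally have "lft S' * W' = W * lft T'" .
  thus ?thesis using that[OF S(1,2) S'(1) T'(1) S(3,4) eq S(5) S'(2,3) T'(2,3) W'] gS by blast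
qed

lemma hom_inverse:
  assumes "g \<in> hom W W'" "invertible_mat g" "W \<in> carrier_mat n n" "W' \<in> carrier_mat n n"
  obtains h where "h \<in> hom W' W" "h * g = 1\<^sub>m n" "g * h = 1\<^sub>m n"
proof -
  obtain S T S' T' where *: "S' \<in> carrier_mat n n" "T' \<in> carrier_mat n n" "mres S' = mres T'"
    "lft S' * W' = W * lft T'" "mres S' * g = 1\<^sub>m n" "g * mres S' = 1\<^sub>m n" using invertible_hom[OF assms] .
  have "mres S' \<in> hom W' W" by (rule homI[of W' n W n S' T']) (use * assms in simp_all)
  from that[OF this *(5,6)] show ?thesis .
qed

text \<open>Reduces equivalence to the existence of one morphism with invertible residue; from here
  on it is treated as isomorphism in a category.\<close>

lemma mat_equiv_iff_hom:
  "mat_equiv res W W' \<longleftrightarrow> (\<exists>n g. W \<in> carrier_mat n n \<and> W' \<in> carrier_mat n n \<and> g \<in> hom W W' \<and> invertible_mat g)"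
proof
  assume "mat_equiv res W W'"
  then obtain n S T T' where W: "W \<in> carrier_mat n n" "W' \<in> carrier_mat n n"
    and S: "S \<in> GL n" "T \<in> GL n" and T': "T' \<in> carrier_mat n n" "inverts_mat T T'" "inverts_mat T' T"
    and r: "mres S = mres T" and eq: "W' = lft S * W * lft T'"
    unfolding mat_equiv_def by blast
  have c: "S \<in> carrier_mat n n" "T \<in> carrier_mat n n" "invertible_mat S" using S unfolding GL_def by auto
  have i: "T' * T = 1\<^sub>m n" using T' unfolding inverts_mat_def by auto
  have "lft T' * lft T = 1\<^sub>m n" using T' c i by (simp flip: to_fract.mat_hom_mult[of _ n n _ n] add: to_fract.mat_hom_one)
  hence "lft S * W = W' * lft T" unfolding eq using W c T' by (simp add: assoc_mult_mat[of _ n n _ n _ n])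
  hence h: "mres S \<in> hom W W'" using W c r by (intro homI[of W n W' n S T]) auto
  obtain S' where S': "S' \<in> carrier_mat n n" "S * S' = 1\<^sub>m n" "S' * S = 1\<^sub>m n" using c invertible_matE by blast
  have "mres S * mres S' = 1\<^sub>m n" "mres S' * mres S = 1\<^sub>m n"
    using S' c by (simp_all flip: res.mat_hom_mult[of _ n n _ n] add: res.mat_hom_one)
  hence "invertible_mat (mres S)" using c S' by (intro invertible_matI[of _ n "mres S'"]) auto
  thus "\<exists>n g. W \<in> carrier_mat n n \<and> W' \<in> carrier_mat n n \<and> g \<in> hom W W' \<and> invertible_mat g" using W h by (intro exI[of _ n] exI[of _ "mres S"]) simp
next
  assume "\<exists>n g. W \<in> carrier_mat n n \<and> W' \<in> carrier_mat n n \<and> g \<in> hom W W' \<and> invertible_mat g"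
  then obtain n g where W: "W \<in> carrier_mat n n" "W' \<in> carrier_mat n n" and g: "g \<in> hom W W'" "invertible_mat g" by blast
  obtain S T S' T' where *: "S \<in> carrier_mat n n" "T \<in> carrier_mat n n" "S' \<in> carrier_mat n n" "T' \<in> carrier_mat n n"
    "mres T = mres S" "S * S' = 1\<^sub>m n" "S' * S = 1\<^sub>m n" "T * T' = 1\<^sub>m n" "T' * T = 1\<^sub>m n" "W' = lft S * W * lft T'"
    using invertible_hom[OF g W] .
  have "S \<in> GL n" "T \<in> GL n" unfolding GL_def using * invertible_matI by auto
  moreover have "inverts_mat T T'" "inverts_mat T' T" using * unfolding inverts_mat_def by auto
  ultimately show "mat_equiv res W W'" unfolding mat_equiv_def using * W by metis
qed

lemma mat_equivI:
  "g \<in> hom W W' \<Longrightarrow> invertible_mat g \<Longrightarrow> W \<in> carrier_mat n n \<Longrightarrow> W' \<in> carrier_mat n n \<Longrightarrow> mat_equiv res W W'"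
  unfolding mat_equiv_iff_hom by (rule exI[of _ n], rule exI[of _ g]) simp

lemma mat_equivE:
  assumes "mat_equiv res W W'" "W \<in> carrier_mat n n"
  obtains g h where "W' \<in> carrier_mat n n" "g \<in> hom W W'" "h \<in> hom W' W" "h * g = 1\<^sub>m n" "g * h = 1\<^sub>m n"
    "invertible_mat g"
proof -
  obtain m g where W: "W \<in> carrier_mat m m" "W' \<in> carrier_mat m m" and g: "g \<in> hom W W'" "invertible_mat g"
    using assms(1) unfolding mat_equiv_iff_hom by blast
  have "m = n" using W assms(2) by auto
  obtain h where "h \<in> hom W' W" "h * g = 1\<^sub>m m" "g * h = 1\<^sub>m m" using hom_inverse[OF g W] .
  thus ?thesis using that[of g h] g W \<open>m = n\<close> by simp
qed

lemma mat_equiv_carrier: "mat_equiv res W W' \<Longrightarrow> W \<in> carrier_mat n n \<Longrightarrow> W' \<in> carrier_mat n n"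
  using mat_equivE by blast

lemma mat_equiv_square: "mat_equiv res W W' \<Longrightarrow> W \<in> carrier_mat (dim_row W) (dim_row W)"
  unfolding mat_equiv_def by auto

lemma mat_equiv_refl: "W \<in> carrier_mat n n \<Longrightarrow> mat_equiv res W W"
  by (rule mat_equivI[of "1\<^sub>m n"]) (auto intro: hom_one invertible_matI[of _ n "1\<^sub>m n"])

lemma mat_equiv_sym:
  assumes "mat_equiv res W W'" shows "mat_equiv res W' W"
proof -
  note W = mat_equiv_square[OF assms]
  obtain g h where *: "W' \<in> carrier_mat (dim_row W) (dim_row W)" "g \<in> hom W W'" "h \<in> hom W' W"
    "h * g = 1\<^sub>m (dim_row W)" "g * h = 1\<^sub>m (dim_row W)" using mat_equivE[OF assms W] .
  have "invertible_mat h"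
    by (rule invertible_matI[OF hom_carrier[OF *(3,1) W] hom_carrier[OF *(2) W *(1)] *(4,5)])
  thus ?thesis by (rule mat_equivI[OF *(3) _ *(1) W])
qed

lemma mat_equiv_trans:
  assumes "mat_equiv res W W'" "mat_equiv res W' W''" shows "mat_equiv res W W''"
proof -
  let ?n = "dim_row W"
  note W = mat_equiv_square[OF assms(1)]
  obtain g where g: "W' \<in> carrier_mat ?n ?n" "g \<in> hom W W'" "invertible_mat g" using mat_equivE[OF assms(1) W] by metis
  obtain h where h: "W'' \<in> carrier_mat ?n ?n" "h \<in> hom W' W''" "invertible_mat h" using mat_equivE[OF assms(2) g(1)] by metis
  have "invertible_mat (h * g)"
    by (rule invertible_mat_mult[OF hom_carrier[OF h(2) g(1) h(1)] h(3) hom_carrier[OF g(2) W g(1)] g(3)])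
  thus ?thesis by (rule mat_equivI[OF hom_comp[OF g(2) h(2) W g(1) h(1)] _ W h(1)])
qed

subsection \<open>Direct sums and the Krull--Schmidt theorem\<close>

text \<open>Together with \<open>hom_four_blockE\<close> this shows that \<open>diag2\<close> is a
  direct sum: morphisms between sums are the 2 by 2 matrices of morphisms.\<close>

lemma hom_four_block:
  assumes W: "A \<in> carrier_mat a a" "B \<in> carrier_mat b b" "A' \<in> carrier_mat a' a'" "B' \<in> carrier_mat b' b'"
    and g: "p \<in> hom A A'" "q \<in> hom B A'" "r \<in> hom A B'" "s \<in> hom B B'"
  shows "four_block_mat p q r s \<in> hom (diag2 A B) (diag2 A' B')"
proof -
  obtain S1 T1 where 1: "S1 \<in> carrier_mat a' a" "T1 \<in> carrier_mat a' a" "p = mres S1" "mres T1 = mres S1"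
    "lft S1 * A = A' * lft T1" using homE[OF g(1) W(1,3)] .
  obtain S2 T2 where 2: "S2 \<in> carrier_mat a' b" "T2 \<in> carrier_mat a' b" "q = mres S2" "mres T2 = mres S2"
    "lft S2 * B = A' * lft T2" using homE[OF g(2) W(2,3)] .
  obtain S3 T3 where 3: "S3 \<in> carrier_mat b' a" "T3 \<in> carrier_mat b' a" "r = mres S3" "mres T3 = mres S3"
    "lft S3 * A = B' * lft T3" using homE[OF g(3) W(1,4)] .
  obtain S4 T4 where 4: "S4 \<in> carrier_mat b' b" "T4 \<in> carrier_mat b' b" "s = mres S4" "mres T4 = mres S4"
    "lft S4 * B = B' * lft T4" using homE[OF g(4) W(2,4)] .
  have m: "map_mat f (four_block_mat P Q R S) = four_block_mat (map_mat f P) (map_mat f Q) (map_mat f R) (map_mat f S)"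
    if "P \<in> carrier_mat a' a" "Q \<in> carrier_mat a' b" "R \<in> carrier_mat b' a" "S \<in> carrier_mat b' b"
    for P Q R S :: "'d mat" and f :: "'d \<Rightarrow> 'x"
    by (rule map_four_block_mat[OF that])
  have l: "lft (four_block_mat S1 S2 S3 S4) * diag2 A B = four_block_mat (lft S1 * A) (lft S2 * B) (lft S3 * A) (lft S4 * B)"
    unfolding m[OF 1(1) 2(1) 3(1) 4(1)] using 1(1) 2(1) 3(1) 4(1) W
    by (subst mult_four_block_mat[of _ a' a _ b _ b' _ _ a _ b]) auto
  have r: "diag2 A' B' * lft (four_block_mat T1 T2 T3 T4) = four_block_mat (A' * lft T1) (A' * lft T2) (B' * lft T3) (B' * lft T4)"
    unfolding m[OF 1(2) 2(2) 3(2) 4(2)] using 1(2) 2(2) 3(2) 4(2) W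
    by (subst mult_four_block_mat[of _ a' a' _ b' _ b' _ _ a _ b]) auto
  have eq: "lft (four_block_mat S1 S2 S3 S4) * diag2 A B = diag2 A' B' * lft (four_block_mat T1 T2 T3 T4)"
    by (simp only: l r 1(5) 2(5) 3(5) 4(5))
  show ?thesis
    by (rule homI[OF _ _ _ _ _ _ eq, of "a + b" "a' + b'"])
       (use W 1(1-4) 2(1-4) 3(1-4) 4(1-4) in \<open>simp_all add: m\<close>)
qed

lemma hom_four_blockE:
  assumes W: "A \<in> carrier_mat a a" "B \<in> carrier_mat b b" "A' \<in> carrier_mat a' a'" "B' \<in> carrier_mat b' b'"
    and g: "g \<in> hom (diag2 A B) (diag2 A' B')"
  obtains p q r s where "p \<in> hom A A'" "q \<in> hom B A'" "r \<in> hom A B'" "s \<in> hom B B'" "g = four_block_mat p q r s"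
proof -
  have c: "diag2 A B \<in> carrier_mat (a + b) (a + b)" "diag2 A' B' \<in> carrier_mat (a' + b') (a' + b')" using W by auto
  obtain S T where S: "S \<in> carrier_mat (a' + b') (a + b)" "T \<in> carrier_mat (a' + b') (a + b)" "g = mres S"
    "mres T = mres S" "lft S * diag2 A B = diag2 A' B' * lft T" using homE[OF g c] .
  obtain S1 S2 S3 S4 where 1: "S = four_block_mat S1 S2 S3 S4" "S1 \<in> carrier_mat a' a" "S2 \<in> carrier_mat a' b"
    "S3 \<in> carrier_mat b' a" "S4 \<in> carrier_mat b' b" using four_block_mat_exhaust[OF S(1)] .
  obtain T1 T2 T3 T4 where 2: "T = four_block_mat T1 T2 T3 T4" "T1 \<in> carrier_mat a' a" "T2 \<in> carrier_mat a' b"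
    "T3 \<in> carrier_mat b' a" "T4 \<in> carrier_mat b' b" using four_block_mat_exhaust[OF S(2)] .
  have m: "map_mat f (four_block_mat P Q R S) = four_block_mat (map_mat f P) (map_mat f Q) (map_mat f R) (map_mat f S)"
    if "P \<in> carrier_mat a' a" "Q \<in> carrier_mat a' b" "R \<in> carrier_mat b' a" "S \<in> carrier_mat b' b"
    for P Q R S :: "'d mat" and f :: "'d \<Rightarrow> 'x"
    by (rule map_four_block_mat[OF that])
  have l: "lft (four_block_mat S1 S2 S3 S4) * diag2 A B = four_block_mat (lft S1 * A) (lft S2 * B) (lft S3 * A) (lft S4 * B)"
    unfolding m[OF 1(2-5)] using 1(2-5) W
    by (subst mult_four_block_mat[of _ a' a _ b _ b' _ _ a _ b]) auto
  have r: "diag2 A' B' * lft (four_block_mat T1 T2 T3 T4) = four_block_mat (A' * lft T1) (A' * lft T2) (B' * lft T3) (B' * lft T4)"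
    unfolding m[OF 2(2-5)] using 2(2-5) W
    by (subst mult_four_block_mat[of _ a' a' _ b' _ b' _ _ a _ b]) auto
  have e1: "lft S1 * A = A' * lft T1" "lft S2 * B = A' * lft T2" "lft S3 * A = B' * lft T3" "lft S4 * B = B' * lft T4"
    by (rule four_block_mat_eqD[OF S(5)[unfolded 1(1) 2(1) l r], of a' a b b']; use 1(2-5) 2(2-5) W in \<open>auto intro!: mult_carrier_mat\<close>)+
  have e2: "mres T1 = mres S1" "mres T2 = mres S2" "mres T3 = mres S3" "mres T4 = mres S4"
    by (rule four_block_mat_eqD[OF S(4)[unfolded 1(1) 2(1) m[OF 1(2-5)] m[OF 2(2-5)]], of a' a b b']; use 1(2-5) 2(2-5) in auto)+
  show ?thesis
    by (rule that[OF homI[OF W(1,3) 1(2) 2(2) refl e2(1) e1(1)] homI[OF W(2,3) 1(3) 2(3) refl e2(2) e1(2)]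
          homI[OF W(1,4) 1(4) 2(4) refl e2(3) e1(3)] homI[OF W(2,4) 1(5) 2(5) refl e2(4) e1(4)]])
       (simp add: S(3) 1(1) m[OF 1(2-5)])
qed

lemma diag2_assoc:
  assumes A: "A \<in> carrier_mat a a" "B \<in> carrier_mat b b" "C \<in> carrier_mat c c"
  shows "diag2 (diag2 A B) C = diag2 A (diag2 B C)"
  using assoc_four_block_mat[of A B C] A by simp

text \<open>A nonzero object with local endomorphism ring, phrased elementwise: \<open>g\<close> or
  \<open>1 - g\<close> is a unit. Invertibility as a matrix is the right notion of unit because
  \<open>hom_inverse\<close> places the inverse in \<open>hom\<close>.\<close>

definition local_mat :: "'d fract mat \<Rightarrow> bool" where
  "local_mat W \<longleftrightarrow> W \<in> carrier_mat (dim_row W) (dim_row W) \<and> 0 < dim_row W \<and>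
     (\<forall>g \<in> hom W W. invertible_mat g \<or> invertible_mat (1\<^sub>m (dim_row W) - g))"

text \<open>Multiplying by the inverse \<open>u\<close> of the sum gives
  \<open>u * p + u * q = 1\<close>, to which locality applies. An invertible \<open>u * p\<close>
  makes \<open>p\<close> left invertible, which is enough for square matrices over a field.\<close>

lemma local_mat_summand:
  assumes X: "X \<in> carrier_mat n n" "local_mat X"
    and p: "p \<in> hom X X" "q \<in> hom X X" and inv: "invertible_mat (p + q)"
  shows "invertible_mat p \<or> invertible_mat q"
proof -
  have n: "dim_row X = n" using X by auto
  note c = hom_carrier[OF p(1) X(1) X(1)] hom_carrier[OF p(2) X(1) X(1)]
  obtain u where u: "u \<in> hom X X" "u * (p + q) = 1\<^sub>m n" "(p + q) * u = 1\<^sub>m n"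
    using hom_inverse[OF hom_add[OF p X(1) X(1)] inv X(1) X(1)] .
  note uc = hom_carrier[OF u(1) X(1) X(1)]
  have "u * p + u * q = 1\<^sub>m n" using u(2) mult_add_distrib_mat[OF uc c] by simp
  hence uq: "1\<^sub>m n - u * p = u * q"
  proof -
    assume e: "u * p + u * q = 1\<^sub>m n"
    show ?thesis unfolding e[symmetric] using uc c by (intro eq_matI) auto
  qed
  have inv_of: "invertible_mat r" if r: "r \<in> carrier_mat n n" and ur: "invertible_mat (u * r)" for r
  proof -
    obtain v where "v \<in> carrier_mat n n" "v * (u * r) = 1\<^sub>m n"
      by (rule invertible_matE[OF ur, of n]) (use uc r in auto)
    hence "(v * u) * r = 1\<^sub>m n" "v * u \<in> carrier_mat n n" using uc r by (auto simp: assoc_mult_mat[of v n n u n r n])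
    thus ?thesis unfolding invertible_mat_iff_left_inverse[OF r] by blast
  qed
  have "u * p \<in> hom X X" by (rule hom_comp[OF p(1) u(1) X(1) X(1) X(1)])
  hence "invertible_mat (u * p) \<or> invertible_mat (u * q)" using X(2) unfolding local_mat_def n uq[symmetric] by blast
  thus ?thesis using inv_of c by blast
qed

text \<open>\<open>p\<close> has a left inverse \<open>?v\<close>, so \<open>?e = p * ?v\<close> is
  an idempotent of a local ring, hence 0 or 1. The value 0 would force \<open>?v = 0\<close> and
  \<open>X\<close> to have size 0.\<close>

lemma local_mat_retract:
  assumes X: "X \<in> carrier_mat n n" "0 < n" and Z: "Z \<in> carrier_mat m m" "local_mat Z"
    and p: "p \<in> hom X Z" and q: "q \<in> hom Z X" and inv: "invertible_mat (q * p)"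
  shows "m = n" "invertible_mat p"
proof -
  have m: "dim_row Z = m" using Z by auto
  note c = hom_carrier[OF p X(1) Z(1)] hom_carrier[OF q Z(1) X(1)]
  obtain u where u: "u \<in> hom X X" "u * (q * p) = 1\<^sub>m n" "(q * p) * u = 1\<^sub>m n"
    using hom_inverse[OF hom_comp[OF p q X(1) Z(1) X(1)] inv X(1) X(1)] .
  note uc = hom_carrier[OF u(1) X(1) X(1)]
  let ?v = "u * q"
  have v: "?v \<in> hom Z X" by (rule hom_comp[OF q u(1) Z(1) X(1) X(1)])
  note vc = hom_carrier[OF v Z(1) X(1)]
  have vp: "?v * p = 1\<^sub>m n" using u(2) uc c by (simp add: assoc_mult_mat[of u n n q m p n])
  let ?e = "p * ?v"
  have e: "?e \<in> hom Z Z" by (rule hom_comp[OF v p Z(1) X(1) Z(1)])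
  note ec = hom_carrier[OF e Z(1) Z(1)]
  have "?v * (p * ?v) = ?v" using vc c by (intro mult_mat_cancel[OF vp]) auto
  hence ee: "?e * ?e = ?e" using assoc_mult_mat[OF c(1) vc ec] by simp
  have "?e = 1\<^sub>m m"
  proof -
    from Z(2) e consider "invertible_mat ?e" | "invertible_mat (1\<^sub>m m - ?e)" unfolding local_mat_def m by blast
    thus ?thesis
    proof cases
      case 1
      then obtain w where w: "w \<in> carrier_mat m m" "w * ?e = 1\<^sub>m m" using ec invertible_matE by metis
      have "w * (?e * ?e) = ?e" by (rule mult_mat_cancel[OF w(2) w(1) ec ec])
      thus ?thesis using w ee by simp
    next
      case 2
      then obtain w where w: "w \<in> carrier_mat m m" "w * (1\<^sub>m m - ?e) = 1\<^sub>m m"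
        using invertible_matE[OF 2 minus_carrier_mat[OF ec]] by metis
      have z: "(1\<^sub>m m - ?e) * ?e = 0\<^sub>m m m"
        using minus_mult_distrib_mat[OF one_carrier_mat ec ec] minus_r_inv_mat[OF ec] left_mult_one_mat[OF ec] ee by simp
      have "w * ((1\<^sub>m m - ?e) * ?e) = ?e" by (rule mult_mat_cancel[OF w(2) w(1) minus_carrier_mat[OF ec] ec])
      hence "?e = 0\<^sub>m m m" using z w by simp
      hence "?v * (p * ?v) = 0\<^sub>m n m" using right_mult_zero_mat[OF vc] by simp
      hence "?v = 0\<^sub>m n m" using \<open>?v * (p * ?v) = ?v\<close> by simp
      hence "1\<^sub>m n = (0\<^sub>m n n :: 'r mat)" using vp c by simp
      hence "(1\<^sub>m n :: 'r mat) $$ (0, 0) = 0" using X(2) by simp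
      thus ?thesis using X(2) by simp
    qed
  qed
  have mn: "m = n"
  proof (rule ccontr)
    assume "m \<noteq> n"
    \<comment> \<open>An identity matrix cannot factor through a smaller size: padding with zeros
      makes both factors square, so they also commute to the identity, but the padded right factor
      has a zero row.\<close>
    have aux: False if A: "A \<in> carrier_mat k l" and B: "B \<in> carrier_mat l k" and AB: "A * B = 1\<^sub>m k" and lk: "l < k" for A B :: "'r mat" and k l
    proof -
      obtain d where d: "k = l + d" "d > 0" using lk less_imp_add_positive by blast
      let ?B' = "four_block_mat B (0\<^sub>m l 0) (0\<^sub>m d k) (0\<^sub>m d 0)"
      have Bc: "?B' \<in> carrier_mat k k" using B d by auto
      let ?A' = "four_block_mat A (0\<^sub>m k d) (0\<^sub>m 0 l) (0\<^sub>m 0 d)"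
      have Ac: "?A' \<in> carrier_mat k k" by (rule carrier_matI) (use carrier_matD[OF A] d in simp_all)
      have "?A' * ?B' = 1\<^sub>m k"
        by (subst mult_four_block_mat[of A k l "0\<^sub>m k d" d "0\<^sub>m 0 l" 0 "0\<^sub>m 0 d" B k "0\<^sub>m l 0" 0])
           (use A B AB in \<open>auto intro!: eq_matI\<close>)
      hence "?B' * ?A' = 1\<^sub>m k" using mat_mult_left_right_inverse[OF Ac Bc] by simp
      hence e: "(?B' * ?A') $$ (l, l) = 1" using d by simp
      have "row ?B' l = 0\<^sub>v k" using B d by (intro eq_vecI) auto
      moreover have "(?B' * ?A') $$ (l, l) = row ?B' l \<bullet> col ?A' l"
        by (rule index_mult_mat) (use Ac Bc d in auto)
      moreover have "0\<^sub>v k \<bullet> col ?A' l = 0"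
        by (rule scalar_prod_left_zero) (use carrier_matD(1)[OF Ac] in \<open>auto intro!: carrier_vecI\<close>)
      ultimately have "(?B' * ?A') $$ (l, l) = 0" by simp
      thus False using e by simp
    qed
    show False using \<open>m \<noteq> n\<close> aux[OF vc c(1) vp] aux[OF c(1) vc \<open>?e = 1\<^sub>m m\<close>] by linarith
  qed
  thus "m = n" "invertible_mat p" using vp vc c invertible_mat_iff_left_inverse[of p n] by auto
qed

text \<open>Gaussian elimination with the pivot \<open>p\<close>: the Schur complement
  \<open>?d\<close> is a morphism, and the lower right block \<open>s'\<close> of the inverse of the
  whole matrix is its left inverse.\<close>

lemma diag2_cancel:
  assumes W: "A \<in> carrier_mat a a" "B \<in> carrier_mat b b" "A' \<in> carrier_mat a a" "B' \<in> carrier_mat b b"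
    and g: "p \<in> hom A A'" "q \<in> hom B A'" "r \<in> hom A B'" "s \<in> hom B B'"
    and inv: "invertible_mat (four_block_mat p q r s)" and p: "invertible_mat p"
  shows "mat_equiv res B B'"
proof -
  note c = hom_carrier[OF g(1) W(1,3)] hom_carrier[OF g(2) W(2,3)] hom_carrier[OF g(3) W(1,4)] hom_carrier[OF g(4) W(2,4)]
  obtain u where u: "u \<in> hom A' A" "u * p = 1\<^sub>m a" "p * u = 1\<^sub>m a" using hom_inverse[OF g(1) p W(1,3)] .
  note uc = hom_carrier[OF u(1) W(3,1)]
  obtain h where h: "h \<in> carrier_mat (a + b) (a + b)" "h * four_block_mat p q r s = 1\<^sub>m (a + b)"
    using invertible_matE[OF inv, of "a + b"] c by auto
  obtain p' q' r' s' where h': "h = four_block_mat p' q' r' s'" "p' \<in> carrier_mat a a" "q' \<in> carrier_mat a b"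
    "r' \<in> carrier_mat b a" "s' \<in> carrier_mat b b" using four_block_mat_exhaust[OF h(1)] .
  have "four_block_mat (p' * p + q' * r) (p' * q + q' * s) (r' * p + s' * r) (r' * q + s' * s)
      = four_block_mat (1\<^sub>m a) (0\<^sub>m a b) (0\<^sub>m b a) (1\<^sub>m b)"
    using h(2) unfolding h'(1) using mult_four_block_mat[OF h'(2-5) c] by simp
  note * = four_block_mat_eqD[OF this, of a a b b]
  have e: "r' * p + s' * r = 0\<^sub>m b a" "r' * q + s' * s = 1\<^sub>m b"
    by (rule *(3); use h' c in auto) (rule *(4); use h' c in auto)
  let ?d = "s - r * (u * q)"
  have d: "?d \<in> hom B B'"
    by (rule hom_minus[OF g(4) hom_comp[OF hom_comp[OF g(2) u(1) W(2,3,1)] g(3) W(2,1,4)] W(2,4)])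
  have sr: "s' * r = - (r' * p)"
  proof (rule eq_matI)
    fix i j assume "i < dim_row (- (r' * p))" "j < dim_col (- (r' * p))"
    hence ij: "i < b" "j < a" using h' c by auto
    have "(r' * p + s' * r) $$ (i, j) = 0" unfolding e(1) using ij by simp
    moreover have "(r' * p + s' * r) $$ (i, j) = (r' * p) $$ (i, j) + (s' * r) $$ (i, j)"
      using ij h' c by (intro index_add_mat) auto
    moreover have "(- (r' * p)) $$ (i, j) = - ((r' * p) $$ (i, j))"
      using ij h' c by (intro index_uminus_mat) auto
    ultimately show "(s' * r) $$ (i, j) = (- (r' * p)) $$ (i, j)"
      by (metis add_left_cancel add.right_inverse)
  qed (use h' c in auto)
  have "s' * (r * (u * q)) = s' * r * (u * q)" using h' c uc by (simp add: assoc_mult_mat[of s' b b r a _ b])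
  also have "\<dots> = - (r' * p * (u * q))" unfolding sr using h' c uc by (simp add: uminus_mult_left_mat)
  also have "r' * p * (u * q) = r' * q"
    using h' c uc mult_mat_cancel[OF u(3) c(1) uc c(2)] by (simp add: assoc_mult_mat[of r' b a p a _ b])
  finally have k: "s' * (r * (u * q)) = - (r' * q)" .
  have "s' * ?d = s' * s - - (r' * q)" unfolding k[symmetric] using h' c uc by (intro mult_minus_distrib_mat[of _ b b]) auto
  also have "\<dots> = r' * q + s' * s" using h' c by (intro eq_matI) auto
  finally have "s' * ?d = 1\<^sub>m b" using e by simp
  hence "invertible_mat ?d" using h'(5) invertible_mat_iff_left_inverse[OF hom_carrier[OF d W(2,4)]] by blast
  thus ?thesis using d W mat_equivI by metis
qed

text \<open>The 0 by 0 matrix is a zero object; adding it to \<open>X\<close> makes this, like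
  \<open>hom_col_split\<close>, a case of \<open>hom_four_blockE\<close>.\<close>

lemma hom_row_split:
  assumes W: "X \<in> carrier_mat n n" "Z \<in> carrier_mat z z" "D \<in> carrier_mat d d"
    and p: "p \<in> hom X (diag2 Z D)"
  obtains p1 p2 where "p1 \<in> hom X Z" "p2 \<in> hom X D" "p = four_block_mat p1 (0\<^sub>m z 0) p2 (0\<^sub>m d 0)"
proof -
  let ?O = "0\<^sub>m 0 0 :: 'd fract mat"
  have X: "diag2 X ?O = X" using W by (intro eq_matI) auto
  have O: "?O \<in> carrier_mat 0 0" by simp
  have "p \<in> hom (diag2 X ?O) (diag2 Z D)" unfolding X by (rule p)
  then obtain p1 q1 p2 q2 where *: "p1 \<in> hom X Z" "q1 \<in> hom ?O Z" "p2 \<in> hom X D" "q2 \<in> hom ?O D"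
    "p = four_block_mat p1 q1 p2 q2" using hom_four_blockE[OF W(1) O W(2,3)] by metis
  have "q1 = 0\<^sub>m z 0" "q2 = 0\<^sub>m d 0"
    using hom_carrier[OF *(2) O W(2)] hom_carrier[OF *(4) O W(3)] by (auto intro!: eq_matI)
  thus ?thesis using that * by blast
qed

lemma hom_col_split:
  assumes W: "X \<in> carrier_mat n n" "Z \<in> carrier_mat z z" "D \<in> carrier_mat d d"
    and q: "q \<in> hom (diag2 Z D) X"
  obtains q1 q2 where "q1 \<in> hom Z X" "q2 \<in> hom D X" "q = four_block_mat q1 q2 (0\<^sub>m 0 z) (0\<^sub>m 0 d)"
proof -
  let ?O = "0\<^sub>m 0 0 :: 'd fract mat"
  have X: "diag2 X ?O = X" using W by (intro eq_matI) auto
  have O: "?O \<in> carrier_mat 0 0" by simp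
  have "q \<in> hom (diag2 Z D) (diag2 X ?O)" unfolding X by (rule q)
  then obtain q1 q2 r1 r2 where *: "q1 \<in> hom Z X" "q2 \<in> hom D X" "r1 \<in> hom Z ?O" "r2 \<in> hom D ?O"
    "q = four_block_mat q1 q2 r1 r2" using hom_four_blockE[OF W(2,3,1) O] by metis
  have "r1 = 0\<^sub>m 0 z" "r2 = 0\<^sub>m 0 d"
    using hom_carrier[OF *(3) W(2) O] hom_carrier[OF *(4) W(3) O] by (auto intro!: eq_matI)
  thus ?thesis using that * by blast
qed

lemma diag_block_mat_carrier:
  "(\<And>X. X \<in> set Xs \<Longrightarrow> X \<in> carrier_mat (dim_row X) (dim_row X)) \<Longrightarrow>
    diag_block_mat Xs \<in> carrier_mat (sum_list (map dim_row Xs)) (sum_list (map dim_row Xs))"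
proof (induction Xs)
  case (Cons X Xs)
  have "X \<in> carrier_mat (dim_row X) (dim_row X)" "diag_block_mat Xs \<in> carrier_mat (sum_list (map dim_row Xs)) (sum_list (map dim_row Xs))"
    using Cons by auto
  from four_block_carrier_mat[OF this] show ?case by (simp only: diag_block_mat.simps Let_def list.map sum_list.Cons)
qed auto

lemma diag_block_mat_Cons: "diag_block_mat (X # Xs) = diag2 X (diag_block_mat Xs)"
  by (simp add: Let_def)

lemma local_mat_carrier: "local_mat X \<Longrightarrow> X \<in> carrier_mat (dim_row X) (dim_row X)"
  by (simp add: local_mat_def)

text \<open>An automorphism \<open>q * p\<close> of \<open>X\<close> is the sum of the contributions
  of the single summands, so by locality one of them is already invertible. The position of
  \<open>p'\<close> inside \<open>p\<close> is recorded because the exchange step must recognise it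
  as a block of a larger isomorphism.\<close>

lemma local_mat_component:
  assumes X: "X \<in> carrier_mat n n" "local_mat X"
  shows "(\<And>Z. Z \<in> set Zs \<Longrightarrow> local_mat Z) \<Longrightarrow>
    p \<in> hom X (diag_block_mat Zs) \<Longrightarrow> q \<in> hom (diag_block_mat Zs) X \<Longrightarrow> invertible_mat (q * p) \<Longrightarrow>
    \<exists>As Z Bs p' q'. Zs = As @ Z # Bs \<and> p' \<in> hom X Z \<and> q' \<in> hom Z X \<and> invertible_mat (q' * p') \<and>
      (\<forall>i < dim_row Z. \<forall>j < n. p' $$ (i, j) = p $$ (sum_list (map dim_row As) + i, j))"
proof (induction Zs arbitrary: p q)
  case Nil
  have n: "0 < n" using X by (auto simp: local_mat_def)
  have Z: "diag_block_mat [] \<in> carrier_mat 0 0" by simp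
  note c = hom_carrier[OF Nil(2) X(1) Z] hom_carrier[OF Nil(3) Z X(1)]
  obtain u where u: "u \<in> carrier_mat n n" "u * (q * p) = 1\<^sub>m n"
    by (rule invertible_matE[OF Nil(4), of n]) (use c in auto)
  have "q * p = 0\<^sub>m n n" using c by (intro eq_matI) (auto simp: scalar_prod_def)
  hence "(1\<^sub>m n :: 'r mat) = 0\<^sub>m n n" using u by simp
  hence "(1\<^sub>m n :: 'r mat) $$ (0, 0) = 0" using n by simp
  thus ?case using n by simp
next
  case (Cons Z Zs)
  define z d where zd: "z = dim_row Z" "d = sum_list (map dim_row Zs)"
  let ?D = "diag_block_mat Zs"
  have Z: "Z \<in> carrier_mat z z" using Cons(2) local_mat_carrier by (auto simp: zd)
  have D: "?D \<in> carrier_mat d d" unfolding zd by (rule diag_block_mat_carrier) (use Cons(2) local_mat_carrier in auto)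
  obtain p1 p2 where p: "p1 \<in> hom X Z" "p2 \<in> hom X ?D" "p = four_block_mat p1 (0\<^sub>m z 0) p2 (0\<^sub>m d 0)"
    using hom_row_split[OF X(1) Z D] Cons(3) unfolding diag_block_mat_Cons by metis
  obtain q1 q2 where q: "q1 \<in> hom Z X" "q2 \<in> hom ?D X" "q = four_block_mat q1 q2 (0\<^sub>m 0 z) (0\<^sub>m 0 d)"
    using hom_col_split[OF X(1) Z D] Cons(4) unfolding diag_block_mat_Cons by metis
  note c = hom_carrier[OF p(1) X(1) Z] hom_carrier[OF p(2) X(1) D] hom_carrier[OF q(1) Z X(1)] hom_carrier[OF q(2) D X(1)]
  have "q * p = q1 * p1 + q2 * p2" unfolding p(3) q(3) using c
    by (subst mult_four_block_mat[of _ n z _ d _ 0 _ _ n _ 0]) (auto intro!: eq_matI)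
  hence "invertible_mat (q1 * p1) \<or> invertible_mat (q2 * p2)"
    using local_mat_summand[OF X hom_comp[OF p(1) q(1) X(1) Z X(1)] hom_comp[OF p(2) q(2) X(1) D X(1)]] Cons(5) by simp
  thus ?case
  proof
    assume inv: "invertible_mat (q1 * p1)"
    have "\<forall>i < dim_row Z. \<forall>j < n. p1 $$ (i, j) = p $$ (sum_list (map dim_row []) + i, j)"
      unfolding p(3) using c zd by auto
    thus ?thesis using p(1) q(1) inv by (intro exI[of _ "[]"] exI[of _ Z] exI[of _ Zs] exI[of _ p1] exI[of _ q1]) simp
  next
    assume inv: "invertible_mat (q2 * p2)"
    obtain As Z' Bs p' q' where IH: "Zs = As @ Z' # Bs" "p' \<in> hom X Z'" "q' \<in> hom Z' X" "invertible_mat (q' * p')"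
      and e: "\<forall>i < dim_row Z'. \<forall>j < n. p' $$ (i, j) = p2 $$ (sum_list (map dim_row As) + i, j)"
      using Cons(1)[OF _ p(2) q(2) inv] Cons(2) by auto
    have "\<forall>i < dim_row Z'. \<forall>j < n. p' $$ (i, j) = p $$ (sum_list (map dim_row (Z # As)) + i, j)"
      unfolding p(3) using c zd e IH(1) by (auto simp: add.assoc)
    thus ?thesis using IH by (intro exI[of _ "Z # As"] exI[of _ Z'] exI[of _ Bs] exI[of _ p'] exI[of _ q']) simp
  qed
qed

text \<open>The exchange step of the Krull--Schmidt theorem: the component of the isomorphism from
  \<open>X\<close> to a suitable \<open>Z\<close> is invertible and serves as pivot for
  \<open>diag2_cancel\<close>.\<close>

lemma local_mat_split_off:
  assumes X: "X \<in> carrier_mat n n" "local_mat X" and Y: "Y \<in> carrier_mat y y"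
    and loc: "\<And>Z. Z \<in> set Zs \<Longrightarrow> local_mat Z" and eqv: "mat_equiv res (diag2 X Y) (diag_block_mat Zs)"
  shows "\<exists>As Z Bs. Zs = As @ Z # Bs \<and> mat_equiv res X Z \<and> mat_equiv res Y (diag_block_mat (Bs @ As))"
proof -
  have XY: "diag2 X Y \<in> carrier_mat (n + y) (n + y)" using X Y by auto
  have n: "0 < n" using X by (auto simp: local_mat_def)
  let ?D = "diag_block_mat Zs"
  obtain g h where g: "?D \<in> carrier_mat (n + y) (n + y)" "g \<in> hom (diag2 X Y) ?D" "h \<in> hom ?D (diag2 X Y)"
    "h * g = 1\<^sub>m (n + y)" "invertible_mat g" using mat_equivE[OF eqv XY] by metis
  let ?O = "0\<^sub>m 0 0 :: 'd fract mat"
  have O: "?O \<in> carrier_mat 0 0" by simp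
  obtain p q where p: "p \<in> hom X ?D" "q \<in> hom Y ?D" "g = four_block_mat p q (0\<^sub>m 0 n) (0\<^sub>m 0 y)"
    using hom_col_split[OF g(1) X(1) Y g(2)] .
  obtain p' q' where p': "p' \<in> hom ?D X" "q' \<in> hom ?D Y" "h = four_block_mat p' (0\<^sub>m n 0) q' (0\<^sub>m y 0)"
    using hom_row_split[OF g(1) X(1) Y g(3)] .
  note c = hom_carrier[OF p(1) X(1) g(1)] hom_carrier[OF p(2) Y g(1)] hom_carrier[OF p'(1) g(1) X(1)] hom_carrier[OF p'(2) g(1) Y]
  have "h * g = four_block_mat (p' * p) (p' * q) (q' * p) (q' * q)" unfolding p(3) p'(3) using c
    by (subst mult_four_block_mat[of _ n "n + y" _ 0 _ y _ _ n _ y]) (auto intro!: cong_four_block_mat eq_matI)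
  hence "four_block_mat (p' * p) (p' * q) (q' * p) (q' * q) = four_block_mat (1\<^sub>m n) (0\<^sub>m n y) (0\<^sub>m y n) (1\<^sub>m y)"
    unfolding g(4) by simp
  hence "p' * p = 1\<^sub>m n" by (rule four_block_mat_eqD[of _ _ _ _ _ _ _ _ n n y y]) (use c in auto)
  hence "invertible_mat (p' * p)" using invertible_matI[of "1\<^sub>m n" n "1\<^sub>m n"] by simp
  then obtain As Z Bs r r' where Z: "Zs = As @ Z # Bs" "r \<in> hom X Z" "r' \<in> hom Z X" "invertible_mat (r' * r)"
    and re: "\<forall>i < dim_row Z. \<forall>j < n. r $$ (i, j) = p $$ (sum_list (map dim_row As) + i, j)"
    using local_mat_component[OF X loc p(1) p'(1)] by blast
  define z a b where zab: "z = dim_row Z" "a = sum_list (map dim_row As)" "b = sum_list (map dim_row Bs)"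
  have Zc: "Z \<in> carrier_mat z z" "local_mat Z" using loc[of Z] Z(1) local_mat_carrier by (auto simp: zab)
  let ?A = "diag_block_mat As" and ?B = "diag_block_mat Bs"
  have A: "?A \<in> carrier_mat a a" "?B \<in> carrier_mat b b" unfolding zab
    by (rule diag_block_mat_carrier; use loc Z(1) local_mat_carrier in auto)+
  have ZB: "diag2 Z ?B \<in> carrier_mat (z + b) (z + b)" using Zc A by auto
  have D: "?D = diag2 ?A (diag2 Z ?B)" unfolding Z(1) diag_block_mat_append diag_block_mat_Cons Let_def ..
  have zn: "z = n" and ri: "invertible_mat r" using local_mat_retract[OF X(1) n Zc Z(2-4)] by auto
  obtain ga gay gz gzy where gg: "ga \<in> hom X ?A" "gay \<in> hom Y ?A" "gz \<in> hom X (diag2 Z ?B)" "gzy \<in> hom Y (diag2 Z ?B)"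
    "g = four_block_mat ga gay gz gzy" using hom_four_blockE[OF X(1) Y A(1) ZB g(2)[unfolded D]] .
  note gc = hom_carrier[OF gg(1) X(1) A(1)] hom_carrier[OF gg(2) Y A(1)] hom_carrier[OF gg(3) X(1) ZB] hom_carrier[OF gg(4) Y ZB]
  \<comment> \<open>To bring \<open>Z\<close> to the front, the row blocks belonging to
    \<open>As\<close> are moved to the end. This is a rotation, so associativity of
    \<open>diag2\<close> suffices, and the remaining summands appear in the order
    \<open>Bs @ As\<close>.\<close>
  let ?f = "four_block_mat gz gzy ga gay"
  have f: "?f \<in> hom (diag2 X Y) (diag2 (diag2 Z ?B) ?A)" by (rule hom_four_block[OF X(1) Y ZB A(1) gg(3,4,1,2)])
  have dims: "a + (z + b) = n + y"
    using carrier_matD(1)[OF g(1)] carrier_matD(1)[OF four_block_carrier_mat[OF A(1) ZB]] unfolding D by simp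
  \<comment> \<open>\<open>?f\<close> is \<open>g\<close> with permuted rows and so has the same
    kernel.\<close>
  have fi: "invertible_mat ?f"
  proof -
    have "z + b + a = n + y" using dims by simp
    hence fc: "?f \<in> carrier_mat (n + y) (n + y)" using four_block_carrier_mat[OF gc(3,2)] by simp
    have "v = 0\<^sub>v (n + y)" if v: "v \<in> carrier_vec (n + y)" "?f *\<^sub>v v = 0\<^sub>v (n + y)" for v
    proof -
      have "g *\<^sub>v v = 0\<^sub>v (n + y)"
      proof (rule eq_vecI)
        fix i assume "i < dim_vec (0\<^sub>v (n + y))"
        hence i: "i < n + y" by simp
        show "(g *\<^sub>v v) $ i = 0\<^sub>v (n + y) $ i"
        proof (cases "i < a")
          case True
          have "row g i = row ?f (z + b + i)" unfolding gg(5) using gc True i dims by (intro eq_vecI) auto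
          moreover have "(?f *\<^sub>v v) $ (z + b + i) = 0" unfolding v(2) using True dims by simp
          ultimately show ?thesis using True i dims gc gg(5) by (simp add: index_mult_mat_vec del: index_mat_four_block(1))
        next
          case False
          have "row g i = row ?f (i - a)" unfolding gg(5) using gc False i dims by (intro eq_vecI) auto
          moreover have "(?f *\<^sub>v v) $ (i - a) = 0" unfolding v(2) using i dims by simp
          ultimately show ?thesis using False i dims gc gg(5) by (simp add: index_mult_mat_vec del: index_mat_four_block(1))
        qed
      qed (use gc gg(5) dims in simp)
      thus ?thesis using g(5) v invertible_mat_iff_inj[OF hom_carrier[OF g(2) XY g(1)]] by blast
    qed
    thus ?thesis unfolding invertible_mat_iff_inj[OF fc] by blast
  qed
  have BA: "diag2 ?B ?A \<in> carrier_mat (b + a) (b + a)" using A by auto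
  have f': "?f \<in> hom (diag2 X Y) (diag2 Z (diag2 ?B ?A))" using f unfolding diag2_assoc[OF Zc(1) A(2,1)] .
  obtain f1 f2 f3 f4 where ff: "f1 \<in> hom X Z" "f2 \<in> hom Y Z" "f3 \<in> hom X (diag2 ?B ?A)" "f4 \<in> hom Y (diag2 ?B ?A)"
    "?f = four_block_mat f1 f2 f3 f4" using hom_four_blockE[OF X(1) Y Zc(1) BA f'] .
  note fc = hom_carrier[OF ff(1) X(1) Zc(1)] hom_carrier[OF ff(4) Y BA]
  have "f1 = r"
  proof (rule eq_matI)
    fix i j assume "i < dim_row r" "j < dim_col r"
    hence ij: "i < z" "j < n" using hom_carrier[OF Z(2) X(1) Zc(1)] by auto
    have "f1 $$ (i, j) = ?f $$ (i, j)" unfolding ff(5) using ij fc by simp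
    also have "\<dots> = g $$ (a + i, j)" unfolding gg(5) using ij gc by simp
    also have "\<dots> = p $$ (a + i, j)" unfolding p(3) using ij c dims by simp
    finally show "f1 $$ (i, j) = r $$ (i, j)" using re ij zab by simp
  qed (use fc hom_carrier[OF Z(2) X(1) Zc(1)] in auto)
  hence f1: "invertible_mat f1" using ri by simp
  have yb: "b + a = y" using dims zn by simp
  have "mat_equiv res Y (diag2 ?B ?A)"
    by (rule diag2_cancel[OF X(1) Y Zc(1)[unfolded zn] BA[unfolded yb] ff(1-4) _ f1]) (use fi ff(5) in simp)
  moreover have "diag2 ?B ?A = diag_block_mat (Bs @ As)" unfolding diag_block_mat_append Let_def ..
  moreover have "mat_equiv res X Z" using mat_equivI[OF Z(2) ri X(1)] Zc zn by simp
  ultimately show ?thesis using Z(1) by metis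
qed

theorem krull_schmidt:
  assumes "\<And>X. X \<in> set Xs \<Longrightarrow> local_mat X" "\<And>Z. Z \<in> set Zs \<Longrightarrow> local_mat Z"
    "mat_equiv res (diag_block_mat Xs) (diag_block_mat Zs)"
  shows "\<exists>Zs'. mset Zs' = mset Zs \<and> list_all2 (mat_equiv res) Xs Zs'"
  using assms
proof (induction Xs arbitrary: Zs)
  case Nil
  have "diag_block_mat Zs \<in> carrier_mat 0 0" using mat_equiv_carrier[OF Nil(3), of 0] by simp
  moreover have "diag_block_mat Zs \<in> carrier_mat (sum_list (map dim_row Zs)) (sum_list (map dim_row Zs))"
    by (rule diag_block_mat_carrier) (use Nil local_mat_carrier in auto)
  ultimately have "sum_list (map dim_row Zs) = 0" by auto
  hence "Zs = []" using Nil(2) unfolding local_mat_def by (cases Zs) fastforce+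
  thus ?case by simp
next
  case (Cons X Xs)
  have X: "X \<in> carrier_mat (dim_row X) (dim_row X)" "local_mat X" using Cons(2) local_mat_carrier by auto
  have D: "diag_block_mat Xs \<in> carrier_mat (sum_list (map dim_row Xs)) (sum_list (map dim_row Xs))"
    by (rule diag_block_mat_carrier) (use Cons(2) local_mat_carrier in auto)
  obtain As Z Bs where *: "Zs = As @ Z # Bs" "mat_equiv res X Z" "mat_equiv res (diag_block_mat Xs) (diag_block_mat (Bs @ As))"
    using local_mat_split_off[OF X D Cons(3) Cons(4)[unfolded diag_block_mat_Cons]] by blast
  obtain Zs' where "mset Zs' = mset (Bs @ As)" "list_all2 (mat_equiv res) Xs Zs'"
    using Cons(1)[of "Bs @ As"] Cons(2,3) * by auto
  thus ?case using * by (intro exI[of _ "Z # Zs'"]) auto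
qed

text \<open>The two projections of a decomposition, transported to \<open>X\<close>, are
  endomorphisms with sum 1. Locality would make one projection invertible, yet each has a zero
  row.\<close>

lemma local_mat_indecomposable:
  assumes "local_mat X" shows "indecomposable_mat res X"
proof -
  define n where "n = dim_row X"
  have X: "X \<in> carrier_mat n n" "local_mat X" using assms local_mat_carrier by (auto simp: n_def)
  have False if kl: "0 < k" "0 < l" and W: "W1 \<in> carrier_mat k k" "W2 \<in> carrier_mat l l"
    and eqv: "mat_equiv res X (diag_block_mat [W1, W2])" for k l W1 W2
  proof -
    have d: "diag_block_mat [W1, W2] = diag2 W1 W2"
    by (subst diag_block_mat_Cons) (simp only: diag_block_mat_singleton)
    obtain g h where g: "diag2 W1 W2 \<in> carrier_mat n n" "g \<in> hom X (diag2 W1 W2)" "h \<in> hom (diag2 W1 W2) X"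
      "h * g = 1\<^sub>m n" "g * h = 1\<^sub>m n" using mat_equivE[OF eqv[unfolded d] X(1)] by metis
    have nk: "n = k + l" using g(1) W by auto
    let ?e = "four_block_mat (1\<^sub>m k) (0\<^sub>m k l) (0\<^sub>m l k) (0\<^sub>m l l) :: 'r mat"
    let ?f = "four_block_mat (0\<^sub>m k k) (0\<^sub>m k l) (0\<^sub>m l k) (1\<^sub>m l) :: 'r mat"
    have e: "?e \<in> hom (diag2 W1 W2) (diag2 W1 W2)"
      by (rule hom_four_block[OF W W hom_one[OF W(1)] hom_zero[OF W(2,1)] hom_zero[OF W(1,2)] hom_zero[OF W(2,2)]])
    have ec: "?e \<in> carrier_mat n n" "?f \<in> carrier_mat n n" unfolding nk by auto
    note c = hom_carrier[OF g(2) X(1) g(1)] hom_carrier[OF g(3) g(1) X(1)]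
    let ?u = "h * (?e * g)"
    have u: "?u \<in> hom X X" by (rule hom_comp[OF hom_comp[OF g(2) e X(1) g(1) g(1)] g(3) X(1) g(1) X(1)])
    have v: "1\<^sub>m n - ?u = h * (?f * g)"
    proof -
      have "?f = 1\<^sub>m n - ?e" unfolding nk by (intro eq_matI) auto
      hence "h * (?f * g) = h * g - ?u" using c ec
        by (simp add: minus_mult_distrib_mat[of _ n n _ g n] mult_minus_distrib_mat[of h n n _ n])
      thus ?thesis using g(4) by simp
    qed
    have inv: "invertible_mat E" if E: "E \<in> carrier_mat n n" "invertible_mat (h * (E * g))" for E
    proof -
      obtain w where w: "w \<in> carrier_mat n n" "w * (h * (E * g)) = 1\<^sub>m n"
        by (rule invertible_matE[OF E(2), of n]) (use E c in auto)
      have "h * (E * g) * w = 1\<^sub>m n" using mat_mult_left_right_inverse[OF w(1) _ w(2)] E c by auto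
      have "E = E * (g * h)" using g E by simp
      also have "\<dots> = (E * g) * h" using E c by (simp add: assoc_mult_mat[of E n n g n h n])
      finally have Eh: "E = (E * g) * h" .
      have "(E * g) * w * h = 1\<^sub>m n"
      proof -
        have "h * ((E * g) * w) = 1\<^sub>m n" using \<open>h * (E * g) * w = 1\<^sub>m n\<close> E c w by (simp add: assoc_mult_mat[of h n n "E * g" n w n])
        thus ?thesis using mat_mult_left_right_inverse[of h n "(E * g) * w"] E c w by auto
      qed
      hence "E * (g * (w * h)) = 1\<^sub>m n" using E c w by (simp add: assoc_mult_mat[of _ n n _ n _ n])
      hence "g * (w * h) * E = 1\<^sub>m n" using mat_mult_left_right_inverse[of E n "g * (w * h)"] E c w by auto
      thus ?thesis unfolding invertible_mat_iff_left_inverse[OF E(1)] using E c w by (intro bexI[of _ "g * (w * h)"]) auto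
    qed
    have "invertible_mat ?u \<or> invertible_mat (1\<^sub>m n - ?u)" using X(2) u unfolding local_mat_def n_def by blast
    hence "invertible_mat ?e \<or> invertible_mat ?f" using inv ec unfolding v by blast
    thus False
    proof
      assume "invertible_mat ?e"
      then obtain w where w: "w \<in> carrier_mat n n" "?e * w = 1\<^sub>m n" using ec invertible_matE by metis
      have "(?e * w) $$ (k, k) = row ?e k \<bullet> col w k" using ec w nk kl by (intro index_mult_mat) auto
      also have "row ?e k = 0\<^sub>v n" using nk kl by (intro eq_vecI) auto
      also have "0\<^sub>v n \<bullet> col w k = 0" by (rule scalar_prod_left_zero) (use w in auto)
      finally show False using w nk kl by simp
    next
      assume "invertible_mat ?f"
      then obtain w where w: "w \<in> carrier_mat n n" "?f * w = 1\<^sub>m n" using ec invertible_matE by metis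
      have "(?f * w) $$ (0, 0) = row ?f 0 \<bullet> col w 0" using ec w nk kl by (intro index_mult_mat) auto
      also have "row ?f 0 = 0\<^sub>v n" using nk kl by (intro eq_vecI) auto
      also have "0\<^sub>v n \<bullet> col w 0 = 0" by (rule scalar_prod_left_zero) (use w in auto)
      finally show False using w nk kl by simp
    qed
  qed
  thus ?thesis unfolding indecomposable_mat_def by blast
qed

end

section \<open>Cyclic block matrices\<close>

lemma sum_div_mod:
  fixes f :: "nat \<Rightarrow> 'a::comm_monoid_add"
  shows "(\<Sum>r<n * k. f r) = (\<Sum>b<n. \<Sum>u<k. f (b * k + u))"
proof -
  have "(\<Sum>r<n * k. f r) = (\<Sum>b<n. sum f {b * k..<b * k + k})" by (rule sum.nat_group[symmetric])
  moreover have "sum f {b * k..<b * k + k} = (\<Sum>u<k. f (b * k + u))" for b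
    using sum.shift_bounds_nat_ivl[of f 0 "b * k" k] by (simp add: add.commute lessThan_atLeast0)
  ultimately show ?thesis by simp
qed

lemma block_index_less: "a < n \<Longrightarrow> p < k \<Longrightarrow> a * k + p < n * (k :: nat)"
proof -
  assume "a < n" "p < k"
  hence "a * k + p < Suc a * k" by simp
  also have "\<dots> \<le> n * k" using \<open>a < n\<close> by (intro mult_le_mono1) simp
  finally show ?thesis .
qed

lemma mult_mat_right_zeroD:
  fixes A :: "'a::semiring_1 mat"
  assumes "A * B = 0\<^sub>m m k" "B * N = 1\<^sub>m n" "A \<in> carrier_mat m n" "B \<in> carrier_mat n k" "N \<in> carrier_mat k n"
  shows "A = 0\<^sub>m m n"
proof -
  have "A = A * (B * N)" unfolding assms(2) using assms(3) by simp
  also have "\<dots> = A * B * N" by (rule assoc_mult_mat[symmetric, OF assms(3-5)])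
  finally show ?thesis unfolding assms(1) using assms(5) by simp
qed

definition blk :: "nat \<Rightarrow> nat \<Rightarrow> 'a mat \<Rightarrow> nat \<Rightarrow> nat \<Rightarrow> 'a mat" where
  "blk k' k g a b = mat k' k (\<lambda>(p, q). g $$ (a * k' + p, b * k + q))"

lemma blk_carrier [simp]: "blk k' k g a b \<in> carrier_mat k' k"
  and blk_index [simp]: "p < k' \<Longrightarrow> q < k \<Longrightarrow> blk k' k g a b $$ (p, q) = g $$ (a * k' + p, b * k + q)"
  and blk_dim [simp]: "dim_row (blk k' k g a b) = k'" "dim_col (blk k' k g a b) = k"
  by (simp_all add: blk_def)

lemma mult_index_blk:
  fixes A :: "'a::semiring_0 mat"
  assumes "A \<in> carrier_mat m (n * k)" "B \<in> carrier_mat (n * k) l" "i < m" "j < l"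
  shows "(A * B) $$ (i, j) = (\<Sum>b<n. \<Sum>u<k. A $$ (i, b * k + u) * B $$ (b * k + u, j))"
proof -
  have "(A * B) $$ (i, j) = (\<Sum>r<n * k. A $$ (i, r) * B $$ (r, j))"
    using assms by (auto simp: scalar_prod_def lessThan_atLeast0 intro!: sum.cong)
  thus ?thesis by (simp add: sum_div_mod)
qed

text \<open>Block triangularity without choosing an order of the cells: a kernel vector vanishes
  cell by cell along the well-founded relation, because in block row \<open>i\<close> only the
  invertible diagonal block is left.\<close>

lemma block_acyclic_invertible:
  fixes g :: "'a::field mat"
  assumes g: "g \<in> carrier_mat (n * k) (n * k)" and diag: "\<And>a. a < n \<Longrightarrow> invertible_mat (blk k k g a a)"
    and acyc: "acyclic {(i, j). i < n \<and> j < n \<and> i \<noteq> j \<and> blk k k g i j \<noteq> 0\<^sub>m k k}"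
  shows "invertible_mat g"
  unfolding invertible_mat_iff_inj[OF g]
proof (intro ballI impI)
  fix v assume v: "v \<in> carrier_vec (n * k)" "g *\<^sub>v v = 0\<^sub>v (n * k)"
  let ?r = "{(i, j). i < n \<and> j < n \<and> i \<noteq> j \<and> blk k k g i j \<noteq> 0\<^sub>m k k}"
  have "finite ?r" by (rule finite_subset[of _ "{..<n} \<times> {..<n}"]) auto
  hence wf: "wf (?r\<inverse>)" using acyc by (rule finite_acyclic_wf_converse)
  have "i < n \<Longrightarrow> \<forall>q<k. v $ (i * k + q) = 0" for i
  proof (induction i rule: wf_induct_rule[OF wf])
    case (1 i)
    let ?v = "vec k (\<lambda>q. v $ (i * k + q))"
    have "blk k k g i i *\<^sub>v ?v = 0\<^sub>v k"
    proof (rule eq_vecI)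
      fix p assume "p < dim_vec (0\<^sub>v k :: 'a vec)"
      hence p: "p < k" by simp
      have ip: "i * k + p < n * k" using block_index_less 1 p by blast
      have "0 = (g *\<^sub>v v) $ (i * k + p)" unfolding v(2) using ip by simp
      also have "\<dots> = (\<Sum>r<n * k. g $$ (i * k + p, r) * v $ r)"
        using g v(1) ip by (auto simp: scalar_prod_def lessThan_atLeast0 intro!: sum.cong)
      also have "\<dots> = (\<Sum>j<n. \<Sum>q<k. g $$ (i * k + p, j * k + q) * v $ (j * k + q))" by (rule sum_div_mod)
      also have "\<dots> = (\<Sum>j<n. if j = i then \<Sum>q<k. g $$ (i * k + p, i * k + q) * v $ (i * k + q) else 0)"
      proof (rule sum.cong[OF refl])
        fix j assume "j \<in> {..<n}"
        hence j: "j < n" by simp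
        have "g $$ (i * k + p, j * k + q) * v $ (j * k + q) = 0" if "j \<noteq> i" "q < k" for q
        proof (cases "blk k k g i j = 0\<^sub>m k k")
          case True
          hence "blk k k g i j $$ (p, q) = 0" using p that by simp
          thus ?thesis using p that by simp
        next
          case False
          hence "(j, i) \<in> ?r\<inverse>" using that j 1 by auto
          thus ?thesis using 1(1) j that by auto
        qed
        thus "(\<Sum>q<k. g $$ (i * k + p, j * k + q) * v $ (j * k + q)) =
          (if j = i then \<Sum>q<k. g $$ (i * k + p, i * k + q) * v $ (i * k + q) else 0)" by (auto intro!: sum.neutral)
      qed
      also have "\<dots> = (\<Sum>q<k. g $$ (i * k + p, i * k + q) * v $ (i * k + q))" using 1 by simp
      also have "\<dots> = (blk k k g i i *\<^sub>v ?v) $ p"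
        using p by (auto simp: scalar_prod_def lessThan_atLeast0 intro!: sum.cong)
      finally show "(blk k k g i i *\<^sub>v ?v) $ p = 0\<^sub>v k $ p" using p by simp
    qed simp
    hence "?v = 0\<^sub>v k" using diag[OF 1(2)] invertible_mat_iff_inj[of "blk k k g i i" k] by auto
    thus ?case by (metis index_vec index_zero_vec(1))
  qed
  note * = this
  show "v = 0\<^sub>v (n * k)"
  proof (rule eq_vecI)
    fix r assume "r < dim_vec (0\<^sub>v (n * k) :: 'a vec)"
    hence r: "r < n * k" by simp
    hence k: "k > 0" by (cases k) auto
    have "r div k < n" using r k by (simp add: less_mult_imp_div_less)
    moreover have "r mod k < k" using k by simp
    ultimately have "v $ (r div k * k + r mod k) = 0" using * by blast
    thus "v $ r = 0\<^sub>v (n * k) $ r" using r by simp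
  qed (use v in simp)
qed

context dvr
begin

text \<open>\<open>n \<times> n\<close> blocks of size \<open>k \<times> k\<close>; the only nonzero ones are \<open>t\<^sup>l M\<^sub>a\<close> at the positions
  \<open>(a, a + 1 mod n)\<close> with label \<open>l\<close>. The label \<open>\<infinity>\<close> stands for a zero block, so that \<open>S(\<mu>)\<close> becomes
  the cyclic matrix with the labels \<open>\<mu>\<^sub>1, \<dots>, \<mu>\<^sub>n, \<infinity>\<close>.\<close>

definition cyc :: "nat \<Rightarrow> nat \<Rightarrow> (nat \<Rightarrow> int extended) \<Rightarrow> (nat \<Rightarrow> 'd mat) \<Rightarrow> 'd fract mat" where
  "cyc n k lab M = mat (n * k) (n * k) (\<lambda>(i, j). if j div k = Suc (i div k) mod n
     then (case lab (i div k) of Fin l \<Rightarrow> to_fract t powi l * to_fract (M (i div k) $$ (i mod k, j mod k)) | _ \<Rightarrow> 0)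
     else 0)"

definition cyc_data :: "nat \<Rightarrow> nat \<Rightarrow> (nat \<Rightarrow> int extended) \<Rightarrow> (nat \<Rightarrow> 'd mat) \<Rightarrow> bool" where
  "cyc_data n k lab M \<longleftrightarrow> 0 < n \<and> 0 < k \<and>
     (\<forall>a < n. lab a \<noteq> Minf \<and> M a \<in> carrier_mat k k \<and> invertible_mat (mres (M a)))"

lemma cyc_carrier [simp]: "cyc n k lab M \<in> carrier_mat (n * k) (n * k)"
  by (simp add: cyc_def)

fun wt :: "int extended \<Rightarrow> 'd fract" where
  "wt (Fin i) = to_fract t powi i" | "wt _ = 0"

lemma cyc_index:
  assumes "a < n" "b < n" "p < k" "q < k"
  shows "cyc n k lab M $$ (a * k + p, b * k + q) = (if b = Suc a mod n then wt (lab a) * to_fract (M a $$ (p, q)) else 0)"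
  using assms block_index_less[of a n p k] block_index_less[of b n q k]
  by (auto simp: cyc_def split: extended.splits)

lemma Suc_mod_inj: "a < n \<Longrightarrow> b < n \<Longrightarrow> Suc a mod n = Suc b mod n \<longleftrightarrow> a = b"
  by (auto simp: mod_Suc split: if_splits)

text \<open>Columns are addressed through the successor of a cell \<open>b\<close>, since
  \<open>b\<close> is the only block row of the cyclic matrix that is nonzero in this block
  column.\<close>

lemma cyc_mult_right:
  assumes S: "S \<in> carrier_mat (n' * k') (n * k)" and a: "a < n'" "b < n" "p < k'" "q < k"
  shows "(lft S * cyc n k lab M) $$ (a * k' + p, Suc b mod n * k + q) =
    wt (lab b) * to_fract (\<Sum>u<k. S $$ (a * k' + p, b * k + u) * M b $$ (u, q))"
proof -
  let ?i = "a * k' + p" and ?j = "Suc b mod n * k + q"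
  have sb: "Suc b mod n < n" using a by auto
  have i: "?i < n' * k'" "?j < n * k" using block_index_less a sb by auto
  have "(lft S * cyc n k lab M) $$ (?i, ?j) = (\<Sum>c<n. \<Sum>u<k. lft S $$ (?i, c * k + u) * cyc n k lab M $$ (c * k + u, ?j))"
    by (rule mult_index_blk[of _ "n' * k'" _ _ _ "n * k"]) (use S i in auto)
  also have "\<dots> = (\<Sum>c<n. if c = b then \<Sum>u<k. to_fract (S $$ (?i, b * k + u)) * (wt (lab b) * to_fract (M b $$ (u, q))) else 0)"
    using a sb S i block_index_less by (intro sum.cong refl) (auto simp: cyc_index Suc_mod_inj intro!: sum.cong)
  also have "\<dots> = wt (lab b) * to_fract (\<Sum>u<k. S $$ (?i, b * k + u) * M b $$ (u, q))"
    using a by (simp add: sum_distrib_left mult_ac)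
  finally show ?thesis .
qed

lemma cyc_mult_left:
  assumes T: "T \<in> carrier_mat (n' * k') (n * k)" and a: "a < n'" "b < n" "p < k'" "q < k"
  shows "(cyc n' k' lab' M' * lft T) $$ (a * k' + p, Suc b mod n * k + q) =
    wt (lab' a) * to_fract (\<Sum>u<k'. M' a $$ (p, u) * T $$ (Suc a mod n' * k' + u, Suc b mod n * k + q))"
proof -
  let ?i = "a * k' + p" and ?j = "Suc b mod n * k + q"
  have sb: "Suc b mod n < n" "Suc a mod n' < n'" using a by auto
  have i: "?i < n' * k'" "?j < n * k" using block_index_less a sb by auto
  have "(cyc n' k' lab' M' * lft T) $$ (?i, ?j) = (\<Sum>c<n'. \<Sum>u<k'. cyc n' k' lab' M' $$ (?i, c * k' + u) * lft T $$ (c * k' + u, ?j))"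
    by (rule mult_index_blk[of _ "n' * k'" _ _ _ "n * k"]) (use T i in auto)
  also have "\<dots> = (\<Sum>c<n'. if c = Suc a mod n' then \<Sum>u<k'. wt (lab' a) * to_fract (M' a $$ (p, u)) * to_fract (T $$ (Suc a mod n' * k' + u, ?j)) else 0)"
    using a sb T i block_index_less by (intro sum.cong refl) (auto simp: cyc_index intro!: sum.cong)
  also have "\<dots> = wt (lab' a) * to_fract (\<Sum>u<k'. M' a $$ (p, u) * T $$ (Suc a mod n' * k' + u, ?j))"
    using sb by (simp add: sum_distrib_left mult_ac)
  finally show ?thesis .
qed

lemma hom_cyc_eq:
  assumes S: "S \<in> carrier_mat (n' * k') (n * k)" "T \<in> carrier_mat (n' * k') (n * k)"
    "lft S * cyc n k lab M = cyc n' k' lab' M' * lft T"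
    and a: "a < n'" "b < n" "p < k'" "q < k"
  shows "wt (lab b) * to_fract (\<Sum>u<k. S $$ (a * k' + p, b * k + u) * M b $$ (u, q)) =
    wt (lab' a) * to_fract (\<Sum>u<k'. M' a $$ (p, u) * T $$ (Suc a mod n' * k' + u, Suc b mod n * k + q))"
  unfolding cyc_mult_right[OF S(1) a, symmetric] cyc_mult_left[OF S(2) a, symmetric] S(3) ..

text \<open>Cancelling the smaller power of \<open>t\<close> leaves a positive power on the right;
  if \<open>l'\<close> is infinite, \<open>x\<close> itself is 0.\<close>

lemma wt_eq_imp:
  assumes "l < l'" "l \<noteq> Minf" "wt l * to_fract x = wt l' * to_fract y"
  shows "res x = 0"
proof (cases l')
  case (Fin i')
  then obtain i where i: "l = Fin i" "i < i'" using assms by (cases l) auto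
  have "to_fract t powi i' = to_fract t powi i * to_fract t ^ nat (i' - i)"
    using i t_nonzero power_int_add[of "to_fract t" i "i' - i"] by (simp add: power_int_def)
  hence "to_fract x = to_fract (t ^ nat (i' - i) * y)" using assms(3) i Fin t_nonzero by (simp add: to_fract_pow)
  hence "x = t ^ nat (i' - i) * y" unfolding to_fract_eq_iff .
  thus ?thesis using i by (simp add: hom_distribs power_0_left)
next
  case Pinf
  then obtain i where i: "l = Fin i" using assms by (cases l) auto
  thus ?thesis using assms Pinf t_nonzero by simp
next
  case Minf thus ?thesis using assms by simp
qed

text \<open>At block (a, b + 1) the intertwining equation reads: weight of \<open>lab b\<close>
  times \<open>S_ab * M_b\<close> equals weight of \<open>lab' a\<close> times
  \<open>M'_a * T_(a+1, b+1)\<close>. If \<open>lab b\<close> is smaller, the left factor vanishes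
  modulo \<open>t\<close> and \<open>M_b\<close> can be cancelled; if the labels are equal and
  finite, the weights cancel.\<close>

lemma hom_cyc:
  assumes g: "g \<in> hom (cyc n k lab M) (cyc n' k' lab' M')"
    and dat: "cyc_data n k lab M" "cyc_data n' k' lab' M'" and a: "a < n'" "b < n"
  shows hom_cyc_le: "blk k' k g a b \<noteq> 0\<^sub>m k' k \<Longrightarrow> lab' a \<le> lab b"
    and hom_cyc_step: "lab b = lab' a \<Longrightarrow> lab b = Fin l \<Longrightarrow>
      blk k' k g a b * mres (M b) = mres (M' a) * blk k' k g (Suc a mod n') (Suc b mod n)"
proof -
  obtain S T where S: "S \<in> carrier_mat (n' * k') (n * k)" "T \<in> carrier_mat (n' * k') (n * k)"
    "g = mres S" "mres T = mres S" "lft S * cyc n k lab M = cyc n' k' lab' M' * lft T"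
    using homE[OF g cyc_carrier cyc_carrier] .
  have gT: "g = mres T" using S by simp
  have M: "M b \<in> carrier_mat k k" "invertible_mat (mres (M b))" "lab b \<noteq> Minf" "M' a \<in> carrier_mat k' k'"
    using dat a unfolding cyc_data_def by auto
  have l: "(blk k' k g a b * mres (M b)) $$ (p, q) = res (\<Sum>u<k. S $$ (a * k' + p, b * k + u) * M b $$ (u, q))"
    if "p < k'" "q < k" for p q
    using that a S(1) M block_index_less unfolding S(3)
    by (auto simp: scalar_prod_def lessThan_atLeast0 hom_distribs intro!: sum.cong)
  have r: "(mres (M' a) * blk k' k g (Suc a mod n') (Suc b mod n)) $$ (p, q) =
      res (\<Sum>u<k'. M' a $$ (p, u) * T $$ (Suc a mod n' * k' + u, Suc b mod n * k + q))"
    if "p < k'" "q < k" for p q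
  proof -
    have "Suc a mod n' < n'" "Suc b mod n < n" using a by auto
    thus ?thesis using that a S(2) M block_index_less unfolding gT
      by (auto simp: scalar_prod_def lessThan_atLeast0 hom_distribs intro!: sum.cong)
  qed
  show "lab' a \<le> lab b" if "blk k' k g a b \<noteq> 0\<^sub>m k' k"
  proof (rule ccontr)
    assume "\<not> lab' a \<le> lab b"
    hence lt: "lab b < lab' a" by simp
    have "blk k' k g a b * mres (M b) = 0\<^sub>m k' k"
    proof (rule eq_matI)
      fix p q assume "p < dim_row (0\<^sub>m k' k :: 'r mat)" "q < dim_col (0\<^sub>m k' k :: 'r mat)"
      hence pq: "p < k'" "q < k" by auto
      show "(blk k' k g a b * mres (M b)) $$ (p, q) = 0\<^sub>m k' k $$ (p, q)"
        unfolding l[OF pq] using wt_eq_imp[OF lt M(3) hom_cyc_eq[OF S(1,2,5) a pq]] pq by simp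
    qed (use M in auto)
    moreover obtain N where N: "N \<in> carrier_mat k k" "mres (M b) * N = 1\<^sub>m k"
      using invertible_matE[OF M(2)] M(1) by (metis map_carrier_mat)
    ultimately show False using that mult_mat_right_zeroD[of "blk k' k g a b" "mres (M b)" k' k N k] M(1) by simp
  qed
  show "blk k' k g a b * mres (M b) = mres (M' a) * blk k' k g (Suc a mod n') (Suc b mod n)"
    if "lab b = lab' a" "lab b = Fin l"
  proof (rule eq_matI)
    fix p q assume "p < dim_row (mres (M' a) * blk k' k g (Suc a mod n') (Suc b mod n))"
      "q < dim_col (mres (M' a) * blk k' k g (Suc a mod n') (Suc b mod n))"
    hence pq: "p < k'" "q < k" using M by auto
    have "(\<Sum>u<k. S $$ (a * k' + p, b * k + u) * M b $$ (u, q)) =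
      (\<Sum>u<k'. M' a $$ (p, u) * T $$ (Suc a mod n' * k' + u, Suc b mod n * k + q))"
      using hom_cyc_eq[OF S(1,2,5) a pq] that(2) that(1)[symmetric] t_nonzero by (simp del: to_fract_sum to_fract_mult)
    thus "(blk k' k g a b * mres (M b)) $$ (p, q) = (mres (M' a) * blk k' k g (Suc a mod n') (Suc b mod n)) $$ (p, q)"
      unfolding l[OF pq] r[OF pq] by simp
  qed (use M in auto)
qed

text \<open>By \<open>hom_cyc_step\<close>, a zero block one step further would make the product of
  the present block with the invertible residue of \<open>M b\<close> vanish.\<close>

lemma hom_cyc_next:
  assumes g: "g \<in> hom (cyc n k lab M) (cyc n' k' lab' M')"
    and dat: "cyc_data n k lab M" "cyc_data n' k' lab' M'" and a: "a < n'" "b < n"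
    and l: "lab b = lab' a" "lab b = Fin l" and nz: "blk k' k g a b \<noteq> 0\<^sub>m k' k"
  shows "blk k' k g (Suc a mod n') (Suc b mod n) \<noteq> 0\<^sub>m k' k"
proof
  have M: "M b \<in> carrier_mat k k" "invertible_mat (mres (M b))" "M' a \<in> carrier_mat k' k'"
    using dat a unfolding cyc_data_def by auto
  assume "blk k' k g (Suc a mod n') (Suc b mod n) = 0\<^sub>m k' k"
  hence z: "blk k' k g a b * mres (M b) = 0\<^sub>m k' k" using hom_cyc_step[OF g dat a l] M by simp
  obtain N where N: "N \<in> carrier_mat k k" "mres (M b) * N = 1\<^sub>m k"
    using invertible_matE[OF M(2)] M(1) by (metis map_carrier_mat)
  thus False using nz z mult_mat_right_zeroD[of "blk k' k g a b" "mres (M b)" k' k N k] M(1) by simp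
qed

text \<open>Distinct cells of the cycle are distinguished by their words before a zero block is met.\<close>

definition separated :: "nat \<Rightarrow> (nat \<Rightarrow> int extended) \<Rightarrow> bool" where
  "separated n lab \<longleftrightarrow> (\<forall>i < n. \<forall>j < n. i \<noteq> j \<longrightarrow> (\<exists>s. lab ((i + s) mod n) \<noteq> lab ((j + s) mod n) \<and>
     (\<forall>r < s. lab ((i + r) mod n) = lab ((j + r) mod n) \<and> (\<exists>l. lab ((i + r) mod n) = Fin l))))"

lemma hom_cyc_shift:
  assumes g: "g \<in> hom (cyc n k lab M) (cyc n' k' lab' M')"
    and dat: "cyc_data n k lab M" "cyc_data n' k' lab' M'" and a: "a < n'" "b < n"
    and nz: "blk k' k g a b \<noteq> 0\<^sub>m k' k"
    and eq: "\<And>r. r < s \<Longrightarrow> lab' ((a + r) mod n') = lab ((b + r) mod n)"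
    and fin: "\<And>r. r < s \<Longrightarrow> \<exists>l. lab ((b + r) mod n) = Fin l"
  shows "blk k' k g ((a + s) mod n') ((b + s) mod n) \<noteq> 0\<^sub>m k' k"
  using eq fin
proof (induction s)
  case 0 thus ?case using nz a by simp
next
  case (Suc s)
  have n: "n > 0" "n' > 0" using a by auto
  obtain l where l: "lab ((b + s) mod n) = Fin l" using Suc.prems(2) by auto
  have IH: "blk k' k g ((a + s) mod n') ((b + s) mod n) \<noteq> 0\<^sub>m k' k" using Suc by simp
  have "blk k' k g (Suc ((a + s) mod n') mod n') (Suc ((b + s) mod n) mod n) \<noteq> 0\<^sub>m k' k"
    by (rule hom_cyc_next[OF g dat _ _ _ l IH]) (use n Suc.prems(1) in auto)
  thus ?case by (simp add: mod_Suc_eq)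
qed

text \<open>Identity edges make all diagonal blocks of an endomorphism equal to one matrix
  \<open>h\<close>. A nonzero block (i, j) is pushed along to the first difference of the two words,
  where \<open>hom_cyc_le\<close> forces a strict lexicographic inequality; hence the off-diagonal
  part is acyclic and \<open>g\<close> is invertible as soon as \<open>h\<close> is. The only
  remaining condition on \<open>h\<close> comes from the last edge, and an infinite label there
  imposes none.\<close>

lemma cyc_local:
  assumes dat: "cyc_data n k lab M" and sep: "separated n lab"
    and fin: "\<And>a. Suc a < n \<Longrightarrow> (\<exists>l. lab a = Fin l) \<and> M a = 1\<^sub>m k"
    and centr: "\<And>h. h \<in> carrier_mat k k \<Longrightarrow> (\<And>l. lab (n - 1) = Fin l \<Longrightarrow> h * mres (M (n - 1)) = mres (M (n - 1)) * h) \<Longrightarrow>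
      invertible_mat h \<or> invertible_mat (1\<^sub>m k - h)"
  shows "local_mat (cyc n k lab M)"
proof -
  let ?X = "cyc n k lab M"
  have nk: "n > 0" "k > 0" using dat by (auto simp: cyc_data_def)
  have dim: "dim_row ?X = n * k" by (simp add: cyc_def)
  have diag: "blk k k g a a = blk k k g 0 0" if g: "g \<in> hom ?X ?X" and a: "a < n" for g a
    using a
  proof (induction a)
    case (Suc a)
    obtain l where l: "lab a = Fin l" "M a = 1\<^sub>m k" using fin[OF Suc(2)] by auto
    have "blk k k g a a * mres (M a) = mres (M a) * blk k k g (Suc a mod n) (Suc a mod n)"
      by (rule hom_cyc_step[OF g dat dat _ _ refl l(1)]) (use Suc in auto)
    hence "blk k k g a a = blk k k g (Suc a) (Suc a)"
      using l(2) Suc(2) left_mult_one_mat[OF blk_carrier] right_mult_one_mat[OF blk_carrier] by (simp add: res.mat_hom_one)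
    thus ?case using Suc by simp
  qed simp
  have inv: "invertible_mat g" if g: "g \<in> hom ?X ?X" and h: "invertible_mat (blk k k g 0 0)" for g
  proof (rule block_acyclic_invertible[of g n k])
    show "g \<in> carrier_mat (n * k) (n * k)" by (rule hom_carrier[OF g]) auto
    show "invertible_mat (blk k k g a a)" if "a < n" for a using diag[OF g that] h by simp
    let ?w = "\<lambda>i s. lab ((i + s) mod n)"
    let ?r = "{(i, j). i < n \<and> j < n \<and> i \<noteq> j \<and> blk k k g i j \<noteq> 0\<^sub>m k k}"
    let ?R = "{(i, j). less_fun (?w i) (?w j)}"
    have "?r \<subseteq> ?R"
    proof clarify
      fix i j assume ij: "i < n" "j < n" "i \<noteq> j" "blk k k g i j \<noteq> 0\<^sub>m k k"
      then obtain s where s: "?w i s \<noteq> ?w j s" "\<And>r. r < s \<Longrightarrow> ?w i r = ?w j r" "\<And>r. r < s \<Longrightarrow> \<exists>l. ?w i r = Fin l"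
        using sep unfolding separated_def by metis
      have "blk k k g ((i + s) mod n) ((j + s) mod n) \<noteq> 0\<^sub>m k k"
        by (rule hom_cyc_shift[OF g dat dat ij(1,2,4)]) (use s in metis)+
      hence "?w i s \<le> ?w j s" by (rule hom_cyc_le[OF g dat dat, rotated 2]) (use nk in auto)
      thus "less_fun (?w i) (?w j)" using s unfolding less_fun_def by (intro exI[of _ s]) auto
    qed
    moreover have "acyclic ?R"
    proof -
      have "trans ?R" using less_fun_trans unfolding trans_def by blast
      thus ?thesis unfolding acyclic_def by (simp add: less_fun_irrefl trancl_id)
    qed
    ultimately show "acyclic ?r" by (rule acyclic_subset[rotated])
  qed
  have "invertible_mat g \<or> invertible_mat (1\<^sub>m (n * k) - g)" if g: "g \<in> hom ?X ?X" for g
  proof -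
    note gc = hom_carrier[OF g cyc_carrier cyc_carrier]
    have "1\<^sub>m (n * k) - g \<in> hom ?X ?X"
      by (rule hom_minus[OF hom_one[OF cyc_carrier] g cyc_carrier cyc_carrier])
    note inv' = inv[OF this]
    have "blk k k (1\<^sub>m (n * k) - g) 0 0 = 1\<^sub>m k - blk k k g 0 0"
    proof (rule eq_matI)
      fix p q assume "p < dim_row (1\<^sub>m k - blk k k g 0 0)" "q < dim_col (1\<^sub>m k - blk k k g 0 0)"
      hence pq: "p < k" "q < k" by auto
      thus "blk k k (1\<^sub>m (n * k) - g) 0 0 $$ (p, q) = (1\<^sub>m k - blk k k g 0 0) $$ (p, q)"
        using gc block_index_less[of 0 n _ k] nk by simp
    qed auto
    moreover have "invertible_mat (blk k k g 0 0) \<or> invertible_mat (1\<^sub>m k - blk k k g 0 0)"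
    proof (rule centr[OF blk_carrier])
      fix l assume l: "lab (n - 1) = Fin l"
      have "blk k k g (n - 1) (n - 1) * mres (M (n - 1)) = mres (M (n - 1)) * blk k k g (Suc (n - 1) mod n) (Suc (n - 1) mod n)"
        by (rule hom_cyc_step[OF g dat dat _ _ refl l]) (use nk in auto)
      thus "blk k k g 0 0 * mres (M (n - 1)) = mres (M (n - 1)) * blk k k g 0 0"
        using diag[OF g, of "n - 1"] nk by simp
    qed
    ultimately show ?thesis using inv[OF g] inv' by auto
  qed
  thus ?thesis using nk unfolding local_mat_def dim by simp
qed

text \<open>Since \<open>h * g\<close> has entry 1 at the origin, some cell \<open>b\<close> is
  joined to cell 0 by nonzero blocks in both directions. Following both blocks along the words
  bounds each label by the other, up to and including the first infinite one.\<close>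

lemma cyc_iso_word:
  assumes eqv: "mat_equiv res (cyc n k lab M) (cyc n' k' lab' M')"
    and dat: "cyc_data n k lab M" "cyc_data n' k' lab' M'"
  obtains b where "b < n'" "\<And>s. (\<And>r. r < s \<Longrightarrow> \<exists>l. lab (r mod n) = Fin l) \<Longrightarrow> lab' ((b + s) mod n') = lab (s mod n)"
    "n * k = n' * k'"
proof -
  have nk: "n > 0" "k > 0" "n' > 0" "k' > 0" using dat by (auto simp: cyc_data_def)
  obtain g h where g: "cyc n' k' lab' M' \<in> carrier_mat (n * k) (n * k)" "g \<in> hom (cyc n k lab M) (cyc n' k' lab' M')"
    "h \<in> hom (cyc n' k' lab' M') (cyc n k lab M)" "h * g = 1\<^sub>m (n * k)" using mat_equivE[OF eqv cyc_carrier] by metis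
  have sz: "n * k = n' * k'"
    using carrier_matD(1)[OF g(1)] carrier_matD(1)[OF cyc_carrier, of n' k' lab' M'] by simp
  note c = hom_carrier[OF g(2) cyc_carrier cyc_carrier] hom_carrier[OF g(3) cyc_carrier cyc_carrier]
  have "(h * g) $$ (0, 0) = 1" unfolding g(4) using nk by simp
  moreover have "(h * g) $$ (0, 0) = (\<Sum>b<n'. \<Sum>u<k'. h $$ (0, b * k' + u) * g $$ (b * k' + u, 0))"
    by (rule mult_index_blk[of _ "n * k" _ _ _ "n * k"]) (use c nk in auto)
  ultimately have "(\<Sum>b<n'. \<Sum>u<k'. h $$ (0, b * k' + u) * g $$ (b * k' + u, 0)) \<noteq> 0" by simp
  then obtain b where b: "b < n'" "(\<Sum>u<k'. h $$ (0, b * k' + u) * g $$ (b * k' + u, 0)) \<noteq> 0"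
    by (meson lessThan_iff sum.not_neutral_contains_not_neutral)
  then obtain u where u: "u < k'" "h $$ (0, b * k' + u) \<noteq> 0" "g $$ (b * k' + u, 0) \<noteq> 0"
    by (metis (no_types, lifting) lessThan_iff mult_eq_0_iff sum.not_neutral_contains_not_neutral)
  have hb: "blk k k' h 0 b \<noteq> 0\<^sub>m k k'"
  proof
    assume z: "blk k k' h 0 b = 0\<^sub>m k k'"
    have "blk k k' h 0 b $$ (0, u) = 0" unfolding z using nk u by simp
    thus False using nk u by simp
  qed
  have gb: "blk k' k g b 0 \<noteq> 0\<^sub>m k' k"
  proof
    assume z: "blk k' k g b 0 = 0\<^sub>m k' k"
    have "blk k' k g b 0 $$ (u, 0) = 0" unfolding z using nk u by simp
    thus False using nk u by simp
  qed
  have "lab' ((b + s) mod n') = lab (s mod n)" if "\<And>r. r < s \<Longrightarrow> \<exists>l. lab (r mod n) = Fin l" for s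
    using that
  proof (induction s rule: less_induct)
    case (less s)
    have eq: "lab' ((b + r) mod n') = lab (r mod n)" if "r < s" for r using less that by simp
    have "blk k' k g ((b + s) mod n') ((0 + s) mod n) \<noteq> 0\<^sub>m k' k"
      by (rule hom_cyc_shift[OF g(2) dat b(1) _ gb]) (use eq less nk in auto)
    hence 1: "lab' ((b + s) mod n') \<le> lab ((0 + s) mod n)"
      by (rule hom_cyc_le[OF g(2) dat, rotated 2]) (use nk in auto)
    have "blk k k' h ((0 + s) mod n) ((b + s) mod n') \<noteq> 0\<^sub>m k k'"
      by (rule hom_cyc_shift[OF g(3) dat(2,1) _ b(1) hb]) (use eq less nk in auto)
    hence 2: "lab ((0 + s) mod n) \<le> lab' ((b + s) mod n')"
      by (rule hom_cyc_le[OF g(3) dat(2,1), rotated 2]) (use nk in auto)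
    show ?case using antisym[OF 1 2] by simp
  qed
  thus ?thesis using that b(1) sz by blast
qed

text \<open>For equal words the morphisms restrict to the diagonal blocks, since a composition that
  passes through another cell cannot return.\<close>

lemma cyc_iso_monodromy:
  assumes eqv: "mat_equiv res (cyc n k lab M) (cyc n k lab M')"
    and dat: "cyc_data n k lab M" "cyc_data n k lab M'" and sep: "separated n lab"
    and fin: "\<And>a. a < n \<Longrightarrow> \<exists>l. lab a = Fin l"
    and one: "\<And>a. Suc a < n \<Longrightarrow> M a = 1\<^sub>m k \<and> M' a = 1\<^sub>m k"
  obtains f h where "f \<in> carrier_mat k k" "h \<in> carrier_mat k k" "h * f = 1\<^sub>m k"
    "f * mres (M (n - 1)) = mres (M' (n - 1)) * f"
proof -
  let ?X = "cyc n k lab M" and ?Y = "cyc n k lab M'"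
  have nk: "n > 0" "k > 0" using dat by (auto simp: cyc_data_def)
  obtain g h where g: "g \<in> hom ?X ?Y" "h \<in> hom ?Y ?X" "h * g = 1\<^sub>m (n * k)" using mat_equivE[OF eqv cyc_carrier] by metis
  note c = hom_carrier[OF g(1) cyc_carrier cyc_carrier] hom_carrier[OF g(2) cyc_carrier cyc_carrier]
  have diag: "blk k k g a a = blk k k g 0 0" if a: "a < n" for a
    using a
  proof (induction a)
    case (Suc a)
    obtain l where l: "lab a = Fin l" "M a = 1\<^sub>m k" "M' a = 1\<^sub>m k" using fin[of a] one[OF Suc(2)] Suc(2) by auto
    have "blk k k g a a * mres (M a) = mres (M' a) * blk k k g (Suc a mod n) (Suc a mod n)"
      by (rule hom_cyc_step[OF g(1) dat _ _ refl l(1)]) (use Suc in auto)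
    hence "blk k k g a a = blk k k g (Suc a) (Suc a)"
      using l(2,3) Suc(2) left_mult_one_mat[OF blk_carrier] right_mult_one_mat[OF blk_carrier] by (simp add: res.mat_hom_one)
    thus ?case using Suc by simp
  qed simp
  have off: "blk k k h 0 b = 0\<^sub>m k k \<or> blk k k g b 0 = 0\<^sub>m k k" if b: "b < n" "b \<noteq> 0" for b
  proof (rule ccontr)
    assume "\<not> (blk k k h 0 b = 0\<^sub>m k k \<or> blk k k g b 0 = 0\<^sub>m k k)"
    hence nz: "blk k k h 0 b \<noteq> 0\<^sub>m k k" "blk k k g b 0 \<noteq> 0\<^sub>m k k" by auto
    obtain s where s: "lab ((0 + s) mod n) \<noteq> lab ((b + s) mod n)" "\<And>r. r < s \<Longrightarrow> lab ((0 + r) mod n) = lab ((b + r) mod n)"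
      using sep b nk unfolding separated_def by metis
    have f: "\<exists>l. lab (i mod n) = Fin l" for i using fin nk by simp
    have "blk k k g ((b + s) mod n) ((0 + s) mod n) \<noteq> 0\<^sub>m k k"
      by (rule hom_cyc_shift[OF g(1) dat b(1) nk(1) nz(2)]) (use s f in auto)
    hence 1: "lab ((b + s) mod n) \<le> lab ((0 + s) mod n)"
      by (rule hom_cyc_le[OF g(1) dat, rotated 2]) (use nk in auto)
    have "blk k k h ((0 + s) mod n) ((b + s) mod n) \<noteq> 0\<^sub>m k k"
      by (rule hom_cyc_shift[OF g(2) dat(2,1) nk(1) b(1) nz(1)]) (use s f in auto)
    hence 2: "lab ((0 + s) mod n) \<le> lab ((b + s) mod n)"
      by (rule hom_cyc_le[OF g(2) dat(2,1), rotated 2]) (use nk in auto)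
    show False using antisym[OF 1 2] s(1) by simp
  qed
  have "blk k k h 0 0 * blk k k g 0 0 = 1\<^sub>m k"
  proof (rule eq_matI)
    fix p q assume "p < dim_row (1\<^sub>m k :: 'r mat)" "q < dim_col (1\<^sub>m k :: 'r mat)"
    hence pq: "p < k" "q < k" by auto
    have i: "p < n * k" "q < n * k" using block_index_less[of 0 n _ k] nk pq by auto
    have "1\<^sub>m k $$ (p, q) = (h * g) $$ (p, q)" unfolding g(3) using i pq by simp
    also have "\<dots> = (\<Sum>b<n. \<Sum>u<k. h $$ (p, b * k + u) * g $$ (b * k + u, q))"
      by (rule mult_index_blk[of _ "n * k" _ _ _ "n * k"]) (use c i in auto)
    also have "\<dots> = (\<Sum>b<n. if b = 0 then \<Sum>u<k. h $$ (p, u) * g $$ (u, q) else 0)"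
    proof (rule sum.cong[OF refl])
      fix b assume "b \<in> {..<n}"
      hence b: "b < n" by simp
      have "h $$ (p, b * k + u) * g $$ (b * k + u, q) = 0" if "b \<noteq> 0" "u < k" for u
      proof -
        have "blk k k h 0 b $$ (p, u) = 0 \<or> blk k k g b 0 $$ (u, q) = 0"
          using off[OF b that(1)] pq that by (elim disjE) (simp_all del: blk_index)
        thus ?thesis using pq that by simp
      qed
      thus "(\<Sum>u<k. h $$ (p, b * k + u) * g $$ (b * k + u, q)) = (if b = 0 then \<Sum>u<k. h $$ (p, u) * g $$ (u, q) else 0)"
        by (auto intro!: sum.neutral)
    qed
    also have "\<dots> = (blk k k h 0 0 * blk k k g 0 0) $$ (p, q)"
      using pq nk by (auto simp: scalar_prod_def lessThan_atLeast0)
    finally show "(blk k k h 0 0 * blk k k g 0 0) $$ (p, q) = 1\<^sub>m k $$ (p, q)" by simp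
  qed auto
  moreover have "blk k k g 0 0 * mres (M (n - 1)) = mres (M' (n - 1)) * blk k k g 0 0"
  proof -
    obtain l where l: "lab (n - 1) = Fin l" using fin nk by fastforce
    have "blk k k g (n - 1) (n - 1) * mres (M (n - 1)) = mres (M' (n - 1)) * blk k k g (Suc (n - 1) mod n) (Suc (n - 1) mod n)"
      by (rule hom_cyc_step[OF g(1) dat _ _ refl l]) (use nk in auto)
    thus ?thesis using diag[of "n - 1"] nk by simp
  qed
  ultimately show ?thesis using that[OF blk_carrier blk_carrier] by blast
qed

end

section \<open>Frobenius blocks\<close>

definition vec_of_poly :: "nat \<Rightarrow> 'a::zero poly \<Rightarrow> 'a vec" where
  "vec_of_poly e q = vec e (coeff q)"

lemma vec_of_poly_carrier [simp]: "vec_of_poly e q \<in> carrier_vec e"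
  and vec_of_poly_index [simp]: "i < e \<Longrightarrow> vec_of_poly e q $ i = coeff q i"
  and vec_of_poly_dim [simp]: "dim_vec (vec_of_poly e q) = e"
  by (simp_all add: vec_of_poly_def)

lemma vec_of_poly_0 [simp]: "vec_of_poly e 0 = 0\<^sub>v e"
  by (intro eq_vecI) auto

lemma vec_of_poly_eq_0_iff:
  assumes "q = 0 \<or> degree q < e"
  shows "vec_of_poly e q = 0\<^sub>v e \<longleftrightarrow> q = 0"
proof
  assume v: "vec_of_poly e q = 0\<^sub>v e"
  show "q = 0"
  proof (rule poly_eqI)
    fix i show "coeff q i = coeff 0 i"
    proof (cases "i < e")
      case True thus ?thesis using arg_cong[OF v, of "\<lambda>v. vec_index v i"] by simp
    next
      case False thus ?thesis using assms by (auto intro: coeff_eq_0)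
    qed
  qed
qed simp

lemma vec_of_poly_inj:
  assumes "degree q < e" "degree r < e" "vec_of_poly e q = vec_of_poly e r"
  shows "q = (r :: 'a::comm_ring poly)"
proof (rule poly_eqI)
  fix i show "coeff q i = coeff r i"
  proof (cases "i < e")
    case True thus ?thesis using arg_cong[OF assms(3), of "\<lambda>v. vec_index v i"] by simp
  next
    case False thus ?thesis using assms by (simp add: coeff_eq_0)
  qed
qed

lemma vec_of_poly_surj:
  fixes v :: "'a::comm_monoid_add vec"
  assumes "v \<in> carrier_vec e" "0 < e"
  obtains q where "degree q < e" "v = vec_of_poly e q"
proof -
  let ?q = "\<Sum>i<e. monom (v $ i) i"
  have c: "coeff ?q j = (if j < e then v $ j else 0)" for j
    by (auto simp: coeff_sum)
  have "degree ?q < e"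
  proof (cases "?q = 0")
    case False
    hence "coeff ?q (degree ?q) \<noteq> 0" by simp
    thus ?thesis unfolding c by (auto split: if_splits)
  qed (use assms in simp)
  moreover have "v = vec_of_poly e ?q" using assms by (intro eq_vecI) (auto simp: c)
  ultimately show ?thesis using that by blast
qed

lemma frobenius_block_carrier [simp]: "frobenius_block p \<in> carrier_mat (degree p) (degree p)"
  by (simp add: frobenius_block_def)

lemma degree_mod_less_degree:
  fixes p q :: "'a::field poly"
  assumes "0 < degree p"
  shows "degree (q mod p) < degree p"
proof -
  have "p \<noteq> 0" using assms by auto
  from degree_mod_less[OF this, of q] show ?thesis using assms by auto
qed

text \<open>Subtracting \<open>?c\<close> times \<open>p\<close> cancels the top coefficient of
  \<xi> q, so \<open>?r\<close> is already the remainder; its coefficients are what the last column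
  of the block contributes.\<close>

lemma frobenius_block_mult:
  fixes p q :: "'a::field poly"
  assumes p: "lead_coeff p = 1" "0 < degree p" and q: "degree q < degree p"
  shows "frobenius_block p *\<^sub>v vec_of_poly (degree p) q = vec_of_poly (degree p) (pCons 0 q mod p)"
proof -
  let ?e = "degree p" and ?c = "coeff q (degree p - 1)"
  let ?r = "pCons 0 q - Polynomial.smult ?c p"
  have "degree ?r < ?e"
  proof -
    have "degree (pCons 0 q) \<le> ?e" using q by (metis degree_pCons_le Suc_leI le_trans)
    moreover have "degree (Polynomial.smult ?c p) \<le> ?e" by simp
    ultimately have "degree ?r \<le> ?e" by (rule degree_diff_le)
    moreover have "coeff ?r ?e = 0" using p by (cases ?e) (auto simp: coeff_pCons)
    ultimately show ?thesis using p(2) by (metis coeff_0 degree_0 leading_coeff_0_iff le_neq_implies_less)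
  qed
  moreover have "pCons 0 q mod p = ?r mod p"
    by (simp add: poly_mod_diff_left mod_smult_left)
  ultimately have m: "pCons 0 q mod p = ?r" by (simp add: mod_poly_less)
  show ?thesis unfolding m
  proof (rule eq_vecI)
    fix i assume "i < dim_vec (vec_of_poly ?e ?r)"
    hence i: "i < ?e" by simp
    have "(frobenius_block p *\<^sub>v vec_of_poly ?e q) $ i =
        (\<Sum>j<?e. (if j + 1 = ?e then - coeff p i else if i = j + 1 then 1 else 0) * coeff q j)"
      using i by (auto simp: frobenius_block_def scalar_prod_def lessThan_atLeast0 intro!: sum.cong)
    also have "\<dots> = (\<Sum>j<?e. (if j = ?e - 1 then - coeff p i * ?c else 0) + (if i = Suc j then coeff q j else 0))"
      using p(2) i by (intro sum.cong refl) auto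
    also have "\<dots> = - coeff p i * ?c + (\<Sum>j<?e. if i = Suc j then coeff q j else 0)"
      using p(2) by (simp add: sum.distrib)
    also have "(\<Sum>j<?e. if i = Suc j then coeff q j else 0) = coeff (pCons 0 q) i"
      using i by (cases i) (auto simp: coeff_pCons)
    finally show "(frobenius_block p *\<^sub>v vec_of_poly ?e q) $ i = vec_of_poly ?e ?r $ i" using i by simp
  qed (simp add: frobenius_block_def)
qed

text \<open>A matrix intertwining two Frobenius blocks is multiplication by a polynomial.\<close>

lemma frobenius_intertwiner:
  fixes p p' :: "'a::field poly"
  assumes p: "lead_coeff p = 1" "0 < degree p" and p': "lead_coeff p' = 1" "0 < degree p'"
    and h: "h \<in> carrier_mat (degree p') (degree p)" "h * frobenius_block p = frobenius_block p' * h"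
    and c: "degree c < degree p'" "h *\<^sub>v vec_of_poly (degree p) 1 = vec_of_poly (degree p') c"
  shows "h *\<^sub>v vec_of_poly (degree p) (q mod p) = vec_of_poly (degree p') (q * c mod p')"
proof (induction q)
  case 0 thus ?case using h by (intro eq_vecI) (auto simp: scalar_prod_def)
next
  case (pCons a q)
  let ?e = "degree p" and ?e' = "degree p'"
  have 1: "pCons a q mod p = pCons a 0 + pCons 0 (q mod p) mod p"
  proof -
    have "pCons a q mod p = ([:a:] + [:0, 1:] * q) mod p" by simp
    also have "\<dots> = ([:a:] mod p + [:0, 1:] * (q mod p) mod p) mod p" by (metis mod_add_eq mod_mult_right_eq)
    also have "\<dots> = [:a:] mod p + [:0, 1:] * (q mod p) mod p" by (metis mod_add_eq mod_mod_trivial poly_mod_add_left)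
    finally show ?thesis using p(2) by (simp add: mod_poly_less)
  qed
  have 2: "pCons a q * c mod p' = Polynomial.smult a c + pCons 0 (q * c mod p') mod p'"
  proof -
    have "pCons a q * c mod p' = (Polynomial.smult a c + [:0, 1:] * (q * c)) mod p'" by simp
    also have "\<dots> = Polynomial.smult a c mod p' + [:0, 1:] * (q * c mod p') mod p'" by (metis mod_mult_right_eq poly_mod_add_left)
    finally show ?thesis using c(1) by (simp add: mod_poly_less)
  qed
  have d: "vec_of_poly e (Polynomial.smult a r + s) = a \<cdot>\<^sub>v vec_of_poly e r + vec_of_poly e s" for e and r s :: "'a poly"
    by (intro eq_vecI) auto
  have a: "pCons a 0 = Polynomial.smult a 1" by simp
  have "h *\<^sub>v vec_of_poly ?e (pCons a q mod p) =
      h *\<^sub>v (a \<cdot>\<^sub>v vec_of_poly ?e 1 + frobenius_block p *\<^sub>v vec_of_poly ?e (q mod p))"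
    unfolding 1 a d frobenius_block_mult[OF p degree_mod_less_degree[OF p(2)]] ..
  also have "\<dots> = a \<cdot>\<^sub>v (h *\<^sub>v vec_of_poly ?e 1) + h *\<^sub>v (frobenius_block p *\<^sub>v vec_of_poly ?e (q mod p))"
    using h(1) mult_mat_vec_carrier[OF frobenius_block_carrier[of p] vec_of_poly_carrier[of "degree p" "q mod p"]]
    by (simp add: mult_add_distrib_mat_vec[of h ?e' ?e] mult_mat_vec[of h ?e' ?e])
  also have "h *\<^sub>v (frobenius_block p *\<^sub>v vec_of_poly ?e (q mod p)) = frobenius_block p' *\<^sub>v (h *\<^sub>v vec_of_poly ?e (q mod p))"
    using assoc_mult_mat_vec[OF h(1) frobenius_block_carrier vec_of_poly_carrier, of "q mod p"]
      assoc_mult_mat_vec[OF frobenius_block_carrier h(1) vec_of_poly_carrier, of "q mod p"] unfolding h(2) by simp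
  also have "\<dots> = vec_of_poly ?e' (pCons 0 (q * c mod p') mod p')"
    unfolding pCons(2) by (rule frobenius_block_mult[OF p' degree_mod_less_degree[OF p'(2)]])
  finally show ?case unfolding 2 d c(2) .
qed

lemma prime_elem_power_dvd_cancel:
  fixes x :: "'a::idom"
  assumes "prime_elem x" "\<not> x dvd b"
  shows "x ^ m dvd a * b \<Longrightarrow> x ^ m dvd a"
proof (induction m arbitrary: a)
  case (Suc m)
  have "x dvd a * b" using Suc(2) by (metis dvd_mult_left power_Suc)
  hence "x dvd a" using assms by (auto simp: prime_elem_dvd_mult_iff)
  then obtain a' where a: "a = x * a'" ..
  have "x * x ^ m dvd x * (a' * b)" using Suc(2) unfolding a by (simp add: mult.assoc)
  hence "x ^ m dvd a' * b" using assms(1) by (simp add: prime_elem_def)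
  thus ?case using Suc(1)[of a'] unfolding a by (simp add: mult_dvd_mono)
qed simp

context
  fixes \<pi> :: "'a::field poly" and m :: nat
  assumes \<pi>: "irreducible \<pi>" "lead_coeff \<pi> = 1" and m: "1 \<le> m"
begin

lemma degree_irreducible_pos: "0 < degree \<pi>"
proof (rule ccontr)
  assume "\<not> 0 < degree \<pi>"
  hence "\<pi> = 1" using \<pi>(2) by (metis degree_0_id gr0I one_pCons)
  thus False using \<pi>(1) by (simp add: irreducible_def)
qed

lemma degree_irreducible_power: "degree (\<pi> ^ m) = m * degree \<pi>" "0 < degree (\<pi> ^ m)" "lead_coeff (\<pi> ^ m) = 1"
proof -
  have "\<pi> \<noteq> 0" using \<pi>(2) by auto
  thus "degree (\<pi> ^ m) = m * degree \<pi>" by (simp add: degree_power_eq)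
  thus "0 < degree (\<pi> ^ m)" using m degree_irreducible_pos by simp
  show "lead_coeff (\<pi> ^ m) = 1" using \<pi>(2) by (simp add: lead_coeff_power)
qed

text \<open>A commuting matrix is multiplication by some \<open>c\<close> on k[\<xi>]/(\<pi>^m),
  which is a local ring: if \<pi> does not divide \<open>c\<close>, multiplication is injective, and
  otherwise \<pi> does not divide \<open>1 - c\<close>.\<close>

lemma frobenius_block_commuting_local:
  assumes h: "h \<in> carrier_mat (m * degree \<pi>) (m * degree \<pi>)"
    "h * frobenius_block (\<pi> ^ m) = frobenius_block (\<pi> ^ m) * h"
  shows "invertible_mat h \<or> invertible_mat (1\<^sub>m (m * degree \<pi>) - h)"
proof -
  let ?p = "\<pi> ^ m" and ?e = "m * degree \<pi>"
  note p = degree_irreducible_power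
  have prime: "prime_elem \<pi>" using \<pi>(1) by (rule field_poly_irreducible_imp_prime)
  have inv: "invertible_mat g" if g: "g \<in> carrier_mat ?e ?e" "g * frobenius_block ?p = frobenius_block ?p * g"
    and c: "degree c < ?e" "g *\<^sub>v vec_of_poly ?e 1 = vec_of_poly ?e c" "\<not> \<pi> dvd c" for g c
    unfolding invertible_mat_iff_inj[OF g(1)]
  proof (intro ballI impI)
    fix v assume v: "v \<in> carrier_vec ?e" "g *\<^sub>v v = 0\<^sub>v ?e"
    obtain q where q: "degree q < ?e" "v = vec_of_poly ?e q" using vec_of_poly_surj[OF v(1)] p by metis
    have qp: "q mod ?p = q" using q p by (simp add: mod_poly_less)
    have "vec_of_poly ?e (q * c mod ?p) = 0\<^sub>v ?e"
      using frobenius_intertwiner[OF p(3,2) p(3,2), of g c q] g c(1,2) v q qp unfolding p(1) by simp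
    hence "q * c mod ?p = 0" using degree_mod_less_degree[OF p(2), of "q * c"] p by (subst (asm) vec_of_poly_eq_0_iff) auto
    hence "?p dvd q * c" by (simp add: dvd_eq_mod_eq_0)
    hence "?p dvd q" by (rule prime_elem_power_dvd_cancel[OF prime c(3)])
    hence "q = 0" using qp by (simp add: dvd_eq_mod_eq_0)
    thus "v = 0\<^sub>v ?e" using q by simp
  qed
  obtain c where c: "degree c < ?e" "h *\<^sub>v vec_of_poly ?e 1 = vec_of_poly ?e c"
    using vec_of_poly_surj[of "h *\<^sub>v vec_of_poly ?e 1" ?e] h p by auto
  show ?thesis
  proof (cases "\<pi> dvd c")
    case False thus ?thesis using inv[OF h c] by simp
  next
    case True
    let ?g = "1\<^sub>m ?e - h"
    have F: "frobenius_block ?p \<in> carrier_mat ?e ?e" using frobenius_block_carrier[of ?p] unfolding p(1) .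
    have "?g * frobenius_block ?p = frobenius_block ?p * ?g"
      using h F by (simp add: minus_mult_distrib_mat[of _ ?e ?e _ _ ?e] mult_minus_distrib_mat[of _ ?e ?e _ ?e])
    moreover have "?g *\<^sub>v vec_of_poly ?e 1 = vec_of_poly ?e (1 - c)"
    proof -
      have "?g *\<^sub>v vec_of_poly ?e 1 = vec_of_poly ?e 1 - vec_of_poly ?e c"
        using h by (simp add: minus_mult_distrib_mat_vec[of _ ?e ?e] c(2)[symmetric])
      also have "\<dots> = vec_of_poly ?e (1 - c)" by (intro eq_vecI) auto
      finally show ?thesis .
    qed
    moreover have "degree (1 - c) < ?e" using c(1) p by (intro degree_diff_less) auto
    moreover have "\<not> \<pi> dvd 1 - c"
    proof
      assume "\<pi> dvd 1 - c"
      hence "\<pi> dvd 1 - c + c" using True by (rule dvd_add)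
      thus False using \<pi>(1) by (simp add: irreducible_def)
    qed
    ultimately show ?thesis using inv[of ?g "1 - c"] minus_carrier_mat[OF h(1)] by simp
  qed
qed

text \<open>A root at 0 would make \<xi> a divisor of the monic irreducible \<pi>, hence equal to
  it. This is where the exclusion of \<xi> gives an invertible monodromy.\<close>

lemma coeff_0_irreducible_power:
  assumes "\<pi> \<noteq> [:0, 1:]" shows "coeff (\<pi> ^ m) 0 \<noteq> 0"
proof
  assume "coeff (\<pi> ^ m) 0 = 0"
  hence "poly \<pi> 0 = 0" by (simp add: poly_0_coeff_0[symmetric] poly_power)
  hence "[:0, 1:] dvd \<pi>" using poly_eq_0_iff_dvd[of \<pi> 0] by simp
  then obtain r where r: "\<pi> = [:0, 1:] * r" ..
  have "\<not> [:0, 1:] dvd (1 :: 'a poly)" by (simp add: is_unit_iff_degree)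
  hence "r dvd 1" using irreducibleD[OF \<pi>(1) r] by blast
  hence "degree r = 0" by (cases "r = 0") (auto simp: is_unit_iff_degree)
  then obtain a where a: "r = [:a:]" by (metis degree_0_id)
  have "a = 1" using \<pi>(2) unfolding r a by (simp split: if_splits)
  thus False using assms unfolding r a by simp
qed

end

text \<open>A kernel vector is a polynomial \<open>q\<close> with \<open>p\<close> dividing \<xi> q.
  For degree reasons the quotient is constant, and comparing constant terms shows that it is
  0.\<close>

lemma frobenius_block_invertible:
  fixes p :: "'a::field poly"
  assumes p: "lead_coeff p = 1" "0 < degree p" and c: "coeff p 0 \<noteq> 0"
  shows "invertible_mat (frobenius_block p)"
  unfolding invertible_mat_iff_inj[OF frobenius_block_carrier]
proof (intro ballI impI)
  fix v assume v: "v \<in> carrier_vec (degree p)" "frobenius_block p *\<^sub>v v = 0\<^sub>v (degree p)"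
  obtain q where q: "degree q < degree p" "v = vec_of_poly (degree p) q" using vec_of_poly_surj[OF v(1) p(2)] .
  have "vec_of_poly (degree p) (pCons 0 q mod p) = 0\<^sub>v (degree p)" using v q frobenius_block_mult[OF p q(1)] by simp
  hence "p dvd pCons 0 q" using degree_mod_less_degree[OF p(2), of "pCons 0 q"] p
    by (subst (asm) vec_of_poly_eq_0_iff) (auto simp: dvd_eq_mod_eq_0)
  then obtain r where r: "pCons 0 q = p * r" ..
  have "q = 0"
  proof (rule ccontr)
    assume "q \<noteq> 0"
    hence nz: "pCons 0 q \<noteq> 0" by simp
    hence "p \<noteq> 0" "r \<noteq> 0" unfolding r by auto
    hence "degree p + degree r = Suc (degree q)" using arg_cong[OF r, of degree] \<open>q \<noteq> 0\<close> by (simp add: degree_mult_eq)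
    hence "degree r = 0" using q(1) by simp
    then obtain a where a: "r = [:a:]" by (metis degree_0_id)
    have "coeff p 0 * a = 0" using arg_cong[OF r, of "\<lambda>x. coeff x 0"] unfolding a by auto
    thus False using c a \<open>r \<noteq> 0\<close> by simp
  qed
  thus "v = 0\<^sub>v (degree p)" using q by simp
qed

text \<open>\<open>f\<close> is multiplication by \<open>c\<close> from k[\<xi>]/(p) to
  k[\<xi>]/(p'). Surjectivity makes \<open>c\<close> a unit modulo \<open>p'\<close>, and being well
  defined means that \<open>p'\<close> divides \<open>p * c\<close>; so \<open>p'\<close> divides
  \<open>p\<close>, and both are monic of the same degree.\<close>

lemma frobenius_block_intertwined_eq:
  fixes p p' :: "'a::field poly"
  assumes p: "lead_coeff p = 1" "0 < degree p" and p': "lead_coeff p' = 1" "degree p' = degree p"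
    and f: "f \<in> carrier_mat (degree p) (degree p)" "f * frobenius_block p = frobenius_block p' * f"
    and h: "h \<in> carrier_mat (degree p) (degree p)" "f * h = 1\<^sub>m (degree p)"
  shows "p = p'"
proof -
  let ?e = "degree p"
  have p'0: "0 < degree p'" using p p' by simp
  obtain c where c: "degree c < ?e" "f *\<^sub>v vec_of_poly ?e 1 = vec_of_poly ?e c"
    using vec_of_poly_surj[of "f *\<^sub>v vec_of_poly ?e 1" ?e] f p by auto
  have *: "f *\<^sub>v vec_of_poly ?e (q mod p) = vec_of_poly ?e (q * c mod p')" for q
    using frobenius_intertwiner[OF p p'(1) p'0, of f c q] f c unfolding p'(2) by simp
  obtain q where q: "degree q < ?e" "h *\<^sub>v vec_of_poly ?e 1 = vec_of_poly ?e q"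
    using vec_of_poly_surj[of "h *\<^sub>v vec_of_poly ?e 1" ?e] h p by auto
  have qp: "q mod p = q" using q by (simp add: mod_poly_less)
  have "(f * h) *\<^sub>v vec_of_poly ?e 1 = f *\<^sub>v (h *\<^sub>v vec_of_poly ?e 1)"
    by (rule assoc_mult_mat_vec[OF f(1) h(1) vec_of_poly_carrier])
  hence "vec_of_poly ?e (q * c mod p') = (f * h) *\<^sub>v vec_of_poly ?e 1"
    using *[of q] unfolding qp q(2) by simp
  hence "vec_of_poly ?e (q * c mod p') = vec_of_poly ?e 1" unfolding h(2) by simp
  hence qc: "q * c mod p' = 1" using degree_mod_less_degree[OF p'0, of "q * c"] p p'(2) by (intro vec_of_poly_inj[of _ ?e]) auto
  have "f *\<^sub>v 0\<^sub>v ?e = 0\<^sub>v ?e" using f by (intro eq_vecI) auto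
  hence "vec_of_poly ?e (p * c mod p') = 0\<^sub>v ?e" using *[of p] by simp
  hence pc: "p * c mod p' = 0" using degree_mod_less_degree[OF p'0, of "p * c"] p'(2) by (subst (asm) vec_of_poly_eq_0_iff) auto
  have "p mod p' = p * (q * c mod p') mod p'" unfolding qc by simp
  also have "\<dots> = q * (p * c mod p') mod p'" by (simp add: mod_mult_right_eq mult_ac)
  finally have "p' dvd p" unfolding pc by (simp add: dvd_eq_mod_eq_0)
  then obtain r where r: "p = p' * r" ..
  have "degree r = 0" using p p' r by (metis add_cancel_right_right degree_mult_eq leading_coeff_0_iff mult_zero_right zero_neq_one)
  then obtain a where a: "r = [:a:]" by (metis degree_0_id)
  have "a = 1" using p(1) p'(1) unfolding r a by (simp split: if_splits)
  thus ?thesis unfolding r a by simp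
qed

lemma irreducible_power_eq:
  fixes \<pi> \<pi>' :: "'a::field poly"
  assumes \<pi>: "irreducible \<pi>" "lead_coeff \<pi> = 1" and \<pi>': "irreducible \<pi>'" "lead_coeff \<pi>' = 1"
    and m: "1 \<le> m" and eq: "\<pi> ^ m = \<pi>' ^ m'"
  shows "\<pi> = \<pi>' \<and> m = m'"
proof -
  have "\<pi> dvd \<pi>' ^ m'" unfolding eq[symmetric] using m by (simp add: dvd_power)
  hence "\<pi> dvd \<pi>'" using field_poly_irreducible_imp_prime[OF \<pi>(1)] by (rule prime_elem_dvd_power[rotated])
  then obtain r where r: "\<pi>' = \<pi> * r" ..
  have "\<not> \<pi> dvd 1" using \<pi>(1) by (rule irreducible_not_unit)
  hence "r dvd 1" using irreducibleD[OF \<pi>'(1) r] by blast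
  hence "degree r = 0" by (cases "r = 0") (auto simp: is_unit_iff_degree)
  then obtain a where a: "r = [:a:]" by (metis degree_0_id)
  have "a = 1" using \<pi>'(2) \<pi>(2) unfolding r a by (simp split: if_splits)
  hence e: "\<pi> = \<pi>'" unfolding r a by simp
  have "\<pi> \<noteq> 0" using \<pi>(2) by auto
  hence "m * degree \<pi> = m' * degree \<pi>" using arg_cong[OF eq, of degree] e by (simp add: degree_power_eq)
  moreover have "0 < degree \<pi>" by (rule degree_irreducible_pos[OF \<pi> le_refl])
  ultimately show ?thesis using e by simp
qed

text \<open>The change of basis consists of the powers \<open>(\<xi> - c)\<^sup>m\<^sup>-\<^sup>1, \<dots>, \<xi> - c, 1\<close>.\<close>

lemma jordan_block_similar_frobenius:
  fixes c :: "'a::field"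
  assumes m: "1 \<le> m"
  shows "similar_mat (jordan_block m c) (frobenius_block ([:- c, 1:] ^ m))"
proof -
  let ?p = "[:- c, 1:] ^ m" and ?F = "frobenius_block ([:- c, 1:] ^ m)"
  have dp: "degree ?p = m" by (simp add: degree_power_eq)
  have p: "lead_coeff ?p = 1" "0 < degree ?p" using lead_coeff_power[of "[:- c, 1:]" m] m unfolding dp by (simp_all add: dp)
  have F: "?F \<in> carrier_mat m m" using frobenius_block_carrier[of ?p] unfolding dp .
  let ?b = "\<lambda>j. [:- c, 1:] ^ (m - 1 - j)"
  have db: "degree (?b j) < m" for j using m by (simp add: degree_power_eq)
  define P where "P = mat m m (\<lambda>(i, j). coeff (?b j) i)"
  have P: "P \<in> carrier_mat m m" by (simp add: P_def)
  have col: "col P j = vec_of_poly m (?b j)" if "j < m" for j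
    using that by (intro eq_vecI) (auto simp: P_def)
  have FP: "?F * P = P * jordan_block m c"
  proof (rule eq_matI)
    fix i j assume "i < dim_row (P * jordan_block m c)" "j < dim_col (P * jordan_block m c)"
    hence ij: "i < m" "j < m" by (auto simp: P_def jordan_block_def)
    have "(?F * P) $$ (i, j) = (?F *\<^sub>v col P j) $ i" using ij F P by simp
    also have "\<dots> = coeff (pCons 0 (?b j) mod ?p) i"
      unfolding col[OF ij(2)] using frobenius_block_mult[OF p, of "?b j"] db[of j] ij unfolding dp by simp
    also have "pCons 0 (?b j) mod ?p = Polynomial.smult c (?b j) + (if j = 0 then 0 else ?b (j - 1))"
    proof -
      have "pCons 0 (?b j) = Polynomial.smult c (?b j) + [:- c, 1:] * ?b j" by simp
      also have "[:- c, 1:] * ?b j = [:- c, 1:] ^ (m - j)" using ij(2) by (metis Suc_diff_Suc diff_diff_left plus_1_eq_Suc power_Suc)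
      finally have e: "pCons 0 (?b j) = Polynomial.smult c (?b j) + [:- c, 1:] ^ (m - j)" .
      show ?thesis
      proof (cases "j = 0")
        case True
        have "pCons 0 (?b j) mod ?p = Polynomial.smult c (?b j) mod ?p" unfolding e using True by simp
        also have "\<dots> = Polynomial.smult c (?b j)" using db[of j] dp by (simp add: mod_poly_less del: mod_smult_left)
        finally show ?thesis using True by simp
      next
        case False
        hence e2: "[:- c, 1:] ^ (m - j) = ?b (j - 1)" using ij(2) by simp
        have "degree (Polynomial.smult c (?b j) + ?b (j - 1)) < degree ?p"
          using db[of j] db[of "j - 1"] dp by (metis degree_add_less degree_smult_le le_less_trans)
        thus ?thesis unfolding e e2 using False by (simp add: mod_poly_less)
      qed
    qed
    finally have l: "(?F * P) $$ (i, j) = c * P $$ (i, j) + (if j = 0 then 0 else P $$ (i, j - 1))"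
      using ij by (auto simp: P_def)
    have "(P * jordan_block m c) $$ (i, j) = (\<Sum>u<m. P $$ (i, u) * (if u = j then c else if Suc u = j then 1 else 0))"
      using ij P by (auto simp: scalar_prod_def jordan_block_def lessThan_atLeast0 intro!: sum.cong)
    also have "\<dots> = (\<Sum>u<m. (if u = j then c * P $$ (i, j) else 0) + (if Suc u = j then P $$ (i, u) else 0))"
      by (intro sum.cong refl) auto
    also have "\<dots> = c * P $$ (i, j) + (\<Sum>u<m. if Suc u = j then P $$ (i, u) else 0)"
      using ij by (simp add: sum.distrib)
    also have "(\<Sum>u<m. if Suc u = j then P $$ (i, u) else 0) = (if j = 0 then 0 else P $$ (i, j - 1))"
      using ij by (cases j) auto
    finally show "(?F * P) $$ (i, j) = (P * jordan_block m c) $$ (i, j)" using l by simp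
  qed (use F P in \<open>auto simp: jordan_block_def\<close>)
  have "invertible_mat P" unfolding invertible_mat_iff_inj[OF P]
  proof (intro ballI impI)
    fix v assume v: "v \<in> carrier_vec m" "P *\<^sub>v v = 0\<^sub>v m"
    let ?q = "\<Sum>j<m. Polynomial.smult (v $ j) (?b j)"
    have "?q = 0"
    proof (rule poly_eqI)
      fix i show "coeff ?q i = coeff 0 i"
      proof (cases "i < m")
        case True
        have "coeff ?q i = (P *\<^sub>v v) $ i" using True v(1)
          by (auto simp: coeff_sum scalar_prod_def P_def lessThan_atLeast0 mult.commute intro!: sum.cong)
        thus ?thesis using v True by simp
      next
        case False
        have "coeff (?b j) i = 0" for j using db[of j] False by (intro coeff_eq_0) simp
        thus ?thesis by (simp add: coeff_sum)
      qed
    qed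
    have pw: "pcompose (r ^ i) s = pcompose r s ^ i" for r s :: "'a poly" and i
      by (induction i) (simp_all add: pcompose_mult pcompose_1)
    \<comment> \<open>The substitution of \<xi> + c for \<xi> turns the powers of \<xi> - c into
      monomials, whose independence is read off from coefficients.\<close>
    from \<open>?q = 0\<close> have "0 = pcompose ?q [:c, 1:]" by simp
    also have "\<dots> = (\<Sum>j<m. Polynomial.smult (v $ j) ([:0, 1:] ^ (m - 1 - j)))"
      by (simp add: pcompose_sum pcompose_smult pw pcompose_pCons)
    also have "\<dots> = (\<Sum>j<m. monom (v $ j) (m - 1 - j))"
      by (simp add: monom_altdef)
    finally have z: "(\<Sum>j<m. monom (v $ j) (m - 1 - j)) = 0" by simp
    show "v = 0\<^sub>v m"
    proof (rule eq_vecI)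
      fix i assume "i < dim_vec (0\<^sub>v m :: 'a vec)"
      hence i: "i < m" by simp
      have "0 = coeff (\<Sum>j<m. monom (v $ j) (m - 1 - j)) (m - 1 - i)" unfolding z by simp
      also have "\<dots> = (\<Sum>j<m. if j = i then v $ i else 0)"
        unfolding coeff_sum using i by (intro sum.cong refl) auto
      finally show "v $ i = 0\<^sub>v m $ i" using i by simp
    qed (use v in simp)
  qed
  then obtain Q where Q: "Q \<in> carrier_mat m m" "P * Q = 1\<^sub>m m" "Q * P = 1\<^sub>m m" using P invertible_matE by metis
  have J: "jordan_block m c \<in> carrier_mat m m" by (simp add: jordan_block_def)
  have "Q * ?F * P = Q * (P * jordan_block m c)" using F P Q(1) by (simp add: assoc_mult_mat[of _ m m _ m _ m] FP)
  also have "\<dots> = jordan_block m c" by (rule mult_mat_cancel[OF Q(3) Q(1) P J])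
  finally have "similar_mat_wit (jordan_block m c) ?F Q P"
    using F P Q J unfolding similar_mat_wit_def by (auto simp: Let_def)
  thus ?thesis unfolding similar_mat_def by blast
qed

context dvr
begin

section \<open>The canonical blocks\<close>

text \<open>Converse of \<open>hom_cyc_eq\<close>: every block column is the successor of exactly
  one cell, so the listed equations cover all entries. The predecessor is computed by adding
  \<open>n - 1\<close>.\<close>

lemma hom_cycI:
  assumes S: "S \<in> carrier_mat (n' * k') (n * k)" "T \<in> carrier_mat (n' * k') (n * k)" "mres T = mres S"
    and n: "0 < n" "0 < k'" "0 < k"
    and eq: "\<And>a b p q. a < n' \<Longrightarrow> b < n \<Longrightarrow> p < k' \<Longrightarrow> q < k \<Longrightarrow>
      wt (lab b) * to_fract (\<Sum>u<k. S $$ (a * k' + p, b * k + u) * M b $$ (u, q)) =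
      wt (lab' a) * to_fract (\<Sum>u<k'. M' a $$ (p, u) * T $$ (Suc a mod n' * k' + u, Suc b mod n * k + q))"
  shows "mres S \<in> hom (cyc n k lab M) (cyc n' k' lab' M')"
proof (rule homI[OF cyc_carrier cyc_carrier S(1,2) refl S(3)], rule eq_matI)
  fix i j assume "i < dim_row (cyc n' k' lab' M' * lft T)" "j < dim_col (cyc n' k' lab' M' * lft T)"
  hence ij: "i < n' * k'" "j < n * k" using S by (auto simp: cyc_def)
  define a p q where apq: "a = i div k'" "p = i mod k'" "q = j mod k"
  define b where "b = (j div k + (n - 1)) mod n"
  have jn: "j div k < n" using ij n by (simp add: less_mult_imp_div_less)
  have a: "a < n'" "b < n" "p < k'" "q < k" using ij n by (auto simp: apq b_def less_mult_imp_div_less)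
  have "Suc b mod n = Suc (j div k + (n - 1)) mod n" unfolding b_def by (rule mod_Suc_eq)
  also have "\<dots> = (j div k + n) mod n" using n by simp
  also have "\<dots> = j div k" using jn by simp
  finally have b: "Suc b mod n = j div k" .
  have i: "i = a * k' + p" "j = Suc b mod n * k + q" unfolding b by (simp_all add: apq)
  show "(lft S * cyc n k lab M) $$ (i, j) = (cyc n' k' lab' M' * lft T) $$ (i, j)"
    unfolding i cyc_mult_right[OF S(1) a] cyc_mult_left[OF S(2) a] by (rule eq[OF a])
qed (use S in \<open>auto simp: cyc_def\<close>)

text \<open>\<open>S\<close> repeats a lift \<open>P'\<close> of the conjugating matrix on the
  diagonal. On the wrap-around edge the equation \<open>P' * F = G * R\<close> must hold exactly, so
  \<open>T\<close> uses \<open>R\<close>, the inverse of \<open>G\<close> times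
  \<open>P' * F\<close>, in cell 0; the conjugation relation shows that \<open>R\<close> and
  \<open>P'\<close> have the same residue.\<close>

lemma cyc_equiv_similar:
  assumes dat: "cyc_data n k lab M" "cyc_data n k lab M'"
    and one: "\<And>a. Suc a < n \<Longrightarrow> M a = 1\<^sub>m k \<and> M' a = 1\<^sub>m k"
    and sim: "similar_mat (mres (M' (n - 1))) (mres (M (n - 1)))"
  shows "mat_equiv res (cyc n k lab M) (cyc n k lab M')"
proof -
  have n: "0 < n" "0 < k" using dat by (auto simp: cyc_data_def)
  let ?F = "M (n - 1)" and ?G = "M' (n - 1)"
  have F: "?F \<in> carrier_mat k k" "?G \<in> carrier_mat k k" "invertible_mat (mres ?G)"
    using dat n by (auto simp: cyc_data_def)
  obtain P Q where w: "similar_mat_wit (mres ?G) (mres ?F) P Q" using sim unfolding similar_mat_def by blast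
  have P: "P \<in> carrier_mat k k" "Q \<in> carrier_mat k k" "P * Q = 1\<^sub>m k" "Q * P = 1\<^sub>m k" "mres ?G = P * mres ?F * Q"
    using similar_mat_witD2[of "mres ?G" k k, OF _ w] F by auto
  obtain lift where lift: "\<And>c. res (lift c) = c" using res_surj by metis
  define P' where "P' = map_mat lift P"
  have P': "P' \<in> carrier_mat k k" "mres P' = P" using P(1) lift by (auto simp: P'_def)
  have Pres: "res (P' $$ (p, q)) = P $$ (p, q)" if "p < k" "q < k" for p q
    unfolding P'(2)[symmetric] using that carrier_matD[OF P'(1)] by (auto intro!: index_map_mat(1)[symmetric])
  obtain G' where G': "G' \<in> carrier_mat k k" "?G * G' = 1\<^sub>m k" "G' * ?G = 1\<^sub>m k"
    using invertible_matE[OF unit_inverse_lift[OF F(2,3)] F(2)] .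
  define R where "R = G' * (P' * ?F)"
  have R: "R \<in> carrier_mat k k" using G' P' F by (auto simp: R_def)
  have GR: "?G * R = P' * ?F" unfolding R_def by (rule mult_mat_cancel[OF G'(2) F(2) G'(1)]) (use P' F in auto)
  have Rres: "mres R = P"
  proof -
    have 1: "mres G' * mres ?G = 1\<^sub>m k" using G' F by (simp flip: res.mat_hom_mult[of _ k k _ k] add: res.mat_hom_one)
    have "P * mres ?F = P * mres ?F * (Q * P)" unfolding P(4) using P F by simp
    also have "\<dots> = mres ?G * P" unfolding P(5) using P(1,2) F by (simp add: assoc_mult_mat[of _ k k _ k _ k])
    finally have e: "P * mres ?F = mres ?G * P" .
    have "mres R = mres G' * (P * mres ?F)" unfolding R_def using G' P' F by (simp add: res.mat_hom_mult[of _ k k _ k])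
    thus ?thesis unfolding e using mult_mat_cancel[OF 1] G' F P by simp
  qed
  define D where "D = (\<lambda>N :: nat \<Rightarrow> 'd mat. mat (n * k) (n * k) (\<lambda>(i, j). if i div k = j div k then N (i div k) $$ (i mod k, j mod k) else 0))"
  have Dc: "D N \<in> carrier_mat (n * k) (n * k)" for N by (simp add: D_def)
  have Di: "D N $$ (a * k + p, b * k + q) = (if a = b then N a $$ (p, q) else 0)"
    if "a < n" "b < n" "p < k" "q < k" for N a b p q
    using that block_index_less[of a n p k] block_index_less[of b n q k] by (auto simp: D_def)
  define S T where "S = D (\<lambda>_. P')" and "T = D (\<lambda>a. if a = 0 then R else P')"
  have eq: "mres S = mres T"
  proof (rule eq_matI)
    fix i j assume "i < dim_row (mres T)" "j < dim_col (mres T)"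
    hence ij: "i < n * k" "j < n * k" by (auto simp: T_def D_def)
    have m: "i mod k < k" "j mod k < k" using n by auto
    have "mres P' $$ (i mod k, j mod k) = res (P' $$ (i mod k, j mod k))"
      "mres R $$ (i mod k, j mod k) = res (R $$ (i mod k, j mod k))"
      using carrier_matD[OF P'(1)] carrier_matD[OF R] m by (auto intro!: index_map_mat)
    hence "res (P' $$ (i mod k, j mod k)) = res (R $$ (i mod k, j mod k))" unfolding P'(2) Rres by simp
    thus "mres S $$ (i, j) = mres T $$ (i, j)" using ij by (auto simp: S_def T_def D_def)
  qed (auto simp: S_def T_def D_def)
  have h: "mres S \<in> hom (cyc n k lab M) (cyc n k lab M')"
  proof (rule hom_cycI)
    show "S \<in> carrier_mat (n * k) (n * k)" "T \<in> carrier_mat (n * k) (n * k)" "mres T = mres S"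
      using Dc eq by (auto simp: S_def T_def)
    fix a b p q assume ab: "a < n" "b < n" "p < k" "q < k"
    have sb: "Suc a mod n < n" "Suc b mod n < n" using n by auto
    have 1: "(\<Sum>u<k. S $$ (a * k + p, b * k + u) * M b $$ (u, q)) = (if a = b then (P' * M b) $$ (p, q) else 0)"
      using ab P' dat(1) unfolding S_def cyc_data_def by (auto simp: Di scalar_prod_def lessThan_atLeast0)
    have 2: "(\<Sum>u<k. M' a $$ (p, u) * T $$ (Suc a mod n * k + u, Suc b mod n * k + q)) =
        (if a = b then (M' a * (if Suc a mod n = 0 then R else P')) $$ (p, q) else 0)"
      using ab sb P' R dat(2) unfolding T_def cyc_data_def by (auto simp: Di Suc_mod_inj scalar_prod_def lessThan_atLeast0)
    have "P' * M a = M' a * (if Suc a mod n = 0 then R else P')"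
    proof (cases "Suc a < n")
      case True thus ?thesis using one[OF True] P' by simp
    next
      case False
      hence "a = n - 1" using ab by simp
      thus ?thesis using GR n by simp
    qed
    thus "wt (lab b) * to_fract (\<Sum>u<k. S $$ (a * k + p, b * k + u) * M b $$ (u, q)) =
      wt (lab a) * to_fract (\<Sum>u<k. M' a $$ (p, u) * T $$ (Suc a mod n * k + u, Suc b mod n * k + q))"
      unfolding 1 2 by auto
  qed (use n in auto)
  have "invertible_mat (mres S)"
  proof (rule block_acyclic_invertible[of _ n k])
    show "mres S \<in> carrier_mat (n * k) (n * k)" using Dc by (simp add: S_def)
    have b: "blk k k (mres S) a b = (if a = b then P else 0\<^sub>m k k)" if "a < n" "b < n" for a b
    proof (rule eq_matI)
      fix p q assume "p < dim_row (if a = b then P else 0\<^sub>m k k)" "q < dim_col (if a = b then P else 0\<^sub>m k k)"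
      hence pq: "p < k" "q < k" using P by (auto split: if_splits)
      hence "blk k k (mres S) a b $$ (p, q) = res (D (\<lambda>_. P') $$ (a * k + p, b * k + q))"
        using block_index_less that Dc[of "\<lambda>_. P'"] by (auto simp: S_def)
      also have "\<dots> = (if a = b then P $$ (p, q) else 0)" using that pq Pres by (simp add: Di)
      finally show "blk k k (mres S) a b $$ (p, q) = (if a = b then P else 0\<^sub>m k k) $$ (p, q)" using pq by simp
    qed (use P in auto)
    show "invertible_mat (blk k k (mres S) a a)" if "a < n" for a
      using b[OF that that] P invertible_matI[of P k Q] by simp
    have e: "{(i, j). i < n \<and> j < n \<and> i \<noteq> j \<and> blk k k (mres S) i j \<noteq> 0\<^sub>m k k} = {}" using b by auto
    show "acyclic {(i, j). i < n \<and> j < n \<and> i \<noteq> j \<and> blk k k (mres S) i j \<noteq> 0\<^sub>m k k}"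
      unfolding e by (simp add: acyclic_def)
  qed
  thus ?thesis by (rule mat_equivI[OF h _ cyc_carrier cyc_carrier])
qed

text \<open>The cell \<open>b\<close> goes to the cell \<open>b + 1\<close>; the matrix \<open>F\<close> has to be carried past all cells but the
  last one, because the wrap-around sits at another letter of the word.\<close>

lemma cyc_equiv_rotate:
  assumes n: "0 < n" "0 < k" and F: "F \<in> carrier_mat k k" "invertible_mat (mres F)"
    and lab: "\<And>b. b < n \<Longrightarrow> lab' (Suc b mod n) = lab b"
  shows "mat_equiv res (cyc n k lab (\<lambda>a. if a = n - 1 then F else 1\<^sub>m k)) (cyc n k lab' (\<lambda>a. if a = n - 1 then F else 1\<^sub>m k))"
proof -
  let ?M = "\<lambda>a. if a = n - 1 then F else 1\<^sub>m k"
  define N where "N = (\<lambda>b. if b = n - 1 then 1\<^sub>m k else F)"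
  have N: "N b \<in> carrier_mat k k" for b using F by (simp add: N_def)
  define S where "S = mat (n * k) (n * k) (\<lambda>(i, j). if i div k = Suc (j div k) mod n then N (j div k) $$ (i mod k, j mod k) else 0)"
  have Sc: "S \<in> carrier_mat (n * k) (n * k)" by (simp add: S_def)
  have Si: "S $$ (a * k + p, b * k + q) = (if a = Suc b mod n then N b $$ (p, q) else 0)"
    if "a < n" "b < n" "p < k" "q < k" for a b p q
    using that block_index_less[of a n p k] block_index_less[of b n q k] by (auto simp: S_def)
  have h: "mres S \<in> hom (cyc n k lab ?M) (cyc n k lab' ?M)"
  proof (rule hom_cycI[OF Sc Sc refl])
    fix a b p q assume ab: "a < n" "b < n" "p < k" "q < k"
    have sb: "Suc a mod n < n" "Suc b mod n < n" using n by auto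
    have 1: "(\<Sum>u<k. S $$ (a * k + p, b * k + u) * ?M b $$ (u, q)) = (if a = Suc b mod n then (N b * ?M b) $$ (p, q) else 0)"
      using ab N[of b] F by (auto simp: Si scalar_prod_def lessThan_atLeast0)
    have 2: "(\<Sum>u<k. ?M a $$ (p, u) * S $$ (Suc a mod n * k + u, Suc b mod n * k + q)) =
        (if a = Suc b mod n then (?M a * N (Suc b mod n)) $$ (p, q) else 0)"
      using ab sb N[of "Suc b mod n"] F by (auto simp: Si Suc_mod_inj scalar_prod_def lessThan_atLeast0)
    have "N b * ?M b = ?M (Suc b mod n) * N (Suc b mod n)"
    proof (cases "b = n - 1")
      case True thus ?thesis using n F by (auto simp: N_def)
    next
      case False
      hence "Suc b mod n = Suc b" using ab by simp
      thus ?thesis using False F by (simp add: N_def)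
    qed
    thus "wt (lab b) * to_fract (\<Sum>u<k. S $$ (a * k + p, b * k + u) * ?M b $$ (u, q)) =
      wt (lab' a) * to_fract (\<Sum>u<k. ?M a $$ (p, u) * S $$ (Suc a mod n * k + u, Suc b mod n * k + q))"
      unfolding 1 2 using lab[OF ab(2)] by auto
  qed (use n in auto)
  have "invertible_mat (mres S)" unfolding invertible_mat_iff_inj[OF map_carrier_mat[THEN iffD2, OF Sc]]
  proof (intro ballI impI)
    fix v assume v: "v \<in> carrier_vec (n * k)" "mres S *\<^sub>v v = 0\<^sub>v (n * k)"
    have "vec k (\<lambda>q. v $ (b * k + q)) = 0\<^sub>v k" (is "?v = _") if b: "b < n" for b
    proof -
      have "mres (N b) *\<^sub>v ?v = 0\<^sub>v k"
      proof (rule eq_vecI)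
        fix p assume "p < dim_vec (0\<^sub>v k :: 'r vec)"
        hence p: "p < k" by simp
        have i: "Suc b mod n < n" using n by simp
        have ip: "Suc b mod n * k + p < n * k" using block_index_less[OF i p] .
        have "0 = (mres S *\<^sub>v v) $ (Suc b mod n * k + p)" unfolding v(2) using ip by simp
        also have "\<dots> = (\<Sum>r<n * k. res (S $$ (Suc b mod n * k + p, r)) * v $ r)"
          using Sc v(1) ip by (auto simp: scalar_prod_def lessThan_atLeast0 intro!: sum.cong)
        also have "\<dots> = (\<Sum>c<n. \<Sum>q<k. res (S $$ (Suc b mod n * k + p, c * k + q)) * v $ (c * k + q))" by (rule sum_div_mod)
        also have "\<dots> = (\<Sum>c<n. if c = b then \<Sum>q<k. res (N b $$ (p, q)) * v $ (b * k + q) else 0)"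
          using b p i by (intro sum.cong refl) (auto simp: Si Suc_mod_inj)
        also have "\<dots> = (mres (N b) *\<^sub>v ?v) $ p"
          using b p N[of b] by (auto simp: scalar_prod_def lessThan_atLeast0 intro!: sum.cong)
        finally show "(mres (N b) *\<^sub>v ?v) $ p = 0\<^sub>v k $ p" using p by simp
      qed (use N[of b] in simp)
      moreover have "invertible_mat (mres (N b))"
        using F invertible_matI[of "1\<^sub>m k :: 'r mat" k "1\<^sub>m k"] by (simp add: N_def res.mat_hom_one)
      moreover have "mres (N b) \<in> carrier_mat k k" using N[of b] by simp
      ultimately show ?thesis using invertible_mat_iff_inj[of "mres (N b)" k] vec_carrier by blast
    qed
    note * = this
    show "v = 0\<^sub>v (n * k)"
    proof (rule eq_vecI)
      fix r assume "r < dim_vec (0\<^sub>v (n * k) :: 'r vec)"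
      hence r: "r < n * k" by simp
      have "r div k < n" "r mod k < k" using r n by (simp_all add: less_mult_imp_div_less)
      hence "vec k (\<lambda>q. v $ (r div k * k + q)) $ (r mod k) = 0" using * by simp
      thus "v $ r = 0\<^sub>v (n * k) $ r" using r \<open>r mod k < k\<close> by simp
    qed (use v in simp)
  qed
  thus ?thesis by (rule mat_equivI[OF h _ cyc_carrier cyc_carrier])
qed

section \<open>The blocks of the statement as cyclic block matrices\<close>

definition S_lab :: "int list \<Rightarrow> nat \<Rightarrow> int extended" where
  "S_lab \<mu> a = (if a < length \<mu> then Fin (\<mu> ! a) else Pinf)"

definition B_mat :: "nat \<Rightarrow> nat \<Rightarrow> 'd mat \<Rightarrow> nat \<Rightarrow> 'd mat" where
  "B_mat n k F a = (if a = n - 1 then F else 1\<^sub>m k)"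

lemma S_block_cyc: "S_block t \<mu> = cyc (Suc (length \<mu>)) 1 (S_lab \<mu>) (\<lambda>_. 1\<^sub>m 1)"
  by (rule eq_matI) (auto simp: S_block_def cyc_def S_lab_def)

lemma B_block_cyc:
  assumes "\<nu> \<noteq> []" "F \<in> carrier_mat k k"
  shows "B_block t \<nu> F = cyc (length \<nu>) k (\<lambda>a. Fin (\<nu> ! a)) (B_mat (length \<nu>) k F)"
proof (rule eq_matI)
  let ?n = "length \<nu>"
  fix i j assume "i < dim_row (cyc ?n k (\<lambda>a. Fin (\<nu> ! a)) (B_mat ?n k F))" "j < dim_col (cyc ?n k (\<lambda>a. Fin (\<nu> ! a)) (B_mat ?n k F))"
  hence ij: "i < ?n * k" "j < ?n * k" by (auto simp: cyc_def)
  hence k: "k > 0" by (cases k) auto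
  have d: "i div k < ?n" "j div k < ?n" "i mod k < k" "j mod k < k" using ij k by (auto simp: less_mult_imp_div_less)
  show "B_block t \<nu> F $$ (i, j) = cyc ?n k (\<lambda>a. Fin (\<nu> ! a)) (B_mat ?n k F) $$ (i, j)"
  proof (cases "i div k = ?n - 1")
    case True
    hence "Suc (i div k) mod ?n = 0" using assms(1) by simp
    moreover have "j div k \<noteq> i div k + 1" using True d by simp
    ultimately show ?thesis using ij d assms True by (auto simp: B_block_def cyc_def Let_def B_mat_def)
  next
    case False
    hence "Suc (i div k) mod ?n = i div k + 1" using d by simp
    thus ?thesis using ij d assms False by (auto simp: B_block_def cyc_def Let_def B_mat_def)
  qed
qed (use assms in \<open>auto simp: B_block_def cyc_def Let_def\<close>)

lemma S_cyc_data: "cyc_data (Suc (length \<mu>)) 1 (S_lab \<mu>) (\<lambda>_. 1\<^sub>m 1)"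
  using invertible_matI[of "1\<^sub>m 1 :: 'r mat" 1 "1\<^sub>m 1"] by (auto simp: cyc_data_def S_lab_def res.mat_hom_one)

lemma B_cyc_data:
  assumes "\<nu> \<noteq> []" "0 < k" "F \<in> carrier_mat k k" "invertible_mat (mres F)"
  shows "cyc_data (length \<nu>) k (\<lambda>a. Fin (\<nu> ! a)) (B_mat (length \<nu>) k F)"
  using assms invertible_matI[of "1\<^sub>m k :: 'r mat" k "1\<^sub>m k"] by (auto simp: cyc_data_def B_mat_def res.mat_hom_one)

text \<open>Any difference reached from the later cell through finite labels suffices: the least
  difference comes no later, and before it both words agree. Symmetry in \<open>i\<close> and
  \<open>j\<close> does the rest.\<close>

lemma separatedI:
  assumes "\<And>i j. i < j \<Longrightarrow> j < n \<Longrightarrow> \<exists>s. lab ((i + s) mod n) \<noteq> lab ((j + s) mod n) \<and>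
    (\<forall>r < s. (\<exists>l. lab ((j + r) mod n) = Fin l))"
  shows "separated n lab"
  unfolding separated_def
proof (intro allI impI)
  have *: "\<exists>s. lab ((i + s) mod n) \<noteq> lab ((j + s) mod n) \<and>
    (\<forall>r < s. lab ((i + r) mod n) = lab ((j + r) mod n) \<and> (\<exists>l. lab ((j + r) mod n) = Fin l))"
    if ij: "i < j" "j < n" for i j
  proof -
    obtain s where s: "lab ((i + s) mod n) \<noteq> lab ((j + s) mod n)" "\<forall>r < s. (\<exists>l. lab ((j + r) mod n) = Fin l)"
      using assms[OF ij] by blast
    define s0 where "s0 = (LEAST s. lab ((i + s) mod n) \<noteq> lab ((j + s) mod n))"
    have 1: "lab ((i + s0) mod n) \<noteq> lab ((j + s0) mod n)"
      unfolding s0_def by (rule LeastI[of "\<lambda>s. lab ((i + s) mod n) \<noteq> lab ((j + s) mod n)", OF s(1)])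
    have 2: "s0 \<le> s"
      unfolding s0_def by (rule Least_le[of "\<lambda>s. lab ((i + s) mod n) \<noteq> lab ((j + s) mod n)", OF s(1)])
    have 3: "lab ((i + r) mod n) = lab ((j + r) mod n)" if "r < s0" for r
      using not_less_Least[OF that[unfolded s0_def]] by blast
    show ?thesis using 1 2 3 s(2) by (intro exI[of _ s0]) auto
  qed
  fix i j assume ij: "i < n" "j < n" "i \<noteq> j"
  show "\<exists>s. lab ((i + s) mod n) \<noteq> lab ((j + s) mod n) \<and>
     (\<forall>r < s. lab ((i + r) mod n) = lab ((j + r) mod n) \<and> (\<exists>l. lab ((i + r) mod n) = Fin l))"
  proof (cases "i < j")
    case True
    then obtain s where "lab ((i + s) mod n) \<noteq> lab ((j + s) mod n)"
      "\<forall>r < s. lab ((i + r) mod n) = lab ((j + r) mod n) \<and> (\<exists>l. lab ((j + r) mod n) = Fin l)" using *[of i j] ij by blast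
    thus ?thesis by (intro exI[of _ s]) auto
  next
    case False
    then obtain s where "lab ((j + s) mod n) \<noteq> lab ((i + s) mod n)"
      "\<forall>r < s. lab ((j + r) mod n) = lab ((i + r) mod n) \<and> (\<exists>l. lab ((i + r) mod n) = Fin l)" using *[of j i] ij by auto
    thus ?thesis by (intro exI[of _ s]) auto
  qed
qed

text \<open>The cell nearer to the end reaches the unique infinite label first.\<close>

lemma S_separated: "separated (Suc (length \<mu>)) (S_lab \<mu>)"
proof (rule separatedI)
  fix i j assume ij: "i < j" "j < Suc (length \<mu>)"
  let ?s = "length \<mu> - j"
  show "\<exists>s. S_lab \<mu> ((i + s) mod Suc (length \<mu>)) \<noteq> S_lab \<mu> ((j + s) mod Suc (length \<mu>)) \<and>
    (\<forall>r < s. (\<exists>l. S_lab \<mu> ((j + r) mod Suc (length \<mu>)) = Fin l))"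
    using ij by (intro exI[of _ ?s]) (auto simp: S_lab_def)
qed

lemma nonperiodic_shift:
  assumes "nonperiodic \<nu>" "0 < d" "d < length \<nu>"
  shows "\<exists>x < length \<nu>. \<nu> ! x \<noteq> \<nu> ! ((x + d) mod length \<nu>)"
proof (rule ccontr)
  assume "\<not> ?thesis"
  hence "rotate d \<nu> = \<nu>" by (intro nth_equalityI) (auto simp: nth_rotate add.commute)
  thus False using assms unfolding nonperiodic_def by blast
qed

lemma B_separated:
  assumes "nonperiodic \<nu>" shows "separated (length \<nu>) (\<lambda>a. Fin (\<nu> ! a))"
proof (rule separatedI)
  let ?n = "length \<nu>"
  fix i j assume ij: "i < j" "j < ?n"
  have "0 < j - i" "j - i < ?n" using ij by auto
  then obtain x where x: "x < ?n" "\<nu> ! x \<noteq> \<nu> ! ((x + (j - i)) mod ?n)" using nonperiodic_shift[OF assms] by blast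
  \<comment> \<open>From cell \<open>i\<close> it takes \<open>n - i\<close> steps to reach cell 0
    and \<open>x\<close> more to reach the place where the two rotations differ.\<close>
  let ?s = "?n - i + x"
  have 1: "(i + ?s) mod ?n = x" using ij x by simp
  have "(j + ?s) mod ?n = (x + (j - i) + ?n) mod ?n" using ij by (intro arg_cong[of _ _ "\<lambda>y. y mod ?n"]) simp
  hence 2: "(j + ?s) mod ?n = (x + (j - i)) mod ?n" by simp
  show "\<exists>s. Fin (\<nu> ! ((i + s) mod ?n)) \<noteq> Fin (\<nu> ! ((j + s) mod ?n)) \<and> (\<forall>r < s. \<exists>l. Fin (\<nu> ! ((j + r) mod ?n)) = Fin l)"
    using x(2) 1 2 by (intro exI[of _ ?s]) simp
qed

text \<open>The cells have size 1, so \<open>h\<close> is a scalar, and \<open>h\<close> or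
  \<open>1 - h\<close> is nonzero.\<close>

lemma S_block_local: "local_mat (S_block t \<mu>)"
  unfolding S_block_cyc
proof (rule cyc_local[OF S_cyc_data S_separated])
  fix a assume "Suc a < Suc (length \<mu>)"
  thus "(\<exists>l. S_lab \<mu> a = Fin l) \<and> 1\<^sub>m 1 = 1\<^sub>m 1" by (simp add: S_lab_def)
next
  fix h :: "'r mat" assume h: "h \<in> carrier_mat 1 1"
  have "invertible_mat g" if g: "g \<in> carrier_mat 1 1" "g $$ (0, 0) \<noteq> 0" for g :: "'r mat"
    unfolding invertible_mat_iff_inj[OF g(1)]
  proof (intro ballI impI)
    fix v assume v: "v \<in> carrier_vec 1" "g *\<^sub>v v = 0\<^sub>v 1"
    have "(g *\<^sub>v v) $ 0 = g $$ (0, 0) * v $ 0" using g v(1) by (simp add: scalar_prod_def)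
    hence "v $ 0 = 0" unfolding v(2) using g by simp
    thus "v = 0\<^sub>v 1" using v by (intro eq_vecI) auto
  qed
  from this[of h] this[of "1\<^sub>m 1 - h"] show "invertible_mat h \<or> invertible_mat (1\<^sub>m 1 - h)"
    using h minus_carrier_mat[OF h, of "1\<^sub>m 1"] by (cases "h $$ (0, 0) = 0") auto
qed

lemma B_data_facts:
  assumes "B_data (\<nu>, m, \<pi>)" "frobenius_lift res m \<pi> F"
  shows "\<nu> \<noteq> []" "nonperiodic \<nu>" "1 \<le> m" "irreducible \<pi>" "lead_coeff \<pi> = 1" "\<pi> \<noteq> [:0, 1:]"
    "F \<in> carrier_mat (m * degree \<pi>) (m * degree \<pi>)" "mres F = frobenius_block (\<pi> ^ m)"
    "invertible_mat (mres F)" "0 < m * degree \<pi>"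
    "cyc_data (length \<nu>) (m * degree \<pi>) (\<lambda>a. Fin (\<nu> ! a)) (B_mat (length \<nu>) (m * degree \<pi>) F)"
    "B_block t \<nu> F = cyc (length \<nu>) (m * degree \<pi>) (\<lambda>a. Fin (\<nu> ! a)) (B_mat (length \<nu>) (m * degree \<pi>) F)"
proof -
  show 1: "\<nu> \<noteq> []" "nonperiodic \<nu>" "1 \<le> m" "irreducible \<pi>" "lead_coeff \<pi> = 1" "\<pi> \<noteq> [:0, 1:]"
    "F \<in> carrier_mat (m * degree \<pi>) (m * degree \<pi>)" "mres F = frobenius_block (\<pi> ^ m)"
    using assms by (auto simp: B_data_def frobenius_lift_def)
  note d = degree_irreducible_power[OF 1(4,5,3)]
  show 2: "invertible_mat (mres F)" unfolding 1(8)
    by (rule frobenius_block_invertible[OF d(3,2) coeff_0_irreducible_power[OF 1(4,5,3,6)]])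
  show 3: "0 < m * degree \<pi>" using d by simp
  show "cyc_data (length \<nu>) (m * degree \<pi>) (\<lambda>a. Fin (\<nu> ! a)) (B_mat (length \<nu>) (m * degree \<pi>) F)"
    by (rule B_cyc_data[OF 1(1) 3 1(7) 2])
  show "B_block t \<nu> F = cyc (length \<nu>) (m * degree \<pi>) (\<lambda>a. Fin (\<nu> ! a)) (B_mat (length \<nu>) (m * degree \<pi>) F)"
    by (rule B_block_cyc[OF 1(1) 1(7)])
qed

lemma B_block_local:
  assumes "B_data (\<nu>, m, \<pi>)" "frobenius_lift res m \<pi> F"
  shows "local_mat (B_block t \<nu> F)"
proof -
  note b = B_data_facts[OF assms]
  show ?thesis unfolding b(12)
  proof (rule cyc_local[OF b(11) B_separated[OF b(2)]])
    fix a assume "Suc a < length \<nu>"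
    thus "(\<exists>l. Fin (\<nu> ! a) = Fin l) \<and> B_mat (length \<nu>) (m * degree \<pi>) F a = 1\<^sub>m (m * degree \<pi>)"
      by (auto simp: B_mat_def)
  next
    fix h assume h: "h \<in> carrier_mat (m * degree \<pi>) (m * degree \<pi>)"
      "\<And>l. Fin (\<nu> ! (length \<nu> - 1)) = Fin l \<Longrightarrow> h * mres (B_mat (length \<nu>) (m * degree \<pi>) F (length \<nu> - 1)) =
        mres (B_mat (length \<nu>) (m * degree \<pi>) F (length \<nu> - 1)) * h"
    show "invertible_mat h \<or> invertible_mat (1\<^sub>m (m * degree \<pi>) - h)"
      by (rule frobenius_block_commuting_local[OF b(4,5,3) h(1)]) (use h(2) b(8) in \<open>simp add: B_mat_def\<close>)
  qed
qed

lemma B_block_similar: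
  assumes "B_data (\<nu>, m, \<pi>)" "frobenius_lift res m \<pi> F" "similar_mat (mres G) (mres F)"
  shows "mat_equiv res (B_block t \<nu> F) (B_block t \<nu> G)"
proof -
  let ?k = "m * degree \<pi>"
  note b = B_data_facts[OF assms(1,2)]
  obtain P Q where w: "similar_mat_wit (mres G) (mres F) P Q" using assms(3) unfolding similar_mat_def by blast
  define n where "n = dim_row (mres G)"
  have c: "mres G \<in> carrier_mat n n" "mres F \<in> carrier_mat n n" "P \<in> carrier_mat n n" "Q \<in> carrier_mat n n"
    "P * Q = 1\<^sub>m n" "Q * P = 1\<^sub>m n" "mres G = P * mres F * Q"
    using w unfolding similar_mat_wit_def n_def[symmetric] by (auto simp: Let_def)
  have n: "n = ?k" using c(2) b(7) by auto
  have G: "G \<in> carrier_mat ?k ?k" using c(1) unfolding n by simp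
  have "invertible_mat P" "invertible_mat Q" using c invertible_matI by metis+
  hence "invertible_mat (mres G)" unfolding c(7) using c b(9) by (intro invertible_mat_mult[of _ n]) auto
  note dat = B_cyc_data[OF b(1,10) G this]
  show ?thesis unfolding b(12) B_block_cyc[OF b(1) G]
    by (rule cyc_equiv_similar[OF b(11) dat]) (use assms(3) in \<open>auto simp: B_mat_def\<close>)
qed

lemma B_block_rotate_right:
  assumes "B_data (\<nu>, m, \<pi>)" "frobenius_lift res m \<pi> F"
  shows "mat_equiv res (B_block t (rotate_right \<nu>) F) (B_block t \<nu> F)"
proof -
  note b = B_data_facts[OF assms]
  have len: "length (rotate_right \<nu>) = length \<nu>" using b(1) by (simp add: rotate_right_def)
  hence ne: "rotate_right \<nu> \<noteq> []" using b(1) by auto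
  have nth: "rotate_right \<nu> ! (Suc x mod length \<nu>) = \<nu> ! x" if "x < length \<nu>" for x
  proof -
    have "rotate1 (rotate_right \<nu>) ! x = rotate_right \<nu> ! (Suc x mod length \<nu>)"
      using nth_rotate1[of x "rotate_right \<nu>"] that len by simp
    thus ?thesis by (simp add: rotate1_rotate_right)
  qed
  have e: "B_mat n k F = (\<lambda>a. if a = n - 1 then F else 1\<^sub>m k)" for n k by (simp add: B_mat_def fun_eq_iff)
  have "mat_equiv res (B_block t \<nu> F) (B_block t (rotate_right \<nu>) F)"
    unfolding b(12) B_block_cyc[OF ne b(7)] len e
    by (rule cyc_equiv_rotate) (use b nth in auto)
  thus ?thesis by (rule mat_equiv_sym)
qed

lemma B_data_rotate1: "B_data (\<nu>, m, \<pi>) \<Longrightarrow> B_data (rotate1 \<nu>, m, \<pi>)"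
proof -
  assume b: "B_data (\<nu>, m, \<pi>)"
  have "nonperiodic (rotate1 \<nu>)" unfolding nonperiodic_def
  proof (intro allI impI notI)
    fix l assume l: "0 < l" "l < length (rotate1 \<nu>)" "rotate l (rotate1 \<nu>) = rotate1 \<nu>"
    hence "rotate1 (rotate l \<nu>) = rotate1 \<nu>" by (simp add: rotate1_rotate_swap)
    hence "rotate l \<nu> = \<nu>" by (metis rotate_right_rotate1)
    thus False using b l unfolding B_data_def nonperiodic_def by auto
  qed
  thus ?thesis using b by (auto simp: B_data_def)
qed

lemma B_block_rotate:
  assumes "B_data (\<nu>, m, \<pi>)" "frobenius_lift res m \<pi> F"
  shows "B_data (rotate l \<nu>, m, \<pi>) \<and> mat_equiv res (B_block t \<nu> F) (B_block t (rotate l \<nu>) F)"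
proof (induction l)
  case 0 show ?case using assms local_mat_carrier[OF B_block_local[OF assms]] by (auto intro: mat_equiv_refl)
next
  case (Suc l)
  hence d: "B_data (rotate (Suc l) \<nu>, m, \<pi>)" by (auto intro: B_data_rotate1)
  have "mat_equiv res (B_block t (rotate l \<nu>) F) (B_block t (rotate (Suc l) \<nu>) F)"
    using B_block_rotate_right[OF d assms(2)] by (simp add: rotate_right_rotate1)
  thus ?case using d Suc mat_equiv_trans by blast
qed

text \<open>The words agree up to the infinite label of the first block. This label is met after
  exactly \<open>length \<mu>\<close> steps and occurs only once in the second block, so the
  comparison starts at cell 0.\<close>

lemma S_block_equiv_iff: "mat_equiv res (S_block t \<mu>) (S_block t \<mu>') \<longleftrightarrow> \<mu> = \<mu>'"
proof
  assume "mat_equiv res (S_block t \<mu>) (S_block t \<mu>')"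
  then obtain b where b: "b < Suc (length \<mu>')"
    "\<And>s. (\<And>r. r < s \<Longrightarrow> \<exists>l. S_lab \<mu> (r mod Suc (length \<mu>)) = Fin l) \<Longrightarrow>
      S_lab \<mu>' ((b + s) mod Suc (length \<mu>')) = S_lab \<mu> (s mod Suc (length \<mu>))"
    "Suc (length \<mu>) * 1 = Suc (length \<mu>') * 1" unfolding S_block_cyc using cyc_iso_word[OF _ S_cyc_data S_cyc_data] by metis
  have len: "length \<mu> = length \<mu>'" using b(3) by simp
  have e: "S_lab \<mu>' ((b + s) mod Suc (length \<mu>)) = S_lab \<mu> s" if "s \<le> length \<mu>" for s
    using b(2)[of s] that len by (auto simp: S_lab_def)
  have "S_lab \<mu>' ((b + length \<mu>) mod Suc (length \<mu>)) = Pinf" using e[of "length \<mu>"] by (simp add: S_lab_def)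
  hence "\<not> (b + length \<mu>) mod Suc (length \<mu>) < length \<mu>" using len by (auto simp: S_lab_def)
  hence "(b + length \<mu>) mod Suc (length \<mu>) = length \<mu>" using mod_less_divisor[of "Suc (length \<mu>)" "b + length \<mu>"] by linarith
  hence "b = 0" using b(1) len by (cases b) (auto simp: mod_if)
  hence "S_lab \<mu>' s = S_lab \<mu> s" if "s < length \<mu>" for s using e[of s] that by simp
  thus "\<mu> = \<mu>'" using len by (intro nth_equalityI) (auto simp: S_lab_def split: if_splits)
next
  assume "\<mu> = \<mu>'" thus "mat_equiv res (S_block t \<mu>) (S_block t \<mu>')"
    using local_mat_carrier[OF S_block_local] by (auto intro: mat_equiv_refl)
qed

text \<open>All labels of a band are finite, so the comparison of words never stops, whereas the
  word of the string contains an infinite label.\<close>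

lemma B_block_not_S_block:
  assumes "B_data (\<nu>, m, \<pi>)" "frobenius_lift res m \<pi> F"
  shows "\<not> mat_equiv res (B_block t \<nu> F) (S_block t \<mu>)"
proof
  note b = B_data_facts[OF assms]
  assume "mat_equiv res (B_block t \<nu> F) (S_block t \<mu>)"
  then obtain i where i: "i < Suc (length \<mu>)"
    "\<And>s. S_lab \<mu> ((i + s) mod Suc (length \<mu>)) = Fin (\<nu> ! (s mod length \<nu>))"
    unfolding S_block_cyc b(12) using cyc_iso_word[OF _ b(11) S_cyc_data] by metis
  have "S_lab \<mu> ((i + (length \<mu> - i)) mod Suc (length \<mu>)) = Pinf" using i(1) by (simp add: S_lab_def)
  thus False using i(2) by simp
qed

text \<open>Equality of the infinite words first gives equal lengths and a rotation; after rotating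
  to a common word the monodromies are conjugate Frobenius blocks, which determine \<pi>^m.\<close>

lemma B_block_equivD:
  assumes b: "B_data (\<nu>, m, \<pi>)" "frobenius_lift res m \<pi> F"
    and b': "B_data (\<nu>', m', \<pi>')" "frobenius_lift res m' \<pi>' F'"
    and eqv: "mat_equiv res (B_block t \<nu> F) (B_block t \<nu>' F')"
  shows "(\<pi>, m) = (\<pi>', m') \<and> (\<exists>l. \<nu> = rotate l \<nu>')"
proof -
  note f = B_data_facts[OF b] and f' = B_data_facts[OF b']
  let ?n = "length \<nu>" and ?n' = "length \<nu>'" and ?k = "m * degree \<pi>" and ?k' = "m' * degree \<pi>'"
  obtain i where i: "i < ?n'" "\<And>s. Fin (\<nu>' ! ((i + s) mod ?n')) = Fin (\<nu> ! (s mod ?n))" "?n * ?k = ?n' * ?k'"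
    using cyc_iso_word[OF eqv[unfolded f(12) f'(12)] f(11) f'(11)] by metis
  have w: "\<nu>' ! ((i + s) mod ?n') = \<nu> ! (s mod ?n)" for s using i(2)[of s] by simp
  have n0: "0 < ?n" "0 < ?n'" using f(1) f'(1) by auto
  \<comment> \<open>Both lengths are periods of the common infinite word. A shorter period would be
    a proper rotation fixing the longer sequence, against \<open>nonperiodic\<close>.\<close>
  have 1: "\<not> ?n < ?n'"
  proof
    assume lt: "?n < ?n'"
    obtain x where x: "x < ?n'" "\<nu>' ! x \<noteq> \<nu>' ! ((x + ?n) mod ?n')" using nonperiodic_shift[OF f'(2) n0(1) lt] by blast
    let ?s = "?n' - i + x"
    have "(i + ?s) mod ?n' = x" using i(1) x by simp
    moreover have "(i + (?s + ?n)) mod ?n' = (x + ?n) mod ?n'"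
    proof -
      have e: "i + (?s + ?n) = x + ?n + ?n'" using i(1) by simp
      show ?thesis unfolding e by simp
    qed
    moreover have "\<nu> ! ((?s + ?n) mod ?n) = \<nu> ! (?s mod ?n)" by simp
    ultimately show False using x(2) w[of ?s] w[of "?s + ?n"] by simp
  qed
  have 2: "\<not> ?n' < ?n"
  proof
    assume lt: "?n' < ?n"
    obtain x where x: "x < ?n" "\<nu> ! x \<noteq> \<nu> ! ((x + ?n') mod ?n)" using nonperiodic_shift[OF f(2) n0(2) lt] by blast
    have "(i + (x + ?n')) mod ?n' = (i + x) mod ?n'" by (simp flip: add.assoc)
    thus False using x w[of x] w[of "x + ?n'"] by simp
  qed
  have n: "?n = ?n'" using 1 2 by simp
  have rot: "\<nu> = rotate i \<nu>'"
    using n w by (intro nth_equalityI) (auto simp: nth_rotate)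
  have k: "?k = ?k'" using i(3) n n0 by simp
  have "mat_equiv res (B_block t \<nu>' F') (B_block t \<nu> F')" using B_block_rotate[OF b', of i] rot by simp
  hence eq: "mat_equiv res (B_block t \<nu> F) (B_block t \<nu> F')" using eqv mat_equiv_trans by blast
  have F'c: "F' \<in> carrier_mat ?k ?k" using f'(7) k by simp
  have dat': "cyc_data ?n ?k (\<lambda>a. Fin (\<nu> ! a)) (B_mat ?n ?k F')" by (rule B_cyc_data[OF f(1,10) F'c f'(9)])
  obtain g h where g: "g \<in> carrier_mat ?k ?k" "h \<in> carrier_mat ?k ?k" "h * g = 1\<^sub>m ?k"
    "g * mres (B_mat ?n ?k F (?n - 1)) = mres (B_mat ?n ?k F' (?n - 1)) * g"
    by (rule cyc_iso_monodromy[OF eq[unfolded f(12) B_block_cyc[OF f(1) F'c]] f(11) dat' B_separated[OF f(2)]])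
       (auto simp: B_mat_def)
  have gF: "g * frobenius_block (\<pi> ^ m) = frobenius_block (\<pi>' ^ m') * g" using g(4) f(8) f'(8) by (simp add: B_mat_def)
  note d = degree_irreducible_power[OF f(4,5,3)] and d' = degree_irreducible_power[OF f'(4,5,3)]
  have "\<pi> ^ m = \<pi>' ^ m'"
  proof (rule frobenius_block_intertwined_eq[OF d(3,2) d'(3) _ _ gF])
    show "g * h = 1\<^sub>m (degree (\<pi> ^ m))" unfolding d(1) by (rule mat_mult_left_right_inverse[OF g(2,1,3)])
  qed (use d d' k g in auto)
  thus ?thesis using irreducible_power_eq[OF f(4,5) f'(4,5) f(3)] rot by blast
qed

end

text \<open>A right rotation is a left rotation by one less than the length, so integer iterates
  give nothing beyond \<open>rotate\<close>.\<close>

lemma rotation_eq_rotate: "\<exists>l'. rotation l \<nu> = rotate l' \<nu>" "\<exists>l. rotate l' \<nu> = rotation l \<nu>"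
proof -
  have r: "rotate_right \<nu> = rotate (length \<nu> - 1) \<nu>" for \<nu> :: "'a list"
  proof (cases "\<nu> = []")
    case False
    have "rotate1 (rotate (length \<nu> - 1) \<nu>) = rotate (Suc (length \<nu> - 1)) \<nu>" by simp
    also have "\<dots> = \<nu>" using False by (metis One_nat_def Suc_pred length_greater_0_conv rotate_id mod_self)
    finally show ?thesis by (metis rotate_right_rotate1)
  qed (simp add: rotate_right_def)
  have "\<exists>l'. (rotate_right ^^ i) \<nu> = rotate l' \<nu>" for i
  proof (induction i)
    case 0 show ?case by (intro exI[of _ 0]) simp
  next
    case (Suc i)
    then obtain l' where "(rotate_right ^^ i) \<nu> = rotate l' \<nu>" by blast
    thus ?case using r[of "rotate l' \<nu>"] by (auto simp: rotate_rotate)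
  qed
  thus "\<exists>l'. rotation l \<nu> = rotate l' \<nu>" unfolding rotation_def by (auto simp: rotate_def)
  show "\<exists>l. rotate l' \<nu> = rotation l \<nu>"
    by (rule exI[of _ "- int l'"]) (auto simp: rotation_def rotate_def)
qed

section \<open>Linear algebra in subspaces\<close>

text \<open>A separate locale, because definitions made in \<open>vector_space\<close> itself would also be
  interpreted, without qualifier, for real vector spaces.\<close>

locale vspace = vector_space scale for scale :: "'a::field \<Rightarrow> 'b::ab_group_add \<Rightarrow> 'b" (infixr \<open>*s\<close> 75)
begin

text \<open>Finiteness is required of subspaces only, because the ambient space in the application,
  all functions on the natural numbers, has infinite dimension.\<close>

definition finite_subspace :: "'b set \<Rightarrow> bool" where
  "finite_subspace U \<longleftrightarrow> subspace U \<and> (\<exists>B. finite B \<and> U \<subseteq> span B)"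

text \<open>Bases are lists because their members later become the columns of a matrix, grouped
  according to the blocks.\<close>

definition list_basis :: "'b list \<Rightarrow> 'b set \<Rightarrow> bool" where
  "list_basis vs U \<longleftrightarrow> distinct vs \<and> independent (set vs) \<and> span (set vs) = U"

lemma finite_subspaceD: "finite_subspace U \<Longrightarrow> subspace U"
  by (simp add: finite_subspace_def)

lemma fin_dim_subset: "finite_subspace U \<Longrightarrow> subspace U' \<Longrightarrow> U' \<subseteq> U \<Longrightarrow> finite_subspace U'"
  unfolding finite_subspace_def by blast

lemma fin_dim_basis:
  assumes "finite_subspace U"
  obtains B where "finite B" "independent B" "span B = U" "card B = dim U"
proof -
  obtain B where B: "B \<subseteq> U" "independent B" "U \<subseteq> span B" "card B = dim U" using basis_exists .
  obtain C where C: "finite C" "U \<subseteq> span C" using assms unfolding finite_subspace_def by blast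
  have "finite B" using independent_span_bound[OF C(1) B(2)] B(1) C(2) by auto
  moreover have "span B = U" using B(1,3) assms span_minimal unfolding finite_subspace_def by blast
  ultimately show ?thesis using that B by blast
qed

lemma dim_less:
  assumes U: "finite_subspace U" and U': "subspace U'" "U' \<subset> U"
  shows "dim U' < dim U"
proof -
  obtain B' where B': "finite B'" "independent B'" "span B' = U'" "card B' = dim U'"
    using fin_dim_basis fin_dim_subset[OF U U'(1)] U'(2) by blast
  have "B' \<subseteq> U" using B'(3) U'(2) span_superset by blast
  then obtain B where B: "B' \<subseteq> B" "B \<subseteq> U" "independent B" "U \<subseteq> span B" using maximal_independent_subset_extend B'(2) by blast
  have sp: "span B = U" using B span_minimal finite_subspaceD[OF U] by blast
  obtain C where C: "finite C" "U \<subseteq> span C" using U unfolding finite_subspace_def by blast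
  have fin: "finite B" using independent_span_bound[OF C(1) B(3)] B(2) C(2) by auto
  have "B' \<noteq> B" using sp B'(3) U'(2) by auto
  hence "card B' < card B" using B(1) fin by (intro psubset_card_mono) auto
  thus ?thesis using dim_eq_card_independent[OF B(3)] sp B'(4) by (metis dim_span)
qed

lemma fin_dim_independent_span:
  assumes U: "finite_subspace U" and B: "B \<subseteq> U" "independent B" "dim U \<le> card B"
  shows "finite B" "span B = U"
proof -
  obtain C where C: "finite C" "independent C" "span C = U" "card C = dim U" using fin_dim_basis[OF U] .
  show f: "finite B" using independent_span_bound[OF C(1) B(2)] B(1) C(3) by auto
  show "span B = U"
  proof (rule ccontr)
    assume "span B \<noteq> U"
    hence "span B \<subset> U" using B(1) span_minimal finite_subspaceD[OF U] by blast
    hence "dim (span B) < dim U" by (intro dim_less[OF U subspace_span])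
    thus False using B by (simp add: dim_eq_card_independent)
  qed
qed

lemma independent_familyI:
  fixes g :: "'i \<Rightarrow> 'b"
  assumes I: "finite I" and c: "\<And>c. (\<Sum>i\<in>I. c i *s g i) = 0 \<Longrightarrow> \<forall>i\<in>I. c i = 0"
  shows "inj_on g I" "independent (g ` I)"
proof -
  show inj: "inj_on g I"
  proof (rule inj_onI, rule ccontr)
    fix i j assume ij: "i \<in> I" "j \<in> I" "g i = g j" "i \<noteq> j"
    let ?c = "\<lambda>x. if x = i then 1 else if x = j then -1 else (0 :: 'a)"
    have "(\<Sum>x\<in>I. ?c x *s g x) = (\<Sum>x\<in>I. (if x = i then g i else 0) - (if x = j then g j else 0))"
      by (intro sum.cong refl) (use ij in auto)
    also have "\<dots> = 0" using ij I by (simp add: sum_subtractf)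
    finally have "?c i = 0" using c[of ?c] ij by blast
    thus False by simp
  qed
  show "independent (g ` I)"
  proof (rule independent_if_scalars_zero)
    fix f x assume f: "(\<Sum>x\<in>g ` I. f x *s x) = 0" "x \<in> g ` I"
    have "(\<Sum>i\<in>I. f (g i) *s g i) = 0" using f(1) inj by (simp add: sum.reindex)
    from c[OF this] f(2) show "f x = 0" by auto
  qed (use I in simp)
qed

lemma independent_familyD:
  assumes I: "finite I" and g: "inj_on g I" "independent (g ` I)" and z: "(\<Sum>i\<in>I. c i *s g i) = 0" and i: "i \<in> I"
  shows "c i = 0"
proof -
  let ?u = "\<lambda>v. c (the_inv_into I g v)"
  have "(\<Sum>v\<in>g ` I. ?u v *s v) = 0"
    using z g(1) by (simp add: sum.reindex the_inv_into_f_f)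
  hence "?u (g i) = 0" by (intro independentD[OF g(2) finite_imageI[OF I] subset_refl]) (use i in auto)
  thus ?thesis using i g(1) by (simp add: the_inv_into_f_f)
qed

lemma span_image_eq:
  assumes "finite I" shows "span (g ` I) = {\<Sum>i\<in>I. c i *s g i | c. True}"
proof
  show "{\<Sum>i\<in>I. c i *s g i | c. True} \<subseteq> span (g ` I)" by (auto intro!: span_sum span_scale intro: span_base)
  have "subspace {\<Sum>i\<in>I. c i *s g i | c. True}"
  proof (rule subspaceI)
    show "0 \<in> {\<Sum>i\<in>I. c i *s g i | c. True}" by (auto intro!: exI[of _ "\<lambda>_. 0"])
  next
    fix x y assume "x \<in> {\<Sum>i\<in>I. c i *s g i | c. True}" "y \<in> {\<Sum>i\<in>I. c i *s g i | c. True}"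
    then obtain c d where "x = (\<Sum>i\<in>I. c i *s g i)" "y = (\<Sum>i\<in>I. d i *s g i)" by blast
    hence "x + y = (\<Sum>i\<in>I. (c i + d i) *s g i)" by (simp add: scale_left_distrib sum.distrib)
    thus "x + y \<in> {\<Sum>i\<in>I. c i *s g i | c. True}" by (intro CollectI exI[of _ "\<lambda>i. c i + d i"]) simp
  next
    fix a x assume "x \<in> {\<Sum>i\<in>I. c i *s g i | c. True}"
    then obtain c where "x = (\<Sum>i\<in>I. c i *s g i)" by blast
    hence "a *s x = (\<Sum>i\<in>I. (a * c i) *s g i)" by (simp add: scale_sum_right)
    thus "a *s x \<in> {\<Sum>i\<in>I. c i *s g i | c. True}" by (intro CollectI exI[of _ "\<lambda>i. a * c i"]) simp
  qed
  moreover have "g i \<in> {\<Sum>i\<in>I. c i *s g i | c. True}" if "i \<in> I" for i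
  proof -
    have "(\<Sum>j\<in>I. (if j = i then 1 else 0) *s g j) = (\<Sum>j\<in>I. if j = i then g j else 0)"
      by (intro sum.cong) auto
    also have "\<dots> = g i" using that assms by simp
    finally show ?thesis by (intro CollectI exI[of _ "\<lambda>j. if j = i then 1 else 0"]) simp
  qed
  ultimately show "span (g ` I) \<subseteq> {\<Sum>i\<in>I. c i *s g i | c. True}" by (intro span_minimal) auto
qed

lemma list_basis_append:
  assumes A: "list_basis vs U1" and B: "list_basis ws U2" and int: "U1 \<inter> U2 = {0}"
  shows "list_basis (vs @ ws) {x + y | x y. x \<in> U1 \<and> y \<in> U2}"
proof -
  have sp: "span (set vs) = U1" "span (set ws) = U2" using A B by (auto simp: list_basis_def)
  have disj: "set vs \<inter> set ws = {}"
  proof (rule ccontr)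
    assume "set vs \<inter> set ws \<noteq> {}"
    then obtain x where x: "x \<in> set vs" "x \<in> set ws" by blast
    hence "x \<in> U1 \<inter> U2" using sp span_base by blast
    hence "x = 0" using int by blast
    thus False using x(1) A dependent_zero unfolding list_basis_def by blast
  qed
  have "independent (set vs \<union> set ws)"
  proof (rule independent_if_scalars_zero)
    fix f x assume f: "(\<Sum>x\<in>set vs \<union> set ws. f x *s x) = 0" "x \<in> set vs \<union> set ws"
    let ?a = "\<Sum>x\<in>set vs. f x *s x" and ?b = "\<Sum>x\<in>set ws. f x *s x"
    have "?a + ?b = 0" using f(1) disj by (simp add: sum.union_disjoint)
    hence ab: "?a = - ?b" by (simp add: eq_neg_iff_add_eq_0)
    have "?a \<in> U1" "?b \<in> U2" unfolding sp[symmetric] by (auto intro!: span_sum span_scale intro: span_base)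
    moreover have "- ?b \<in> U2" using \<open>?b \<in> U2\<close> unfolding sp[symmetric] by (rule span_neg)
    ultimately have "?a \<in> U1 \<inter> U2" using ab by simp
    hence a: "?a = 0" using int by blast
    hence b: "?b = 0" using ab by simp
    show "f x = 0" using f(2)
    proof
      assume "x \<in> set vs" thus ?thesis using independentD[of "set vs" "set vs" f x] a A by (simp add: list_basis_def)
    next
      assume "x \<in> set ws" thus ?thesis using independentD[of "set ws" "set ws" f x] b B by (simp add: list_basis_def)
    qed
  qed simp
  thus ?thesis using A B disj by (auto simp: list_basis_def span_Un)
qed

lemma linear_surj_of_inj:
  assumes f: "Vector_Spaces.linear scale scale f" and U: "finite_subspace U" "f ` U \<subseteq> U"
    and inj: "\<And>u. u \<in> U \<Longrightarrow> f u = 0 \<Longrightarrow> u = 0"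
  shows "f ` U = U"
proof -
  interpret f: Vector_Spaces.linear scale scale f by fact
  obtain B where B: "finite B" "independent B" "span B = U" "card B = dim U" using fin_dim_basis[OF U(1)] .
  have i: "inj_on f U"
  proof (rule inj_onI)
    fix x y assume xy: "x \<in> U" "y \<in> U" "f x = f y"
    hence "x - y \<in> U" using U(1) unfolding finite_subspace_def by (auto intro: subspace_diff)
    thus "x = y" using inj[of "x - y"] xy by (simp add: f.diff)
  qed
  have BU: "B \<subseteq> U" using B(3) span_superset by blast
  have "independent (f ` B)" using f.independent_injective_image[of B] B(2,3) i by simp
  moreover have "card (f ` B) = card B" using i BU by (intro card_image inj_on_subset[OF i])
  ultimately have "span (f ` B) = U" using fin_dim_independent_span(2)[OF U(1), of "f ` B"] BU U(2) B(4) by auto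
  moreover have "span (f ` B) = f ` U" using f.span_image[of B] B(3) by simp
  ultimately show ?thesis by simp
qed

text \<open>A linear relation, that is, a subspace of the product of the space with itself.\<close>

definition subrel :: "('b \<times> 'b) set \<Rightarrow> bool" where
  "subrel R \<longleftrightarrow> (0, 0) \<in> R \<and> (\<forall>x y x' y'. (x, y) \<in> R \<longrightarrow> (x', y') \<in> R \<longrightarrow> (x + x', y + y') \<in> R) \<and>
     (\<forall>c x y. (x, y) \<in> R \<longrightarrow> (c *s x, c *s y) \<in> R)"

lemma subrel_0: "subrel R \<Longrightarrow> (0, 0) \<in> R"
  and subrel_add: "subrel R \<Longrightarrow> (x, y) \<in> R \<Longrightarrow> (x', y') \<in> R \<Longrightarrow> (x + x', y + y') \<in> R"
  and subrel_scale: "subrel R \<Longrightarrow> (x, y) \<in> R \<Longrightarrow> (c *s x, c *s y) \<in> R"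
  unfolding subrel_def by blast+

lemma subrel_diff: "subrel R \<Longrightarrow> (x, y) \<in> R \<Longrightarrow> (x', y') \<in> R \<Longrightarrow> (x - x', y - y') \<in> R"
  using subrel_add[of R x y "- x'" "- y'"] subrel_scale[of R x' y' "-1"] by simp

lemma subrel_sum: "subrel R \<Longrightarrow> (\<And>i. i \<in> I \<Longrightarrow> (f i, g i) \<in> R) \<Longrightarrow> (sum f I, sum g I) \<in> R"
  by (induction I rule: infinite_finite_induct) (auto intro: subrel_0 subrel_add)

lemma subrel_lincomb: "subrel R \<Longrightarrow> (\<And>i. i \<in> I \<Longrightarrow> (f i, g i) \<in> R) \<Longrightarrow> (\<Sum>i\<in>I. c i *s f i, \<Sum>i\<in>I. c i *s g i) \<in> R"
  by (intro subrel_sum subrel_scale)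

lemma subrel_Image:
  assumes R: "subrel R" and U: "subspace U" shows "subspace (R `` U)"
proof (rule subspaceI)
  show "0 \<in> R `` U" using subrel_0[OF R] subspace_0[OF U] by blast
  show "x + y \<in> R `` U" if "x \<in> R `` U" "y \<in> R `` U" for x y
    using that subrel_add[OF R] subspace_add[OF U] by blast
  show "c *s x \<in> R `` U" if "x \<in> R `` U" for c x
    using that subrel_scale[OF R] subspace_scale[OF U] by blast
qed

lemma subrel_converse: "subrel R \<Longrightarrow> subrel (R\<inverse>)"
  unfolding subrel_def by blast

lemma subrel_relcomp: "subrel R \<Longrightarrow> subrel R' \<Longrightarrow> subrel (R O R')"
  unfolding subrel_def relcomp_unfold by blast

text \<open>Values chosen on a basis extend linearly and stay in the relation. Projections, inverses
  of bijections and preimages under relations are all turned into linear maps in this way.\<close>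

lemma linear_selection:
  assumes U: "subspace U" and R: "subrel R" and sel: "\<And>x. x \<in> U \<Longrightarrow> \<exists>y. (x, y) \<in> R"
  obtains h where "Vector_Spaces.linear scale scale h" "\<And>x. x \<in> U \<Longrightarrow> (x, h x) \<in> R"
proof -
  obtain B where B: "B \<subseteq> U" "independent B" "U \<subseteq> span B" "card B = dim U" by (rule basis_exists)
  interpret vector_space_pair scale scale by unfold_locales
  obtain f where f: "\<And>x. x \<in> U \<Longrightarrow> (x, f x) \<in> R" using sel by metis
  define h where "h = construct B f"
  have lin: "Vector_Spaces.linear scale scale h" unfolding h_def by (rule linear_construct[OF B(2)])
  interpret h: Vector_Spaces.linear scale scale h by (rule lin)
  have "(x, h x) \<in> R" if "x \<in> span B" for x
    using that
  proof (induction x rule: span_induct_alt)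
    case base show ?case using subrel_0[OF R] by (simp add: h.zero)
  next
    case (step c x y)
    have "(x, h x) \<in> R" unfolding h_def construct_basis[OF B(2) step(1)] using f B(1) step(1) by blast
    thus ?case using step(2) by (simp add: h.add h.scale subrel_add[OF R] subrel_scale[OF R])
  qed
  thus ?thesis using that lin B(3) by blast
qed

subsection \<open>Primary rational canonical form\<close>

text \<open>The module structure of the space over k[\<xi>], with \<xi> acting as
  \<open>T\<close>.\<close>

definition act :: "('b \<Rightarrow> 'b) \<Rightarrow> 'a poly \<Rightarrow> 'b \<Rightarrow> 'b" where
  "act T p v = (\<Sum>i\<le>degree p. coeff p i *s (T ^^ i) v)"

lemma act_bound: "degree p \<le> n \<Longrightarrow> act T p v = (\<Sum>i\<le>n. coeff p i *s (T ^^ i) v)"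
  unfolding act_def by (rule sum.mono_neutral_left) (auto simp: coeff_eq_0 not_le)

lemma act_less: "degree p < n \<Longrightarrow> act T p v = (\<Sum>i<n. coeff p i *s (T ^^ i) v)"
  unfolding act_def by (rule sum.mono_neutral_left) (auto simp: coeff_eq_0 not_le)

lemma act_zero [simp]: "act T 0 v = 0" and act_const [simp]: "act T [:a:] v = a *s v" and act_1 [simp]: "act T 1 v = v"
  by (simp_all add: act_def)

lemma act_add: "act T (p + q) v = act T p v + act T q v"
proof -
  let ?n = "max (degree p) (degree q)"
  have "degree (p + q) \<le> ?n" by (rule degree_add_le) auto
  thus ?thesis by (simp add: act_bound[of _ ?n] scale_left_distrib sum.distrib)
qed

lemma act_smult: "act T (Polynomial.smult c p) v = c *s act T p v"
  by (simp add: act_bound[of _ "degree p"] scale_sum_right)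

context
  fixes T assumes T: "Vector_Spaces.linear scale scale T"
begin

interpretation T: Vector_Spaces.linear scale scale T by (rule T)

lemma funpow_linear: "Vector_Spaces.linear scale scale (T ^^ i)"
proof (induction i)
  case 0 show ?case by (simp add: Vector_Spaces.linear_iff vector_space_axioms)
next
  case (Suc i) show ?case using Vector_Spaces.linear_compose[OF Suc T] by (simp add: o_def)
qed

lemma act_pCons: "act T (pCons a p) v = a *s v + T (act T p v)"
proof -
  have "act T (pCons a p) v = (\<Sum>i\<le>Suc (degree p). coeff (pCons a p) i *s (T ^^ i) v)"
    by (rule act_bound[OF degree_pCons_le])
  also have "\<dots> = a *s v + (\<Sum>i\<le>degree p. coeff p i *s T ((T ^^ i) v))"
    by (simp add: sum.atMost_Suc_shift del: sum.atMost_Suc)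
  finally show ?thesis by (simp add: act_def T.sum T.scale)
qed

lemma act_x: "act T [:0, 1:] v = T v"
  by (simp add: act_pCons)

lemma act_linear: "Vector_Spaces.linear scale scale (act T p)"
proof (induction p)
  case 0 show ?case by (simp add: Vector_Spaces.linear_iff vector_space_axioms)
next
  case (pCons a p)
  interpret p: Vector_Spaces.linear scale scale "act T p" by fact
  show ?case by (simp add: Vector_Spaces.linear_iff vector_space_axioms act_pCons p.add p.scale T.add T.scale scale_right_distrib algebra_simps)
qed

lemma act_mult: "act T (p * q) v = act T p (act T q v)"
  by (induction p) (simp_all add: act_add act_smult act_pCons)

lemma act_commute: "act T p (act T q v) = act T q (act T p v)"
  by (simp flip: act_mult add: mult.commute)

lemma act_funpow: "act T p ((T ^^ i) v) = (T ^^ i) (act T p v)"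
proof (induction i)
  case (Suc i)
  thus ?case using act_commute[of p "[:0, 1:]" "(T ^^ i) v"] by (simp add: act_x)
qed simp

lemma act_invariant: "subspace U \<Longrightarrow> T ` U \<subseteq> U \<Longrightarrow> v \<in> U \<Longrightarrow> act T p v \<in> U"
  by (induction p) (auto simp: act_pCons subspace_0 intro!: subspace_add subspace_scale)

lemma act_zero_vec [simp]: "act T p 0 = 0"
  using act_linear[of p] unfolding Vector_Spaces.linear_iff by (metis add_cancel_right_right)

lemma act_add_vec: "act T p (x + y) = act T p x + act T p y"
  and act_scale_vec: "act T p (c *s x) = c *s act T p x"
  using act_linear[of p] by (simp_all add: Vector_Spaces.linear_iff)

lemma act_diff_vec: "act T p (x - y) = act T p x - act T p y"
  using act_add_vec[of p "x - y" y] by simp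

lemma act_mod: "act T p v = 0 \<Longrightarrow> act T (q mod p) v = act T q v"
proof -
  assume z: "act T p v = 0"
  have "act T q v = act T (q div p * p + q mod p) v" by simp
  also have "\<dots> = act T (q mod p) v" unfolding act_add act_mult z by simp
  finally show ?thesis by simp
qed

text \<open>Take a polynomial of least degree among all nonzero ones killing some nonzero vector of
  \<open>U\<close>; one exists because \<open>dim U + 1\<close> iterates of a vector are dependent.
  In a proper factorisation one factor would kill a nonzero vector, so it is irreducible.\<close>

lemma minimal_annihilator:
  assumes U: "finite_subspace U" "T ` U \<subseteq> U" "U \<noteq> {0}"
  obtains \<pi> w where "irreducible \<pi>" "lead_coeff \<pi> = 1" "w \<in> U" "w \<noteq> 0" "act T \<pi> w = 0"
    "\<And>p u. p \<noteq> 0 \<Longrightarrow> degree p < degree \<pi> \<Longrightarrow> u \<in> U \<Longrightarrow> u \<noteq> 0 \<Longrightarrow> act T p u \<noteq> 0"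
proof -
  have sub: "subspace U" using U finite_subspaceD by blast
  let ?P = "\<lambda>n. \<exists>p w. p \<noteq> 0 \<and> degree p = n \<and> w \<in> U \<and> w \<noteq> 0 \<and> act T p w = 0"
  obtain v where v: "v \<in> U" "v \<noteq> 0" using U(3) subspace_0[OF sub] by blast
  have "\<exists>n. ?P n"
  proof (rule ccontr)
    assume no: "\<not> (\<exists>n. ?P n)"
    let ?n = "Suc (dim U)"
    have ind: "inj_on (\<lambda>i. (T ^^ i) v) {..<?n} \<and> independent ((\<lambda>i. (T ^^ i) v) ` {..<?n})"
    proof -
      have c: "\<forall>i\<in>{..<?n}. c i = 0" if z: "(\<Sum>i\<in>{..<?n}. c i *s (T ^^ i) v) = 0" for c
      proof -
        define p where "p = (\<Sum>i<?n. monom (c i) i)"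
        have cp: "coeff p i = (if i < ?n then c i else 0)" for i by (auto simp: p_def coeff_sum)
        have "degree p < ?n"
        proof (cases "p = 0")
          case False
          hence "coeff p (degree p) \<noteq> 0" by simp
          thus ?thesis unfolding cp by (auto split: if_splits)
        qed simp
        hence "act T p v = 0" using z by (simp add: act_less[of p ?n] cp)
        hence "p = 0" using no v by blast
        thus ?thesis using cp by (metis coeff_0 lessThan_iff)
      qed
      show ?thesis
        by (rule conjI; rule independent_familyI[OF finite_lessThan]; rule c)
    qed
    have "(\<lambda>i. (T ^^ i) v) ` {..<?n} \<subseteq> U"
    proof -
      have "(T ^^ i) v \<in> U" for i using v(1) U(2) by (induction i) auto
      thus ?thesis by blast
    qed
    moreover obtain B where B: "finite B" "independent B" "span B = U" "card B = dim U" using fin_dim_basis[OF U(1)] .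
    ultimately have "card ((\<lambda>i. (T ^^ i) v) ` {..<?n}) \<le> dim U" using independent_span_bound[of B] ind by metis
    thus False using ind by (simp add: card_image)
  qed
  then obtain n where n: "?P n" "\<And>m. m < n \<Longrightarrow> \<not> ?P m" using exists_least_iff[of ?P] by blast
  then obtain p w where p: "p \<noteq> 0" "degree p = n" "w \<in> U" "w \<noteq> 0" "act T p w = 0" by blast
  have min: "act T q u \<noteq> 0" if "q \<noteq> 0" "degree q < n" "u \<in> U" "u \<noteq> 0" for q u using n(2) that by blast
  define \<pi> where "\<pi> = Polynomial.smult (inverse (lead_coeff p)) p"
  have \<pi>: "\<pi> \<noteq> 0" "degree \<pi> = n" "lead_coeff \<pi> = 1" "act T \<pi> w = 0" using p by (auto simp: \<pi>_def act_smult)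
  have "irreducible \<pi>"
  proof (rule irreducibleI)
    show "\<pi> \<noteq> 0" by (rule \<pi>)
    show "\<not> \<pi> dvd 1"
    proof
      assume "\<pi> dvd 1"
      hence "degree \<pi> = 0" using \<pi>(1) by (simp add: is_unit_iff_degree)
      then obtain a where a: "\<pi> = [:a:]" by (metis degree_0_id)
      thus False using \<pi> p(4) by simp
    qed
    fix a b assume ab: "\<pi> = a * b"
    hence nz: "a \<noteq> 0" "b \<noteq> 0" using \<pi>(1) by auto
    have deg: "degree a + degree b = n" using ab nz \<pi>(2) by (simp add: degree_mult_eq)
    have z: "act T a (act T b w) = 0" using \<pi>(4) unfolding ab act_mult .
    show "a dvd 1 \<or> b dvd 1"
    proof (rule ccontr)
      assume "\<not> (a dvd 1 \<or> b dvd 1)"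
      hence "degree a \<noteq> 0" "degree b \<noteq> 0" using nz by (auto simp: is_unit_iff_degree)
      hence lt: "degree a < n" "degree b < n" using deg by auto
      have "act T b w \<noteq> 0" by (rule min[OF nz(2) lt(2) p(3,4)])
      hence "act T a (act T b w) \<noteq> 0" by (rule min[OF nz(1) lt(1) act_invariant[OF sub U(2) p(3)]])
      thus False using z by simp
    qed
  qed
  thus ?thesis using that[OF _ \<pi>(3) p(3,4) \<pi>(4)] min \<pi>(2) by blast
qed

definition cyclic_list :: "'b \<times> 'a poly \<times> nat \<Rightarrow> 'b list" where
  "cyclic_list = (\<lambda>(v, \<pi>, m). map (\<lambda>i. (T ^^ i) v) [0..<degree (\<pi> ^ m)])"

definition cyclic_data :: "'b set \<Rightarrow> 'b \<times> 'a poly \<times> nat \<Rightarrow> bool" where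
  "cyclic_data U = (\<lambda>(v, \<pi>, m). v \<in> U \<and> irreducible \<pi> \<and> lead_coeff \<pi> = 1 \<and> 1 \<le> m \<and> act T (\<pi> ^ m) v = 0)"

text \<open>The kernels of the powers of \<open>p\<close> increase and must become stationary. Then
  the stable power acts injectively, hence bijectively, on its own image, which splits
  \<open>U\<close> into kernel and image.\<close>

lemma fitting:
  assumes U: "finite_subspace U" "T ` U \<subseteq> U"
  obtains K where "0 < K" "\<And>u. u \<in> U \<Longrightarrow> \<exists>x y. x \<in> U \<and> act T (p ^ K) x = 0 \<and> y \<in> act T (p ^ K) ` U \<and> u = x + y"
    "\<And>u. u \<in> act T (p ^ K) ` U \<Longrightarrow> act T (p ^ K) u = 0 \<Longrightarrow> u = 0"
proof -
  have sub: "subspace U" using U finite_subspaceD by blast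
  let ?N = "\<lambda>i. {u \<in> U. act T (p ^ i) u = 0}"
  have subN: "subspace (?N i)" for i using sub by (auto intro!: subspaceI simp: act_add_vec act_scale_vec subspace_0 subspace_add subspace_scale)
  have mono: "?N i \<subseteq> ?N (Suc i)" for i
    using act_mult[of p "p ^ i"] by auto
  have "\<exists>K. ?N K = ?N (Suc K)"
  proof (rule ccontr)
    assume "\<not> ?thesis"
    hence "?N i \<subset> ?N (Suc i)" for i using mono[of i] by blast
    hence d: "dim (?N i) < dim (?N (Suc i))" for i
      by (intro dim_less[OF fin_dim_subset[OF U(1) subN] subN]) auto
    have "i \<le> dim (?N i)" for i using d by (induction i) (auto intro: order_trans[OF _ Suc_leI])
    moreover have "dim (?N i) \<le> dim U" for i
    proof (cases "?N i = U")
      case False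
      hence "?N i \<subset> U" by blast
      thus ?thesis using dim_less[OF U(1) subN[of i]] by simp
    qed simp
    ultimately show False by (meson Suc_n_not_le_n le_trans)
  qed
  then obtain K0 where K0: "?N K0 = ?N (Suc K0)" by blast
  \<comment> \<open>One more than the first stable exponent, so that \<open>K\<close> is positive
    and the kernel contains every vector killed by \<open>p\<close> itself.\<close>
  define K where "K = Suc K0"
  have K: "?N K = ?N (Suc K)"
  proof
    show "?N (Suc K) \<subseteq> ?N K"
    proof
      fix u assume "u \<in> ?N (Suc K)"
      hence u: "u \<in> U" "act T (p ^ Suc K) u = 0" by auto
      hence "act T p u \<in> ?N (Suc K0)"
        using act_invariant[OF sub U(2) u(1)] by (simp add: K_def flip: act_mult) (simp add: mult_ac)
      hence "act T (p ^ K0) (act T p u) = 0" using K0 by blast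
      thus "u \<in> ?N K" using u(1) by (simp add: K_def mult.commute flip: act_mult)
    qed
  qed (rule mono)
  have stab: "act T (p ^ (K + i)) u = 0 \<Longrightarrow> act T (p ^ K) u = 0" if "u \<in> U" for i u
    using that
  proof (induction i arbitrary: u)
    case (Suc i)
    have "act T (p ^ (K + i)) (act T p u) = 0" using Suc(2) by (simp flip: act_mult add: mult.commute)
    hence "act T (p ^ K) (act T p u) = 0" using Suc(1) act_invariant[OF sub U(2) Suc(3)] by blast
    hence "u \<in> ?N (Suc K)" using Suc(3) by (simp flip: act_mult add: mult.commute)
    thus ?case using K by blast
  qed simp
  let ?f = "act T (p ^ K)"
  have subI: "subspace (?f ` U)"
    using act_linear[of "p ^ K"] sub by (metis (no_types) linear_iff_module_hom module_hom.subspace_image)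
  have IU: "?f ` U \<subseteq> U" using act_invariant[OF sub U(2)] by blast
  have inj: "u = 0" if u: "u \<in> ?f ` U" "?f u = 0" for u
  proof -
    obtain x where x: "x \<in> U" "u = ?f x" using u by blast
    have "act T (p ^ (K + K)) x = 0" using u x by (simp add: power_add act_mult)
    thus ?thesis using stab[OF x(1)] x(2) by simp
  qed
  have ff: "?f ` (?f ` U) = ?f ` U"
    by (rule linear_surj_of_inj[OF act_linear fin_dim_subset[OF U(1) subI IU] _ inj]) (use IU in auto)
  have "\<exists>x y. x \<in> U \<and> ?f x = 0 \<and> y \<in> ?f ` U \<and> u = x + y" if u: "u \<in> U" for u
  proof -
    have "?f u \<in> ?f ` (?f ` U)" unfolding ff using u by blast
    then obtain y where y: "y \<in> ?f ` U" "?f u = ?f y" by blast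
    have "?f (u - y) = 0" using y by (simp add: act_diff_vec)
    moreover have "u - y \<in> U" using u y IU sub subspace_diff by blast
    ultimately show ?thesis using y by (intro exI[of _ "u - y"] exI[of _ y]) auto
  qed
  thus ?thesis using that[of K] inj by (simp add: K_def)
qed

end

text \<open>A vector \<open>v\<close> of maximal order generates a direct summand, because
  k[\<xi>]/(\<pi>^m) is a Frobenius algebra: the top-coefficient functional pairs it perfectly with
  itself, and the orthogonal space with respect to an extension of this functional is an invariant
  complement.\<close>

lemma primary_split_off:
  assumes T: "Vector_Spaces.linear scale scale T"
    and U: "finite_subspace U" "T ` U \<subseteq> U" "U \<noteq> {0}" and \<pi>: "irreducible \<pi>" "lead_coeff \<pi> = 1"
    and nil: "\<And>u. u \<in> U \<Longrightarrow> act T (\<pi> ^ K) u = 0"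
    and min: "\<And>p u. p \<noteq> 0 \<Longrightarrow> degree p < degree \<pi> \<Longrightarrow> u \<in> U \<Longrightarrow> u \<noteq> 0 \<Longrightarrow> act T p u \<noteq> 0"
  obtains v m W where "cyclic_data T U (v, \<pi>, m)" "subspace W" "W \<subset> U" "T ` W \<subseteq> W"
    "list_basis (cyclic_list T (v, \<pi>, m)) {act T r v | r. True}" "{act T r v | r. True} \<inter> W = {0}"
    "U = {x + y | x y. x \<in> {act T r v | r. True} \<and> y \<in> W}"
proof -
  interpret T: Vector_Spaces.linear scale scale T by (rule T)
  note [simp] = act_zero_vec[OF T]
  note act_mult = act_mult[OF T] and act_invariant = act_invariant[OF T] and act_mod = act_mod[OF T]
  have sub: "subspace U" using U finite_subspaceD by blast
  obtain m where m: "\<And>u. u \<in> U \<Longrightarrow> act T (\<pi> ^ m) u = 0" "\<And>j. j < m \<Longrightarrow> \<exists>u\<in>U. act T (\<pi> ^ j) u \<noteq> 0"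
  proof -
    have "\<exists>m. (\<forall>u\<in>U. act T (\<pi> ^ m) u = 0) \<and> (\<forall>j<m. \<not> (\<forall>u\<in>U. act T (\<pi> ^ j) u = 0))"
      using exists_least_iff[of "\<lambda>m. \<forall>u\<in>U. act T (\<pi> ^ m) u = 0"] nil by blast
    thus ?thesis using that by blast
  qed
  have m1: "1 \<le> m"
  proof (rule ccontr)
    assume "\<not> 1 \<le> m"
    hence "u = 0" if "u \<in> U" for u using m(1)[OF that] by (simp add: not_le)
    thus False using U(3) subspace_0[OF sub] by blast
  qed
  note d = degree_irreducible_power[OF \<pi> m1]
  let ?p = "\<pi> ^ m" and ?e = "degree (\<pi> ^ m)"
  have \<pi>0: "\<pi> \<noteq> 0" "\<pi> ^ i \<noteq> 0" for i using \<pi>(2) by auto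
  obtain v where v: "v \<in> U" "act T (\<pi> ^ (m - 1)) v \<noteq> 0" using m(2)[of "m - 1"] m1 by auto
  \<comment> \<open>The annihilator of \<open>v\<close> is exactly \<pi>^m: write \<open>r\<close>
    as \<pi>^j times \<open>s\<close> with \<pi> not dividing \<open>s\<close>. Multiplying by
    \<pi>^(m-1-j) gives \<open>s\<close> applied to \<open>?w\<close>, which only sees
    \<open>s mod \<pi>\<close> and is nonzero by the minimality of the degree of \<pi>.\<close>
  have nz: "act T r v \<noteq> 0" if r: "r \<noteq> 0" "degree r < ?e" for r
  proof -
    have "\<not> ?p dvd r" using r dvd_imp_degree_le[of ?p r] by auto
    have "\<exists>j<m. \<pi> ^ j dvd r \<and> \<not> \<pi> ^ Suc j dvd r"
    proof (rule ccontr)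
      assume "\<not> ?thesis"
      hence s: "\<pi> ^ Suc j dvd r" if "j < m" "\<pi> ^ j dvd r" for j using that by blast
      have "j \<le> m \<Longrightarrow> \<pi> ^ j dvd r" for j by (induction j) (use s in auto)
      thus False using \<open>\<not> ?p dvd r\<close> by blast
    qed
    then obtain j s where j: "j < m" "r = \<pi> ^ j * s" "\<not> \<pi> ^ Suc j dvd r" by (metis dvdE)
    have ns: "s mod \<pi> \<noteq> 0" using j(3) unfolding j(2) by (auto simp: dvd_eq_mod_eq_0[symmetric] mult_dvd_mono mult.commute)
    let ?w = "act T (\<pi> ^ (m - 1)) v"
    have wU: "?w \<in> U" by (rule act_invariant[OF sub U(2) v(1)])
    have "act T \<pi> ?w = act T (\<pi> * \<pi> ^ (m - 1)) v" by (simp add: act_mult)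
    also have "\<pi> * \<pi> ^ (m - 1) = ?p" using m1 by (metis One_nat_def Suc_diff_le Suc_eq_plus1 diff_Suc_1 power_Suc le_add_diff_inverse2)
    finally have w0: "act T \<pi> ?w = 0" using m(1) v by simp
    have "degree (s mod \<pi>) < degree \<pi>" using degree_mod_less_degree[OF degree_irreducible_pos[OF \<pi> m1]] .
    hence "act T (s mod \<pi>) ?w \<noteq> 0" by (rule min[OF ns _ wU v(2)])
    hence "act T s ?w \<noteq> 0" using act_mod[OF w0, of s] by simp
    hence "act T (s * \<pi> ^ (m - 1)) v \<noteq> 0" by (simp add: act_mult)
    moreover have "s * \<pi> ^ (m - 1) = \<pi> ^ (m - 1 - j) * r"
    proof -
      have "m - 1 = (m - 1 - j) + j" using j(1) by simp
      hence "\<pi> ^ (m - 1) = \<pi> ^ (m - 1 - j) * \<pi> ^ j" by (metis power_add)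
      thus ?thesis unfolding j(2) by (simp add: mult_ac)
    qed
    ultimately have "act T (\<pi> ^ (m - 1 - j)) (act T r v) \<noteq> 0" by (simp only: act_mult[symmetric] not_False_eq_True)
    thus ?thesis by (metis act_zero_vec[OF T])
  qed
  let ?g = "\<lambda>i. (T ^^ i) v"
  let ?C = "{act T r v | r. True}"
  have comb: "\<exists>p. (\<forall>i<?e. coeff p i = c i) \<and> degree p < ?e \<and> (\<Sum>i<?e. c i *s (T ^^ i) u) = act T p u" for c u
  proof -
    define p where "p = (\<Sum>i<?e. monom (c i) i)"
    have cp: "coeff p i = (if i < ?e then c i else 0)" for i by (auto simp: p_def coeff_sum)
    have "degree p < ?e"
    proof (cases "p = 0")
      case False
      hence "coeff p (degree p) \<noteq> 0" by simp
      thus ?thesis unfolding cp by (auto split: if_splits)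
    qed (use d in simp)
    thus ?thesis using cp by (intro exI[of _ p]) (auto simp: act_less[of p ?e])
  qed
  have fam: "\<forall>i\<in>{..<?e}. c i = 0" if "(\<Sum>i\<in>{..<?e}. c i *s ?g i) = 0" for c
  proof -
    obtain p where p: "\<forall>i<?e. coeff p i = c i" "degree p < ?e" "(\<Sum>i<?e. c i *s ?g i) = act T p v" using comb by blast
    hence "p = 0" using nz that by auto
    thus ?thesis using p by simp
  qed
  note ind = independent_familyI[of "{..<?e}" ?g, OF finite_lessThan fam]
  have spC: "span (?g ` {..<?e}) = ?C"
  proof
    show "span (?g ` {..<?e}) \<subseteq> ?C" unfolding span_image_eq[OF finite_lessThan]
    proof clarify
      fix c show "\<exists>r. (\<Sum>i<?e. c i *s ?g i) = act T r v \<and> True" using comb[of c v] by blast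
    qed
    show "?C \<subseteq> span (?g ` {..<?e})"
    proof clarify
      fix r
      have "act T r v = act T (r mod ?p) v" using act_mod m(1) v(1) by simp
      also have "\<dots> = (\<Sum>i<?e. coeff (r mod ?p) i *s ?g i)" by (rule act_less[OF degree_mod_less_degree[OF d(2)]])
      finally show "act T r v \<in> span (?g ` {..<?e})" by (auto intro!: span_sum span_scale intro: span_base)
    qed
  qed
  have CU: "?C \<subseteq> U" using act_invariant[OF sub U(2) v(1)] by blast
  have subC: "subspace ?C" unfolding spC[symmetric] by (rule subspace_span)
  have lb: "list_basis (cyclic_list T (v, \<pi>, m)) ?C"
    using ind spC by (auto simp: list_basis_def cyclic_list_def[OF T] distinct_map lessThan_atLeast0)
  interpret fp: vector_space_pair scale "(*) :: 'a \<Rightarrow> 'a \<Rightarrow> 'a" by unfold_locales (auto simp: algebra_simps)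
  \<comment> \<open>The functional reading off the coefficient of the last basis vector of the
    cyclic space, extended to the whole space.\<close>
  obtain f where f: "Vector_Spaces.linear scale (*) f" "\<forall>x \<in> ?g ` {..<?e}. f x = (if x = ?g (?e - 1) then 1 else 0)"
    using fp.linear_independent_extend[OF ind(2), where f = "\<lambda>x. if x = ?g (?e - 1) then 1 else 0"] by blast
  have f_add: "f (x + y) = f x + f y" and f_scale: "f (c *s x) = c * f x" for x y c using f(1) by (auto simp: Vector_Spaces.linear_iff)
  have f0: "f 0 = 0" using f_scale[of 0 0] by simp
  have f_sum: "f (\<Sum>i\<in>I. h i) = (\<Sum>i\<in>I. f (h i))" for h and I :: "nat set"
    by (induction I rule: infinite_finite_induct) (auto simp: f_add f0)
  have fg: "f (?g i) = (if i = ?e - 1 then 1 else 0)" if "i < ?e" for i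
    using f(2) that inj_onD[OF ind(1), of i "?e - 1"] d(2) by auto
  let ?W = "{w \<in> U. \<forall>i<?e. f ((T ^^ i) w) = 0}"
  have funpow_add: "(T ^^ i) (x + y) = (T ^^ i) x + (T ^^ i) y" and funpow_scale: "(T ^^ i) (c *s x) = c *s (T ^^ i) x" for i x y c
    using funpow_linear[OF T, of i] by (auto simp: Vector_Spaces.linear_iff)
  have funpow_0: "(T ^^ i) 0 = 0" for i using funpow_scale[of i 0 0] by simp
  have subW: "subspace ?W"
    using sub by (auto intro!: subspaceI simp: funpow_add funpow_scale funpow_0 f_add f_scale f0 subspace_0 subspace_add subspace_scale)
  \<comment> \<open>Applying \<open>T\<close> until the leading term of \<open>r\<close> sits on the
    last basis vector exposes its leading coefficient to \<open>f\<close>.\<close>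
  have CW: "x = 0" if x: "x \<in> ?C" "\<forall>i<?e. f ((T ^^ i) x) = 0" for x
  proof (rule ccontr)
    assume "x \<noteq> 0"
    obtain r' where "x = act T r' v" using x by blast
    then obtain r where r: "x = act T r v" "degree r < ?e"
      using act_mod[of ?p v r'] m(1) v(1) degree_mod_less_degree[OF d(2), of r'] by metis
    have rn: "r \<noteq> 0" using r \<open>x \<noteq> 0\<close> by auto
    let ?h = "?e - 1 - degree r"
    have "(T ^^ ?h) x = (\<Sum>i\<le>degree r. coeff r i *s ?g (?h + i))"
    proof -
      have "(T ^^ ?h) (\<Sum>i\<in>I. c i *s z i) = (\<Sum>i\<in>I. c i *s (T ^^ ?h) (z i))" for c z and I :: "nat set"
        by (induction I rule: infinite_finite_induct) (auto simp: funpow_add funpow_scale funpow_0)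
      thus ?thesis unfolding r(1) act_def by (simp add: funpow_add[symmetric] Nat.funpow_add)
    qed
    hence "f ((T ^^ ?h) x) = (\<Sum>i\<le>degree r. coeff r i * f (?g (?h + i)))" by (simp add: f_sum f_scale)
    also have "\<dots> = (\<Sum>i\<le>degree r. if i = degree r then coeff r i else 0)"
      using r(2) by (intro sum.cong refl) (auto simp: fg)
    also have "\<dots> = lead_coeff r" by simp
    finally have "lead_coeff r = 0" using x(2) r(2) by simp
    thus False using rn by simp
  qed
  \<comment> \<open>Only the condition with exponent \<open>?e\<close> is new. Since \<pi>^m is
    monic and kills \<open>U\<close>, the \<open>?e\<close>-th iterate is a combination of the
    earlier ones.\<close>
  have TW: "T ` ?W \<subseteq> ?W"
  proof clarify
    fix w assume w: "w \<in> U" "\<forall>i<?e. f ((T ^^ i) w) = 0"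
    have "f ((T ^^ ?e) w) = 0"
    proof -
      have "0 = f (act T ?p w)" using m(1)[OF w(1)] f0 by simp
      also have "act T ?p w = (\<Sum>i<?e. coeff ?p i *s (T ^^ i) w) + (T ^^ ?e) w"
        unfolding act_def using d(3) by (simp add: lessThan_Suc_atMost[symmetric])
      also have "f \<dots> = f ((T ^^ ?e) w)" using w(2) by (simp add: f_add f_sum f_scale)
      finally show ?thesis by simp
    qed
    note e = this
    have "f ((T ^^ i) (T w)) = 0" if "i < ?e" for i
    proof -
      have "(T ^^ i) (T w) = (T ^^ Suc i) w" by (simp only: funpow_Suc_right o_apply)
      moreover have "Suc i < ?e \<or> Suc i = ?e" using that by auto
      ultimately show ?thesis using w(2) e by metis
    qed
    thus "T w \<in> U \<and> (\<forall>i<?e. f ((T ^^ i) (T w)) = 0)" using w U(2) by blast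
  qed
  \<comment> \<open>The kernel of this map on \<open>U\<close> is \<open>?W\<close>. It is injective
    on the cyclic space and takes values there, hence maps it onto itself, and every vector can be
    corrected by an element of the cyclic space to land in \<open>?W\<close>.\<close>
  define \<Phi> where "\<Phi> = (\<lambda>u. \<Sum>i<?e. f ((T ^^ i) u) *s ?g i)"
  have lin\<Phi>: "Vector_Spaces.linear scale scale \<Phi>"
    unfolding Vector_Spaces.linear_iff \<Phi>_def
    by (auto simp: vector_space_axioms funpow_add funpow_scale f_add f_scale scale_left_distrib sum.distrib scale_sum_right)
  have \<Phi>C: "\<Phi> u \<in> ?C" for u unfolding spC[symmetric] \<Phi>_def by (auto intro!: span_sum span_scale intro: span_base)
  have \<Phi>0: "\<forall>i<?e. f ((T ^^ i) u) = 0" if "\<Phi> u = 0" for u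
    using fam[of "\<lambda>i. f ((T ^^ i) u)"] that unfolding \<Phi>_def by auto
  have "\<Phi> ` ?C = ?C"
    by (rule linear_surj_of_inj[OF lin\<Phi> fin_dim_subset[OF U(1) subC CU]]) (use \<Phi>C CW \<Phi>0 in blast)+
  hence "\<exists>x y. x \<in> ?C \<and> y \<in> ?W \<and> u = x + y" if u: "u \<in> U" for u
  proof -
    assume e: "\<Phi> ` ?C = ?C"
    have "\<Phi> u \<in> \<Phi> ` ?C" unfolding e by (rule \<Phi>C)
    then obtain x where x: "x \<in> ?C" "\<Phi> u = \<Phi> x" by blast
    have "\<Phi> (u - x) = 0" using x lin\<Phi> by (metis diff_self linear_iff_module_hom module_hom.diff)
    hence "u - x \<in> ?W" using \<Phi>0 subspace_diff[OF sub u] x(1) CU by blast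
    thus ?thesis using x(1) by (intro exI[of _ x] exI[of _ "u - x"]) auto
  qed
  moreover have "x + y \<in> U" if "x \<in> ?C" "y \<in> ?W" for x y using that CU subspace_add[OF sub] by blast
  ultimately have sum: "U = {x + y | x y. x \<in> ?C \<and> y \<in> ?W}" by blast
  have int: "?C \<inter> ?W = {0}" using CW subspace_0[OF subC] subspace_0[OF subW] by blast
  have "v \<notin> ?W"
  proof
    assume "v \<in> ?W"
    hence "f (?g (?e - 1)) = 0" using d(2) by simp
    thus False using fg[of "?e - 1"] d(2) by simp
  qed
  hence "?W \<subset> U" using v(1) by blast
  moreover have "cyclic_data T U (v, \<pi>, m)" using v(1) \<pi> m1 m(1) by (simp add: cyclic_data_def[OF T])
  ultimately show ?thesis using that[OF _ subW _ TW lb int sum] by blast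
qed

text \<open>Induction on the dimension: if a power of \<pi> kills all of \<open>U\<close>, a cyclic
  summand is split off; otherwise \<open>fitting\<close> divides \<open>U\<close> into two proper
  invariant subspaces.\<close>

theorem primary_decomposition:
  assumes T: "Vector_Spaces.linear scale scale T" and U: "finite_subspace U" "T ` U \<subseteq> U"
  shows "\<exists>ps. (\<forall>q \<in> set ps. cyclic_data T U q) \<and> list_basis (concat (map (cyclic_list T) ps)) U"
  using U
proof (induction "dim U" arbitrary: U rule: less_induct)
  case less
  have sub: "subspace U" using less finite_subspaceD by blast
  have mono: "cyclic_data T U q" if "cyclic_data T W q" "W \<subseteq> U" for q W
    using that by (auto simp: cyclic_data_def[OF T])
  show ?case
  proof (cases "U = {0}")
    case True thus ?thesis by (intro exI[of _ "[]"]) (auto simp: list_basis_def independent_empty)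
  next
    case False
    obtain \<pi> w where \<pi>: "irreducible \<pi>" "lead_coeff \<pi> = 1" "w \<in> U" "w \<noteq> 0" "act T \<pi> w = 0"
      "\<And>p u. p \<noteq> 0 \<Longrightarrow> degree p < degree \<pi> \<Longrightarrow> u \<in> U \<Longrightarrow> u \<noteq> 0 \<Longrightarrow> act T p u \<noteq> 0"
      by (rule minimal_annihilator[OF T less(2,3) False]) blast
    obtain K where K0: "0 < K" and K: "\<And>u. u \<in> U \<Longrightarrow> \<exists>x y. x \<in> U \<and> act T (\<pi> ^ K) x = 0 \<and> y \<in> act T (\<pi> ^ K) ` U \<and> u = x + y"
      "\<And>u. u \<in> act T (\<pi> ^ K) ` U \<Longrightarrow> act T (\<pi> ^ K) u = 0 \<Longrightarrow> u = 0"
      by (rule fitting[OF T less(2,3), of \<pi>]) blast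
    let ?f = "act T (\<pi> ^ K)"
    let ?N = "{u \<in> U. ?f u = 0}" and ?I = "?f ` U"
    have IU: "?I \<subseteq> U" using act_invariant[OF T sub less(3)] by blast
    have subN: "subspace ?N"
      using sub by (auto intro!: subspaceI simp: act_add_vec[OF T] act_scale_vec[OF T] act_zero_vec[OF T] subspace_0 subspace_add subspace_scale)
    have subI: "subspace ?I"
      using act_linear[OF T, of "\<pi> ^ K"] sub by (metis (no_types) linear_iff_module_hom module_hom.subspace_image)
    have commT: "?f (T u) = T (?f u)" for u using act_funpow[OF T, of "\<pi> ^ K" 1 u] by simp
    have Tz: "T 0 = 0" using T by (metis linear_iff_module_hom module_hom.zero)
    have int: "?N \<inter> ?I = {0}" using K(2) subspace_0[OF subN] subspace_0[OF subI] by blast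
    show ?thesis
    proof (cases "?N = U")
      case True
      have nil: "?f u = 0" if "u \<in> U" for u using True that by blast
      obtain v m W where W: "cyclic_data T U (v, \<pi>, m)" "subspace W" "W \<subset> U" "T ` W \<subseteq> W"
        "list_basis (cyclic_list T (v, \<pi>, m)) {act T r v | r. True}" "{act T r v | r. True} \<inter> W = {0}"
        "U = {x + y | x y. x \<in> {act T r v | r. True} \<and> y \<in> W}"
        by (rule primary_split_off[OF T less(2,3) False \<pi>(1,2) nil \<pi>(6)])
      have "finite_subspace W" using fin_dim_subset[OF less(2) W(2)] W(3) by blast
      then obtain ps where ps: "\<forall>q \<in> set ps. cyclic_data T W q" "list_basis (concat (map (cyclic_list T) ps)) W"
        using less(1)[OF dim_less[OF less(2) W(2,3)] _ W(4)] by blast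
      have "list_basis (cyclic_list T (v, \<pi>, m) @ concat (map (cyclic_list T) ps)) U"
        using list_basis_append[OF W(5) ps(2) W(6)] W(7) by simp
      thus ?thesis using ps(1) W(1,3) mono by (intro exI[of _ "(v, \<pi>, m) # ps"]) auto
    next
      case False
      have N: "?N \<subset> U" using False by blast
      have wN: "w \<in> ?N"
      proof -
        from K0 obtain K' where "K = Suc K'" by (cases K) auto
        thus ?thesis using \<pi>(3,5) act_mult[OF T, of "\<pi> ^ K'" \<pi> w] act_zero_vec[OF T] by (simp add: mult.commute)
      qed
      \<comment> \<open>The vector \<open>w\<close> killed by \<pi> lies in the kernel and, being
        nonzero, outside the image, so both parts are proper.\<close>
      have I: "?I \<subset> U"
      proof -
        have "w \<notin> ?I" using wN K(2) \<pi>(4) by blast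
        thus ?thesis using IU \<pi>(3) by blast
      qed
      have "T ` ?N \<subseteq> ?N" using less(3) commT Tz by auto
      then obtain ps where ps: "\<forall>q \<in> set ps. cyclic_data T ?N q" "list_basis (concat (map (cyclic_list T) ps)) ?N"
        using less(1)[OF dim_less[OF less(2) subN N] fin_dim_subset[OF less(2) subN]] N by blast
      have "T ` ?I \<subseteq> ?I" using less(3) by (auto simp: commT[symmetric])
      then obtain qs where qs: "\<forall>q \<in> set qs. cyclic_data T ?I q" "list_basis (concat (map (cyclic_list T) qs)) ?I"
        using less(1)[OF dim_less[OF less(2) subI I] fin_dim_subset[OF less(2) subI]] I by blast
      have "U = {x + y | x y. x \<in> ?N \<and> y \<in> ?I}"
        using K(1) IU subspace_add[OF sub] by blast
      hence "list_basis (concat (map (cyclic_list T) (ps @ qs))) U"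
        using list_basis_append[OF ps(2) qs(2) int] by simp
      moreover have "\<forall>q \<in> set (ps @ qs). cyclic_data T U q" using ps(1) qs(1) mono[OF _ IU] mono[of ?N] by auto
      ultimately show ?thesis by blast
    qed
  qed
qed

end

section \<open>Families of linear relations\<close>

lemma mset_map_upt: "mset (map f [0..<n]) = (\<Sum>j<n. {#f j#})"
  by (induction n) (simp_all add: add.commute)

lemma int_threshold:
  fixes P :: "int \<Rightarrow> bool"
  assumes "\<not> P a" "P b" and mono: "\<And>i j. i \<le> j \<Longrightarrow> P i \<Longrightarrow> P j"
  shows "\<exists>i. P i \<and> \<not> P (i - 1)"
proof -
  have "a < b" using assms by (meson not_le)
  hence "P (a + int (nat (b - a)))" using assms(2) by simp
  then obtain n where n: "P (a + int n)" "\<And>m. m < n \<Longrightarrow> \<not> P (a + int m)"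
    using exists_least_iff[of "\<lambda>n. P (a + int n)"] by blast
  have "n \<noteq> 0" using n(1) assms(1) by (cases n) auto
  hence "\<not> P (a + int n - 1)" using n(2)[of "n - 1"] by (simp add: of_nat_diff algebra_simps)
  thus ?thesis using n(1) by blast
qed

context vspace
begin

lemma list_basis_index:
  assumes "list_basis L U"
  shows "(\<Sum>j<length L. c j *s L ! j) = 0 \<Longrightarrow> j < length L \<Longrightarrow> c j = 0"
    and "U = {\<Sum>j<length L. c j *s L ! j | c. True}"
proof -
  have L: "inj_on ((!) L) {..<length L}" "(!) L ` {..<length L} = set L" "independent (set L)" "span (set L) = U"
    using assms by (auto simp: list_basis_def inj_on_def nth_eq_iff_index_eq in_set_conv_nth)
  show "(\<Sum>j<length L. c j *s L ! j) = 0 \<Longrightarrow> j < length L \<Longrightarrow> c j = 0"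
    using independent_familyD[of "{..<length L}" "(!) L" c j] L by simp
  show "U = {\<Sum>j<length L. c j *s L ! j | c. True}"
    using span_image_eq[of "{..<length L}" "(!) L"] L by simp
qed

lemma list_basisI_index:
  assumes "\<And>c j. (\<Sum>j<length L. c j *s L ! j) = 0 \<Longrightarrow> j < length L \<Longrightarrow> c j = 0"
  shows "list_basis L (span (set L))"
proof -
  have i: "(!) L ` {..<length L} = set L" by (auto simp: in_set_conv_nth)
  note * = independent_familyI[of "{..<length L}" "(!) L"]
  have "inj_on ((!) L) {..<length L}" "independent (set L)"
    using * assms unfolding i by blast+
  thus ?thesis by (auto simp: list_basis_def distinct_conv_nth inj_on_def)
qed

lemma list_basis_mset: "list_basis vs U \<Longrightarrow> mset vs = mset ws \<Longrightarrow> list_basis ws U"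
  unfolding list_basis_def by (metis mset_eq_setD mset_eq_imp_distinct_iff)

lemma complement_exists:
  assumes E: "finite_subspace E" and E': "subspace E'" "E' \<subseteq> E"
  obtains U where "subspace U" "U \<subseteq> E" "U \<inter> E' = {0}" "\<And>x. x \<in> E \<Longrightarrow> \<exists>u\<in>U. x - u \<in> E'"
proof -
  obtain B' where B': "finite B'" "independent B'" "span B' = E'" "card B' = dim E'"
    by (rule fin_dim_basis[OF fin_dim_subset[OF E E']])
  have "B' \<subseteq> E" using B'(3) E'(2) span_superset[of B'] by blast
  then obtain B where B: "B' \<subseteq> B" "B \<subseteq> E" "independent B" "E \<subseteq> span B"
    by (rule maximal_independent_subset_extend[OF _ B'(2)])
  let ?U = "span (B - B')"
  have UE: "?U \<subseteq> E" using B(2) finite_subspaceD[OF E] by (intro span_minimal) auto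
  have dec: "\<exists>u\<in>?U. x - u \<in> E'" if "x \<in> E" for x
  proof -
    have "B = (B - B') \<union> B'" using B(1) by auto
    hence "x \<in> span ((B - B') \<union> B')" using that B(4) by auto
    then obtain a b where ab: "x = a + b" "a \<in> ?U" "b \<in> E'" unfolding span_Un B'(3) by blast
    thus ?thesis by (intro bexI[of _ a]) auto
  qed
  have "?U \<inter> E' = {0}"
  proof -
    have "x = 0" if x: "x \<in> ?U" "x \<in> E'" for x
    proof (rule ccontr)
      assume nz: "x \<noteq> 0"
      obtain D where "finite D" "span D = E" by (rule fin_dim_basis[OF E]) blast
      hence C: "finite B" using independent_span_bound[OF _ B(3), of D] B(2) by simp
      obtain u where u: "x = (\<Sum>v\<in>B - B'. u v *s v)" using x(1) C by (auto simp: span_finite)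
      have "x \<in> span B'" using x(2) B'(3) by simp
      then obtain w where w: "x = (\<Sum>v\<in>B'. w v *s v)" using B'(1) by (auto simp: span_finite)
      let ?f = "\<lambda>v. if v \<in> B' then - w v else u v"
      have "(\<Sum>v\<in>B. ?f v *s v) = (\<Sum>v\<in>B - B'. ?f v *s v) + (\<Sum>v\<in>B'. ?f v *s v)"
        using B(1) C by (rule sum.subset_diff)
      also have "(\<Sum>v\<in>B - B'. ?f v *s v) = x" unfolding u by (intro sum.cong) auto
      also have "(\<Sum>v\<in>B'. ?f v *s v) = - x" unfolding w by (simp add: sum_negf)
      finally have z: "(\<Sum>v\<in>B. ?f v *s v) = 0" by simp
      have "u v = 0" if "v \<in> B - B'" for v
        using independentD[OF B(3) C subset_refl z, of v] that by auto
      hence "x = 0" unfolding u by simp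
      thus False using nz by simp
    qed
    thus ?thesis using span_zero[of "B - B'"] subspace_0[OF E'(1)] by blast
  qed
  thus ?thesis using that[OF subspace_span UE _ dec] by blast
qed

end

text \<open>\<open>image_zero\<close> and \<open>preimage_zero\<close> express that a vector with
  residue 0 can be divided by \<open>t\<close>, which moves the exponent by one. The four existence
  axioms bound the exponents from both sides; those for high exponents fail for singular
  matrices.\<close>

locale relation_family = vspace scale for scale :: "'a::field \<Rightarrow> 'b::ab_group_add \<Rightarrow> 'b" (infixr \<open>*s\<close> 75) +
  fixes V :: "'b set" and R :: "int \<Rightarrow> ('b \<times> 'b) set"
  assumes V: "finite_subspace V"
    and subrel_R: "subrel (R i)"
    and R_subset: "R i \<subseteq> V \<times> V"
    and image_zero: "R i `` {0} = R (i - 1) `` V"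
    and preimage_zero: "(R i)\<inverse> `` {0} = (R (i + 1))\<inverse> `` V"
    and image_low: "\<exists>i. R i `` V = {0}" and image_high: "\<exists>i. R i `` V = V"
    and preimage_low: "\<exists>i. (R i)\<inverse> `` V = V" and preimage_high: "\<exists>i. (R i)\<inverse> `` V = {0}"
begin

text \<open>The smallest family containing 0 and \<open>V\<close> and closed under images by all
  relations. It turns out to be a finite chain, the common stable filtration.\<close>

inductive_set flag :: "'b set set" where
  zero: "{0} \<in> flag"
| whole: "V \<in> flag"
| image: "F \<in> flag \<Longrightarrow> R i `` F \<in> flag"

lemma flag_subspace: "F \<in> flag \<Longrightarrow> subspace F"
  by (induction rule: flag.induct) (use V finite_subspaceD subrel_Image[OF subrel_R] in auto)

lemma flag_subset: "F \<in> flag \<Longrightarrow> F \<subseteq> V"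
  by (induction rule: flag.induct) (use subspace_0[OF finite_subspaceD[OF V]] R_subset in auto)

lemma flag_0: "F \<in> flag \<Longrightarrow> 0 \<in> F"
  using flag_subspace subspace_0 by blast

lemma image_bounds: "F \<in> flag \<Longrightarrow> R (i - 1) `` V \<subseteq> R i `` F" "F \<in> flag \<Longrightarrow> R i `` F \<subseteq> R i `` V"
  using flag_0 flag_subset image_zero[of i] by blast+

lemma image_mono: "i \<le> j \<Longrightarrow> R i `` V \<subseteq> R j `` V"
proof (induction j rule: int_ge_induct)
  case (step j)
  have "R j `` V \<subseteq> R (j + 1) `` V" using image_bounds(1)[OF flag.whole, of "j + 1"] by simp
  thus ?case using step by blast
qed simp

lemma preimage_antimono: "i \<le> j \<Longrightarrow> (R j)\<inverse> `` V \<subseteq> (R i)\<inverse> `` V"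
proof (induction j rule: int_ge_induct)
  case (step j)
  have "(R (j + 1))\<inverse> `` V \<subseteq> (R j)\<inverse> `` V" using preimage_zero[of j] flag_0[OF flag.whole] by blast
  thus ?case using step by blast
qed simp

text \<open>Images at different exponents are separated by the image of \<open>V\<close> at the
  smaller one; at the same exponent the comparison reduces to the subspaces from which they
  arise.\<close>

lemma flag_chain: "F \<in> flag \<Longrightarrow> G \<in> flag \<Longrightarrow> F \<subseteq> G \<or> G \<subseteq> F"
proof (induction F arbitrary: G rule: flag.induct)
  case zero thus ?case using flag_0 by blast
next
  case whole thus ?case using flag_subset by blast
next
  case (image F i)
  from image(3) show ?case
  proof cases
    case zero thus ?thesis using flag_0[OF flag.image[OF image(1)]] by blast
  next
    case whole thus ?thesis using flag_subset[OF flag.image[OF image(1)]] by blast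
  next
    case (image G' j)
    consider "i < j" | "j < i" | "i = j" by linarith
    thus ?thesis
    proof cases
      case 1
      have "R i `` F \<subseteq> R i `` V" by (rule image_bounds(2)[OF \<open>F \<in> flag\<close>])
      also have "\<dots> \<subseteq> R (j - 1) `` V" using 1 by (intro image_mono) simp
      also have "\<dots> \<subseteq> R j `` G'" by (rule image_bounds(1)[OF image(2)])
      finally show ?thesis using image(1) by simp
    next
      case 2
      have "R j `` G' \<subseteq> R j `` V" by (rule image_bounds(2)[OF image(2)])
      also have "\<dots> \<subseteq> R (i - 1) `` V" using 2 by (intro image_mono) simp
      also have "\<dots> \<subseteq> R i `` F" by (rule image_bounds(1)[OF \<open>F \<in> flag\<close>])
      finally show ?thesis using image(1) by simp
    next
      case 3 thus ?thesis using \<open>\<And>G. G \<in> flag \<Longrightarrow> F \<subseteq> G \<or> G \<subseteq> F\<close>[OF image(2)] image(1) by blast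
    qed
  qed
qed

lemma flag_finite_subspace: "F \<in> flag \<Longrightarrow> finite_subspace F"
  using fin_dim_subset[OF V] flag_subspace flag_subset by blast

text \<open>In a chain of subspaces the dimension determines the member.\<close>

lemma finite_flag: "finite flag"
proof (rule finite_imageD)
  have "dim F \<le> dim V" if "F \<in> flag" for F
  proof (cases "F = V")
    case False
    hence "F \<subset> V" using flag_subset[OF that] by blast
    thus ?thesis using dim_less[OF V flag_subspace[OF that]] by simp
  qed simp
  hence "dim ` flag \<subseteq> {..dim V}" by auto
  thus "finite (dim ` flag)" by (rule finite_subset) simp
  show "inj_on dim flag"
  proof (rule inj_onI, rule ccontr)
    fix F G assume FG: "F \<in> flag" "G \<in> flag" "dim F = dim G" "F \<noteq> G"
    hence "F \<subset> G \<or> G \<subset> F" using flag_chain by blast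
    thus False
      using FG(3) dim_less[OF flag_finite_subspace[OF FG(2)] flag_subspace[OF FG(1)]]
        dim_less[OF flag_finite_subspace[OF FG(1)] flag_subspace[OF FG(2)]] by auto
  qed
qed

text \<open>A nonzero member \<open>F\<close> stands for the graded piece of the chain, the quotient
  of \<open>F\<close> by its predecessor \<open>pre F\<close>.\<close>

definition jumps :: "'b set set" where "jumps = flag - {{0}}"

definition pre :: "'b set \<Rightarrow> 'b set" where
  "pre F = (SOME P. P \<in> flag \<and> P \<subset> F \<and> (\<forall>G \<in> flag. G \<subset> F \<longrightarrow> G \<subseteq> P))"

lemma pre: assumes "F \<in> jumps"
  shows "pre F \<in> flag" "pre F \<subset> F" "\<And>G. G \<in> flag \<Longrightarrow> G \<subset> F \<Longrightarrow> G \<subseteq> pre F"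
proof -
  let ?A = "{G \<in> flag. G \<subset> F}"
  have fin: "finite ?A" using finite_flag by simp
  have "{0} \<in> ?A" using assms flag.zero flag_0 by (auto simp: jumps_def)
  hence ne: "?A \<noteq> {}" by blast
  obtain P where P: "P \<in> ?A" "\<forall>G \<in> ?A. P \<subseteq> G \<longrightarrow> P = G"
    by (rule bexE[OF finite_has_maximal[OF fin ne]])
  have "P \<in> flag \<and> P \<subset> F \<and> (\<forall>G \<in> flag. G \<subset> F \<longrightarrow> G \<subseteq> P)"
    using P flag_chain by blast
  hence "pre F \<in> flag \<and> pre F \<subset> F \<and> (\<forall>G \<in> flag. G \<subset> F \<longrightarrow> G \<subseteq> pre F)"
    unfolding pre_def by (rule someI)
  thus "pre F \<in> flag" "pre F \<subset> F" "\<And>G. G \<in> flag \<Longrightarrow> G \<subset> F \<Longrightarrow> G \<subseteq> pre F" by auto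
qed

text \<open>The exponent at which \<open>F\<close> appears in the growing images of
  \<open>V\<close>; these numbers become the entries of \<nu> and \<mu>.\<close>

definition letter :: "'b set \<Rightarrow> int" where
  "letter F = (SOME i. F \<subseteq> R i `` V \<and> \<not> F \<subseteq> R (i - 1) `` V)"

lemma letter: assumes "F \<in> jumps"
  shows "F \<subseteq> R (letter F) `` V" "\<not> F \<subseteq> R (letter F - 1) `` V"
proof -
  have F: "F \<in> flag" "F \<noteq> {0}" using assms by (auto simp: jumps_def)
  obtain a where a: "R a `` V = {0}" using image_low by blast
  obtain b where b: "R b `` V = V" using image_high by blast
  have "\<exists>i. F \<subseteq> R i `` V \<and> \<not> F \<subseteq> R (i - 1) `` V"
  proof (rule int_threshold)
    show "\<not> F \<subseteq> R a `` V" using F flag_0 a by blast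
    show "F \<subseteq> R b `` V" using b flag_subset[OF F(1)] by simp
  qed (use image_mono in blast)
  hence "F \<subseteq> R (letter F) `` V \<and> \<not> F \<subseteq> R (letter F - 1) `` V" unfolding letter_def by (rule someI_ex)
  thus "F \<subseteq> R (letter F) `` V" "\<not> F \<subseteq> R (letter F - 1) `` V" by auto
qed

lemma letter_unique:
  assumes "F \<in> jumps" "F \<subseteq> R i `` V" "\<not> F \<subseteq> R (i - 1) `` V"
  shows "letter F = i"
proof (rule ccontr)
  assume "letter F \<noteq> i"
  then consider "letter F \<le> i - 1" | "i \<le> letter F - 1" by linarith
  thus False
    using letter[OF assms(1)] assms(2,3) image_mono by cases blast+
qed

text \<open>Choosing the least source of \<open>F\<close> under \<open>R (letter F)\<close> ensures
  that \<open>pre (sig F)\<close> is too small to reach \<open>F\<close>, so that the relation links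
  the graded piece at \<open>sig F\<close> with the one at \<open>F\<close>.\<close>

definition sig :: "'b set \<Rightarrow> 'b set" where
  "sig F = (SOME G. G \<in> flag \<and> F = R (letter F) `` G \<and> (\<forall>G' \<in> flag. F \<subseteq> R (letter F) `` G' \<longrightarrow> G \<subseteq> G'))"

lemma sig: assumes "F \<in> jumps"
  shows "sig F \<in> jumps" "F = R (letter F) `` sig F" "\<And>G. G \<in> flag \<Longrightarrow> F \<subseteq> R (letter F) `` G \<Longrightarrow> sig F \<subseteq> G"
proof -
  have F: "F \<in> flag" "F \<noteq> {0}" using assms by (auto simp: jumps_def)
  let ?i = "letter F"
  note l = letter[OF assms]
  have ex: "\<exists>G \<in> flag. F = R ?i `` G"
    using F(1)
  proof cases
    case zero thus ?thesis using F by simp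
  next
    case whole
    hence "F = R ?i `` V" using l(1) R_subset by blast
    thus ?thesis using flag.whole by blast
  next
    case (image G j)
    consider "j \<le> ?i - 1" | "?i \<le> j - 1" | "j = ?i" by linarith
    thus ?thesis
    proof cases
      case 1 thus ?thesis using l(2) image image_bounds(2)[OF image(2), of j] image_mono by blast
    next
      case 2
      have "R ?i `` V \<subseteq> F" using image image_bounds(1)[OF image(2), of j] image_mono[OF 2] by blast
      hence "F = R ?i `` V" using l(1) by blast
      thus ?thesis using flag.whole by blast
    next
      case 3 thus ?thesis using image by blast
    qed
  qed
  then obtain G0 where G0: "G0 \<in> flag" "F = R ?i `` G0" by blast
  let ?A = "{G \<in> flag. F \<subseteq> R ?i `` G}"
  have fin: "finite ?A" using finite_flag by simp
  have "G0 \<in> ?A" using G0 by simp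
  hence ne: "?A \<noteq> {}" by blast
  obtain G where G: "G \<in> ?A" "\<forall>G' \<in> ?A. G' \<subseteq> G \<longrightarrow> G = G'"
    by (rule bexE[OF finite_has_minimal[OF fin ne]])
  have least: "G \<subseteq> G'" if "G' \<in> flag" "F \<subseteq> R ?i `` G'" for G' using G flag_chain[of G G'] that by blast
  have "F = R ?i `` G" using G(1) least[OF G0(1)] G0(2) by blast
  hence "G \<in> flag \<and> F = R ?i `` G \<and> (\<forall>G' \<in> flag. F \<subseteq> R ?i `` G' \<longrightarrow> G \<subseteq> G')" using G(1) least by blast
  hence s: "sig F \<in> flag \<and> F = R ?i `` sig F \<and> (\<forall>G' \<in> flag. F \<subseteq> R ?i `` G' \<longrightarrow> sig F \<subseteq> G')"
    unfolding sig_def by (rule someI)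
  thus "F = R (letter F) `` sig F" "\<And>G. G \<in> flag \<Longrightarrow> F \<subseteq> R (letter F) `` G \<Longrightarrow> sig F \<subseteq> G" by auto
  have "sig F \<noteq> {0}"
  proof
    assume "sig F = {0}"
    hence "F = R ?i `` {0}" using s by simp
    thus False using l(2) image_zero[of ?i] by simp
  qed
  thus "sig F \<in> jumps" using s by (simp add: jumps_def)
qed

text \<open>The image of \<open>pre (sig F)\<close> misses part of \<open>F\<close> by minimality of
  \<open>sig F\<close>. Conversely, if \<open>pre F\<close> is not already contained in the image of
  \<open>V\<close> at the previous exponent, it is a jump with the same letter, and its own source
  is strictly smaller than \<open>sig F\<close>.\<close>

lemma pre_sig: assumes F: "F \<in> jumps" shows "pre F = R (letter F) `` pre (sig F)"
proof
  let ?i = "letter F"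
  note s = sig[OF F] and p = pre[OF sig(1)[OF F]]
  have ne: "\<not> F \<subseteq> R ?i `` pre (sig F)" using s(3)[OF p(1)] p(2) by blast
  have "R ?i `` pre (sig F) \<subseteq> F" using s(2) p(2) by blast
  thus "R ?i `` pre (sig F) \<subseteq> pre F" using pre(3)[OF F flag.image[OF p(1)]] ne by blast
  let ?H = "pre F"
  show "?H \<subseteq> R ?i `` pre (sig F)"
  proof (cases "?H \<subseteq> R (?i - 1) `` V")
    case True
    thus ?thesis using image_bounds(1)[OF p(1), of ?i] by blast
  next
    case False
    have H: "?H \<in> jumps" using pre(1)[OF F] False flag_0[OF flag.image[OF flag.whole]] by (auto simp: jumps_def)
    have l: "letter ?H = ?i" using letter_unique[OF H _ False] letter(1)[OF F] pre(2)[OF F] by blast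
    note sH = sig[OF H, unfolded l]
    have "\<not> sig F \<subseteq> sig ?H" using sH(2) s(2) pre(2)[OF F] by blast
    hence "sig ?H \<subset> sig F" using flag_chain[of "sig F" "sig ?H"] s(1) sH(1) by (auto simp: jumps_def)
    hence "sig ?H \<subseteq> pre (sig F)" using p(3) sH(1) by (auto simp: jumps_def)
    thus ?thesis using sH(2) by blast
  qed
qed

text \<open>By finiteness it suffices to find, for each jump \<open>G\<close>, a jump
  \<open>F\<close> with \<open>sig F = G\<close>.\<close>

lemma sig_bij: "bij_betw sig jumps jumps"
proof -
  have fin: "finite jumps" using finite_flag by (simp add: jumps_def)
  have "jumps \<subseteq> sig ` jumps"
  proof
    fix G assume G: "G \<in> jumps"
    hence Gf: "G \<in> flag" by (simp add: jumps_def)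
    note p = pre[OF G]
    \<comment> \<open>Take the last exponent \<open>j\<close> whose domain still meets
      \<open>G\<close> outside \<open>pre G\<close>. Two vectors with a common image under
      \<open>R j\<close> differ by an element of the domain at \<open>j + 1\<close>, which within
      \<open>G\<close> lies in \<open>pre G\<close>; so the image of \<open>G\<close> is strictly
      larger than that of \<open>pre G\<close>.\<close>
    let ?P = "\<lambda>i. G \<inter> (R i)\<inverse> `` V \<subseteq> pre G"
    obtain a where a: "(R a)\<inverse> `` V = V" using preimage_low by blast
    obtain b where b: "(R b)\<inverse> `` V = {0}" using preimage_high by blast
    have "\<exists>i. ?P i \<and> \<not> ?P (i - 1)"
    proof (rule int_threshold)
      show "\<not> ?P a" unfolding a using flag_subset[OF Gf] p(2) by blast
      show "?P b" unfolding b using flag_0[OF p(1)] by blast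
    qed (use preimage_antimono in blast)
    then obtain i where i: "?P i" "\<not> ?P (i - 1)" by blast
    define j where "j = i - 1"
    have j: "G \<inter> (R (j + 1))\<inverse> `` V \<subseteq> pre G" "\<not> G \<inter> (R j)\<inverse> `` V \<subseteq> pre G" using i by (auto simp: j_def)
    then obtain x y where x: "x \<in> G" "x \<notin> pre G" "(x, y) \<in> R j" by blast
    let ?F = "R j `` G"
    have y: "y \<notin> R j `` pre G"
    proof
      assume "y \<in> R j `` pre G"
      then obtain x' where x': "x' \<in> pre G" "(x', y) \<in> R j" by blast
      have "(x - x', y - y) \<in> R j" by (rule subrel_diff[OF subrel_R x(3) x'(2)])
      hence "x - x' \<in> (R (j + 1))\<inverse> `` V" unfolding preimage_zero[symmetric] by simp
      moreover have "x - x' \<in> G" using x(1) x'(1) p(2) subspace_diff[OF flag_subspace[OF Gf]] by blast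
      ultimately have "x - x' \<in> pre G" using j(1) by blast
      hence "x - x' + x' \<in> pre G" using x'(1) subspace_add[OF flag_subspace[OF p(1)]] by blast
      thus False using x(2) by simp
    qed
    have F: "?F \<in> flag" by (rule flag.image[OF Gf])
    have nF: "\<not> ?F \<subseteq> R j `` pre G" using x y by blast
    have nF': "\<not> ?F \<subseteq> R (j - 1) `` V" using nF image_bounds(1)[OF p(1), of j] by blast
    have "?F \<noteq> {0}"
    proof
      assume "?F = {0}"
      hence "y = 0" using x by blast
      thus False using y flag_0[OF flag.image[OF p(1), of j]] by simp
    qed
    hence FJ: "?F \<in> jumps" using F by (simp add: jumps_def)
    have l: "letter ?F = j" using letter_unique[OF FJ _ nF'] image_bounds(2)[OF Gf] by blast
    note s = sig[OF FJ, unfolded l]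
    have "sig ?F \<subseteq> G" using s(3)[OF Gf] by blast
    moreover have "\<not> sig ?F \<subset> G"
    proof
      assume "sig ?F \<subset> G"
      hence "sig ?F \<subseteq> pre G" using p(3) s(1) by (auto simp: jumps_def)
      hence "?F \<subseteq> R j `` pre G" using s(2) by blast
      thus False using nF by blast
    qed
    ultimately have "sig ?F = G" by blast
    thus "G \<in> sig ` jumps" using FJ by blast
  qed
  moreover have "sig ` jumps \<subseteq> jumps" using sig(1) by blast
  ultimately have "sig ` jumps = jumps" by blast
  thus ?thesis unfolding bij_betw_def using finite_surj_inj[OF fin] by simp
qed

section \<open>Words read along the orbits of the permutation\<close>

lemma funpow_sig: "F \<in> jumps \<Longrightarrow> (sig ^^ s) F \<in> jumps"
  by (induction s) (auto intro: sig(1))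

text \<open>The first letter is applied last: a pair (u, x) is a path whose cell 0 is
  \<open>x\<close> and whose cell \<open>p\<close> is \<open>u\<close>, each cell being an image of
  the next one. This matches the edges of a band.\<close>

fun word_rel :: "(nat \<Rightarrow> int) \<Rightarrow> nat \<Rightarrow> ('b \<times> 'b) set" where
  "word_rel w 0 = Id"
| "word_rel w (Suc p) = word_rel (\<lambda>s. w (Suc s)) p O R (w 0)"

lemma subrel_word: "subrel (word_rel w p)"
proof (induction p arbitrary: w)
  case 0 show ?case by (simp add: subrel_def)
next
  case (Suc p) show ?case by (simp add: subrel_relcomp[OF Suc subrel_R])
qed

lemma word_rel_add: "word_rel w (a + b) = word_rel (\<lambda>s. w (a + s)) b O word_rel w a"
  by (induction a arbitrary: w) (simp_all add: O_assoc)

lemma word_rel_chain: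
  "(u, x) \<in> word_rel w n \<Longrightarrow> \<exists>c. c 0 = x \<and> c n = u \<and> (\<forall>s < n. (c (Suc s), c s) \<in> R (w s))"
proof (induction n arbitrary: w x)
  case 0 thus ?case by (intro exI[of _ "\<lambda>_. x"]) simp
next
  case (Suc n)
  then obtain y where y: "(u, y) \<in> word_rel (\<lambda>s. w (Suc s)) n" "(y, x) \<in> R (w 0)" by auto
  obtain c where c: "c 0 = y" "c n = u" "\<forall>s < n. (c (Suc s), c s) \<in> R (w (Suc s))" using Suc(1)[OF y(1)] by blast
  let ?c = "case_nat x c"
  have "(?c (Suc s), ?c s) \<in> R (w s)" if "s < Suc n" for s
    using that c y(2) by (cases s) auto
  thus ?case using c(2) by (intro exI[of _ ?c]) auto
qed

definition word :: "'b set \<Rightarrow> nat \<Rightarrow> int" where "word F s = letter ((sig ^^ s) F)"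

lemma word_Suc: "(\<lambda>s. word F (Suc s)) = word (sig F)"
  by (simp add: word_def fun_eq_iff funpow_swap1)

lemma word_add: "(\<lambda>s. word F (a + s)) = word ((sig ^^ a) F)"
  by (simp add: word_def fun_eq_iff funpow_add add.commute[of a])

lemma word_rel_flag:
  assumes "F \<in> jumps"
  shows "word_rel (word F) p `` ((sig ^^ p) F) = F" "word_rel (word F) p `` pre ((sig ^^ p) F) = pre F"
proof -
  have "word_rel (word F) p `` ((sig ^^ p) F) = F \<and> word_rel (word F) p `` pre ((sig ^^ p) F) = pre F"
    using assms
  proof (induction p arbitrary: F)
    case (Suc p)
    have "(sig ^^ Suc p) F = (sig ^^ p) (sig F)" by (simp add: funpow_swap1)
    moreover have "word F 0 = letter F" by (simp add: word_def)
    ultimately show ?case using Suc(1)[OF sig(1)[OF Suc(2)]] sig(2)[OF Suc(2)] pre_sig[OF Suc(2)]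
      by (simp add: word_Suc relcomp_Image del: funpow.simps)
  qed simp
  thus "word_rel (word F) p `` ((sig ^^ p) F) = F" "word_rel (word F) p `` pre ((sig ^^ p) F) = pre F" by auto
qed

text \<open>Induction over the construction of \<open>G\<close>. A smaller exponent than
  \<open>letter F\<close> places \<open>G\<close> in the image of 0 under one relation; a larger one
  would make \<open>G\<close> contain \<open>F\<close>; an equal one passes to the source and to
  \<open>sig F\<close>.\<close>

lemma below_nilpotent: "G \<in> flag \<Longrightarrow> F \<in> jumps \<Longrightarrow> G \<subset> F \<Longrightarrow> \<exists>p. G \<subseteq> word_rel (word F) p `` {0}"
proof (induction G arbitrary: F rule: flag.induct)
  case zero show ?case by (intro exI[of _ 0]) simp
next
  case whole
  thus ?case using flag_subset by (auto simp: jumps_def)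
next
  case (image G i)
  let ?j = "letter F"
  have w0: "word F 0 = ?j" by (simp add: word_def)
  have w1: "word_rel (word F) (Suc p) = word_rel (word (sig F)) p O R ?j" for p by (simp add: word_Suc w0)
  consider "i \<le> ?j - 1" | "?j \<le> i - 1" | "i = ?j" by linarith
  thus ?case
  proof cases
    case 1
    have "R i `` G \<subseteq> R (?j - 1) `` V" using image_bounds(2)[OF image(1), of i] image_mono[OF 1] by blast
    hence "R i `` G \<subseteq> word_rel (word F) 1 `` {0}" using image_zero[of ?j] by (simp add: w0)
    thus ?thesis by blast
  next
    case 2
    have "F \<subseteq> R i `` G" using letter(1)[OF image(3)] image_mono[OF 2] image_bounds(1)[OF image(1), of i] by blast
    thus ?thesis using image(4) by blast
  next
    case 3
    note s = sig[OF image(3)]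
    have "\<not> sig F \<subseteq> G" using s(2) image(4) 3 by blast
    hence "G \<subset> sig F" using flag_chain[OF image(1)] s(1) by (auto simp: jumps_def)
    then obtain p where "G \<subseteq> word_rel (word (sig F)) p `` {0}" using image(2)[OF s(1)] by blast
    hence "R i `` G \<subseteq> word_rel (word F) (Suc p) `` {0}" unfolding w1 3 relcomp_Image by blast
    thus ?thesis by blast
  qed
qed

text \<open>If \<open>F\<close> were strictly inside \<open>G\<close>, it would be reached from 0
  along a prefix of the common word, but along the word of \<open>F\<close> one only gets from 0
  into \<open>pre F\<close>. This is the source of nonperiodicity.\<close>

lemma equal_words:
  assumes "F \<in> jumps" "G \<in> jumps" "word F = word G"
  shows "F = G"
proof -
  have *: False if F: "F \<in> jumps" "G \<in> jumps" "word F = word G" "F \<subset> G" for F G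
  proof -
    obtain p where p: "F \<subseteq> word_rel (word G) p `` {0}"
      using below_nilpotent[OF _ F(2,4)] F(1) by (auto simp: jumps_def)
    have "{0} \<subseteq> pre ((sig ^^ p) F)" using flag_0[OF pre(1)[OF funpow_sig[OF F(1)]]] by simp
    hence "word_rel (word G) p `` {0} \<subseteq> word_rel (word F) p `` pre ((sig ^^ p) F)"
      unfolding F(3) by (rule Image_mono[OF subset_refl])
    hence "F \<subseteq> pre F" using p unfolding word_rel_flag(2)[OF F(1)] by simp
    thus False using pre(2)[OF F(1)] by blast
  qed
  have "F \<subseteq> G \<or> G \<subseteq> F" using flag_chain assms by (auto simp: jumps_def)
  thus ?thesis using *[OF assms] *[OF assms(2,1) assms(3)[symmetric]] by blast
qed

text \<open>The splitting of one step of the filtration along a closed orbit: a section whose defect lies in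
  the \<open>(k+1)\<close>-st step of the nilpotent part is corrected to one with defect in the \<open>k\<close>-th step.\<close>

lemma cycle_section:
  assumes F: "F \<in> jumps" and n: "0 < n" "(sig ^^ n) F = F"
  obtains U T s where "subspace U" "U \<subseteq> F" "U \<inter> pre F = {0}" "\<And>x. x \<in> F \<Longrightarrow> \<exists>u\<in>U. x - u \<in> pre F"
    "Vector_Spaces.linear scale scale T" "T ` U \<subseteq> U" "\<And>x. x \<in> U \<Longrightarrow> T x = 0 \<Longrightarrow> x = 0"
    "Vector_Spaces.linear scale scale s" "\<And>x. x \<in> U \<Longrightarrow> s x - x \<in> pre F"
    "\<And>x. x \<in> U \<Longrightarrow> (s x, s (T x)) \<in> word_rel (word F) n"
proof -
  define E where "E = pre F"
  define Rn where "Rn = word_rel (word F) n"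
  have Ff: "F \<in> flag" using F by (simp add: jumps_def)
  have E: "subspace E" "E \<subseteq> F" using flag_subspace[OF pre(1)[OF F]] pre(2)[OF F] by (auto simp: E_def)
  note subF = flag_subspace[OF Ff]
  have Rn: "subrel Rn" unfolding Rn_def by (rule subrel_word)
  have RF: "Rn `` F = F" "Rn `` E = E" using word_rel_flag[OF F, of n] unfolding Rn_def E_def n(2) by auto
  \<comment> \<open>What is reached from 0 after \<open>k\<close> rounds. These subspaces exhaust
    \<open>pre F\<close> after finitely many rounds and measure how far a section is from being
    exact.\<close>
  define Z where "Z = (\<lambda>k. word_rel (word F) (n * k) `` {0})"
  have Z0: "Z 0 = {0}" by (simp add: Z_def)
  have per: "(\<lambda>s. word F (n + s)) = word F" unfolding word_add n(2) ..
  have ZS: "Z (Suc k) = Rn `` Z k" for k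
    unfolding Z_def Rn_def using word_rel_add[of "word F" n "n * k"] per by (simp add: relcomp_Image)
  have subZ: "subspace (Z k)" for k unfolding Z_def by (intro subrel_Image subrel_word) simp
  have ZE: "Z k \<subseteq> E" for k
  proof (induction k)
    case 0 thus ?case using Z0 subspace_0[OF E(1)] by simp
  next
    case (Suc k) thus ?case using ZS RF(2) by blast
  qed
  obtain K where K: "E \<subseteq> Z K"
  proof -
    obtain p where p: "E \<subseteq> word_rel (word F) p `` {0}"
      using below_nilpotent[OF pre(1)[OF F] F pre(2)[OF F]] unfolding E_def by blast
    have "p \<le> n * p" using n(1) by simp
    then obtain d where d: "n * p = p + d" using le_Suc_ex by blast
    have "0 \<in> word_rel (\<lambda>s. word F (p + s)) d `` {0}" using subrel_0[OF subrel_word] by blast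
    hence "word_rel (word F) p `` {0} \<subseteq> Z p" unfolding Z_def d word_rel_add relcomp_Image by blast
    thus ?thesis using that p by blast
  qed
  obtain U where U: "subspace U" "U \<subseteq> F" "U \<inter> E = {0}" "\<And>x. x \<in> F \<Longrightarrow> \<exists>u\<in>U. x - u \<in> E"
    by (rule complement_exists[OF flag_finite_subspace[OF Ff] E]) blast
  have finU: "finite_subspace U" by (rule fin_dim_subset[OF flag_finite_subspace[OF Ff] U(1,2)])
  have "subrel {(x, u). u \<in> U \<and> x - u \<in> E}"
    unfolding subrel_def using U(1) E(1)
    by (auto simp: subspace_0 subspace_add subspace_scale add_diff_add scale_right_diff_distrib[symmetric])
  then obtain P where P: "Vector_Spaces.linear scale scale P" "\<And>x. x \<in> F \<Longrightarrow> (x, P x) \<in> {(x, u). u \<in> U \<and> x - u \<in> E}"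
    by (rule linear_selection[OF subF]) (use U(4) in auto)
  have "subrel {(x, y). y \<in> F \<and> (y, x) \<in> Rn}"
    unfolding subrel_def using subF Rn by (auto simp: subspace_0 subspace_add subspace_scale subrel_0 subrel_add subrel_scale)
  then obtain y where y: "Vector_Spaces.linear scale scale y" "\<And>x. x \<in> U \<Longrightarrow> (x, y x) \<in> {(x, y). y \<in> F \<and> (y, x) \<in> Rn}"
    by (rule linear_selection[OF U(1)]) (use U(2) RF(1) in auto)
  \<comment> \<open>\<open>y\<close> chooses a predecessor under one round \<open>Rn\<close>, and
    \<open>P\<close> projects it to the complement \<open>U\<close> of \<open>pre F\<close>. Thus
    \<theta> is the map induced by the inverse relation, and the monodromy \<open>T\<close> is its
    inverse on \<open>U\<close>.\<close>
  define \<theta> where "\<theta> = P \<circ> y"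
  have \<theta>: "Vector_Spaces.linear scale scale \<theta>" unfolding \<theta>_def by (rule Vector_Spaces.linear_compose[OF y(1) P(1)])
  have y': "y x \<in> F" "(y x, x) \<in> Rn" "\<theta> x \<in> U" "y x - \<theta> x \<in> E" if "x \<in> U" for x
    using y(2)[OF that] P(2)[of "y x"] by (auto simp: \<theta>_def)
  have \<theta>inj: "x = 0" if x: "x \<in> U" "\<theta> x = 0" for x
  proof -
    have "y x \<in> E" using y'(4)[OF x(1)] x(2) by simp
    hence "x \<in> Rn `` E" using y'(2)[OF x(1)] by blast
    thus ?thesis using RF(2) U(3) x(1) by blast
  qed
  have \<theta>U: "\<theta> ` U = U" by (rule linear_surj_of_inj[OF \<theta> finU _ \<theta>inj]) (use y'(3) in auto)
  have \<theta>_add: "\<theta> (a + b) = \<theta> a + \<theta> b" and \<theta>_scale: "\<theta> (c *s a) = c *s \<theta> a" for a b c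
    using \<theta> by (simp_all add: Vector_Spaces.linear_iff)
  have \<theta>0: "\<theta> 0 = 0" using \<theta>_scale[of 0 0] by simp
  have "subrel {(a, x). x \<in> U \<and> a = \<theta> x}"
    unfolding subrel_def using U(1) by (auto simp: subspace_0 subspace_add subspace_scale \<theta>_add \<theta>_scale \<theta>0)
  then obtain T where T: "Vector_Spaces.linear scale scale T" "\<And>a. a \<in> U \<Longrightarrow> (a, T a) \<in> {(a, x). x \<in> U \<and> a = \<theta> x}"
    by (rule linear_selection[OF U(1)]) (use \<theta>U in blast, blast)
  have TU: "T a \<in> U" "\<theta> (T a) = a" if "a \<in> U" for a using T(2)[OF that] by auto
  have T\<theta>: "T (\<theta> x) = x" if x: "x \<in> U" for x
  proof -
    have d: "T (\<theta> x) - x \<in> U" using TU(1)[OF y'(3)[OF x]] x subspace_diff[OF U(1)] by blast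
    have "\<theta> (T (\<theta> x) - x + x) = \<theta> x" using TU(2)[OF y'(3)[OF x]] by simp
    hence "\<theta> (T (\<theta> x) - x) = 0" unfolding \<theta>_add by simp
    thus ?thesis using \<theta>inj[OF d] by simp
  qed
  \<comment> \<open>If \<open>s\<close> has defect \<open>f\<close> in \<open>Z (Suc k)\<close>,
    then \<open>f (T x)\<close> has a predecessor \<open>f' x\<close> in \<open>Z k\<close>.
    Replacing \<open>s x\<close> by \<open>s x + f (T x)\<close> absorbs the old defect, because
    \<open>T (\<theta> x) = x\<close>, and leaves the defect \<open>f'\<close>.\<close>
  have step: "\<exists>s f. Vector_Spaces.linear scale scale s \<and> Vector_Spaces.linear scale scale f \<and>
      (\<forall>x\<in>U. s x - x \<in> E \<and> f x \<in> Z k \<and> (s (\<theta> x) + f x, s x) \<in> Rn)"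
    if "\<exists>s f. Vector_Spaces.linear scale scale s \<and> Vector_Spaces.linear scale scale f \<and>
      (\<forall>x\<in>U. s x - x \<in> E \<and> f x \<in> Z (Suc k) \<and> (s (\<theta> x) + f x, s x) \<in> Rn)" for k
  proof -
    from that obtain s f where *: "Vector_Spaces.linear scale scale s \<and> Vector_Spaces.linear scale scale f \<and>
      (\<forall>x\<in>U. s x - x \<in> E \<and> f x \<in> Z (Suc k) \<and> (s (\<theta> x) + f x, s x) \<in> Rn)" by (elim exE)
    have s: "Vector_Spaces.linear scale scale s" and f: "Vector_Spaces.linear scale scale f"
      and sf: "\<And>x. x \<in> U \<Longrightarrow> s x - x \<in> E" "\<And>x. x \<in> U \<Longrightarrow> f x \<in> Z (Suc k)" "\<And>x. x \<in> U \<Longrightarrow> (s (\<theta> x) + f x, s x) \<in> Rn"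
      using * by auto
    have fT_add: "f (T (a + b)) = f (T a) + f (T b)" and fT_scale: "f (T (c *s a)) = c *s f (T a)" for a b c
      using f T(1) by (simp_all add: Vector_Spaces.linear_iff)
    have fT0: "f (T 0) = 0" using fT_scale[of 0 0] by simp
    have "subrel {(x, g). g \<in> Z k \<and> (g, f (T x)) \<in> Rn}"
      unfolding subrel_def using subZ[of k] Rn
      by (auto simp: subspace_0 subspace_add subspace_scale subrel_0 subrel_add subrel_scale fT_add fT_scale fT0)
    moreover have "\<exists>g. (x, g) \<in> {(x, g). g \<in> Z k \<and> (g, f (T x)) \<in> Rn}" if "x \<in> U" for x
      using sf(2)[OF TU(1)[OF that]] unfolding ZS by blast
    ultimately obtain f' where f': "Vector_Spaces.linear scale scale f'"
      "\<And>x. x \<in> U \<Longrightarrow> (x, f' x) \<in> {(x, g). g \<in> Z k \<and> (g, f (T x)) \<in> Rn}"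
      by (rule linear_selection[OF U(1)]) auto
    let ?s = "\<lambda>x. s x + f (T x)"
    have "Vector_Spaces.linear scale scale ?s"
      using s by (simp add: Vector_Spaces.linear_iff fT_add fT_scale scale_right_distrib)
    moreover have "?s x - x \<in> E \<and> f' x \<in> Z k \<and> (?s (\<theta> x) + f' x, ?s x) \<in> Rn" if x: "x \<in> U" for x
    proof -
      have "(s x - x) + f (T x) \<in> E" using sf(1)[OF x] sf(2)[OF TU(1)[OF x]] ZE subspace_add[OF E(1)] by blast
      moreover have "(s (\<theta> x) + f x + f' x, s x + f (T x)) \<in> Rn"
        using subrel_add[OF Rn sf(3)[OF x]] f'(2)[OF x] by blast
      ultimately show ?thesis using f'(2)[OF x] T\<theta>[OF x] by (simp add: algebra_simps)
    qed
    ultimately show ?thesis using f'(1) by blast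
  qed
  have "\<exists>s f. Vector_Spaces.linear scale scale s \<and> Vector_Spaces.linear scale scale f \<and>
      (\<forall>x\<in>U. s x - x \<in> E \<and> f x \<in> Z (K - k) \<and> (s (\<theta> x) + f x, s x) \<in> Rn)" for k
  proof (induction k)
    case 0
    \<comment> \<open>The correction starts with the identity, whose defect is the part of
      \<open>y x\<close> removed by the projection; it lies in \<open>pre F\<close> and hence in
      \<open>Z K\<close>.\<close>
    have "Vector_Spaces.linear scale scale (\<lambda>x. x)" by (simp add: Vector_Spaces.linear_iff vector_space_axioms)
    moreover have "Vector_Spaces.linear scale scale (\<lambda>x. y x - \<theta> x)"
      using y(1) \<theta> by (simp add: Vector_Spaces.linear_iff scale_right_diff_distrib)
    ultimately show ?case using y' K subspace_0[OF E(1)]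
      by (intro exI[of _ "\<lambda>x. x"] exI[of _ "\<lambda>x. y x - \<theta> x"]) auto
  next
    case (Suc k)
    show ?case
    proof (cases "k < K")
      case True
      hence "K - k = Suc (K - Suc k)" by simp
      thus ?thesis using step[of "K - Suc k"] Suc by simp
    next
      case False
      hence "K - Suc k = K - k" by simp
      thus ?thesis using Suc by simp
    qed
  qed
  from this[of K] obtain s f where *: "Vector_Spaces.linear scale scale s \<and> Vector_Spaces.linear scale scale f \<and>
      (\<forall>x\<in>U. s x - x \<in> E \<and> f x \<in> Z (K - K) \<and> (s (\<theta> x) + f x, s x) \<in> Rn)" by (elim exE)
  have s: "Vector_Spaces.linear scale scale s"
    and sf: "\<And>x. x \<in> U \<Longrightarrow> s x - x \<in> E" "\<And>x. x \<in> U \<Longrightarrow> f x = 0" "\<And>x. x \<in> U \<Longrightarrow> (s (\<theta> x) + f x, s x) \<in> Rn"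
    using * unfolding diff_self_eq_0 Z0 by auto
  have srel: "(s x, s (T x)) \<in> word_rel (word F) n" if "x \<in> U" for x
    using sf(3)[OF TU(1)[OF that]] sf(2)[OF TU(1)[OF that]] TU(2)[OF that] by (simp add: Rn_def)
  have Tinj: "x = 0" if "x \<in> U" "T x = 0" for x using TU(2)[OF that(1)] that(2) \<theta>0 by simp
  have TUU: "T ` U \<subseteq> U" using TU(1) by blast
  show ?thesis
    by (rule that[OF U(1,2) U(3)[unfolded E_def] U(4)[unfolded E_def] T(1) TUU Tinj s sf(1)[unfolded E_def] srel])
qed

end

context vspace
begin

text \<open>The data of a block \<open>B(\<nu>, m, \<pi>)\<close> inside a relation family: \<open>e s b\<close> is the \<open>b\<close>-th vector of the
  \<open>s\<close>-th cell.\<close>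

definition band :: "(int \<Rightarrow> ('b \<times> 'b) set) \<Rightarrow> int list \<times> 'a poly \<times> nat \<times> (nat \<Rightarrow> nat \<Rightarrow> 'b) \<Rightarrow> bool" where
  "band R = (\<lambda>(\<nu>, \<pi>, m, e). \<nu> \<noteq> [] \<and> nonperiodic \<nu> \<and> irreducible \<pi> \<and> lead_coeff \<pi> = 1 \<and> \<pi> \<noteq> [:0, 1:] \<and> 1 \<le> m \<and>
     (\<forall>s b. Suc s < length \<nu> \<longrightarrow> b < degree (\<pi> ^ m) \<longrightarrow> (e (Suc s) b, e s b) \<in> R (\<nu> ! s)) \<and>
     (\<forall>a < degree (\<pi> ^ m). (e 0 a, \<Sum>b<degree (\<pi> ^ m). frobenius_block (\<pi> ^ m) $$ (b, a) *s e (length \<nu> - 1) b)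
        \<in> R (\<nu> ! (length \<nu> - 1))))"

definition band_vectors :: "int list \<times> 'a poly \<times> nat \<times> (nat \<Rightarrow> nat \<Rightarrow> 'b) \<Rightarrow> 'b list" where
  "band_vectors = (\<lambda>(\<nu>, \<pi>, m, e). map (\<lambda>j. e (j div degree (\<pi> ^ m)) (j mod degree (\<pi> ^ m))) [0..<length \<nu> * degree (\<pi> ^ m)])"

lemma mset_band_vectors:
  "mset (band_vectors (\<nu>, \<pi>, m, e)) = (\<Sum>s<length \<nu>. mset (map (e s) [0..<degree (\<pi> ^ m)]))"
  unfolding band_vectors_def by (simp add: mset_map_upt sum_div_mod del: mset_map)

end

section \<open>Bases adapted to the filtration and its cycles\<close>

context relation_family
begin

text \<open>The classes of \<open>xs\<close> form a basis of the quotient of \<open>F\<close> by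
  \<open>pre F\<close>; the three conjuncts are membership, independence and generation.\<close>

definition good :: "'b set \<Rightarrow> 'b list \<Rightarrow> bool" where
  "good F xs \<longleftrightarrow> set xs \<subseteq> F \<and>
     (\<forall>c. (\<Sum>j<length xs. c j *s xs ! j) \<in> pre F \<longrightarrow> (\<forall>j < length xs. c j = 0)) \<and>
     (\<forall>x \<in> F. \<exists>c. x - (\<Sum>j<length xs. c j *s xs ! j) \<in> pre F)"

lemma good_extend:
  assumes F: "F \<in> jumps" and g: "good F xs" and bs: "list_basis bs (pre F)"
  shows "list_basis (bs @ xs) F"
proof -
  have Ff: "F \<in> flag" using F by (simp add: jumps_def)
  note subF = flag_subspace[OF Ff] and subP = flag_subspace[OF pre(1)[OF F]]
  have lb: "list_basis xs (span (set xs))"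
  proof (rule list_basisI_index)
    fix c j assume "(\<Sum>j<length xs. c j *s xs ! j) = 0" "j < length xs"
    thus "c j = 0" using g subspace_0[OF subP] unfolding good_def by metis
  qed
  note sp = list_basis_index(2)[OF lb]
  have int: "pre F \<inter> span (set xs) = {0}"
  proof -
    have "x = 0" if x: "x \<in> pre F" "x \<in> span (set xs)" for x
    proof -
      obtain c where c: "x = (\<Sum>j<length xs. c j *s xs ! j)" using x(2) sp by blast
      hence "\<forall>j < length xs. c j = 0" using g x(1) unfolding good_def by blast
      thus ?thesis unfolding c by simp
    qed
    thus ?thesis using subspace_0[OF subP] span_zero by blast
  qed
  have "F = {x + y | x y. x \<in> pre F \<and> y \<in> span (set xs)}"
  proof
    show "F \<subseteq> {x + y | x y. x \<in> pre F \<and> y \<in> span (set xs)}"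
    proof
      fix x assume "x \<in> F"
      then obtain c where c: "x - (\<Sum>j<length xs. c j *s xs ! j) \<in> pre F" using g unfolding good_def by blast
      have "(\<Sum>j<length xs. c j *s xs ! j) \<in> span (set xs)" using sp by blast
      thus "x \<in> {x + y | x y. x \<in> pre F \<and> y \<in> span (set xs)}"
        using c by (intro CollectI exI[of _ "x - (\<Sum>j<length xs. c j *s xs ! j)"] exI[of _ "\<Sum>j<length xs. c j *s xs ! j"]) simp
    qed
    have "span (set xs) \<subseteq> F" using g subF unfolding good_def by (intro span_minimal) auto
    thus "{x + y | x y. x \<in> pre F \<and> y \<in> span (set xs)} \<subseteq> F" using pre(2)[OF F] subspace_add[OF subF] by blast
  qed
  thus ?thesis using list_basis_append[OF bs lb int] by simp
qed

text \<open>Lifted bases of the graded pieces of a filtration together form a basis of the whole;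
  only the multiset of vectors is recorded, since they will be regrouped by cycles.\<close>

lemma good_basis:
  assumes good: "\<And>F. F \<in> jumps \<Longrightarrow> good F (xs F)"
  shows "F \<in> flag \<Longrightarrow> \<exists>ws. list_basis ws F \<and> mset ws = (\<Sum>G\<in>{G \<in> jumps. G \<subseteq> F}. mset (xs G))"
proof (induction "dim F" arbitrary: F rule: less_induct)
  case less
  show ?case
  proof (cases "F = {0}")
    case True
    have e: "{G \<in> jumps. G \<subseteq> F} = {}" unfolding True using flag_0 by (auto simp: jumps_def)
    have "list_basis [] F" unfolding True by (auto simp: list_basis_def independent_empty)
    thus ?thesis unfolding e by (intro exI[of _ "[]"]) simp
  next
    case False
    hence F: "F \<in> jumps" using less by (simp add: jumps_def)
    note p = pre[OF F]
    have "dim (pre F) < dim F" by (rule dim_less[OF flag_finite_subspace[OF less(2)] flag_subspace[OF p(1)] p(2)])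
    then obtain ws where ws: "list_basis ws (pre F)" "mset ws = (\<Sum>G\<in>{G \<in> jumps. G \<subseteq> pre F}. mset (xs G))"
      using less(1)[OF _ p(1)] by blast
    have "{G \<in> jumps. G \<subseteq> F} = insert F {G \<in> jumps. G \<subseteq> pre F}"
      using F p by (auto simp: jumps_def)
    moreover have "finite {G \<in> jumps. G \<subseteq> pre F}" using finite_flag by (simp add: jumps_def)
    moreover have "F \<notin> {G \<in> jumps. G \<subseteq> pre F}" using p(2) by blast
    ultimately have "mset (ws @ xs F) = (\<Sum>G\<in>{G \<in> jumps. G \<subseteq> F}. mset (xs G))" using ws(2) by simp
    thus ?thesis using good_extend[OF F good[OF F] ws(1)] by blast
  qed
qed

text \<open>Independence modulo \<open>pre\<close> passes from a cell to the next one along the relation, and generation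
  passes in the opposite direction.\<close>

lemma good_chain:
  assumes F: "F \<in> jumps" and chain: "\<And>j s. j < d \<Longrightarrow> s < n \<Longrightarrow> (c j (Suc s), c j s) \<in> R (word F s)"
    and last: "\<And>j. j < d \<Longrightarrow> c j n \<in> (sig ^^ n) F"
    and ind: "\<And>a. (\<Sum>j<d. a j *s c j 0) \<in> pre F \<Longrightarrow> \<forall>j<d. a j = 0"
    and gen: "\<And>x. x \<in> (sig ^^ n) F \<Longrightarrow> \<exists>a. x - (\<Sum>j<d. a j *s c j n) \<in> pre ((sig ^^ n) F)"
    and s: "s \<le> n"
  shows "good ((sig ^^ s) F) (map (\<lambda>j. c j s) [0..<d])"
proof -
  let ?F = "\<lambda>s. (sig ^^ s) F"
  have J: "?F s \<in> jumps" for s by (rule funpow_sig[OF F])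
  have img: "?F s = R (word F s) `` ?F (Suc s)" "pre (?F s) = R (word F s) `` pre (?F (Suc s))" for s
    using sig(2)[OF J[of s]] pre_sig[OF J[of s]] by (simp_all add: word_def)
  have sub: "subspace (?F s)" "subspace (pre (?F s))" for s
    using flag_subspace J[of s] pre(1)[OF J[of s]] by (auto simp: jumps_def)
  have mem: "c j (n - i) \<in> ?F (n - i)" if "j < d" "i \<le> n" for i j
    using that(2)
  proof (induction i)
    case (Suc i)
    have "(c j (Suc (n - Suc i)), c j (n - Suc i)) \<in> R (word F (n - Suc i))" using chain[OF that(1)] Suc(2) by simp
    moreover have "Suc (n - Suc i) = n - i" using Suc(2) by simp
    ultimately show ?case using Suc img(1)[of "n - Suc i"] by auto
  qed (use last[OF that(1)] in simp)
  have lin: "s < n \<Longrightarrow> (\<Sum>j<d. a j *s c j (Suc s), \<Sum>j<d. a j *s c j s) \<in> R (word F s)" for a s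
    using chain by (intro subrel_lincomb[OF subrel_R]) auto
  have ind': "s \<le> n \<Longrightarrow> (\<Sum>j<d. a j *s c j s) \<in> pre (?F s) \<Longrightarrow> \<forall>j<d. a j = 0" for a s
  proof (induction s)
    case (Suc s)
    have "(\<Sum>j<d. a j *s c j s) \<in> pre (?F s)" using lin[of s a] Suc(2,3) img(2)[of s] by auto
    thus ?case using Suc by simp
  qed (use ind in simp)
  have gen': "\<exists>a. x - (\<Sum>j<d. a j *s c j (n - i)) \<in> pre (?F (n - i))" if "i \<le> n" "x \<in> ?F (n - i)" for i x
    using that
  proof (induction i arbitrary: x)
    case (Suc i)
    let ?s = "n - Suc i"
    have s: "Suc ?s = n - i" "?s < n" using Suc(2) by auto
    obtain y where y: "y \<in> ?F (Suc ?s)" "(y, x) \<in> R (word F ?s)" using Suc(3) img(1)[of ?s] by blast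
    obtain a where a: "y - (\<Sum>j<d. a j *s c j (Suc ?s)) \<in> pre (?F (Suc ?s))"
      using Suc(1)[of y] Suc(2) y(1) unfolding s(1) by auto
    have "(y - (\<Sum>j<d. a j *s c j (Suc ?s)), x - (\<Sum>j<d. a j *s c j ?s)) \<in> R (word F ?s)"
      by (rule subrel_diff[OF subrel_R y(2) lin[OF s(2)]])
    hence "x - (\<Sum>j<d. a j *s c j ?s) \<in> pre (?F ?s)" using a img(2)[of ?s] by blast
    thus ?case by blast
  qed (use gen in simp)
  have m: "c j s \<in> ?F s" if "j < d" for j using mem[OF that, of "n - s"] s by simp
  have g: "\<exists>a. x - (\<Sum>j<d. a j *s c j s) \<in> pre (?F s)" if "x \<in> ?F s" for x
    using gen'[of "n - s" x] that s by simp
  show ?thesis unfolding good_def using m g ind'[OF s] by auto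
qed

text \<open>The complement from \<open>cycle_section\<close> is a k[\<xi>]-module under the
  monodromy \<open>T\<close>. Each cyclic summand of its primary decomposition gives one band: its
  cells are the points of chains through the vectors of the orbit of a generator.\<close>

lemma cycle_bands:
  assumes F: "F \<in> jumps" and n: "0 < n" "(sig ^^ n) F = F" and dist: "\<And>s. 0 < s \<Longrightarrow> s < n \<Longrightarrow> (sig ^^ s) F \<noteq> F"
  shows "\<exists>cs xs. (\<forall>c \<in> set cs. band R c \<and> fst c = map (word F) [0..<n]) \<and>
    mset (concat (map band_vectors cs)) = (\<Sum>s<n. mset (xs s)) \<and> (\<forall>s<n. good ((sig ^^ s) F) (xs s))"
proof -
  obtain U T s where U: "subspace U" "U \<subseteq> F" "U \<inter> pre F = {0}" "\<And>x. x \<in> F \<Longrightarrow> \<exists>u\<in>U. x - u \<in> pre F"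
    and T: "Vector_Spaces.linear scale scale T" "T ` U \<subseteq> U" "\<And>x. x \<in> U \<Longrightarrow> T x = 0 \<Longrightarrow> x = 0"
    and s: "Vector_Spaces.linear scale scale s" "\<And>x. x \<in> U \<Longrightarrow> s x - x \<in> pre F"
      "\<And>x. x \<in> U \<Longrightarrow> (s x, s (T x)) \<in> word_rel (word F) n"
    by (rule cycle_section[OF F n]) blast
  interpret s: Vector_Spaces.linear scale scale s by (rule s(1))
  interpret T: Vector_Spaces.linear scale scale T by (rule T(1))
  have Ff: "F \<in> flag" using F by (simp add: jumps_def)
  have finU: "finite_subspace U" by (rule fin_dim_subset[OF flag_finite_subspace[OF Ff] U(1,2)])
  obtain ps where ps: "\<forall>q \<in> set ps. cyclic_data T U q" "list_basis (concat (map (cyclic_list T) ps)) U"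
    using primary_decomposition[OF T(1) finU T(2)] by blast
  define L where "L = concat (map (cyclic_list T) ps)"
  have L: "list_basis L U" using ps(2) by (simp add: L_def)
  have LU: "x \<in> U" if "x \<in> set L" for x using that L span_base unfolding list_basis_def by blast
  \<comment> \<open>One chain per vector is chosen without linearity in between; linearity of the
    section \<open>s\<close> at the two ends is enough.\<close>
  have "\<forall>x. \<exists>c. x \<in> U \<longrightarrow> c 0 = s (T x) \<and> c n = s x \<and> (\<forall>i < n. (c (Suc i), c i) \<in> R (word F i))"
    using word_rel_chain[OF s(3)] by blast
  then obtain ch where ch: "\<And>x. x \<in> U \<Longrightarrow> ch x 0 = s (T x)" "\<And>x. x \<in> U \<Longrightarrow> ch x n = s x"
    "\<And>x i. x \<in> U \<Longrightarrow> i < n \<Longrightarrow> (ch x (Suc i), ch x i) \<in> R (word F i)" by metis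
  define xs where "xs = (\<lambda>i. map (\<lambda>x. ch x i) L)"
  have nthU: "j < length L \<Longrightarrow> L ! j \<in> U" for j using LU by simp
  have comb: "(\<Sum>j<length L. a j *s L ! j) \<in> U" for a
    using nthU by (intro subspace_sum[OF U(1)] subspace_scale[OF U(1)]) auto
  have subP: "subspace (pre F)" by (rule flag_subspace[OF pre(1)[OF F]])
  have good: "good ((sig ^^ i) F) (xs i)" if "i < n" for i
  proof -
    have "good ((sig ^^ i) F) (map (\<lambda>j. ch (L ! j) i) [0..<length L])"
    proof (rule good_chain[OF F, where n = n and c = "\<lambda>j. ch (L ! j)"])
      show "ch (L ! j) n \<in> (sig ^^ n) F" if "j < length L" for j
      proof -
        have "s (L ! j) - L ! j + L ! j \<in> F"
          using s(2)[OF nthU[OF that]] pre(2)[OF F] nthU[OF that] U(2) subspace_add[OF flag_subspace[OF Ff]] by blast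
        thus ?thesis unfolding ch(2)[OF nthU[OF that]] n(2) by simp
      qed
      show "\<forall>j<length L. a j = 0" if "(\<Sum>j<length L. a j *s ch (L ! j) 0) \<in> pre F" for a
      proof -
        let ?y = "\<Sum>j<length L. a j *s L ! j"
        have yU: "?y \<in> U" "T ?y \<in> U" using comb T(2) by auto
        have "s (T ?y) \<in> pre F" using that nthU by (simp add: ch(1) s.sum s.scale T.sum T.scale)
        hence "s (T ?y) - (s (T ?y) - T ?y) \<in> pre F" by (rule subspace_diff[OF subP _ s(2)[OF yU(2)]])
        hence "T ?y = 0" using U(3) yU(2) by auto
        hence "?y = 0" using T(3) yU(1) by blast
        thus ?thesis using list_basis_index(1)[OF L] by blast
      qed
      show "\<exists>a. x - (\<Sum>j<length L. a j *s ch (L ! j) n) \<in> pre ((sig ^^ n) F)" if x: "x \<in> (sig ^^ n) F" for x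
      proof -
        have "x \<in> F" using x n(2) by simp
        then obtain u where u: "u \<in> U" "x - u \<in> pre F" using U(4) by blast
        then obtain a where a: "u = (\<Sum>j<length L. a j *s L ! j)" using list_basis_index(2)[OF L] by blast
        have "(\<Sum>j<length L. a j *s ch (L ! j) n) = s u" unfolding a using nthU by (simp add: ch(2) s.sum s.scale)
        moreover have "x - u - (s u - u) \<in> pre F" by (rule subspace_diff[OF subP u(2) s(2)[OF u(1)]])
        ultimately show ?thesis unfolding n(2) by (intro exI[of _ a]) simp
      qed
    qed (use ch(3) nthU that in auto)
    moreover have "map (\<lambda>j. ch (L ! j) i) [0..<length L] = xs i" by (intro nth_equalityI) (auto simp: xs_def)
    ultimately show ?thesis by simp
  qed
  define \<nu> where "\<nu> = map (word F) [0..<n]"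
  have len: "length \<nu> = n" by (simp add: \<nu>_def)
  have per: "word F (a + n) = word F a" for a
    by (simp add: word_def funpow_add n(2))
  have permod: "word F a = \<nu> ! (a mod n)" for a
  proof -
    have "word F (a mod n + n * b) = word F (a mod n)" for b
    proof (induction b)
      case (Suc b)
      have "a mod n + n * Suc b = a mod n + n * b + n" by simp
      thus ?case using Suc per by metis
    qed simp
    from this[of "a div n"] show ?thesis using n(1) by (simp add: \<nu>_def)
  qed
  \<comment> \<open>A periodic word would give two jumps of the same orbit equal words, so by
    \<open>equal_words\<close> the orbit would close earlier.\<close>
  have np: "nonperiodic \<nu>" unfolding nonperiodic_def len
  proof (intro allI impI notI)
    fix l assume l: "0 < l" "l < n" "rotate l \<nu> = \<nu>"
    have "word F (l + a) = word F a" for a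
    proof -
      have an: "a mod n < length \<nu>" using n(1) len by simp
      have "\<nu> ! (a mod n) = rotate l \<nu> ! (a mod n)" using l(3) by simp
      also have "\<dots> = \<nu> ! ((l + a mod n) mod n)" using nth_rotate[OF an, of l] len by (simp add: add.commute)
      also have "\<dots> = \<nu> ! ((l + a) mod n)" by (simp add: mod_add_right_eq)
      finally show ?thesis unfolding permod[of a] permod[of "l + a"] by simp
    qed
    hence "word ((sig ^^ l) F) = word F" unfolding word_add[symmetric] by auto
    hence "(sig ^^ l) F = F" using equal_words[OF funpow_sig[OF F] F] by blast
    thus False using dist l by blast
  qed
  define cs where "cs = map (\<lambda>(v, \<pi>, m). (\<nu>, \<pi>, m, \<lambda>i b. ch ((T ^^ b) v) i)) ps"
  have orbU: "(T ^^ b) v \<in> U" if "v \<in> U" for b v using that T(2) by (induction b) auto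
  have "band R (\<nu>, \<pi>, m, \<lambda>i b. ch ((T ^^ b) v) i)" if q: "(v, \<pi>, m) \<in> set ps" for v \<pi> m
  proof -
    let ?e = "degree (\<pi> ^ m)" and ?p = "\<pi> ^ m"
    have d: "v \<in> U" "irreducible \<pi>" "lead_coeff \<pi> = 1" "1 \<le> m" "act T ?p v = 0"
      using ps(1) q by (auto simp: cyclic_data_def[OF T(1)])
    note dp = degree_irreducible_power[OF d(2,3,4)]
    have "v \<in> set L" using q dp(2) by (force simp: L_def cyclic_list_def[OF T(1)])
    hence v0: "v \<noteq> 0" using L dependent_zero unfolding list_basis_def by blast
    \<comment> \<open>\<open>T\<close> is injective on \<open>U\<close>, so no power of it kills the
      nonzero generator.\<close>
    have "\<pi> \<noteq> [:0, 1:]"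
    proof
      assume x: "\<pi> = [:0, 1:]"
      have "act T ([:0, 1:] ^ i) v = (T ^^ i) v" for i
        by (induction i) (simp_all add: act_pCons[OF T(1)])
      hence "(T ^^ m) v = 0" using d(5) x by simp
      moreover have "(T ^^ i) v \<noteq> 0" for i
        by (induction i) (use v0 T(3) orbU[OF d(1)] in auto)
      ultimately show False by blast
    qed
    moreover have "(ch ((T ^^ a) v) 0, \<Sum>b<?e. frobenius_block ?p $$ (b, a) *s ch ((T ^^ b) v) (n - 1)) \<in> R (\<nu> ! (n - 1))"
      if a: "a < ?e" for a
    proof -
      \<comment> \<open>The columns of the Frobenius block express \<open>T\<close> in the orbit
        basis. Hence this combination of chains ends at the section over the next orbit vector,
        which is where the chain of the present one begins.\<close>
      have f: "(\<Sum>b<?e. frobenius_block ?p $$ (b, a) *s (T ^^ b) v) = T ((T ^^ a) v)"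
      proof (cases "a + 1 = ?e")
        case True
        have "0 = (\<Sum>b<?e. coeff ?p b *s (T ^^ b) v) + (T ^^ ?e) v"
          using d(5) dp(3) unfolding act_def by (simp add: lessThan_Suc_atMost[symmetric])
        hence "(T ^^ ?e) v = - (\<Sum>b<?e. coeff ?p b *s (T ^^ b) v)" by (simp add: eq_neg_iff_add_eq_0 add.commute)
        also have "\<dots> = (\<Sum>b<?e. frobenius_block ?p $$ (b, a) *s (T ^^ b) v)"
          unfolding sum_negf[symmetric] by (intro sum.cong refl) (use a True in \<open>simp add: frobenius_block_def\<close>)
        finally show ?thesis using True by (metis Suc_eq_plus1 comp_apply funpow.simps(2))
      next
        case False
        have "(\<Sum>b<?e. frobenius_block ?p $$ (b, a) *s (T ^^ b) v) = (\<Sum>b<?e. if b = a + 1 then (T ^^ b) v else 0)"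
          by (intro sum.cong refl) (use a False in \<open>simp add: frobenius_block_def\<close>)
        also have "\<dots> = T ((T ^^ a) v)" using a False by simp
        finally show ?thesis .
      qed
      have "(\<Sum>b<?e. frobenius_block ?p $$ (b, a) *s ch ((T ^^ b) v) (Suc (n - 1)),
          \<Sum>b<?e. frobenius_block ?p $$ (b, a) *s ch ((T ^^ b) v) (n - 1)) \<in> R (word F (n - 1))"
        by (rule subrel_lincomb[OF subrel_R]) (use ch(3)[OF orbU[OF d(1)], of "n - 1"] n(1) in simp)
      moreover have "(\<Sum>b<?e. frobenius_block ?p $$ (b, a) *s ch ((T ^^ b) v) (Suc (n - 1))) = ch ((T ^^ a) v) 0"
        using n(1) by (simp add: ch(2)[OF orbU[OF d(1)]] ch(1)[OF orbU[OF d(1)]] flip: f) (simp add: s.sum s.scale)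
      moreover have "word F (n - 1) = \<nu> ! (n - 1)" using n(1) by (simp add: \<nu>_def)
      ultimately show ?thesis by simp
    qed
    moreover have "\<nu> \<noteq> []" using n(1) len by auto
    moreover have "(ch ((T ^^ b) v) (Suc i), ch ((T ^^ b) v) i) \<in> R (\<nu> ! i)" if "Suc i < n" for i b
      using ch(3)[OF orbU[OF d(1)], of i b] that by (simp add: \<nu>_def)
    ultimately show ?thesis using np d len unfolding band_def by simp
  qed
  hence "\<forall>c \<in> set cs. band R c \<and> fst c = \<nu>" unfolding cs_def by fastforce
  moreover have "mset (concat (map band_vectors cs)) = (\<Sum>i<n. mset (xs i))"
  proof -
    have "mset (concat (map band_vectors (map (\<lambda>(v, \<pi>, m). (\<nu>, \<pi>, m, \<lambda>i b. ch ((T ^^ b) v) i)) qs))) =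
      (\<Sum>i<n. mset (map (\<lambda>x. ch x i) (concat (map (cyclic_list T) qs))))" for qs
    proof (induction qs)
      case (Cons q qs)
      obtain v \<pi> m where q: "q = (v, \<pi>, m)" by (cases q)
      have "mset (band_vectors (\<nu>, \<pi>, m, \<lambda>i b. ch ((T ^^ b) v) i)) = (\<Sum>i<n. mset (map (\<lambda>x. ch x i) (cyclic_list T q)))"
        unfolding mset_band_vectors len q cyclic_list_def[OF T(1)] by (simp add: o_def)
      thus ?case using Cons by (simp add: q sum.distrib)
    qed simp
    thus ?thesis unfolding cs_def xs_def L_def by simp
  qed
  ultimately show ?thesis using good unfolding \<nu>_def by blast
qed

text \<open>A cycle may be started at any of its jumps. The start is chosen so that a prescribed
  letter \<open>M\<close>, if present, stands last, on the edge that carries the Frobenius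
  block.\<close>

theorem band_decomposition:
  "\<exists>cs. (\<forall>c \<in> set cs. band R c \<and> (M \<in> set (fst c) \<longrightarrow> last (fst c) = M)) \<and> list_basis (concat (map band_vectors cs)) V"
proof -
  have finJ: "finite jumps" using finite_flag by (simp add: jumps_def)
  have inj: "inj_on sig jumps" and im: "sig ` jumps = jumps" using sig_bij by (auto simp: bij_betw_def)
  have cancel: "(sig ^^ a) F = (sig ^^ a) G \<Longrightarrow> F = G" if "F \<in> jumps" "G \<in> jumps" for a F G
    using that
  proof (induction a arbitrary: F G)
    case (Suc a)
    have "(sig ^^ a) F = (sig ^^ a) G"
      using Suc(2) inj_onD[OF inj _ funpow_sig[OF Suc(3), of a] funpow_sig[OF Suc(4), of a]] by simp
    thus ?case using Suc by blast
  qed simp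
  have ex_period: "\<exists>n. 0 < n \<and> (sig ^^ n) F = F" if F: "F \<in> jumps" for F
  proof -
    have "\<not> inj (\<lambda>a. (sig ^^ a) F)"
    proof
      assume "inj (\<lambda>a. (sig ^^ a) F)"
      moreover have "range (\<lambda>a. (sig ^^ a) F) \<subseteq> jumps" using funpow_sig[OF F] by blast
      ultimately show False using finJ by (metis finite_imageD finite_subset infinite_UNIV_nat)
    qed
    then obtain a b where "a \<noteq> b" "(sig ^^ a) F = (sig ^^ b) F" unfolding inj_def by blast
    then obtain a b where ab: "a < b" "(sig ^^ a) F = (sig ^^ b) F" by (metis linorder_neqE_nat)
    have "(sig ^^ a) F = (sig ^^ a) ((sig ^^ (b - a)) F)" using ab by (simp add: funpow_add[symmetric, unfolded o_def, THEN fun_cong] flip: comp_apply[of "sig ^^ a"] funpow_add)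
    hence "(sig ^^ (b - a)) F = F" using cancel[OF F funpow_sig[OF F]] by metis
    thus ?thesis using ab(1) by (intro exI[of _ "b - a"]) simp
  qed
  have "C \<subseteq> jumps \<Longrightarrow> sig ` C \<subseteq> C \<Longrightarrow> \<exists>cs xs. (\<forall>c \<in> set cs. band R c \<and> (M \<in> set (fst c) \<longrightarrow> last (fst c) = M)) \<and>
    mset (concat (map band_vectors cs)) = (\<Sum>F\<in>C. mset (xs F)) \<and> (\<forall>F\<in>C. good F (xs F))" for C
  proof (induction "card C" arbitrary: C rule: less_induct)
    case less
    have finC: "finite C" using finite_subset[OF less(2) finJ] .
    show ?case
    proof (cases "C = {}")
      case True thus ?thesis by (intro exI[of _ "[]"]) simp
    next
      case False
      then obtain F0 where F0: "F0 \<in> C" by blast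
      have orbC: "(sig ^^ a) F \<in> C" if "F \<in> C" for a F using that less(3) by (induction a) auto
      \<comment> \<open>If the letter \<open>M\<close> is carried by \<open>G\<close>, the cycle is
        started at \<open>sig G\<close>; then \<open>G\<close> is its last cell.\<close>
      obtain F where F: "F \<in> C" and FM: "(\<exists>a. word F a = M) \<longrightarrow> (\<exists>G \<in> jumps. F = sig G \<and> letter G = M)"
      proof (cases "\<exists>a. word F0 a = M")
        case True
        then obtain a where "letter ((sig ^^ a) F0) = M" unfolding word_def by blast
        moreover have "(sig ^^ a) F0 \<in> jumps" using orbC[OF F0] less(2) by blast
        ultimately show ?thesis using that[of "sig ((sig ^^ a) F0)"] orbC[OF F0, of "Suc a"] by auto
      next
        case False thus ?thesis using that[OF F0] by blast
      qed
      have FJ: "F \<in> jumps" using F less(2) by blast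
      define n where "n = (LEAST n. 0 < n \<and> (sig ^^ n) F = F)"
      have n: "0 < n \<and> (sig ^^ n) F = F" unfolding n_def by (rule LeastI_ex[OF ex_period[OF FJ]])
      have dist: "(sig ^^ s) F \<noteq> F" if "0 < s" "s < n" for s
        using not_less_Least[of s "\<lambda>n. 0 < n \<and> (sig ^^ n) F = F"] that unfolding n_def by blast
      obtain cs xs where cs: "\<forall>c \<in> set cs. band R c \<and> fst c = map (word F) [0..<n]"
        "mset (concat (map band_vectors cs)) = (\<Sum>s<n. mset (xs s))" "\<forall>s<n. good ((sig ^^ s) F) (xs s)"
        using cycle_bands[OF FJ conjunct1[OF n] conjunct2[OF n] dist] by blast
      let ?O = "(\<lambda>s. (sig ^^ s) F) ` {..<n}"
      have injO: "inj_on (\<lambda>s. (sig ^^ s) F) {..<n}"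
      proof (rule linorder_inj_onI')
        fix a b assume ab: "a \<in> {..<n}" "b \<in> {..<n}" "a < b"
        show "(sig ^^ a) F \<noteq> (sig ^^ b) F"
        proof
          assume e: "(sig ^^ a) F = (sig ^^ b) F"
          have "(sig ^^ b) F = (sig ^^ a) ((sig ^^ (b - a)) F)" using ab(3) by (simp add: funpow_add[symmetric, unfolded o_def, THEN fun_cong] flip: comp_apply[of "sig ^^ a"] funpow_add)
          hence "(sig ^^ (b - a)) F = F" using e cancel[OF FJ funpow_sig[OF FJ]] by metis
          moreover have "0 < b - a" "b - a < n" using ab by auto
          ultimately show False using dist by blast
        qed
      qed
      have OC: "?O \<subseteq> C" using orbC[OF F] by blast
      have "F \<in> ?O" using n by (intro image_eqI[of _ _ 0]) auto
      hence "card (C - ?O) < card C" using F finC by (intro psubset_card_mono) auto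
      moreover have "sig ` (C - ?O) \<subseteq> C - ?O"
      proof clarify
        fix G assume G: "G \<in> C" "G \<notin> ?O"
        have "sig G \<notin> ?O"
        proof
          assume "sig G \<in> ?O"
          then obtain a where a: "a < n" "sig G = (sig ^^ a) F" by blast
          have "sig G = sig ((sig ^^ (if a = 0 then n - 1 else a - 1)) F)"
          proof (cases a)
            case 0
            have "sig ((sig ^^ (n - 1)) F) = (sig ^^ n) F" using conjunct1[OF n] by (cases n) simp_all
            thus ?thesis using n a 0 by simp
          qed (use a in simp)
          hence "G = (sig ^^ (if a = 0 then n - 1 else a - 1)) F"
            by (rule inj_onD[OF inj _ _ funpow_sig[OF FJ]]) (use G(1) less(2) in blast)
          moreover have "(if a = 0 then n - 1 else a - 1) < n" using a(1) by auto
          ultimately show False using G(2) by blast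
        qed
        thus "sig G \<in> C - ?O" using G(1) less(3) by blast
      qed
      ultimately obtain cs' xs' where cs': "\<forall>c \<in> set cs'. band R c \<and> (M \<in> set (fst c) \<longrightarrow> last (fst c) = M)"
        "mset (concat (map band_vectors cs')) = (\<Sum>F\<in>C - ?O. mset (xs' F))" "\<forall>F\<in>C - ?O. good F (xs' F)"
        using less(1)[of "C - ?O"] less(2) by blast
      define ys where "ys = (\<lambda>G. if G \<in> ?O then xs (the_inv_into {..<n} (\<lambda>s. (sig ^^ s) F) G) else xs' G)"
      have ysO: "ys ((sig ^^ s) F) = xs s" if "s < n" for s
        using the_inv_into_f_f[OF injO, of s] that by (simp add: ys_def)
      have "(\<Sum>G\<in>C. mset (ys G)) = (\<Sum>G\<in>C - ?O. mset (ys G)) + (\<Sum>G\<in>?O. mset (ys G))"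
        using OC finC by (intro sum.subset_diff)
      also have "(\<Sum>G\<in>?O. mset (ys G)) = (\<Sum>s<n. mset (xs s))" using injO ysO by (simp add: sum.reindex)
      also have "(\<Sum>G\<in>C - ?O. mset (ys G)) = (\<Sum>G\<in>C - ?O. mset (xs' G))" by (intro sum.cong refl) (simp add: ys_def)
      finally have "mset (concat (map band_vectors (cs' @ cs))) = (\<Sum>G\<in>C. mset (ys G))" using cs(2) cs'(2) by simp
      moreover have "good G (ys G)" if "G \<in> C" for G
      proof (cases "G \<in> ?O")
        case True thus ?thesis using cs(3) ysO by auto
      next
        case False thus ?thesis using cs'(3) that by (simp add: ys_def)
      qed
      moreover have "M \<in> set (fst c) \<longrightarrow> last (fst c) = M" if "c \<in> set cs" for c
      proof
        assume "M \<in> set (fst c)"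
        moreover have fc: "fst c = map (word F) [0..<n]" using cs(1) that by blast
        ultimately obtain G where G: "G \<in> jumps" "F = sig G" "letter G = M" using FM by auto
        have "sig ((sig ^^ (n - 1)) F) = (sig ^^ n) F" using conjunct1[OF n] by (cases n) simp_all
        hence "sig ((sig ^^ (n - 1)) F) = sig G" using conjunct2[OF n] G(2) by simp
        hence "(sig ^^ (n - 1)) F = G" using inj_onD[OF inj _ funpow_sig[OF FJ] G(1)] by blast
        hence "word F (n - 1) = M" using G(3) by (simp add: word_def)
        thus "last (fst c) = M" using n by (simp add: fc last_map)
      qed
      ultimately show ?thesis using cs(1) cs'(1) by (intro exI[of _ "cs' @ cs"] exI[of _ ys]) auto
    qed
  qed
  from this[of jumps] im obtain cs xs where cs: "\<forall>c \<in> set cs. band R c \<and> (M \<in> set (fst c) \<longrightarrow> last (fst c) = M)"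
    "mset (concat (map band_vectors cs)) = (\<Sum>F\<in>jumps. mset (xs F))" "\<forall>F\<in>jumps. good F (xs F)" by blast
  have "{G \<in> jumps. G \<subseteq> V} = jumps" using flag_subset by (auto simp: jumps_def)
  then obtain ws where "list_basis ws V" "mset ws = (\<Sum>F\<in>jumps. mset (xs F))"
    using good_basis[of xs, OF _ flag.whole] cs(3) by auto
  thus ?thesis using cs list_basis_mset by metis
qed

end

section \<open>Completion of the relations of a singular matrix\<close>

context vspace
begin

lemma list_basis_exists:
  assumes "finite_subspace U" obtains L where "list_basis L U"
proof -
  obtain B where B: "finite B" "independent B" "span B = U" "card B = dim U" by (rule fin_dim_basis[OF assms])
  obtain L where "set L = B" "distinct L" using finite_distinct_list[OF B(1)] by blast
  thus ?thesis using that B by (auto simp: list_basis_def)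
qed

lemma list_basis_dim: "list_basis L U \<Longrightarrow> dim U = length L"
  using dim_span_eq_card_independent[of "set L"] by (auto simp: list_basis_def distinct_card)

lemma direct_sum_dim:
  assumes "finite_subspace U1" "finite_subspace U2" "U1 \<inter> U2 = {0}"
  shows "dim {x + y | x y. x \<in> U1 \<and> y \<in> U2} = dim U1 + dim U2"
proof -
  obtain L1 where L1: "list_basis L1 U1" by (rule list_basis_exists[OF assms(1)])
  obtain L2 where L2: "list_basis L2 U2" by (rule list_basis_exists[OF assms(2)])
  show ?thesis using list_basis_dim[OF list_basis_append[OF L1 L2 assms(3)]] list_basis_dim[OF L1] list_basis_dim[OF L2] by simp
qed

text \<open>Rank and nullity for a linear relation: it induces an isomorphism from its domain modulo
  its kernel to its image modulo the image of 0.\<close>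

lemma relation_dim:
  assumes V: "finite_subspace V" and R: "subrel R" "R \<subseteq> V \<times> V"
  shows "dim (R\<inverse> `` V) + dim (R `` {0}) = dim (R `` V) + dim (R\<inverse> `` {0})"
proof -
  note subV = finite_subspaceD[OF V]
  have sub: "subspace (R\<inverse> `` V)" "subspace (R `` {0})" "subspace (R `` V)" "subspace (R\<inverse> `` {0})"
    using subrel_Image[OF R(1)] subrel_Image[OF subrel_converse[OF R(1)]] subV by auto
  have fin: "finite_subspace (R\<inverse> `` V)" "finite_subspace (R `` {0})" "finite_subspace (R `` V)" "finite_subspace (R\<inverse> `` {0})"
    by (rule fin_dim_subset[OF V]; use sub R(2) in auto)+
  have ker: "R\<inverse> `` {0} \<subseteq> R\<inverse> `` V" using subspace_0[OF subV] by blast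
  obtain U where U: "subspace U" "U \<subseteq> R\<inverse> `` V" "U \<inter> R\<inverse> `` {0} = {0}" "\<And>x. x \<in> R\<inverse> `` V \<Longrightarrow> \<exists>u\<in>U. x - u \<in> R\<inverse> `` {0}"
    by (rule complement_exists[OF fin(1) sub(4) ker]) blast
  have finU: "finite_subspace U" by (rule fin_dim_subset[OF fin(1) U(1,2)])
  have "\<exists>y. (x, y) \<in> R" if "x \<in> U" for x using that U(2) by blast
  then obtain h where h: "Vector_Spaces.linear scale scale h" "\<And>x. x \<in> U \<Longrightarrow> (x, h x) \<in> R"
    by (rule linear_selection[OF U(1) R(1)]) auto
  interpret h: Vector_Spaces.linear scale scale h by (rule h(1))
  have z: "x = 0" if "x \<in> U" "h x \<in> R `` {0}" for x
  proof -
    have "(x - 0, h x - h x) \<in> R" using that by (intro subrel_diff[OF R(1) h(2)]) auto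
    thus ?thesis using U(3) that(1) by auto
  qed
  obtain L where L: "list_basis L U" by (rule list_basis_exists[OF finU])
  have inj: "inj_on h U"
  proof (rule inj_onI)
    fix x y assume xy: "x \<in> U" "y \<in> U" "h x = h y"
    have "h (x - y) = 0" using xy(3) by (simp add: h.diff)
    hence "h (x - y) \<in> R `` {0}" using subspace_0[OF sub(2)] by simp
    thus "x = y" using z[of "x - y"] subspace_diff[OF U(1) xy(1,2)] by simp
  qed
  have sp: "span (set L) = U" "set L \<subseteq> U" using L span_superset by (auto simp: list_basis_def)
  have "list_basis (map h L) (h ` U)"
    using L h.independent_injective_image[of "set L"] h.span_image[of "set L"] inj inj_on_subset[OF inj sp(2)]
    by (auto simp: list_basis_def distinct_map)
  hence dh: "dim (h ` U) = dim U" using list_basis_dim[OF L] list_basis_dim by fastforce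
  have subh: "subspace (h ` U)" using h.subspace_image[OF U(1)] .
  have hR: "h ` U \<subseteq> R `` V" using h(2) R(2) by blast
  have e1: "R\<inverse> `` V = {x + y | x y. x \<in> U \<and> y \<in> R\<inverse> `` {0}}"
  proof
    show "R\<inverse> `` V \<subseteq> {x + y | x y. x \<in> U \<and> y \<in> R\<inverse> `` {0}}"
    proof
      fix x assume "x \<in> R\<inverse> `` V"
      then obtain u where "u \<in> U" "x - u \<in> R\<inverse> `` {0}" using U(4) by blast
      thus "x \<in> {x + y | x y. x \<in> U \<and> y \<in> R\<inverse> `` {0}}" by (intro CollectI exI[of _ u] exI[of _ "x - u"]) auto
    qed
    show "{x + y | x y. x \<in> U \<and> y \<in> R\<inverse> `` {0}} \<subseteq> R\<inverse> `` V" using U(2) ker subspace_add[OF sub(1)] by blast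
  qed
  have R0: "R `` {0} \<subseteq> R `` V" using subspace_0[OF subV] by blast
  have e2: "R `` V = {x + y | x y. x \<in> h ` U \<and> y \<in> R `` {0}}"
  proof
    show "R `` V \<subseteq> {x + y | x y. x \<in> h ` U \<and> y \<in> R `` {0}}"
    proof
      fix y assume "y \<in> R `` V"
      then obtain x where x: "(x, y) \<in> R" by blast
      hence "x \<in> R\<inverse> `` V" using R(2) by blast
      then obtain u where u: "u \<in> U" "x - u \<in> R\<inverse> `` {0}" using U(4) by blast
      have "(x - u - (x - u), y - h u - 0) \<in> R" by (rule subrel_diff[OF R(1) subrel_diff[OF R(1) x h(2)[OF u(1)]]]) (use u(2) in blast)
      hence "y - h u \<in> R `` {0}" by auto
      thus "y \<in> {x + y | x y. x \<in> h ` U \<and> y \<in> R `` {0}}"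
        using u(1) by (intro CollectI exI[of _ "h u"] exI[of _ "y - h u"]) auto
    qed
    show "{x + y | x y. x \<in> h ` U \<and> y \<in> R `` {0}} \<subseteq> R `` V" using hR R0 subspace_add[OF sub(3)] by blast
  qed
  have int: "h ` U \<inter> R `` {0} = {0}"
  proof
    show "h ` U \<inter> R `` {0} \<subseteq> {0}"
    proof
      fix y assume "y \<in> h ` U \<inter> R `` {0}"
      then obtain x where "x \<in> U" "y = h x" "h x \<in> R `` {0}" by blast
      thus "y \<in> {0}" using z[of x] h.zero by simp
    qed
    show "{0} \<subseteq> h ` U \<inter> R `` {0}" using subspace_0[OF subh] subspace_0[OF sub(2)] by simp
  qed
  have "dim (R\<inverse> `` V) = dim U + dim (R\<inverse> `` {0})" unfolding e1 by (rule direct_sum_dim[OF finU fin(4) U(3)])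
  moreover have "dim (R `` V) = dim U + dim (R `` {0})"
    unfolding e2 using direct_sum_dim[OF fin_dim_subset[OF fin(3) subh hR] fin(2) int] dh by simp
  ultimately show ?thesis by simp
qed

text \<open>A singular matrix gives a family whose relations become constant for large indices. It is
  completed artificially by a relation with index \<open>M\<close>, whose edges are removed again later.\<close>

lemma relation_family_completion:
  assumes V: "finite_subspace V" and subR: "\<And>i. subrel (R i)" "\<And>i. R i \<subseteq> V \<times> V"
    and im0: "\<And>i. R i `` {0} = R (i - 1) `` V" and pre0: "\<And>i. (R i)\<inverse> `` {0} = (R (i + 1))\<inverse> `` V"
    and low: "\<And>i. i \<le> i0 \<Longrightarrow> (R i)\<inverse> `` V = V" "\<And>i. i < i0 \<Longrightarrow> R i `` V = {0}" and M: "i0 < M"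
  obtains R' where "relation_family scale V R'" "\<And>i. i < M \<Longrightarrow> R' i = R i"
    "\<And>x y. (x, y) \<in> R' M \<Longrightarrow> x \<in> (R M)\<inverse> `` V" "\<And>i x y. M < i \<Longrightarrow> (x, y) \<in> R' i \<Longrightarrow> x = 0"
proof -
  note subV = finite_subspaceD[OF V]
  define A where "A = (R M)\<inverse> `` V"
  define B where "B = R (M - 1) `` V"
  have subA: "subspace A" "subspace B"
    using subrel_Image[OF subrel_converse[OF subR(1)] subV] subrel_Image[OF subR(1) subV] by (auto simp: A_def B_def)
  have AV: "A \<subseteq> V" "B \<subseteq> V" using subR(2) by (auto simp: A_def B_def)
  have dim0: "dim {0} = 0" by (metis dim_span_eq_card_independent card.empty independent_empty span_empty)
  \<comment> \<open>By \<open>relation_dim\<close> and the two interlocking conditions this sum does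
    not depend on \<open>i\<close>; at \<open>i0\<close> it equals \<open>dim V\<close>.\<close>
  have const: "i0 \<le> i \<Longrightarrow> dim ((R i)\<inverse> `` V) + dim (R (i - 1) `` V) = dim V" for i
  proof (induction i rule: int_ge_induct)
    case base show ?case using low(1)[of i0] low(2)[of "i0 - 1"] dim0 by simp
  next
    case (step i)
    have "dim ((R i)\<inverse> `` V) + dim (R (i - 1) `` V) = dim (R i `` V) + dim ((R (i + 1))\<inverse> `` V)"
      using relation_dim[OF V subR, of i] unfolding im0[of i] pre0[of i] .
    thus ?case using step by simp
  qed
  have dAB: "dim A + dim B = dim V" using const[of M] M by (simp add: A_def B_def)
  obtain C where C: "subspace C" "C \<subseteq> V" "C \<inter> B = {0}" "\<And>x. x \<in> V \<Longrightarrow> \<exists>u\<in>C. x - u \<in> B"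
    by (rule complement_exists[OF V subA(2) AV(2)]) blast
  have fin: "finite_subspace A" "finite_subspace B" "finite_subspace C"
    using fin_dim_subset[OF V] subA AV C by blast+
  have CB: "V = {x + y | x y. x \<in> C \<and> y \<in> B}"
  proof
    show "V \<subseteq> {x + y | x y. x \<in> C \<and> y \<in> B}"
    proof
      fix x assume "x \<in> V"
      then obtain u where "u \<in> C" "x - u \<in> B" using C(4) by blast
      thus "x \<in> {x + y | x y. x \<in> C \<and> y \<in> B}" by (intro CollectI exI[of _ u] exI[of _ "x - u"]) auto
    qed
    show "{x + y | x y. x \<in> C \<and> y \<in> B} \<subseteq> V" using C(2) AV(2) subspace_add[OF subV] by blast
  qed
  have dC: "dim C = dim A" using direct_sum_dim[OF fin(3,2) C(3)] dAB unfolding CB[symmetric] by simp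
  obtain as where as: "list_basis as A" by (rule list_basis_exists[OF fin(1)])
  obtain cs where cs: "list_basis cs C" by (rule list_basis_exists[OF fin(3)])
  define d where "d = length as"
  have len: "length as = d" "length cs = d" using list_basis_dim[OF as] list_basis_dim[OF cs] dC by (auto simp: d_def)
  \<comment> \<open>The graph of an isomorphism from \<open>A\<close> onto a complement
    \<open>C\<close> of \<open>B\<close>, enlarged by \<open>B\<close> in the second component. It
    has domain \<open>A\<close>, kernel 0, image \<open>V\<close>, and relates 0 to exactly
    \<open>B\<close>, as the neighbours of index \<open>M\<close> demand.\<close>
  define Q where "Q = {(\<Sum>j<d. a j *s as ! j, (\<Sum>j<d. a j *s cs ! j) + b) | a b. b \<in> B}"
  have asA: "A = {\<Sum>j<d. a j *s as ! j | a. True}" and csC: "C = {\<Sum>j<d. a j *s cs ! j | a. True}"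
    using list_basis_index(2)[OF as] list_basis_index(2)[OF cs] len by auto
  have as0: "a j = 0" if "(\<Sum>j<d. a j *s as ! j) = 0" "j < d" for a j using list_basis_index(1)[OF as, of a j] that len by simp
  have cs0: "a j = 0" if "(\<Sum>j<d. a j *s cs ! j) = 0" "j < d" for a j using list_basis_index(1)[OF cs, of a j] that len by simp
  have QI: "(\<Sum>j<d. a j *s as ! j, (\<Sum>j<d. a j *s cs ! j) + b) \<in> Q" if "b \<in> B" for a b
    unfolding Q_def using that by blast
  have subQ: "subrel Q" unfolding subrel_def
  proof (intro conjI allI impI)
    show "(0, 0) \<in> Q" using QI[of 0 "\<lambda>_. 0"] subspace_0[OF subA(2)] by simp
  next
    fix x y x' y' assume "(x, y) \<in> Q" "(x', y') \<in> Q"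
    then obtain a b a' b' where "b \<in> B" "b' \<in> B" "x = (\<Sum>j<d. a j *s as ! j)" "y = (\<Sum>j<d. a j *s cs ! j) + b"
      "x' = (\<Sum>j<d. a' j *s as ! j)" "y' = (\<Sum>j<d. a' j *s cs ! j) + b'" unfolding Q_def by blast
    thus "(x + x', y + y') \<in> Q" using QI[of "b + b'" "\<lambda>j. a j + a' j"] subspace_add[OF subA(2)]
      by (simp add: scale_left_distrib sum.distrib algebra_simps)
  next
    fix c x y assume "(x, y) \<in> Q"
    then obtain a b where "b \<in> B" "x = (\<Sum>j<d. a j *s as ! j)" "y = (\<Sum>j<d. a j *s cs ! j) + b" unfolding Q_def by blast
    thus "(c *s x, c *s y) \<in> Q" using QI[of "c *s b" "\<lambda>j. c * a j"] subspace_scale[OF subA(2)]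
      by (simp add: scale_sum_right scale_right_distrib)
  qed
  have QA: "x \<in> A" if "(x, y) \<in> Q" for x y using that unfolding Q_def asA by blast
  have QV: "Q \<subseteq> V \<times> V"
  proof clarify
    fix x y assume xy: "(x, y) \<in> Q"
    then obtain a b where "b \<in> B" "y = (\<Sum>j<d. a j *s cs ! j) + b" unfolding Q_def by blast
    hence "y \<in> V" unfolding CB csC by blast
    thus "x \<in> V \<and> y \<in> V" using QA[OF xy] AV by blast
  qed
  have Q_im0: "Q `` {0} = B"
  proof
    show "Q `` {0} \<subseteq> B"
    proof
      fix y assume "y \<in> Q `` {0}"
      hence "(0, y) \<in> Q" by blast
      then obtain a b where ab: "b \<in> B" "0 = (\<Sum>j<d. a j *s as ! j)" "y = (\<Sum>j<d. a j *s cs ! j) + b" unfolding Q_def by blast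
      have "\<forall>j \<in> {..<d}. a j *s cs ! j = 0"
      proof
        fix j assume "j \<in> {..<d}"
        hence "a j = 0" by (intro as0[OF ab(2)[symmetric]]) (rule lessThan_iff[THEN iffD1])
        thus "a j *s cs ! j = 0" by simp
      qed
      hence "(\<Sum>j<d. a j *s cs ! j) = 0" by (rule sum.neutral)
      thus "y \<in> B" using ab by simp
    qed
    show "B \<subseteq> Q `` {0}"
    proof
      fix b assume "b \<in> B" thus "b \<in> Q `` {0}" using QI[of b "\<lambda>_. 0"] by auto
    qed
  qed
  have Q_im: "Q `` V = V"
  proof
    show "Q `` V \<subseteq> V" using QV by blast
    show "V \<subseteq> Q `` V"
    proof
      fix y assume "y \<in> V"
      then obtain a b where "b \<in> B" "y = (\<Sum>j<d. a j *s cs ! j) + b" unfolding CB csC by blast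
      hence "(\<Sum>j<d. a j *s as ! j, y) \<in> Q" using QI[of b a] by simp
      thus "y \<in> Q `` V" using QV by blast
    qed
  qed
  have Q_pre0: "Q\<inverse> `` {0} = {0}"
  proof
    show "Q\<inverse> `` {0} \<subseteq> {0}"
    proof
      fix x assume "x \<in> Q\<inverse> `` {0}"
      hence "(x, 0) \<in> Q" by blast
      then obtain a b where ab: "b \<in> B" "x = (\<Sum>j<d. a j *s as ! j)" "0 = (\<Sum>j<d. a j *s cs ! j) + b" unfolding Q_def by blast
      have "(\<Sum>j<d. a j *s cs ! j) = - b" using ab(3) by (simp add: eq_neg_iff_add_eq_0)
      moreover have "- b \<in> B" using ab(1) subspace_neg[OF subA(2)] by blast
      moreover have "(\<Sum>j<d. a j *s cs ! j) \<in> C" unfolding csC by blast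
      ultimately have "(\<Sum>j<d. a j *s cs ! j) \<in> C \<inter> B" by (metis IntI)
      hence s0: "(\<Sum>j<d. a j *s cs ! j) = 0" unfolding C(3) by (rule singletonD)
      have "\<forall>j \<in> {..<d}. a j *s as ! j = 0"
      proof
        fix j assume "j \<in> {..<d}"
        hence "a j = 0" by (intro cs0[OF s0]) (rule lessThan_iff[THEN iffD1])
        thus "a j *s as ! j = 0" by simp
      qed
      hence "x = 0" unfolding ab(2) by (rule sum.neutral)
      thus "x \<in> {0}" by simp
    qed
    show "{0} \<subseteq> Q\<inverse> `` {0}" using subrel_0[OF subQ] by blast
  qed
  have Q_pre: "Q\<inverse> `` V = A"
  proof
    show "Q\<inverse> `` V \<subseteq> A" using QA by blast
    show "A \<subseteq> Q\<inverse> `` V"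
    proof
      fix x assume "x \<in> A"
      then obtain a where "x = (\<Sum>j<d. a j *s as ! j)" unfolding asA by blast
      hence "(x, (\<Sum>j<d. a j *s cs ! j) + 0) \<in> Q" using QI[of 0 a] subspace_0[OF subA(2)] by simp
      thus "x \<in> Q\<inverse> `` V" using QV by blast
    qed
  qed
  \<comment> \<open>Beyond \<open>M\<close> nothing but 0 is related to anything, so no basis vector
    can be the source of an edge with a larger letter.\<close>
  define R' where "R' = (\<lambda>i. if i < M then R i else if i = M then Q else {0} \<times> V)"
  have lt: "R' i = R i" if "i < M" for i using that by (simp add: R'_def)
  have eqM: "R' M = Q" by (simp add: R'_def)
  have gt: "R' i = {0} \<times> V" if "M < i" for i using that by (simp add: R'_def)
  have V0: "0 \<in> V" using subspace_0[OF subV] .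
  have gt_im: "({0 :: 'b} \<times> V) `` {0} = V" "({0 :: 'b} \<times> V) `` V = V" "({0 :: 'b} \<times> V)\<inverse> `` {0} = {0}" "({0 :: 'b} \<times> V)\<inverse> `` V = {0}"
    using V0 by auto
  have "relation_family scale V R'"
  proof (unfold_locales)
    show "finite_subspace V" by (rule V)
    show "subrel (R' i)" for i
    proof -
      have "subrel ({0} \<times> V)" unfolding subrel_def using V0 subspace_add[OF subV] subspace_scale[OF subV] by auto
      thus ?thesis using subR(1) subQ by (simp add: R'_def)
    qed
    show "R' i \<subseteq> V \<times> V" for i using subR(2) QV V0 by (auto simp: R'_def)
    show "R' i `` {0} = R' (i - 1) `` V" for i
    proof -
      consider "i < M" | "i = M" | "i = M + 1" | "M + 1 < i" by linarith
      thus ?thesis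
      proof cases
        case 1 thus ?thesis using im0 by (simp add: lt)
      next
        case 2 thus ?thesis using Q_im0 by (simp add: eqM lt B_def)
      next
        case 3 thus ?thesis using Q_im gt_im by (simp add: eqM gt)
      next
        case 4 thus ?thesis using gt_im by (simp add: gt)
      qed
    qed
    show "(R' i)\<inverse> `` {0} = (R' (i + 1))\<inverse> `` V" for i
    proof -
      consider "i + 1 < M" | "i + 1 = M" | "i = M" | "M < i" by linarith
      thus ?thesis
      proof cases
        case 1 thus ?thesis using pre0 by (simp add: lt)
      next
        case 2
        hence "i < M" by simp
        thus ?thesis using pre0[of i] Q_pre 2 by (simp add: eqM lt A_def)
      next
        case 3
        hence "R' i = Q" "R' (i + 1) = {0} \<times> V" using eqM gt by auto
        thus ?thesis using Q_pre0 gt_im(4) by (simp only:)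
      next
        case 4
        hence "R' i = {0} \<times> V" "R' (i + 1) = {0} \<times> V" using gt by auto
        thus ?thesis using gt_im(3,4) by (simp only:)
      qed
    qed
    show "\<exists>i. R' i `` V = {0}" using low(2)[of "i0 - 1"] M by (intro exI[of _ "i0 - 1"]) (simp add: lt)
    show "\<exists>i. R' i `` V = V" using Q_im eqM by auto
    show "\<exists>i. (R' i)\<inverse> `` V = V" using low(1)[of i0] M by (intro exI[of _ i0]) (simp add: lt)
    show "\<exists>i. (R' i)\<inverse> `` V = {0}" using gt_im(4) gt[of "M + 1"] by (intro exI[of _ "M + 1"]) (simp only:)
  qed
  moreover have "x \<in> (R M)\<inverse> `` V" if "(x, y) \<in> R' M" for x y using QA that unfolding eqM A_def by blast
  moreover have "x = 0" if "M < i" "(x, y) \<in> R' i" for i x y using that gt by auto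
  ultimately show ?thesis using that[OF _ lt] by blast
qed

end

section \<open>The relations attached to a matrix\<close>

definition fscale :: "'a::field \<Rightarrow> (nat \<Rightarrow> 'a) \<Rightarrow> nat \<Rightarrow> 'a" where
  "fscale c f = (\<lambda>i. c * f i)"

lemma fscale_apply [simp]: "fscale c f i = c * f i"
  by (simp add: fscale_def)

global_interpretation fn: vspace "fscale :: 'a::field \<Rightarrow> (nat \<Rightarrow> 'a) \<Rightarrow> nat \<Rightarrow> 'a"
  by unfold_locales (auto simp: fun_eq_iff algebra_simps)

lemma sum_fun_apply: "(\<Sum>j\<in>A. g j) i = (\<Sum>j\<in>A. (g j i :: 'a::comm_monoid_add))"
  by (induction A rule: infinite_finite_induct) auto

text \<open>Vectors of length \<open>N\<close> are functions vanishing from \<open>N\<close> on, so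
  that all lengths live in one vector space.\<close>

definition fvec :: "nat \<Rightarrow> (nat \<Rightarrow> 'a::zero) set" where
  "fvec N = {f. \<forall>i \<ge> N. f i = 0}"

lemma subspace_fvec: "fn.subspace (fvec N)"
  by (auto simp: fn.subspace_def fvec_def)

definition unit_fun :: "nat \<Rightarrow> nat \<Rightarrow> 'a::zero_neq_one" where
  "unit_fun j = (\<lambda>i. if i = j then 1 else 0)"

lemma sum_unit_fun:
  fixes c :: "nat \<Rightarrow> 'a::field"
  shows "(\<Sum>j<N. fscale (c j) (unit_fun j)) = (\<lambda>i. if i < N then c i else 0)"
proof
  fix i
  have "(\<Sum>j<N. c j * unit_fun j i) = (\<Sum>j<N. if j = i then c i else 0)"
    by (rule sum.cong) (auto simp: unit_fun_def)
  thus "(\<Sum>j<N. fscale (c j) (unit_fun j)) i = (if i < N then c i else 0)" by (simp add: sum_fun_apply)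
qed

lemma list_basis_fvec: "fn.list_basis (map unit_fun [0..<N]) (fvec N :: (nat \<Rightarrow> 'a::field) set)"
proof -
  let ?L = "map unit_fun [0..<N] :: (nat \<Rightarrow> 'a) list"
  have s: "(\<Sum>j<length ?L. fscale (c j) (?L ! j)) = (\<lambda>i. if i < N then c i else 0)" for c :: "nat \<Rightarrow> 'a"
  proof -
    have "(\<Sum>j<length ?L. fscale (c j) (?L ! j)) = (\<Sum>j<N. fscale (c j) (unit_fun j))" by (rule sum.cong) auto
    thus ?thesis by (simp add: sum_unit_fun)
  qed
  have lb: "fn.list_basis ?L (fn.span (set ?L))"
  proof (rule fn.list_basisI_index)
    fix c :: "nat \<Rightarrow> 'a" and j assume "(\<Sum>j<length ?L. fscale (c j) (?L ! j)) = 0" "j < length ?L"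
    from fun_cong[OF this(1)[unfolded s], of j] this(2) show "c j = 0" by simp
  qed
  have "fn.span (set ?L) = {\<lambda>i. if i < N then c i else 0 | c. True}"
    using fn.list_basis_index(2)[OF lb] unfolding s .
  also have "\<dots> = fvec N"
  proof
    show "(fvec N :: (nat \<Rightarrow> 'a) set) \<subseteq> {\<lambda>i. if i < N then c i else 0 | c. True}"
    proof
      fix f :: "nat \<Rightarrow> 'a" assume "f \<in> fvec N"
      hence "f = (\<lambda>i. if i < N then f i else 0)" by (auto simp: fvec_def fun_eq_iff)
      thus "f \<in> {\<lambda>i. if i < N then c i else 0 | c. True}" by blast
    qed
  qed (auto simp: fvec_def)
  finally show ?thesis using lb by simp
qed

lemma dim_fvec: "fn.dim (fvec N :: (nat \<Rightarrow> 'a::field) set) = N"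
  using fn.list_basis_dim[OF list_basis_fvec] by simp

lemma finite_subspace_fvec: "fn.finite_subspace (fvec N :: (nat \<Rightarrow> 'a::field) set)"
  unfolding fn.finite_subspace_def
proof (intro conjI exI)
  show "fvec N \<subseteq> fn.span (set (map unit_fun [0..<N] :: (nat \<Rightarrow> 'a) list))"
    using list_basis_fvec[of N, where ?'a = 'a] by (simp add: fn.list_basis_def)
qed (simp_all add: subspace_fvec)

definition cols :: "nat \<Rightarrow> (nat \<Rightarrow> 'a) list \<Rightarrow> 'a mat" where
  "cols N vs = mat N (length vs) (\<lambda>(a, j). (vs ! j) a)"

lemma cols_carrier [simp]: "cols N vs \<in> carrier_mat N (length vs)"
  by (simp add: cols_def)

lemma cols_basis:
  assumes "fn.list_basis vs (fvec N :: (nat \<Rightarrow> 'a::field) set)"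
  shows "length vs = N" "invertible_mat (cols N vs)"
proof -
  show len: "length vs = N" using fn.list_basis_dim[OF assms] dim_fvec[of N, where ?'a = 'a] by simp
  have c: "cols N vs \<in> carrier_mat N N" using cols_carrier[of N vs] len by simp
  have mem: "vs ! j \<in> fvec N" if "j < N" for j
    using assms that len fn.span_superset[of "set vs"] by (auto simp: fn.list_basis_def)
  show "invertible_mat (cols N vs)" unfolding invertible_mat_iff_inj[OF c]
  proof (intro ballI impI)
    fix v :: "'a vec" assume v: "v \<in> carrier_vec N" "cols N vs *\<^sub>v v = 0\<^sub>v N"
    have "(\<Sum>j<length vs. fscale (vec_index v j) (vs ! j)) = 0"
    proof
      fix a
      show "(\<Sum>j<length vs. fscale (vec_index v j) (vs ! j)) a = 0 a"
      proof (cases "a < N")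
        case True
        have "vec_index (cols N vs *\<^sub>v v) a = (\<Sum>j<N. vec_index v j * (vs ! j) a)"
          using True v(1) len by (auto simp: cols_def scalar_prod_def lessThan_atLeast0 mult.commute intro!: sum.cong)
        thus ?thesis using True unfolding v(2) by (simp add: sum_fun_apply len)
      next
        case False
        have "(vs ! j) a = 0" if "j < N" for j using mem[OF that] False by (simp add: fvec_def)
        thus ?thesis by (simp add: sum_fun_apply len)
      qed
    qed
    hence "vec_index v j = 0" if "j < N" for j using fn.list_basis_index(1)[OF assms, of "vec_index v" j] that len by simp
    thus "v = 0\<^sub>v N" using v(1) by (intro eq_vecI) auto
  qed
qed

section \<open>Reduction modulo the uniformizer of the graph of a matrix\<close>

context dvr
begin

definition red :: "nat \<Rightarrow> (nat \<Rightarrow> 'd) \<Rightarrow> nat \<Rightarrow> 'r" where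
  "red N x = (\<lambda>a. if a < N then res (x a) else 0)"

lemma red_fvec [simp]: "red N x \<in> fvec N"
  by (simp add: red_def fvec_def)

lemma red_surj:
  assumes "f \<in> fvec N" obtains x where "red N x = f"
proof -
  have "\<forall>a. \<exists>d. res d = f a" using res_surj by blast
  then obtain x where "\<forall>a. res (x a) = f a" by (rule choice[THEN exE])
  hence "red N x = f" using assms by (auto simp: red_def fvec_def fun_eq_iff)
  thus ?thesis using that by blast
qed

lemma red_eq_0_iff: "red N x = 0 \<longleftrightarrow> (\<forall>a<N. t dvd x a)"
  by (auto simp: red_def fun_eq_iff res_eq_0_iff)

text \<open>Over the field of fractions \<open>W x = t\<^sup>i y\<close> determines \<open>y\<close>; after reduction modulo \<open>t\<close> only a
  relation remains. The index \<open>\<infinity>\<close> stands for \<open>t\<^sup>i = 0\<close>.\<close>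

definition rel :: "nat \<Rightarrow> 'd fract mat \<Rightarrow> int extended \<Rightarrow> ((nat \<Rightarrow> 'r) \<times> (nat \<Rightarrow> 'r)) set" where
  "rel N W l = {(red N x, red N y) | x y. \<forall>a<N. (\<Sum>b<N. W $$ (a, b) * to_fract (x b)) = wt l * to_fract (y a)}"

lemma relI:
  "(\<And>a. a < N \<Longrightarrow> (\<Sum>b<N. W $$ (a, b) * to_fract (x b)) = wt l * to_fract (y a)) \<Longrightarrow> (red N x, red N y) \<in> rel N W l"
  unfolding rel_def by blast

lemma relE:
  assumes "(u, v) \<in> rel N W l"
  obtains x y where "u = red N x" "v = red N y" "\<And>a. a < N \<Longrightarrow> (\<Sum>b<N. W $$ (a, b) * to_fract (x b)) = wt l * to_fract (y a)"
  using assms unfolding rel_def by blast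

lemma rel_subset: "rel N W l \<subseteq> fvec N \<times> fvec N"
  by (auto elim!: relE)

lemma rel_subrel: "fn.subrel (rel N W l)"
  unfolding fn.subrel_def
proof (intro conjI allI impI)
  have "(red N (\<lambda>_. 0), red N (\<lambda>_. 0)) \<in> rel N W l" by (rule relI) simp
  moreover have "red N (\<lambda>_. 0) = 0" by (auto simp: red_def fun_eq_iff)
  ultimately show "(0, 0) \<in> rel N W l" by simp
next
  fix u v u' v' assume "(u, v) \<in> rel N W l" "(u', v') \<in> rel N W l"
  then obtain x y x' y' where *: "u = red N x" "v = red N y" "u' = red N x'" "v' = red N y'"
    "\<And>a. a < N \<Longrightarrow> (\<Sum>b<N. W $$ (a, b) * to_fract (x b)) = wt l * to_fract (y a)"
    "\<And>a. a < N \<Longrightarrow> (\<Sum>b<N. W $$ (a, b) * to_fract (x' b)) = wt l * to_fract (y' a)" by (elim relE) blast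
  have "(red N (\<lambda>a. x a + x' a), red N (\<lambda>a. y a + y' a)) \<in> rel N W l"
    by (rule relI) (simp add: distrib_left sum.distrib *)
  moreover have "red N (\<lambda>a. x a + x' a) = u + u'" "red N (\<lambda>a. y a + y' a) = v + v'"
    by (auto simp: red_def * fun_eq_iff res.hom_add)
  ultimately show "(u + u', v + v') \<in> rel N W l" by simp
next
  fix c u v assume "(u, v) \<in> rel N W l"
  then obtain x y where *: "u = red N x" "v = red N y"
    "\<And>a. a < N \<Longrightarrow> (\<Sum>b<N. W $$ (a, b) * to_fract (x b)) = wt l * to_fract (y a)" by (elim relE) blast
  obtain d where d: "res d = c" using res_surj by blast
  have "(red N (\<lambda>a. d * x a), red N (\<lambda>a. d * y a)) \<in> rel N W l"
  proof (rule relI)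
    fix a assume "a < N"
    have "(\<Sum>b<N. W $$ (a, b) * to_fract (d * x b)) = to_fract d * (\<Sum>b<N. W $$ (a, b) * to_fract (x b))"
      unfolding sum_distrib_left by (rule sum.cong) (simp_all add: mult_ac)
    thus "(\<Sum>b<N. W $$ (a, b) * to_fract (d * x b)) = wt l * to_fract (d * y a)" using *(3)[OF \<open>a < N\<close>] by (simp add: mult_ac)
  qed
  moreover have "red N (\<lambda>a. d * x a) = fscale c u" "red N (\<lambda>a. d * y a) = fscale c v"
    by (auto simp: red_def * fun_eq_iff res.hom_mult d)
  ultimately show "(fscale c u, fscale c v) \<in> rel N W l" by simp
qed

text \<open>With weight 0 the second vector is unconstrained: the relation only says that
  \<open>u\<close> is the residue of a kernel vector. Any vertex may therefore follow such an
  edge.\<close>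

lemma rel_infinity: "(u, v) \<in> rel N W Pinf \<Longrightarrow> v' \<in> fvec N \<Longrightarrow> (u, v') \<in> rel N W Pinf"
proof -
  assume "(u, v) \<in> rel N W Pinf" "v' \<in> fvec N"
  then obtain x y' where *: "u = red N x" "red N y' = v'" "\<And>a. a < N \<Longrightarrow> (\<Sum>b<N. W $$ (a, b) * to_fract (x b)) = 0"
    by (elim relE red_surj) auto
  have "(red N x, red N y') \<in> rel N W Pinf" by (rule relI) (simp add: *)
  thus ?thesis by (simp add: *)
qed

lemma powi_step: "to_fract t powi (i + 1) = to_fract t powi i * to_fract t"
  using t_nonzero by (simp add: power_int_add)

text \<open>A first vector with residue 0 is \<open>t\<close> times an integral vector, and
  cancelling this \<open>t\<close> lowers the exponent by one; multiplication by \<open>t\<close>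
  goes back.\<close>

lemma rel_image_zero: "rel N W (Fin i) `` {0} = rel N W (Fin (i - 1)) `` fvec N"
proof
  show "rel N W (Fin i) `` {0} \<subseteq> rel N W (Fin (i - 1)) `` fvec N"
  proof
    fix v assume "v \<in> rel N W (Fin i) `` {0}"
    hence "(0, v) \<in> rel N W (Fin i)" by blast
    then obtain x y where xy: "0 = red N x" "v = red N y"
      "\<And>a. a < N \<Longrightarrow> (\<Sum>b<N. W $$ (a, b) * to_fract (x b)) = to_fract t powi i * to_fract (y a)" by (elim relE) auto
    have "\<forall>a. \<exists>z. a < N \<longrightarrow> x a = t * z" using red_eq_0_iff[of N x] xy(1) by (auto simp: dvd_def)
    then obtain z where z: "\<And>a. a < N \<Longrightarrow> x a = t * z a" by metis
    have "(red N z, red N y) \<in> rel N W (Fin (i - 1))"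
    proof (rule relI)
      fix a assume a: "a < N"
      have "to_fract t * (\<Sum>b<N. W $$ (a, b) * to_fract (z b)) = (\<Sum>b<N. W $$ (a, b) * to_fract (x b))"
        unfolding sum_distrib_left by (rule sum.cong) (simp_all add: z mult_ac)
      also have "\<dots> = to_fract t * (to_fract t powi (i - 1) * to_fract (y a))"
        unfolding xy(3)[OF a] using powi_step[of "i - 1"] by simp
      finally show "(\<Sum>b<N. W $$ (a, b) * to_fract (z b)) = wt (Fin (i - 1)) * to_fract (y a)" using t_nonzero by simp
    qed
    thus "v \<in> rel N W (Fin (i - 1)) `` fvec N" using xy(2) red_fvec by blast
  qed
  show "rel N W (Fin (i - 1)) `` fvec N \<subseteq> rel N W (Fin i) `` {0}"
  proof
    fix v assume "v \<in> rel N W (Fin (i - 1)) `` fvec N"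
    then obtain u where "(u, v) \<in> rel N W (Fin (i - 1))" by blast
    then obtain x y where xy: "u = red N x" "v = red N y"
      "\<And>a. a < N \<Longrightarrow> (\<Sum>b<N. W $$ (a, b) * to_fract (x b)) = to_fract t powi (i - 1) * to_fract (y a)" by (elim relE) auto
    have "(red N (\<lambda>a. t * x a), red N y) \<in> rel N W (Fin i)"
    proof (rule relI)
      fix a assume a: "a < N"
      have "(\<Sum>b<N. W $$ (a, b) * to_fract (t * x b)) = to_fract t * (\<Sum>b<N. W $$ (a, b) * to_fract (x b))"
        unfolding sum_distrib_left by (rule sum.cong) (simp_all add: mult_ac)
      thus "(\<Sum>b<N. W $$ (a, b) * to_fract (t * x b)) = wt (Fin i) * to_fract (y a)"
        unfolding xy(3)[OF a] using powi_step[of "i - 1"] by simp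
    qed
    moreover have "red N (\<lambda>a. t * x a) = 0" by (simp add: red_eq_0_iff)
    ultimately show "v \<in> rel N W (Fin i) `` {0}" using xy(2) by auto
  qed
qed

text \<open>As before, but now \<open>t\<close> is moved out of the second vector, which raises the
  exponent.\<close>

lemma rel_preimage_zero: "(rel N W (Fin i))\<inverse> `` {0} = (rel N W (Fin (i + 1)))\<inverse> `` fvec N"
proof
  show "(rel N W (Fin i))\<inverse> `` {0} \<subseteq> (rel N W (Fin (i + 1)))\<inverse> `` fvec N"
  proof
    fix u assume "u \<in> (rel N W (Fin i))\<inverse> `` {0}"
    hence "(u, 0) \<in> rel N W (Fin i)" by blast
    then obtain x y where xy: "u = red N x" "0 = red N y"
      "\<And>a. a < N \<Longrightarrow> (\<Sum>b<N. W $$ (a, b) * to_fract (x b)) = to_fract t powi i * to_fract (y a)" by (elim relE) auto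
    have "\<forall>a. \<exists>z. a < N \<longrightarrow> y a = t * z" using red_eq_0_iff[of N y] xy(2) by (auto simp: dvd_def)
    then obtain z where z: "\<And>a. a < N \<Longrightarrow> y a = t * z a" by metis
    have "(red N x, red N z) \<in> rel N W (Fin (i + 1))" by (rule relI) (simp add: xy(3) z powi_step)
    thus "u \<in> (rel N W (Fin (i + 1)))\<inverse> `` fvec N" using xy(1) red_fvec by blast
  qed
  show "(rel N W (Fin (i + 1)))\<inverse> `` fvec N \<subseteq> (rel N W (Fin i))\<inverse> `` {0}"
  proof
    fix u assume "u \<in> (rel N W (Fin (i + 1)))\<inverse> `` fvec N"
    then obtain v where "(u, v) \<in> rel N W (Fin (i + 1))" by blast
    then obtain x y where xy: "u = red N x" "v = red N y"
      "\<And>a. a < N \<Longrightarrow> (\<Sum>b<N. W $$ (a, b) * to_fract (x b)) = to_fract t powi (i + 1) * to_fract (y a)" by (elim relE) auto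
    have "(red N x, red N (\<lambda>a. t * y a)) \<in> rel N W (Fin i)" by (rule relI) (simp add: xy(3) powi_step)
    moreover have "red N (\<lambda>a. t * y a) = 0" by (simp add: red_eq_0_iff)
    ultimately show "u \<in> (rel N W (Fin i))\<inverse> `` {0}" using xy(1) by auto
  qed
qed

lemma integral_after_scaling_finite:
  "finite I \<Longrightarrow> \<exists>n. \<forall>i \<in> I. \<exists>a. to_fract t ^ n * g i = to_fract a"
proof (induction I rule: finite_induct)
  case (insert i I)
  then obtain n where n: "\<And>j. j \<in> I \<Longrightarrow> \<exists>a. to_fract t ^ n * g j = to_fract a" by blast
  obtain n' a' where n': "to_fract t ^ n' * g i = to_fract a'" using integral_after_scaling by blast
  have up: "\<exists>a. to_fract t ^ (p + q) * z = to_fract a" if "to_fract t ^ q * z = to_fract b" for p q z b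
  proof -
    have "to_fract t ^ (p + q) * z = to_fract (t ^ p * b)"
      using that by (simp add: power_add mult.assoc to_fract_pow)
    thus ?thesis ..
  qed
  have "\<exists>a. to_fract t ^ (n + n') * g j = to_fract a" if "j \<in> insert i I" for j
  proof (cases "j = i")
    case True thus ?thesis using up[OF n'] by simp
  next
    case False
    hence "j \<in> I" using that by simp
    from n[OF this] obtain b where "to_fract t ^ n * g j = to_fract b" ..
    from up[OF this, of n'] show ?thesis by (simp add: add.commute)
  qed
  thus ?case by blast
qed simp

text \<open>If \<open>t ^ n\<close> clears the denominators of \<open>W\<close>, the bound is
  \<open>- n\<close>: at exponents up to it \<open>W x\<close> is always an integral multiple of the
  power of \<open>t\<close>, and strictly below it that multiple is itself divisible by
  \<open>t\<close>.\<close>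

lemma rel_low:
  assumes W: "W \<in> carrier_mat N N"
  obtains i0 where "\<And>i. i \<le> i0 \<Longrightarrow> (rel N W (Fin i))\<inverse> `` fvec N = fvec N" "\<And>i. i < i0 \<Longrightarrow> rel N W (Fin i) `` fvec N = {0}"
proof -
  obtain n where "\<forall>p \<in> {..<N} \<times> {..<N}. \<exists>a. to_fract t ^ n * W $$ p = to_fract a"
    using integral_after_scaling_finite[of "{..<N} \<times> {..<N}" "\<lambda>p. W $$ p"] by auto
  hence "\<forall>a b. \<exists>c. a < N \<longrightarrow> b < N \<longrightarrow> to_fract t ^ n * W $$ (a, b) = to_fract c" by auto
  then obtain c where c: "\<And>a b. a < N \<Longrightarrow> b < N \<Longrightarrow> to_fract t ^ n * W $$ (a, b) = to_fract (c a b)" by metis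
  have W_eq: "(\<Sum>b<N. W $$ (a, b) * to_fract (x b)) = to_fract t powi i * to_fract (t ^ nat (- int n - i) * (\<Sum>b<N. c a b * x b))"
    if "a < N" "i \<le> - int n" for a x i
  proof -
    have tn: "to_fract t \<noteq> 0" using t_nonzero by simp
    have "to_fract t powi i * to_fract (t ^ nat (- int n - i)) = to_fract t powi (- int n)"
    proof -
      have "to_fract (t ^ nat (- int n - i)) = to_fract t powi (- int n - i)"
        using that(2) by (simp add: to_fract_pow power_int_def)
      thus ?thesis using tn by (simp add: power_int_add[symmetric])
    qed
    moreover have "to_fract (\<Sum>b<N. c a b * x b) = to_fract t ^ n * (\<Sum>b<N. W $$ (a, b) * to_fract (x b))"
      unfolding sum_distrib_left by (simp add: c that(1) mult.assoc[symmetric])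
    ultimately have "to_fract t powi i * to_fract (t ^ nat (- int n - i) * (\<Sum>b<N. c a b * x b)) =
      to_fract t powi (- int n) * (to_fract t ^ n * (\<Sum>b<N. W $$ (a, b) * to_fract (x b)))"
      by (simp add: mult.assoc[symmetric])
    also have "\<dots> = (\<Sum>b<N. W $$ (a, b) * to_fract (x b))" using tn by (simp add: power_int_minus)
    finally show ?thesis by simp
  qed
  show ?thesis
  proof (rule that)
    fix i assume i: "i \<le> - int n"
    show "(rel N W (Fin i))\<inverse> `` fvec N = fvec N"
    proof
      show "(rel N W (Fin i))\<inverse> `` fvec N \<subseteq> fvec N" using rel_subset by blast
      show "fvec N \<subseteq> (rel N W (Fin i))\<inverse> `` fvec N"
      proof
        fix u :: "nat \<Rightarrow> 'r" assume "u \<in> fvec N"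
        then obtain x where x: "red N x = u" by (rule red_surj)
        have "(red N x, red N (\<lambda>a. t ^ nat (- int n - i) * (\<Sum>b<N. c a b * x b))) \<in> rel N W (Fin i)"
          by (rule relI) (simp add: W_eq[OF _ i])
        thus "u \<in> (rel N W (Fin i))\<inverse> `` fvec N" using x red_fvec by blast
      qed
    qed
  next
    fix i assume i: "i < - int n"
    show "rel N W (Fin i) `` fvec N = {0}"
    proof
      show "rel N W (Fin i) `` fvec N \<subseteq> {0}"
      proof
        fix v assume "v \<in> rel N W (Fin i) `` fvec N"
        then obtain u where "(u, v) \<in> rel N W (Fin i)" by blast
        then obtain x y where xy: "v = red N y"
          "\<And>a. a < N \<Longrightarrow> (\<Sum>b<N. W $$ (a, b) * to_fract (x b)) = to_fract t powi i * to_fract (y a)" by (elim relE) auto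
        have "t dvd y a" if a: "a < N" for a
        proof -
          have "to_fract t powi i * to_fract (y a) = to_fract t powi i * to_fract (t ^ nat (- int n - i) * (\<Sum>b<N. c a b * x b))"
            by (rule trans[OF xy(2)[OF a, symmetric] W_eq[OF a]]) (use i in simp)
          moreover have "to_fract t powi i \<noteq> 0" using t_nonzero by simp
          ultimately have "to_fract (y a) = to_fract (t ^ nat (- int n - i) * (\<Sum>b<N. c a b * x b))"
            using mult_left_cancel by blast
          hence "y a = t ^ nat (- int n - i) * (\<Sum>b<N. c a b * x b)" by (rule to_fract_eq_iff[THEN iffD1])
          thus ?thesis using i by (simp add: dvd_power)
        qed
        thus "v \<in> {0}" using xy(1) red_eq_0_iff by simp
      qed
      show "{0} \<subseteq> rel N W (Fin i) `` fvec N"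
        using fn.subrel_0[OF rel_subrel, of N W "Fin i"] fn.subspace_0[OF subspace_fvec, of N] by blast
    qed
  qed
qed

text \<open>Over the field of fractions \<open>W\<close> has a linear section \<open>h\<close> on
  its image, with denominators bounded by \<open>t ^ c\<close>. If \<open>W x\<close> is divisible
  by \<open>t ^ (j + c)\<close>, then subtracting \<open>h (W x)\<close>, an integral multiple of
  \<open>t ^ j\<close>, turns \<open>x\<close> into a kernel vector with the same residue.\<close>

lemma rel_high:
  fixes i0 :: int
  obtains M where "i0 < M" "\<And>u. u \<in> (rel N W (Fin M))\<inverse> `` fvec N \<Longrightarrow> (u, 0) \<in> rel N W Pinf"
proof -
  define f where "f = (\<lambda>(x :: nat \<Rightarrow> 'd fract) a. if a < N then \<Sum>b<N. W $$ (a, b) * x b else 0)"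
  have f_add: "f (x + x') = f x + f x'" for x x'
    by (auto simp: f_def fun_eq_iff distrib_left sum.distrib)
  have f_scale: "f (fscale c x) = fscale c (f x)" for c x
    by (auto simp: f_def fun_eq_iff sum_distrib_left mult_ac)
  have f_0: "f 0 = 0" by (auto simp: f_def fun_eq_iff)
  have sub: "fn.subspace (range f)"
  proof (rule fn.subspaceI)
    show "0 \<in> range f" by (rule range_eqI[of _ f 0]) (rule f_0[symmetric])
  next
    fix y y' assume "y \<in> range f" "y' \<in> range f"
    then obtain x x' where "y = f x" "y' = f x'" by blast
    hence "y + y' = f (x + x')" using f_add by simp
    thus "y + y' \<in> range f" by (rule range_eqI[of _ f "x + x'"])
  next
    fix c y assume "y \<in> range f"
    then obtain x where "y = f x" by blast
    hence "fscale c y = f (fscale c x)" using f_scale by simp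
    thus "fscale c y \<in> range f" by (rule range_eqI[of _ f "fscale c x"])
  qed
  have "fn.subrel {(y, x). y = f x}" unfolding fn.subrel_def using f_0 f_add f_scale by auto
  then obtain h where h: "Vector_Spaces.linear fscale fscale h" "\<And>y. y \<in> range f \<Longrightarrow> (y, h y) \<in> {(y, x). y = f x}"
    by (rule fn.linear_selection[OF sub]) auto
  interpret h: Vector_Spaces.linear "fscale :: 'd fract \<Rightarrow> _" fscale h by (rule h(1))
  obtain c where "\<forall>p \<in> {..<N} \<times> {..<N}. \<exists>a. to_fract t ^ c * h (unit_fun (snd p)) (fst p) = to_fract a"
    using integral_after_scaling_finite[of "{..<N} \<times> {..<N}" "\<lambda>p. h (unit_fun (snd p)) (fst p)"] by auto
  hence "\<forall>a b. \<exists>g. a < N \<longrightarrow> b < N \<longrightarrow> to_fract t ^ c * h (unit_fun b) a = to_fract g" by auto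
  then obtain G where G: "\<And>a b. a < N \<Longrightarrow> b < N \<Longrightarrow> to_fract t ^ c * h (unit_fun b) a = to_fract (G a b)" by metis
  \<comment> \<open>Positive, so that the correction vanishes modulo \<open>t\<close>, and large
    enough to place the index above \<open>i0\<close>.\<close>
  define j where "j = Suc (nat i0)"
  show ?thesis
  proof (rule that)
    show "i0 < int (j + c)" by (simp add: j_def)
    fix u assume "u \<in> (rel N W (Fin (int (j + c))))\<inverse> `` fvec N"
    then obtain v where "(u, v) \<in> rel N W (Fin (int (j + c)))" by blast
    then obtain x y where u: "u = red N x" and y: "\<And>a. a < N \<Longrightarrow>
      (\<Sum>b<N. W $$ (a, b) * to_fract (x b)) = wt (Fin (int (j + c))) * to_fract (y a)" by (rule relE) blast
    have xy: "u = red N x"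
      "\<And>a. a < N \<Longrightarrow> (\<Sum>b<N. W $$ (a, b) * to_fract (x b)) = to_fract t ^ (j + c) * to_fract (y a)"
      using u y by (simp_all del: of_nat_add)
    define Y where "Y = (\<lambda>a. if a < N then to_fract t ^ (j + c) * to_fract (y a) else 0)"
    define x' where "x' = (\<lambda>a. x a - t ^ j * (\<Sum>b<N. G a b * y b))"
    have Yf: "Y = f (\<lambda>a. to_fract (x a))" using xy(2) by (auto simp: Y_def f_def fun_eq_iff)
    have fhY: "f (h Y) = Y" using h(2)[of Y] Yf by auto
    have "Y = (\<Sum>b<N. fscale (to_fract t ^ (j + c) * to_fract (y b)) (unit_fun b))" unfolding sum_unit_fun Y_def ..
    hence "h Y = (\<Sum>b<N. fscale (to_fract t ^ (j + c) * to_fract (y b)) (h (unit_fun b)))"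
      by (simp only: h.sum h.scale)
    hence hY: "h Y a = to_fract (t ^ j * (\<Sum>b<N. G a b * y b))" if "a < N" for a
    proof -
      have "h Y a = (\<Sum>b<N. to_fract t ^ j * to_fract (y b) * (to_fract t ^ c * h (unit_fun b) a))"
        unfolding \<open>h Y = _\<close> by (simp add: sum_fun_apply power_add mult_ac)
      also have "\<dots> = (\<Sum>b<N. to_fract (t ^ j * (G a b * y b)))"
        by (rule sum.cong) (simp_all add: G that to_fract_pow mult_ac)
      finally show ?thesis by (simp add: sum_distrib_left)
    qed
    have "(red N x', red N (\<lambda>_. 0)) \<in> rel N W Pinf"
    proof (rule relI)
      fix a assume a: "a < N"
      have "(\<Sum>b<N. W $$ (a, b) * to_fract (x' b)) = (\<Sum>b<N. W $$ (a, b) * to_fract (x b)) - (\<Sum>b<N. W $$ (a, b) * h Y b)"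
        unfolding sum_subtractf[symmetric] by (rule sum.cong) (simp_all add: x'_def hY right_diff_distrib del: to_fract_mult)
      also have "\<dots> = Y a - f (h Y) a" using a by (simp add: xy(2) Y_def f_def)
      finally show "(\<Sum>b<N. W $$ (a, b) * to_fract (x' b)) = wt Pinf * to_fract 0" unfolding fhY by simp
    qed
    moreover have "red N x' = red N x" by (auto simp: red_def x'_def fun_eq_iff res.hom_minus res.hom_mult res.hom_power j_def)
    moreover have "red N (\<lambda>_. 0) = 0" by (auto simp: red_def fun_eq_iff)
    ultimately show "(u, 0) \<in> rel N W Pinf" using xy(1) by simp
  qed
qed

end

lemma mset_concat_filter:
  "mset (concat (map g (filter P xs))) + mset (concat (map g (filter (\<lambda>x. \<not> P x) xs))) = mset (concat (map g xs))"
  by (induction xs) (auto simp: ac_simps)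

context dvr
begin

section \<open>Existence of the decomposition\<close>

text \<open>Each edge of the cycle lifts to an exact equation between integral vectors; these lifts
  supply the columns of the pair behind a morphism from the cyclic matrix to
  \<open>W\<close>.\<close>

lemma cols_hom_cyc:
  assumes W: "W \<in> carrier_mat N N" and dat: "cyc_data n k lab M"
    and edge: "\<And>s q. s < n \<Longrightarrow> q < k \<Longrightarrow>
      (e (Suc s mod n) q, \<Sum>u<k. fscale (res (M s $$ (u, q))) (e s u)) \<in> rel N W (lab s)"
  shows "cols N (map (\<lambda>j. e (j div k) (j mod k)) [0..<n * k]) \<in> hom (cyc n k lab M) W"
proof -
  have n: "0 < n" "0 < k" and M: "\<And>s. s < n \<Longrightarrow> M s \<in> carrier_mat k k" "\<And>s. s < n \<Longrightarrow> invertible_mat (mres (M s))"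
    using dat by (auto simp: cyc_data_def)
  have "\<exists>I. I \<in> carrier_mat k k \<and> M s * I = 1\<^sub>m k \<and> I * M s = 1\<^sub>m k" if "s < n" for s
    by (rule invertible_matE[OF unit_inverse_lift[OF M(1)[OF that] M(2)[OF that]] M(1)[OF that]]) blast
  then obtain I where I: "\<And>s. s < n \<Longrightarrow> I s \<in> carrier_mat k k" "\<And>s. s < n \<Longrightarrow> M s * I s = 1\<^sub>m k"
    "\<And>s. s < n \<Longrightarrow> I s * M s = 1\<^sub>m k" by metis
  define Q where "Q = (\<lambda>s q x y. s < n \<longrightarrow> q < k \<longrightarrow> red N x = e (Suc s mod n) q \<and>
    red N y = (\<Sum>u<k. fscale (res (M s $$ (u, q))) (e s u)) \<and>
    (\<forall>a<N. (\<Sum>b<N. W $$ (a, b) * to_fract (x b)) = wt (lab s) * to_fract (y a)))"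
  have "\<exists>x y. Q s q x y" for s q
  proof (cases "s < n \<and> q < k")
    case True
    obtain x y where "e (Suc s mod n) q = red N x" "(\<Sum>u<k. fscale (res (M s $$ (u, q))) (e s u)) = red N y"
      "\<And>a. a < N \<Longrightarrow> (\<Sum>b<N. W $$ (a, b) * to_fract (x b)) = wt (lab s) * to_fract (y a)"
      by (rule relE[OF edge[of s q]]) (use True in blast)+
    hence "Q s q x y" unfolding Q_def by simp
    thus ?thesis by blast
  qed (auto simp: Q_def)
  then obtain X where "\<forall>s q. \<exists>y. Q s q (X s q) y" by metis
  then obtain Y where Q: "\<And>s q. Q s q (X s q) (Y s q)" by metis
  have XY: "red N (X s q) = e (Suc s mod n) q"
      "red N (Y s q) = (\<Sum>u<k. fscale (res (M s $$ (u, q))) (e s u))"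
      "a < N \<Longrightarrow> (\<Sum>b<N. W $$ (a, b) * to_fract (X s q b)) = wt (lab s) * to_fract (Y s q a)" if "s < n" "q < k" for s q a
    using Q[of s q] that unfolding Q_def by blast+
  have resX: "res (X s q a) = e (Suc s mod n) q a" if "s < n" "q < k" "a < N" for s q a
    using fun_cong[OF XY(1)[OF that(1,2)], of a] that(3) by (simp add: red_def)
  have resY: "res (Y s q a) = (\<Sum>u<k. res (M s $$ (u, q)) * e s u a)" if "s < n" "q < k" "a < N" for s q a
    using fun_cong[OF XY(2)[OF that(1,2)], of a] that(3) by (simp add: red_def sum_fun_apply)
  define prd where "prd = (\<lambda>s. (s + n - 1) mod n)"
  have prd: "prd s < n" "Suc (prd s) mod n = s" if "s < n" for s
  proof -
    show "prd s < n" using n by (simp add: prd_def)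
    have "Suc (prd s) mod n = Suc (s + n - 1) mod n" unfolding prd_def by (rule mod_Suc_eq)
    thus "Suc (prd s) mod n = s" using n that by simp
  qed
  \<comment> \<open>Cell \<open>s\<close> of \<open>T\<close> consists of the first vectors of the
    edges arriving from the previous cell. Cell \<open>s\<close> of \<open>S\<close> takes the
    second vectors \<open>Y s\<close> multiplied by the inverse of \<open>M s\<close>, so that
    \<open>S * M\<close> returns \<open>Y\<close> exactly; both reduce to the given vectors.\<close>
  define T where "T = mat N (n * k) (\<lambda>(a, j). X (prd (j div k)) (j mod k) a)"
  define S where "S = mat N (n * k) (\<lambda>(a, j). \<Sum>q<k. Y (j div k) q a * I (j div k) $$ (q, j mod k))"
  have ST: "S \<in> carrier_mat N (n * k)" "T \<in> carrier_mat N (n * k)" by (simp_all add: S_def T_def)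
  have jn: "j div k < n" "j mod k < k" if "j < n * k" for j
    using that n(2) by (simp_all add: less_mult_imp_div_less)
  have inv_entry: "(\<Sum>u<k. A $$ (p, u) * B $$ (u, q)) = (if p = q then 1 else 0)"
    if "A * B = 1\<^sub>m k" "A \<in> carrier_mat k k" "B \<in> carrier_mat k k" "p < k" "q < k" for A B :: "'d mat" and p q
  proof -
    have "(A * B) $$ (p, q) = (\<Sum>u<k. A $$ (p, u) * B $$ (u, q))"
      using that(2-5) by (auto simp: scalar_prod_def lessThan_atLeast0 intro!: sum.cong)
    thus ?thesis using that by simp
  qed
  let ?E = "cols N (map (\<lambda>j. e (j div k) (j mod k)) [0..<n * k])"
  have T: "mres T = ?E"
  proof (rule eq_matI)
    fix a j assume "a < dim_row ?E" "j < dim_col ?E"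
    hence aj: "a < N" "j < n * k" by (auto simp: cols_def)
    thus "mres T $$ (a, j) = ?E $$ (a, j)" using resX[OF prd(1)[OF jn(1)] jn(2)] prd(2)[OF jn(1)] by (simp add: T_def cols_def)
  qed (auto simp: T_def cols_def)
  have S: "mres S = ?E"
  proof (rule eq_matI)
    fix a j assume "a < dim_row ?E" "j < dim_col ?E"
    hence aj: "a < N" "j < n * k" by (auto simp: cols_def)
    define s v where "s = j div k" and "v = j mod k"
    have sv: "s < n" "v < k" using jn[OF aj(2)] by (auto simp: s_def v_def)
    have "res (S $$ (a, j)) = (\<Sum>q<k. (\<Sum>u<k. res (M s $$ (u, q)) * e s u a) * res (I s $$ (q, v)))"
      using aj sv(1) by (simp add: S_def res.hom_sum res.hom_mult resY s_def[symmetric] v_def[symmetric])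
    also have "\<dots> = (\<Sum>u<k. e s u a * res (\<Sum>q<k. M s $$ (u, q) * I s $$ (q, v)))"
      unfolding res.hom_sum sum_distrib_left sum_distrib_right
      by (subst sum.swap) (simp add: res.hom_mult mult_ac)
    also have "\<dots> = (\<Sum>u<k. if u = v then e s v a else 0)"
      using inv_entry[OF I(2)[OF sv(1)] M(1)[OF sv(1)] I(1)[OF sv(1)] _ sv(2)] by (intro sum.cong) auto
    finally show "mres S $$ (a, j) = ?E $$ (a, j)" using aj sv ST(1) by (simp add: cols_def s_def v_def)
  qed (auto simp: S_def cols_def)
  have "lft S * cyc n k lab M = W * lft T"
  proof (rule eq_matI)
    fix a c assume "a < dim_row (W * lft T)" "c < dim_col (W * lft T)"
    hence ac: "a < N" "c < n * k" using W ST(2) by auto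
    define s q where "s = prd (c div k)" and "q = c mod k"
    have sq: "s < n" "q < k" "Suc s mod n = c div k" using jn[OF ac(2)] prd by (auto simp: s_def q_def)
    have c: "c = Suc s mod n * k + q" unfolding sq(3) q_def by simp
    have Sq: "(\<Sum>u<k. S $$ (a, s * k + u) * M s $$ (u, q)) = Y s q a"
    proof -
      have "(\<Sum>u<k. S $$ (a, s * k + u) * M s $$ (u, q)) = (\<Sum>u<k. (\<Sum>p<k. Y s p a * I s $$ (p, u)) * M s $$ (u, q))"
        using ac(1) sq(1) by (intro sum.cong) (auto simp: S_def block_index_less)
      also have "\<dots> = (\<Sum>p<k. Y s p a * (\<Sum>u<k. I s $$ (p, u) * M s $$ (u, q)))"
        unfolding sum_distrib_left sum_distrib_right by (subst sum.swap) (simp add: mult_ac)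
      also have "\<dots> = (\<Sum>p<k. if p = q then Y s q a else 0)"
        using inv_entry[OF I(3)[OF sq(1)] I(1)[OF sq(1)] M(1)[OF sq(1)] _ sq(2)] by (intro sum.cong) auto
      finally show ?thesis using sq(2) by simp
    qed
    have "(lft S * cyc n k lab M) $$ (a * 1 + 0, Suc s mod n * k + q) =
        wt (lab s) * to_fract (\<Sum>u<k. S $$ (a * 1 + 0, s * k + u) * M s $$ (u, q))"
      by (rule cyc_mult_right[of S N 1]) (use ST(1) ac(1) sq in auto)
    hence "(lft S * cyc n k lab M) $$ (a, c) = wt (lab s) * to_fract (Y s q a)" using Sq c by simp
    also have "\<dots> = (\<Sum>b<N. W $$ (a, b) * to_fract (X s q b))" using XY(3)[OF sq(1,2) ac(1)] by simp
    also have "\<dots> = (W * lft T) $$ (a, c)"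
      using W ST(2) ac by (auto simp: scalar_prod_def lessThan_atLeast0 T_def s_def q_def intro!: sum.cong)
    finally show "(lft S * cyc n k lab M) $$ (a, c) = (W * lft T) $$ (a, c)" .
  qed (use W ST in \<open>auto simp: cyc_def\<close>)
  thus ?thesis using T S by (intro homI[OF cyc_carrier W ST]) auto
qed

lemma cols_hom_diag:
  assumes W: "W \<in> carrier_mat N N"
  shows "list_all2 (\<lambda>C vs. C \<in> carrier_mat (length vs) (length vs) \<and> cols N vs \<in> hom C W) Cs vss \<Longrightarrow>
    diag_block_mat Cs \<in> carrier_mat (length (concat vss)) (length (concat vss)) \<and>
    cols N (concat vss) \<in> hom (diag_block_mat Cs) W"
proof (induction rule: list_all2_induct)
  case Nil
  have "(cols N [] :: 'r mat) = 0\<^sub>m N 0" by (rule eq_matI) (auto simp: cols_def)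
  thus ?case using hom_zero[of "diag_block_mat []" 0 W N] W by simp
next
  case (Cons C Cs vs vss)
  let ?D = "diag_block_mat Cs" and ?ws = "concat vss"
  have C: "C \<in> carrier_mat (length vs) (length vs)" "cols N vs \<in> hom C W"
    and D: "?D \<in> carrier_mat (length ?ws) (length ?ws)" "cols N ?ws \<in> hom ?D W" using Cons by auto
  have Z: "(0\<^sub>m 0 0 :: 'd fract mat) \<in> carrier_mat 0 0" by simp
  have "four_block_mat (cols N vs) (cols N ?ws) (0\<^sub>m 0 (length vs)) (0\<^sub>m 0 (length ?ws)) \<in> hom (diag2 C ?D) (diag2 W (0\<^sub>m 0 0))"
    by (rule hom_four_block[OF C(1) D(1) W Z C(2) D(2) hom_zero[OF C(1) Z] hom_zero[OF D(1) Z]])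
  moreover have "diag2 W (0\<^sub>m 0 0) = W" using W by (intro eq_matI) auto
  moreover have "four_block_mat (cols N vs) (cols N ?ws) (0\<^sub>m 0 (length vs)) (0\<^sub>m 0 (length ?ws)) = cols N (vs @ ?ws)"
    by (rule eq_matI) (auto simp: cols_def nth_append)
  ultimately show ?case unfolding diag_block_mat_Cons using C(1) D(1) by simp
qed

text \<open>The condition on \<open>vs ! 0\<close> says that it is the residue of a true kernel
  vector of \<open>W\<close>.\<close>

definition string :: "nat \<Rightarrow> 'd fract mat \<Rightarrow> int list \<times> (nat \<Rightarrow> 'r) list \<Rightarrow> bool" where
  "string N W = (\<lambda>(\<mu>, vs). length vs = Suc (length \<mu>) \<and> (vs ! 0, 0) \<in> rel N W Pinf \<and>
     (\<forall>j < length \<mu>. (vs ! Suc j, vs ! j) \<in> rel N W (Fin (\<mu> ! j))))"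

text \<open>The zero edge closing the cyclic form of the block is supplied by
  \<open>rel_infinity\<close>, applied to the kernel vector at the start.\<close>

lemma string_hom:
  assumes W: "W \<in> carrier_mat N N" and st: "string N W (\<mu>, vs)"
  shows "S_block t \<mu> \<in> carrier_mat (length vs) (length vs) \<and> cols N vs \<in> hom (S_block t \<mu>) W"
proof -
  have len: "length vs = Suc (length \<mu>)" and zero: "(vs ! 0, 0) \<in> rel N W Pinf"
    and step: "\<And>j. j < length \<mu> \<Longrightarrow> (vs ! Suc j, vs ! j) \<in> rel N W (Fin (\<mu> ! j))"
    using st by (auto simp: string_def)
  have one: "fscale (res ((1\<^sub>m 1 :: 'd mat) $$ (0, 0))) v = v" for v by (simp add: fun_eq_iff)
  have mem: "vs ! s \<in> fvec N" if "s < length vs" for s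
    using zero step[of "s - 1"] rel_subset that len by (cases s) force+
  have "cols N (map (\<lambda>j. vs ! (j div 1)) [0..<Suc (length \<mu>) * 1]) \<in>
    hom (cyc (Suc (length \<mu>)) 1 (S_lab \<mu>) (\<lambda>_. 1\<^sub>m 1)) W"
  proof (rule cols_hom_cyc[OF W S_cyc_data, where e = "\<lambda>s b. vs ! s"])
    fix s q assume sq: "s < Suc (length \<mu>)" "q < (1 :: nat)"
    have "(\<Sum>u<1. fscale (res ((1\<^sub>m 1 :: 'd mat) $$ (u, q))) (vs ! s)) = vs ! s" using sq one by simp
    moreover have "(vs ! (Suc s mod Suc (length \<mu>)), vs ! s) \<in> rel N W (S_lab \<mu> s)"
    proof (cases "s < length \<mu>")
      case True thus ?thesis using step[OF True] by (simp add: S_lab_def mod_less)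
    next
      case False
      hence "s = length \<mu>" using sq(1) by simp
      thus ?thesis using rel_infinity[OF zero mem[of s]] len by (simp add: S_lab_def)
    qed
    ultimately show "(vs ! (Suc s mod Suc (length \<mu>)), \<Sum>u<1. fscale (res (1\<^sub>m 1 $$ (u, q))) (vs ! s)) \<in> rel N W (S_lab \<mu> s)"
      by simp
  qed
  moreover have "map (\<lambda>j. vs ! (j div 1)) [0..<Suc (length \<mu>) * 1] = vs"
    using map_nth[of vs] len by (simp del: upt_Suc)
  ultimately show ?thesis using len cyc_carrier[of "Suc (length \<mu>)" 1] by (simp add: S_block_cyc del: mult_1_right)
qed

text \<open>A path of relations starting in the kernel is cut at the edges of infinite weight.\<close>

lemma string_decomposition:
  assumes c0: "(c 0, 0) \<in> rel N W Pinf"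
    and step: "\<And>s. s < n \<Longrightarrow> (\<exists>l. lab s = Fin l) \<or> lab s = Pinf" "\<And>s. s < n \<Longrightarrow> (c (Suc s), c s) \<in> rel N W (lab s)"
  shows "\<exists>ps. (\<forall>p \<in> set ps. string N W p) \<and> concat (map snd ps) = map c [0..<Suc n]"
proof -
  have "m \<le> n \<Longrightarrow> \<exists>qs \<mu> vs. (\<forall>p \<in> set qs. string N W p) \<and> string N W (\<mu>, vs) \<and> vs ! length \<mu> = c m \<and>
    concat (map snd qs) @ vs = map c [0..<Suc m]" for m
  proof (induction m)
    case 0
    show ?case using c0 by (intro exI[of _ "[]"] exI[of _ "[c 0]"]) (auto simp: string_def)
  next
    case (Suc m)
    then obtain qs \<mu> vs where *: "\<forall>p \<in> set qs. string N W p" "string N W (\<mu>, vs)" "vs ! length \<mu> = c m"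
      "concat (map snd qs) @ vs = map c [0..<Suc m]" by auto
    have len: "length vs = Suc (length \<mu>)" using *(2) by (simp add: string_def)
    have m: "m < n" using Suc by simp
    consider l where "lab m = Fin l" | "lab m = Pinf" using step(1)[OF m] by blast
    thus ?case
    proof cases
      case 1
      have "string N W (\<mu> @ [l], vs @ [c (Suc m)])"
        using *(2,3) step(2)[OF m] 1 by (auto simp: string_def nth_append less_Suc_eq)
      thus ?thesis using * len
        by (intro exI[of _ qs] exI[of _ "\<mu> @ [l]"] exI[of _ "vs @ [c (Suc m)]"]) (auto simp: nth_append)
    next
      \<comment> \<open>The vertex after an edge of weight 0 is again the residue of a kernel
        vector, so it begins a new string.\<close>
      case 2
      have z: "0 \<in> fvec N" by (simp add: fvec_def)
      have "(c (Suc m), 0) \<in> rel N W Pinf" using step(2)[OF m] 2 rel_infinity[OF _ z] by metis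
      hence "string N W ([], [c (Suc m)])" by (simp add: string_def)
      thus ?thesis using *
        by (intro exI[of _ "qs @ [(\<mu>, vs)]"] exI[of _ "[]"] exI[of _ "[c (Suc m)]"]) auto
    qed
  qed
  from this[of n] obtain qs \<mu> vs where "\<forall>p \<in> set qs. string N W p" "string N W (\<mu>, vs)"
    "concat (map snd qs) @ vs = map c [0..<Suc n]" by blast
  thus ?thesis by (intro exI[of _ "qs @ [(\<mu>, vs)]"]) auto
qed

lemma band_hom:
  assumes W: "W \<in> carrier_mat N N" and L: "lift_choice res L" and bd: "fn.band (\<lambda>i. rel N W (Fin i)) (\<nu>, \<pi>, m, e)"
  shows "B_data (\<nu>, m, \<pi>) \<and> B_of t L (\<nu>, m, \<pi>) \<in> carrier_mat (length (fn.band_vectors (\<nu>, \<pi>, m, e))) (length (fn.band_vectors (\<nu>, \<pi>, m, e))) \<and>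
    cols N (fn.band_vectors (\<nu>, \<pi>, m, e)) \<in> hom (B_of t L (\<nu>, m, \<pi>)) W"
proof -
  have b: "\<nu> \<noteq> []" "nonperiodic \<nu>" "irreducible \<pi>" "lead_coeff \<pi> = 1" "\<pi> \<noteq> [:0, 1:]" "1 \<le> m"
    and st: "\<And>s b. Suc s < length \<nu> \<Longrightarrow> b < degree (\<pi> ^ m) \<Longrightarrow> (e (Suc s) b, e s b) \<in> rel N W (Fin (\<nu> ! s))"
    and cl: "\<And>a. a < degree (\<pi> ^ m) \<Longrightarrow> (e 0 a, \<Sum>b<degree (\<pi> ^ m). fscale (frobenius_block (\<pi> ^ m) $$ (b, a)) (e (length \<nu> - 1) b))
        \<in> rel N W (Fin (\<nu> ! (length \<nu> - 1)))"
    using bd by (auto simp: fn.band_def)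
  have data: "B_data (\<nu>, m, \<pi>)" using b by (simp add: B_data_def)
  hence lift: "frobenius_lift res m \<pi> (L m \<pi>)" using L by (simp add: lift_choice_def)
  note f = B_data_facts[OF data lift]
  define n k where "n = length \<nu>" and "k = m * degree \<pi>"
  have k: "degree (\<pi> ^ m) = k" using degree_irreducible_power(1)[OF b(3,4,6)] by (simp add: k_def)
  have n: "0 < n" using b(1) by (simp add: n_def)
  have C: "B_of t L (\<nu>, m, \<pi>) = cyc n k (\<lambda>a. Fin (\<nu> ! a)) (B_mat n k (L m \<pi>))"
    using f(12) by (simp add: B_of_def n_def k_def)
  have "cols N (map (\<lambda>j. e (j div k) (j mod k)) [0..<n * k]) \<in> hom (B_of t L (\<nu>, m, \<pi>)) W"
    unfolding C
  proof (rule cols_hom_cyc[OF W f(11)[folded n_def k_def]])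
    fix s q assume sq: "s < n" "q < k"
    show "(e (Suc s mod n) q, \<Sum>u<k. fscale (res (B_mat n k (L m \<pi>) s $$ (u, q))) (e s u)) \<in> rel N W (Fin (\<nu> ! s))"
    proof (cases "Suc s < n")
      case True
      have "(\<Sum>u<k. fscale (res (B_mat n k (L m \<pi>) s $$ (u, q))) (e s u)) = (\<Sum>u<k. if u = q then e s q else 0)"
        using True sq by (intro sum.cong) (auto simp: B_mat_def fun_eq_iff)
      thus ?thesis using st[of s q] True sq k by (simp add: n_def)
    next
      case False
      hence "Suc s = n" using sq(1) by simp
      hence s: "s = n - 1" "Suc s mod n = 0" by auto
      have "res (L m \<pi> $$ (u, q)) = frobenius_block (\<pi> ^ m) $$ (u, q)" if "u < k" for u
      proof -
        have "mres (L m \<pi>) $$ (u, q) = res (L m \<pi> $$ (u, q))" using f(7) that sq(2) by (simp add: k_def)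
        thus ?thesis unfolding f(8) by simp
      qed
      hence "(\<Sum>u<k. fscale (res (B_mat n k (L m \<pi>) s $$ (u, q))) (e s u)) =
          (\<Sum>u<k. fscale (frobenius_block (\<pi> ^ m) $$ (u, q)) (e (n - 1) u))"
        using s by (intro sum.cong) (auto simp: B_mat_def)
      thus ?thesis using cl[of q] sq s k by (simp add: n_def)
    qed
  qed
  moreover have "map (\<lambda>j. e (j div k) (j mod k)) [0..<n * k] = fn.band_vectors (\<nu>, \<pi>, m, e)"
    by (simp add: fn.band_vectors_def k n_def)
  moreover have "length (fn.band_vectors (\<nu>, \<pi>, m, e)) = n * k" by (simp add: fn.band_vectors_def k n_def)
  ultimately show ?thesis using data cyc_carrier[of n k] unfolding C by simp
qed

text \<open>Dropping the closing edge of the cycle leaves \<open>k\<close> independent paths, one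
  for each position inside the cells, all starting in the kernel.\<close>

lemma band_strings:
  assumes "\<nu> \<noteq> []" "0 < k"
    and zero: "\<And>b. b < k \<Longrightarrow> (e 0 b, 0) \<in> rel N W Pinf"
    and lab: "\<And>s. Suc s < length \<nu> \<Longrightarrow> (\<exists>l. lab s = Fin l) \<or> lab s = Pinf"
    and step: "\<And>s b. Suc s < length \<nu> \<Longrightarrow> b < k \<Longrightarrow> (e (Suc s) b, e s b) \<in> rel N W (lab s)"
  shows "\<exists>ps. (\<forall>p \<in> set ps. string N W p) \<and> mset (concat (map snd ps)) = (\<Sum>s<length \<nu>. mset (map (e s) [0..<k]))"
proof -
  define n where "n = length \<nu> - 1"
  have n: "length \<nu> = Suc n" using assms(1) by (cases \<nu>) (auto simp: n_def)
  have "\<exists>ps. (\<forall>p \<in> set ps. string N W p) \<and> concat (map snd ps) = map (\<lambda>s. e s b) [0..<Suc n]" if "b < k" for b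
    by (rule string_decomposition[where lab = lab]) (use zero lab step n that in auto)
  then obtain f where f: "\<And>b. b < k \<Longrightarrow> (\<forall>p \<in> set (f b). string N W p) \<and> concat (map snd (f b)) = map (\<lambda>s. e s b) [0..<Suc n]"
    by metis
  have "k' \<le> k \<Longrightarrow> mset (concat (map snd (concat (map f [0..<k'])))) = (\<Sum>b<k'. mset (map (\<lambda>s. e s b) [0..<Suc n]))" for k'
    by (induction k') (use f in \<open>simp_all del: upt_Suc add: upt_Suc_append\<close>)
  hence "mset (concat (map snd (concat (map f [0..<k])))) = (\<Sum>b<k. mset (map (\<lambda>s. e s b) [0..<Suc n]))" by simp
  also have "\<dots> = (\<Sum>s<length \<nu>. mset (map (e s) [0..<k]))"
    unfolding mset_map_upt n by (rule sum.swap)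
  finally show ?thesis using f by (intro exI[of _ "concat (map f [0..<k])"]) auto
qed

theorem canonical_form_exists:
  assumes W: "W \<in> carrier_mat N N" and L: "lift_choice res L"
  shows "\<exists>bs \<mu>s. (\<forall>b \<in> set bs. B_data b) \<and> mat_equiv res W (diag_block_mat (canonical_blocks t L bs \<mu>s))"
proof -
  let ?V = "fvec N :: (nat \<Rightarrow> 'r) set" and ?R = "\<lambda>i. rel N W (Fin i)"
  obtain i0 where i0: "\<And>i. i \<le> i0 \<Longrightarrow> (?R i)\<inverse> `` ?V = ?V" "\<And>i. i < i0 \<Longrightarrow> ?R i `` ?V = {0}" by (rule rel_low[OF W]) blast
  obtain M where M: "i0 < M" "\<And>u. u \<in> (?R M)\<inverse> `` ?V \<Longrightarrow> (u, 0) \<in> rel N W Pinf" by (rule rel_high) blast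
  obtain R' where fam: "relation_family fscale ?V R'" and R': "\<And>i. i < M \<Longrightarrow> R' i = ?R i"
    "\<And>x y. (x, y) \<in> R' M \<Longrightarrow> x \<in> (?R M)\<inverse> `` ?V" "\<And>i x y. M < i \<Longrightarrow> (x, y) \<in> R' i \<Longrightarrow> x = 0"
    by (rule fn.relation_family_completion[OF finite_subspace_fvec rel_subrel rel_subset rel_image_zero rel_preimage_zero i0 M(1)], assumption, assumption) (rule that)
  interpret fam: relation_family fscale ?V R' by (rule fam)
  obtain cs where cs: "\<And>c. c \<in> set cs \<Longrightarrow> fn.band R' c" "\<And>c. c \<in> set cs \<Longrightarrow> M \<in> set (fst c) \<Longrightarrow> last (fst c) = M"
    and basis: "fn.list_basis (concat (map fn.band_vectors cs)) ?V" using fam.band_decomposition[of M] by blast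
  \<comment> \<open>The artificial letter \<open>M\<close> is translated back into weight 0.\<close>
  define lab where "lab = (\<lambda>i. if i < M then Fin i else Pinf)"
  have R'_lab: "(x, y) \<in> rel N W (lab i)" if "(x, y) \<in> R' i" "i \<le> M" for x y i
  proof (cases "i < M")
    case True thus ?thesis using that R'(1) by (simp add: lab_def)
  next
    case False
    hence "i = M" using that(2) by simp
    moreover from this have "y \<in> ?V" using fam.R_subset that(1) by blast
    ultimately show ?thesis using rel_infinity[OF M(2)[OF R'(2)], of x y y] that(1) by (simp add: lab_def)
  qed
  have nz: "x \<noteq> 0" if "c \<in> set cs" "x \<in> set (fn.band_vectors c)" for c x
  proof
    assume "x = 0"
    hence "0 \<in> set (concat (map fn.band_vectors cs))" using that by auto
    thus False using basis fn.dependent_zero unfolding fn.list_basis_def by blast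
  qed
  have pieces: "(M \<notin> set (fst c) \<longrightarrow> fn.band ?R c) \<and>
    (M \<in> set (fst c) \<longrightarrow> (\<exists>ps. (\<forall>p \<in> set ps. string N W p) \<and> mset (concat (map snd ps)) = mset (fn.band_vectors c)))"
    if c: "c \<in> set cs" for c
  proof -
    obtain \<nu> \<pi> m e where ceq: "c = (\<nu>, \<pi>, m, e)" by (cases c)
    define k where "k = degree (\<pi> ^ m)"
    have b: "\<nu> \<noteq> []" "nonperiodic \<nu>" "irreducible \<pi>" "lead_coeff \<pi> = 1" "\<pi> \<noteq> [:0, 1:]" "1 \<le> m"
      and st: "\<And>s b. Suc s < length \<nu> \<Longrightarrow> b < k \<Longrightarrow> (e (Suc s) b, e s b) \<in> R' (\<nu> ! s)"
      and cl: "\<And>a. a < k \<Longrightarrow> (e 0 a, \<Sum>b<k. fscale (frobenius_block (\<pi> ^ m) $$ (b, a)) (e (length \<nu> - 1) b)) \<in> R' (\<nu> ! (length \<nu> - 1))"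
      using cs(1)[OF c] by (auto simp: fn.band_def ceq k_def)
    have k: "0 < k" using degree_irreducible_power(2)[OF b(3,4,6)] by (simp add: k_def)
    have mem: "e s b \<noteq> 0" if "s < length \<nu>" "b < k" for s b
    proof (rule nz[OF c])
      have "s * k + b < length \<nu> * k" by (rule block_index_less[OF that])
      moreover have "e s b = (\<lambda>j. e (j div k) (j mod k)) (s * k + b)" using that(2) by simp
      ultimately have "e s b \<in> (\<lambda>j. e (j div k) (j mod k)) ` {0..<length \<nu> * k}" by (intro image_eqI) auto
      thus "e s b \<in> set (fn.band_vectors c)" unfolding ceq fn.band_vectors_def k_def by simp
    qed
    \<comment> \<open>An edge with a larger letter would start at 0, but all its sources are members
      of a basis.\<close>
    have le: "\<nu> ! s \<le> M" if s: "s < length \<nu>" for s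
    proof (rule ccontr)
      assume "\<not> \<nu> ! s \<le> M"
      hence gt: "M < \<nu> ! s" by simp
      show False
      proof (cases "Suc s < length \<nu>")
        case True thus False using R'(3)[OF gt st[OF True k]] mem[OF True k] by simp
      next
        case False
        hence "s = length \<nu> - 1" using s by simp
        thus False using R'(3)[OF gt] cl[OF k] mem[OF _ k, of 0] b(1) by auto
      qed
    qed
    show ?thesis
    proof (intro conjI impI)
      assume "M \<notin> set (fst c)"
      hence lt: "\<nu> ! s < M" if "s < length \<nu>" for s using le[OF that] that by (auto simp: ceq order.strict_iff_order)
      have "length \<nu> - 1 < length \<nu>" using b(1) by simp
      thus "fn.band ?R c" using b st cl R'(1) lt by (auto simp: ceq fn.band_def k_def)
    next
      assume "M \<in> set (fst c)"
      hence "last \<nu> = M" using cs(2)[OF c] by (simp add: ceq)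
      hence last: "\<nu> ! (length \<nu> - 1) = M" using b(1) by (simp add: last_conv_nth)
      show "\<exists>ps. (\<forall>p \<in> set ps. string N W p) \<and> mset (concat (map snd ps)) = mset (fn.band_vectors c)"
        unfolding ceq fn.mset_band_vectors k_def[symmetric]
      proof (rule band_strings[OF b(1) k, where lab = "\<lambda>s. lab (\<nu> ! s)"])
        \<comment> \<open>The closing edge carries the letter \<open>M\<close>, so its source lies
          in the domain of the original relation at \<open>M\<close> and thus comes from the
          kernel.\<close>
        show "(e 0 b, 0) \<in> rel N W Pinf" if "b < k" for b using M(2)[OF R'(2)] cl[OF that] unfolding last by blast
        show "(\<exists>l. lab (\<nu> ! s) = Fin l) \<or> lab (\<nu> ! s) = Pinf" for s by (simp add: lab_def)
        show "(e (Suc s) b, e s b) \<in> rel N W (lab (\<nu> ! s))" if "Suc s < length \<nu>" "b < k" for s b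
          by (rule R'_lab[OF st[OF that] le]) (use that in simp)
      qed
    qed
  qed
  define csB where "csB = filter (\<lambda>c. M \<notin> set (fst c)) cs"
  define csS where "csS = filter (\<lambda>c. M \<in> set (fst c)) cs"
  have "\<forall>c. \<exists>ps. c \<in> set csS \<longrightarrow> (\<forall>p \<in> set ps. string N W p) \<and> mset (concat (map snd ps)) = mset (fn.band_vectors c)"
    using pieces by (auto simp: csS_def)
  then obtain f where f: "\<And>c. c \<in> set csS \<Longrightarrow> (\<forall>p \<in> set (f c). string N W p) \<and> mset (concat (map snd (f c))) = mset (fn.band_vectors c)"
    by metis
  define ps where "ps = concat (map f csS)"
  have ps: "string N W p" if "p \<in> set ps" for p using f that by (auto simp: ps_def)
  have mS: "set cs' \<subseteq> set csS \<Longrightarrow> mset (concat (map snd (concat (map f cs')))) = mset (concat (map fn.band_vectors cs'))" for cs'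
    by (induction cs') (use f in auto)
  let ?vss = "map fn.band_vectors csB @ map snd ps"
  have "mset (concat ?vss) = mset (concat (map fn.band_vectors cs))"
    using mS[of csS] mset_concat_filter[of fn.band_vectors "\<lambda>c. M \<notin> set (fst c)" cs] by (simp add: ps_def csB_def csS_def)
  hence basis': "fn.list_basis (concat ?vss) ?V" using fn.list_basis_mset[OF basis] by simp
  define bs where "bs = map (\<lambda>(\<nu>, \<pi>, m, e). (\<nu>, m, \<pi>)) csB"
  have B: "B_data ((\<lambda>(\<nu>, \<pi>, m, e). (\<nu>, m, \<pi>)) c) \<and>
    B_of t L ((\<lambda>(\<nu>, \<pi>, m, e). (\<nu>, m, \<pi>)) c) \<in> carrier_mat (length (fn.band_vectors c)) (length (fn.band_vectors c)) \<and>
    cols N (fn.band_vectors c) \<in> hom (B_of t L ((\<lambda>(\<nu>, \<pi>, m, e). (\<nu>, m, \<pi>)) c)) W" if "c \<in> set csB" for c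
  proof -
    obtain \<nu> \<pi> m e where ceq: "c = (\<nu>, \<pi>, m, e)" by (cases c)
    have "fn.band ?R c" using pieces[of c] that by (auto simp: csB_def)
    thus ?thesis using band_hom[OF W L, of \<nu> \<pi> m e] unfolding ceq by simp
  qed
  let ?Cs = "canonical_blocks t L bs (map fst ps)"
  have "list_all2 (\<lambda>C vs. C \<in> carrier_mat (length vs) (length vs) \<and> cols N vs \<in> hom C W) ?Cs ?vss"
    unfolding canonical_blocks_def bs_def map_map
  proof (rule list_all2_appendI)
    show "list_all2 (\<lambda>C vs. C \<in> carrier_mat (length vs) (length vs) \<and> cols N vs \<in> hom C W)
      (map (B_of t L \<circ> (\<lambda>(\<nu>, \<pi>, m, e). (\<nu>, m, \<pi>))) csB) (map fn.band_vectors csB)"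
      unfolding list_all2_map1 list_all2_map2 list_all2_same using B by auto
    show "list_all2 (\<lambda>C vs. C \<in> carrier_mat (length vs) (length vs) \<and> cols N vs \<in> hom C W)
      (map (S_block t \<circ> fst) ps) (map snd ps)"
      unfolding list_all2_map1 list_all2_map2 list_all2_same using string_hom[OF W] ps by fastforce
  qed
  note g = cols_hom_diag[OF W this] and inv = cols_basis[OF basis']
  have "mat_equiv res (diag_block_mat ?Cs) W"
    by (rule mat_equivI[OF conjunct2[OF g] inv(2) _ W]) (use g inv(1) in simp)
  hence "mat_equiv res W (diag_block_mat ?Cs)" by (rule mat_equiv_sym)
  moreover have "\<forall>b \<in> set bs. B_data b" using B by (auto simp: bs_def)
  ultimately show ?thesis by blast
qed

end

theorem theorem14p3:
  fixes t :: "'d::idom" and res :: "'d \<Rightarrow> 'r::field" and L :: "nat \<Rightarrow> 'r poly \<Rightarrow> 'd mat"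
  assumes "discrete_valuation_ring TYPE('d)"
    and "residue_map t res"
    and "lift_choice res L"
  shows
    "(\<forall>N. \<forall>W \<in> carrier_mat N N. \<exists>bs \<mu>s. (\<forall>b \<in> set bs. B_data b) \<and>
        mat_equiv res W (diag_block_mat (canonical_blocks t L bs \<mu>s))) \<and>
     (\<forall>b. B_data b \<longrightarrow> indecomposable_mat res (B_of t L b)) \<and>
     (\<forall>\<mu>. indecomposable_mat res (S_block t \<mu>)) \<and>
     \<comment> \<open>(1)\<close>
     (\<forall>\<nu> m \<pi> F F'. B_data (\<nu>, m, \<pi>) \<longrightarrow>
        frobenius_lift res m \<pi> F \<longrightarrow> frobenius_lift res m \<pi> F' \<longrightarrow>
        mat_equiv res (B_block t \<nu> F) (B_block t \<nu> F')) \<and>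
     (\<forall>\<nu> m \<pi> F G. B_data (\<nu>, m, \<pi>) \<longrightarrow>
        frobenius_lift res m \<pi> F \<longrightarrow> similar_mat (map_mat res G) (map_mat res F) \<longrightarrow>
        mat_equiv res (B_block t \<nu> F) (B_block t \<nu> G)) \<and>
     ((\<forall>p :: 'r poly. 0 < degree p \<longrightarrow> (\<exists>x. poly p x = 0)) \<longrightarrow>
        (\<forall>\<nu> m c F J. c \<noteq> 0 \<longrightarrow> B_data (\<nu>, m, [:- c, 1:]) \<longrightarrow>
           frobenius_lift res m [:- c, 1:] F \<longrightarrow>
           J \<in> carrier_mat m m \<longrightarrow> map_mat res J = jordan_block m c \<longrightarrow>
           mat_equiv res (B_block t \<nu> F) (B_block t \<nu> J))) \<and>
     \<comment> \<open>(2)\<close>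
     (\<forall>b \<mu>. B_data b \<longrightarrow> \<not> mat_equiv res (B_of t L b) (S_block t \<mu>)) \<and>
     \<comment> \<open>(3)\<close>
     (\<forall>\<mu> \<mu>'. mat_equiv res (S_block t \<mu>) (S_block t \<mu>') \<longleftrightarrow> \<mu> = \<mu>') \<and>
     \<comment> \<open>(4)\<close>
     (\<forall>\<nu> m \<pi>. B_data (\<nu>, m, \<pi>) \<longrightarrow>
        mat_equiv res (B_of t L (rotate_right \<nu>, m, \<pi>)) (B_of t L (\<nu>, m, \<pi>))) \<and>
     \<comment> \<open>(5)\<close>
     (\<forall>\<nu> m \<pi> \<nu>' m' \<pi>'. B_data (\<nu>, m, \<pi>) \<longrightarrow> B_data (\<nu>', m', \<pi>') \<longrightarrow>
        (mat_equiv res (B_of t L (\<nu>, m, \<pi>)) (B_of t L (\<nu>', m', \<pi>')) \<longleftrightarrow>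
         (\<pi>, m) = (\<pi>', m') \<and> (\<exists>l. \<nu>' = rotation l \<nu>))) \<and>
     \<comment> \<open>(6)\<close>
     (\<forall>N. \<forall>W \<in> carrier_mat N N. \<forall>bs \<mu>s bs' \<mu>s'.
        (\<forall>b \<in> set bs. B_data b) \<longrightarrow> (\<forall>b \<in> set bs'. B_data b) \<longrightarrow>
        mat_equiv res W (diag_block_mat (canonical_blocks t L bs \<mu>s)) \<longrightarrow>
        mat_equiv res W (diag_block_mat (canonical_blocks t L bs' \<mu>s')) \<longrightarrow>
        length (canonical_blocks t L bs \<mu>s) = length (canonical_blocks t L bs' \<mu>s') \<and>
        (\<exists>p. p permutes {..<length (canonical_blocks t L bs \<mu>s)} \<and>
           (\<forall>i < length (canonical_blocks t L bs \<mu>s).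
              mat_equiv res (canonical_blocks t L bs \<mu>s ! i)
                (canonical_blocks t L bs' \<mu>s' ! p i))))"
proof -
  interpret dvr t res using assms(1,2) by unfold_locales
  have lift: "frobenius_lift res m \<pi> (L m \<pi>)" if "B_data (\<nu>, m, \<pi>)" for \<nu> m \<pi>
    using assms(3) that unfolding lift_choice_def by blast
  have B_local: "local_mat (B_of t L b)" if "B_data b" for b
  proof -
    obtain \<nu> m \<pi> where b: "b = (\<nu>, m, \<pi>)" by (cases b)
    show ?thesis using B_block_local[OF that[unfolded b] lift[OF that[unfolded b]]] by (simp add: b B_of_def)
  qed
  have blocks_local: "local_mat X" if "\<forall>b \<in> set bs. B_data b" "X \<in> set (canonical_blocks t L bs \<mu>s)" for bs \<mu>s X
    using that B_local S_block_local unfolding canonical_blocks_def by auto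
  have similar_refl: "similar_mat (map_mat res F) (map_mat res F)" if "B_data (\<nu>, m, \<pi>)" "frobenius_lift res m \<pi> F" for \<nu> m \<pi> F
    by (rule similar_mat_refl) (rule map_carrier_mat[THEN iffD2, OF B_data_facts(7)[OF that]])
  show ?thesis
  proof (intro conjI)
    show "\<forall>N. \<forall>W \<in> carrier_mat N N. \<exists>bs \<mu>s. (\<forall>b \<in> set bs. B_data b) \<and>
        mat_equiv res W (diag_block_mat (canonical_blocks t L bs \<mu>s))"
      using canonical_form_exists[OF _ assms(3)] by blast
    show "\<forall>b. B_data b \<longrightarrow> indecomposable_mat res (B_of t L b)"
      using local_mat_indecomposable[OF B_local] by blast
    show "\<forall>\<mu>. indecomposable_mat res (S_block t \<mu>)"
      using local_mat_indecomposable[OF S_block_local] by blast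
    show "\<forall>\<nu> m \<pi> F F'. B_data (\<nu>, m, \<pi>) \<longrightarrow>
        frobenius_lift res m \<pi> F \<longrightarrow> frobenius_lift res m \<pi> F' \<longrightarrow>
        mat_equiv res (B_block t \<nu> F) (B_block t \<nu> F')"
    proof (intro allI impI)
      fix \<nu> m \<pi> F F'
      assume *: "B_data (\<nu>, m, \<pi>)" "frobenius_lift res m \<pi> F" "frobenius_lift res m \<pi> F'"
      have "map_mat res F' = map_mat res F" using *(2,3) by (simp add: frobenius_lift_def)
      hence "similar_mat (map_mat res F') (map_mat res F)" using similar_refl[OF *(1,2)] by simp
      thus "mat_equiv res (B_block t \<nu> F) (B_block t \<nu> F')" by (rule B_block_similar[OF *(1,2)])
    qed
    show "\<forall>\<nu> m \<pi> F G. B_data (\<nu>, m, \<pi>) \<longrightarrow>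
        frobenius_lift res m \<pi> F \<longrightarrow> similar_mat (map_mat res G) (map_mat res F) \<longrightarrow>
        mat_equiv res (B_block t \<nu> F) (B_block t \<nu> G)"
      using B_block_similar by blast
    show "(\<forall>p :: 'r poly. 0 < degree p \<longrightarrow> (\<exists>x. poly p x = 0)) \<longrightarrow>
        (\<forall>\<nu> m c F J. c \<noteq> 0 \<longrightarrow> B_data (\<nu>, m, [:- c, 1:]) \<longrightarrow>
           frobenius_lift res m [:- c, 1:] F \<longrightarrow>
           J \<in> carrier_mat m m \<longrightarrow> map_mat res J = jordan_block m c \<longrightarrow>
           mat_equiv res (B_block t \<nu> F) (B_block t \<nu> J))"
    proof (intro impI allI)
      fix \<nu> m c F J
      assume *: "B_data (\<nu>, m, [:- c, 1:])" "frobenius_lift res m [:- c, 1:] F" "map_mat res J = jordan_block m c"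
      have "similar_mat (map_mat res J) (map_mat res F)"
        unfolding *(3) B_data_facts(8)[OF *(1,2)] by (rule jordan_block_similar_frobenius[OF B_data_facts(3)[OF *(1,2)]])
      thus "mat_equiv res (B_block t \<nu> F) (B_block t \<nu> J)" by (rule B_block_similar[OF *(1,2)])
    qed
    show "\<forall>b \<mu>. B_data b \<longrightarrow> \<not> mat_equiv res (B_of t L b) (S_block t \<mu>)"
    proof (intro allI impI)
      fix b :: "int list \<times> nat \<times> 'r poly" and \<mu>
      assume B: "B_data b"
      obtain \<nu> m \<pi> where b: "b = (\<nu>, m, \<pi>)" by (cases b)
      show "\<not> mat_equiv res (B_of t L b) (S_block t \<mu>)"
        using B_block_not_S_block[OF B[unfolded b] lift[OF B[unfolded b]]] by (simp add: b B_of_def)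
    qed
    show "\<forall>\<mu> \<mu>'. mat_equiv res (S_block t \<mu>) (S_block t \<mu>') \<longleftrightarrow> \<mu> = \<mu>'"
      using S_block_equiv_iff by blast
    show "\<forall>\<nu> m \<pi>. B_data (\<nu>, m, \<pi>) \<longrightarrow>
        mat_equiv res (B_of t L (rotate_right \<nu>, m, \<pi>)) (B_of t L (\<nu>, m, \<pi>))"
      using B_block_rotate_right[OF _ lift] by (simp add: B_of_def)
    show "\<forall>\<nu> m \<pi> \<nu>' m' \<pi>'. B_data (\<nu>, m, \<pi>) \<longrightarrow> B_data (\<nu>', m', \<pi>') \<longrightarrow>
        (mat_equiv res (B_of t L (\<nu>, m, \<pi>)) (B_of t L (\<nu>', m', \<pi>')) \<longleftrightarrow>
         (\<pi>, m) = (\<pi>', m') \<and> (\<exists>l. \<nu>' = rotation l \<nu>))"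
    proof (intro allI impI iffI)
      fix \<nu> \<nu>' :: "int list" and m m' and \<pi> \<pi>' :: "'r poly"
      assume b: "B_data (\<nu>, m, \<pi>)" "B_data (\<nu>', m', \<pi>')"
        and eqv: "mat_equiv res (B_of t L (\<nu>, m, \<pi>)) (B_of t L (\<nu>', m', \<pi>'))"
      \<comment> \<open>The equivalence is reversed because \<open>B_block_equivD\<close> expresses
        the first sequence as a rotation of the second.\<close>
      have "mat_equiv res (B_block t \<nu>' (L m' \<pi>')) (B_block t \<nu> (L m \<pi>))"
        using mat_equiv_sym[OF eqv] by (simp add: B_of_def)
      from B_block_equivD[OF b(2) lift[OF b(2)] b(1) lift[OF b(1)] this]
      obtain l where l: "(\<pi>', m') = (\<pi>, m)" "\<nu>' = rotate l \<nu>" by blast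
      obtain l' where "rotate l \<nu> = rotation l' \<nu>" using rotation_eq_rotate(2) by blast
      thus "(\<pi>, m) = (\<pi>', m') \<and> (\<exists>l. \<nu>' = rotation l \<nu>)" using l by auto
    next
      fix \<nu> \<nu>' :: "int list" and m m' and \<pi> \<pi>' :: "'r poly"
      assume b: "B_data (\<nu>, m, \<pi>)" and eq: "(\<pi>, m) = (\<pi>', m') \<and> (\<exists>l. \<nu>' = rotation l \<nu>)"
      then obtain l where "\<nu>' = rotation l \<nu>" by blast
      then obtain l' where "\<nu>' = rotate l' \<nu>" using rotation_eq_rotate(1) by metis
      thus "mat_equiv res (B_of t L (\<nu>, m, \<pi>)) (B_of t L (\<nu>', m', \<pi>'))"
        using B_block_rotate[OF b lift[OF b], of l'] eq by (auto simp: B_of_def)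
    qed
    show "\<forall>N. \<forall>W \<in> carrier_mat N N. \<forall>bs \<mu>s bs' \<mu>s'.
        (\<forall>b \<in> set bs. B_data b) \<longrightarrow> (\<forall>b \<in> set bs'. B_data b) \<longrightarrow>
        mat_equiv res W (diag_block_mat (canonical_blocks t L bs \<mu>s)) \<longrightarrow>
        mat_equiv res W (diag_block_mat (canonical_blocks t L bs' \<mu>s')) \<longrightarrow>
        length (canonical_blocks t L bs \<mu>s) = length (canonical_blocks t L bs' \<mu>s') \<and>
        (\<exists>p. p permutes {..<length (canonical_blocks t L bs \<mu>s)} \<and>
           (\<forall>i < length (canonical_blocks t L bs \<mu>s).
              mat_equiv res (canonical_blocks t L bs \<mu>s ! i)
                (canonical_blocks t L bs' \<mu>s' ! p i)))"
    proof (intro allI ballI impI)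
      fix N and W :: "'d fract mat" and bs bs' :: "(int list \<times> nat \<times> 'r poly) list" and \<mu>s \<mu>s'
      let ?X = "canonical_blocks t L bs \<mu>s" and ?Z = "canonical_blocks t L bs' \<mu>s'"
      assume bs: "\<forall>b \<in> set bs. B_data b" "\<forall>b \<in> set bs'. B_data b"
        and eqv: "mat_equiv res W (diag_block_mat ?X)" "mat_equiv res W (diag_block_mat ?Z)"
      have "mat_equiv res (diag_block_mat ?X) (diag_block_mat ?Z)" by (rule mat_equiv_trans[OF mat_equiv_sym[OF eqv(1)] eqv(2)])
      moreover have "local_mat A" if "A \<in> set ?X" for A by (rule blocks_local[OF bs(1) that])
      moreover have "local_mat A" if "A \<in> set ?Z" for A by (rule blocks_local[OF bs(2) that])
      ultimately obtain Zs where Zs: "mset Zs = mset ?Z" "list_all2 (mat_equiv res) ?X Zs"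
        using krull_schmidt[of ?X ?Z] by blast
      \<comment> \<open>The rearrangement found by \<open>krull_schmidt\<close> as an equality of
        multisets is realised by a permutation of indices.\<close>
      obtain p where p: "p permutes {..<length ?Z}" "permute_list p ?Z = Zs" by (rule mset_eq_permutation[OF Zs(1)])
      have len: "length ?X = length ?Z" using list_all2_lengthD[OF Zs(2)] mset_eq_length[OF Zs(1)] by simp
      moreover have "mat_equiv res (?X ! i) (?Z ! p i)" if i: "i < length ?X" for i
        using list_all2_nthD[OF Zs(2) i] permute_list_nth[OF p(1)] i len unfolding p(2)[symmetric] by simp
      ultimately show "length ?X = length ?Z \<and>
        (\<exists>p. p permutes {..<length ?X} \<and> (\<forall>i < length ?X. mat_equiv res (?X ! i) (?Z ! p i)))"
        using p(1) by auto
    qed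
  qed
qed

end
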